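(* Let $m\ge2$ and $1/2<\beta<1$ be such that $\alpha_m<1+\beta$, and let the real toll sequence $(t_n)_{n\ge0}$ satisfy $t_n\sim n^\beta L(n)$, where $L$ is slowly varying. Let $X_n$ be the corresponding additive functional on $m$-ary search trees on $n$ keys under the random permutation model, with mean $\mu_n$. Then, with $\rho:=\prod_{i=0}^{m-2}(1+\beta+i)$, $$\mu_n=\mu n-\frac{\rho}{m!-\rho}\,n^\beta L(n)+o\bigl(n^\beta L(n)\bigr),\qquad\mu:=\frac{K_1}{H_m-1},\quad K_1:=\sum_{j=0}^\infty\frac{t_j}{(j+1)(j+2)} .$$ Moreover, $$\frac{X_n-\mu n}{n^\beta L(n)}\xrightarrow{\ \mathcal L\ }Y(\beta)$$ with convergence of all moments, where $\mathcal L(Y(\beta))$ is the unique distribution with finite second moment satisfying $$Y\stackrel{\mathcal L}{=}\sum_{j=1}^mS_j^\beta Y_j+1 .$$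
   Context: Random permutation model and additive functionals. Fix an integer $m\ge 2$. From a sequence of $n$ distinct keys one builds an $m$-ary search tree $T$ with $|T|=n$ keys: if $n<m$, all keys are stored in the root (for $n=0$ the tree is empty; if $n\le m-1$ all subtrees of the root are empty); if $n\ge m$, the first $m-1$ keys are stored in the root in increasing order $\sigma_1<\dots<\sigma_{m-1}$, and for $1\le j\le m$ the remaining keys lying strictly between $\sigma_{j-1}$ and $\sigma_j$ (with $\sigma_0=-\infty$, $\sigma_m=+\infty$), taken in their original order, recursively form the $j$th subtree $L_j(T)$. Given a real sequence $(t_n)_{n\ge0}$ (toll sequence), the additive functional $f$ is defined by $f(T)=t_{|T|}$ if $0\le |T|\le m-2$ (arbitrary initial values) and $f(T)=\sum_{i=1}^m f(L_i(T))+t_{|T|}$ if $|T|\ge m-1$. $X_n:=f(T_n)$, where $T_n$ is the tree built from a uniformly random permutation of $\{1,\dots,n\}$. In the distributional equation, $Y_1,\dots,Y_m$ are independent copies of $Y$, and $(S_1,\dots,S_m)$ is uniformly distributed on the simplex $\{s_j\ge0,\ \sum_{j=1}^m s_j=1\}$ and independent of $(Y_1,\dots,Y_m)$. $\alpha_m$ is the largest real part among the roots other than $2$ of $\psi_m(\lambda)=\lambda(\lambda+1)\cdots(\lambda+m-2)-m!$ (whose root of largest real part is $2$, all $m-1$ roots being distinct); $\alpha_2:=-\infty$. $H_m=\sum_{j=1}^m1/j$. A slowly varying function is a positive measurable function $L$ on $[1,\infty)$ with $L(cx)/L(x)\to1$ as $x\to\infty$ for every $c>0$. $\xrightarrow{\mathcal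 L}$ and $\stackrel{\mathcal L}{=}$ denote convergence and equality in distribution. *)

theory Defs
  imports
    "HOL-Probability.Probability"
    "HOL-Combinatorics.Multiset_Permutations"
    "HOL-Library.Landau_Symbols"
begin

datatype 'a mtree = Empty | Node "'a list" "'a mtree list"

text \<open>
  The sorted list \<open>ks\<close> of separators is zero-based, so that \<open>ks ! (j - 1)\<close> is the \<open>j\<close>-th smallest
  separator. Keys below the smallest separator (\<open>j = 1\<close>) and above the largest one
  (\<open>j = length ks + 1\<close>) are only bounded on one side.
\<close>

definition between_keys :: "'a::linorder list \<Rightarrow> nat \<Rightarrow> 'a \<Rightarrow> bool" where
  "between_keys ks j x \<longleftrightarrow>
     (1 < j \<longrightarrow> ks ! (j - 2) < x) \<and> (j \<le> length ks \<longrightarrow> x < ks ! (j - 1))"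

text \<open>
  The disjunct \<open>m < 2\<close> is only there to make the recursion terminate for meaningless branching
  factors.
\<close>

function search_tree :: "nat \<Rightarrow> 'a::linorder list \<Rightarrow> 'a mtree" where
  "search_tree m xs =
     (if xs = [] then Empty
      else if length xs < m \<or> m < 2 then Node (sort xs) (replicate m Empty)
      else let ks = sort (take (m - 1) xs) in
        Node ks (map (\<lambda>j. search_tree m (filter (between_keys ks j) (drop (m - 1) xs))) [1..<m+1]))"
  by auto
termination
proof (relation "Wellfounded.measure (\<lambda>(m, xs). length xs)", goal_cases)
  case (2 m xs ks j)
  have "length (filter (between_keys ks j) (drop (m - 1) xs)) \<le> length (drop (m - 1) xs)"
    by (rule length_filter_le)
  also have "\<dots> < length xs"
    using 2 by (auto simp: not_less)
  finally show ?case by simp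
qed simp

declare search_tree.simps [simp del]

fun num_keys :: "'a mtree \<Rightarrow> nat" where
  "num_keys Empty = 0"
| "num_keys (Node ks ts) = length ks + sum_list (map num_keys ts)"

text \<open>
  The additive functional with toll sequence \<open>t\<close>. For \<open>m \<ge> 2\<close> the condition \<open>num_keys T < m - 1\<close>
  is \<open>num_keys T \<le> m - 2\<close> and holds for the empty tree.
\<close>

fun additive_functional :: "nat \<Rightarrow> (nat \<Rightarrow> real) \<Rightarrow> 'a mtree \<Rightarrow> real" where
  "additive_functional m t Empty = t 0"
| "additive_functional m t (Node ks ts) =
     (if num_keys (Node ks ts) < m - 1 then t (num_keys (Node ks ts))
      else sum_list (map (additive_functional m t) ts) + t (num_keys (Node ks ts)))"

definition random_perm :: "nat \<Rightarrow> nat list pmf" where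
  "random_perm n = pmf_of_set (permutations_of_set {1..n})"

text \<open>
  \<open>X m t\<close>, regarded as a random variable on \<open>random_perm n\<close>, is $X_n$.
\<close>

definition X :: "nat \<Rightarrow> (nat \<Rightarrow> real) \<Rightarrow> nat list \<Rightarrow> real" where
  "X m t xs = additive_functional m t (search_tree m xs)"

definition X_mean :: "nat \<Rightarrow> (nat \<Rightarrow> real) \<Rightarrow> nat \<Rightarrow> real" where
  "X_mean m t n = measure_pmf.expectation (random_perm n) (X m t)"

text \<open>\<open>pochhammer z (m - 1)\<close> is $z(z+1)\cdots(z+m-2)$.\<close>

definition psi :: "nat \<Rightarrow> complex \<Rightarrow> complex" where
  "psi m z = pochhammer z (m - 1) - fact m"

definition alpha :: "nat \<Rightarrow> ereal" where
  "alpha m = (if m = 2 then -\<infinity> else ereal (Max (Re ` {z. psi m z = 0 \<and> z \<noteq> 2})))"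

definition rho :: "nat \<Rightarrow> real \<Rightarrow> real" where
  "rho m \<beta> = (\<Prod>i=0..m-2. 1 + \<beta> + real i)"

definition K1 :: "(nat \<Rightarrow> real) \<Rightarrow> real" where
  "K1 t = (\<Sum>j. t j / ((real j + 1) * (real j + 2)))"

definition slope :: "nat \<Rightarrow> (nat \<Rightarrow> real) \<Rightarrow> real" where
  "slope m t = K1 t / (harm m - 1)"

text \<open>Values outside $[1,\infty)$ are irrelevant; measurability is in the sense of Lebesgue.\<close>

definition slowly_varying :: "(real \<Rightarrow> real) \<Rightarrow> bool" where
  "slowly_varying L \<longleftrightarrow>
     L \<in> borel_measurable (lebesgue_on {1..}) \<and> (\<forall>x\<ge>1. L x > 0) \<and>
     (\<forall>c>0. ((\<lambda>x. L (c * x) / L x) \<longlongrightarrow> 1) at_top)"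

text \<open>
  The simplex $\{s_j \ge 0, \sum_{j=1}^m s_j = 1\}$ is a Lebesgue null set in $m$-space. Its uniform
  distribution is obtained from Lebesgue measure in the first \<open>m - 1\<close> coordinates, the last one being
  determined by them; the parametrisation is affine, so it preserves uniformity.
\<close>

definition simplex_coords :: "nat \<Rightarrow> (nat \<Rightarrow> real) set" where
  "simplex_coords m =
     {s \<in> space (\<Pi>\<^sub>M j\<in>{1..m-1}. lborel). (\<forall>j\<in>{1..m-1}. 0 \<le> s j) \<and> (\<Sum>j=1..m-1. s j) \<le> 1}"

definition uniform_simplex :: "nat \<Rightarrow> (nat \<Rightarrow> real) measure" where
  "uniform_simplex m =
     distr (uniform_measure (\<Pi>\<^sub>M j\<in>{1..m-1}. lborel) (simplex_coords m))
       (\<Pi>\<^sub>M j\<in>{1..m}. borel)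
       (\<lambda>s. \<lambda>j\<in>{1..m}. if j = m then 1 - (\<Sum>i=1..m-1. s i) else s j)"

lemma simplex_coords_sets [measurable]:
  "simplex_coords m \<in> sets (\<Pi>\<^sub>M j\<in>{1..m-1}. lborel)"
  unfolding simplex_coords_def by measurable

lemma sets_uniform_simplex [measurable_cong]:
  "sets (uniform_simplex m) = sets (\<Pi>\<^sub>M j\<in>{1..m}. borel)"
  by (simp add: uniform_simplex_def)

lemma emeasure_simplex_coords:
  "emeasure (\<Pi>\<^sub>M j\<in>{1..m-1}. lborel) (simplex_coords m) = ennreal (1 / fact (m - 1))"
  using emeasure_std_simplex_aux[of "{1..m-1}" 1]
  by (simp add: simplex_coords_def Int_def conj_commute)

lemma measurable_simplex_completion [measurable]:
  fixes m :: nat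
  shows "(\<lambda>s. \<lambda>j\<in>{1..m}. if j = m then 1 - (\<Sum>i=1..m-1. s i) else s j)
     \<in> (\<Pi>\<^sub>M j\<in>{1..m-1}. lborel) \<rightarrow>\<^sub>M (\<Pi>\<^sub>M j\<in>{1..m}. (borel :: real measure))"
proof (rule measurable_restrict)
  fix j assume "j \<in> {1..m}"
  then have "j \<noteq> m \<Longrightarrow> j \<in> {1..m-1}" by simp linarith
  then show "(\<lambda>s. if j = m then 1 - (\<Sum>i=1..m-1. s i) else s j)
               \<in> (\<Pi>\<^sub>M j\<in>{1..m-1}. lborel) \<rightarrow>\<^sub>M (borel :: real measure)"
    by (cases "j = m") auto
qed

lemma prob_space_uniform_simplex: "prob_space (uniform_simplex m)"
  unfolding uniform_simplex_def
proof (rule prob_space.prob_space_distr)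
  show "prob_space (uniform_measure (\<Pi>\<^sub>M j\<in>{1..m-1}. lborel) (simplex_coords m))"
    by (rule prob_space_uniform_measure)
       (simp_all only: emeasure_simplex_coords, simp_all add: ennreal_eq_0_iff not_le)
qed (use measurable_simplex_completion in \<open>simp add: measurable_def\<close>)

text \<open>
  If \<open>Y\<close> has law \<open>D\<close>, then \<open>fixed_point_map m \<beta> D\<close> is the law of
  $\sum_{j=1}^m S_j^\beta Y_j + 1$: the product measures express that $S, Y_1, \ldots, Y_m$ are
  independent.
\<close>

definition fixed_point_map :: "nat \<Rightarrow> real \<Rightarrow> real measure \<Rightarrow> real measure" where
  "fixed_point_map m \<beta> D =
     distr (uniform_simplex m \<Otimes>\<^sub>M (\<Pi>\<^sub>M j\<in>{1..m}. D)) borel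
       (\<lambda>(s, y). (\<Sum>j=1..m. s j powr \<beta> * y j) + 1)"

lemma real_distribution_fixed_point_map:
  assumes "real_distribution D"
  shows "real_distribution (fixed_point_map m \<beta> D)"
proof -
  interpret D: real_distribution D by fact
  interpret S: prob_space "uniform_simplex m" by (rule prob_space_uniform_simplex)
  interpret Y: product_prob_space "\<lambda>_. D" "{1..m}" ..
  interpret SY: pair_prob_space "uniform_simplex m" "\<Pi>\<^sub>M j\<in>{1..m}. D" ..
  have "(\<lambda>(s, y). (\<Sum>j=1..m. s j powr \<beta> * y j) + 1)
          \<in> borel_measurable (uniform_simplex m \<Otimes>\<^sub>M (\<Pi>\<^sub>M j\<in>{1..m}. D))"
    by measurable
  then show ?thesis
    unfolding fixed_point_map_def by (rule SY.real_distribution_distr)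
qed

definition solves_fixed_point :: "nat \<Rightarrow> real \<Rightarrow> real measure \<Rightarrow> bool" where
  "solves_fixed_point m \<beta> D \<longleftrightarrow>
     real_distribution D \<and> integrable D (\<lambda>x. x ^ 2) \<and> D = fixed_point_map m \<beta> D"

end

theory Submission
  imports Defs "HOL-Computational_Algebra.Formal_Power_Series"
    "HOL-Computational_Algebra.Fundamental_Theorem_Algebra"
begin

text \<open>
  Write $w_n = n^\beta L(n)$. By the uniform convergence theorem for slowly varying functions,
  $w_j / w_n$ is uniformly close to $(j/n)^\beta$ for $j \le n$; nothing else about $L$ is needed.

  The generating function of the means satisfies an Euler differential equation, that is
  $\psi_m(\vartheta) C = m!\, T$ with $\vartheta = (1 - z)\, d/dz$, where $T$ is the generating function
  of the tolls and $C$ that of the means minus the tolls. Factoring $\psi_m$ over its roots turns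
  this into first-order recursions $(n + 1) F_{n+1} = (n + \lambda) F_n + G_n$. A root with
  $\mathrm{Re}\,\lambda < 1 + \beta$ maps $G_n \sim g w_n$ to $F_n \sim g w_n / (1 + \beta - \lambda)$; the
  root $2$ produces the linear term.

  After subtracting $\mu (n + 1)$ the recursion for the laws is unchanged and the mean is of order
  $w_n$. All moments of the normalised variables are then bounded, because
  $E \sum_j S_j^{k \beta} < 1$ as soon as $k \beta > 1$. With $k = 2$ the same contraction shows that
  the characteristic functions are asymptotically within $C q^i t^2$ of the $i$-th iterate of the
  smoothing operator started at $e^{i t c}$, so they converge to a fixed point; tightness makes the
  limit a characteristic function. The value of $c$ satisfies the mean equation of the fixed point
  because it is the limit of the means, so no beta integral has to be evaluated.
\<close>

section \<open>Slowly varying functions\<close>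

text \<open>What shapes the proof is which powers contract. As \<beta> < 1, the expected sum of the
  S_j^\<beta> exceeds one, so the recursion does not damp first-order differences; only the exponent
  2\<beta> > 1 does. Two characteristic functions can thus be compared only after their linear terms
  at 0 agree, in the sense that the supremum of |\<phi>(t) - \<psi>(t)| / t^2 is finite; this
  quantity is then multiplied by q = E sum S_j^(2\<beta>) < 1, because a product of numbers in the
  unit disc is Lipschitz in its factors. Hence the mean must be known up to o(w_n) before any
  distributional argument, the iteration has to start at the right constant \<open>c\<close>, and
  uniqueness needs its own argument that the fixed-point equation determines the mean of every
  solution with finite second moment. The condition on \<open>alpha\<close> acts through the mean: a
  root other than 2 with real part at least 1 + \<beta> could contribute oscillations that are not
  small against w_n.\<close>

lemma slowly_varying_good_set:
  fixes L :: "real \<Rightarrow> real"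
  assumes "slowly_varying L" and y1: "\<And>n. y n \<ge> 1" and y: "filterlim y at_top sequentially"
    and "\<epsilon> > 0" "M \<ge> 1"
  defines "V \<equiv> \<lambda>n. {v\<in>{1..M}. \<forall>k\<ge>n. \<bar>ln (L (v * y k)) - ln (L (y k))\<bar> < \<epsilon>}"
  shows "\<And>n. V n \<in> lmeasurable" "(\<lambda>n. measure lebesgue (V n)) \<longlonglongrightarrow> M - 1"
proof -
  have pos: "L x > 0" if "x \<ge> 1" for x using assms that by (auto simp: slowly_varying_def)
  \<comment> \<open>\<open>slowly_varying\<close> gives measurability of \<open>L\<close> on [1,
    \<infinity>) only, so the other values are replaced by 0. The arguments below are products of
    two numbers that are at least 1, where \<open>L'\<close> and \<open>L\<close> agree.\<close>
  define L' where "L' = (\<lambda>x. if x \<in> {1..} then L x else 0)"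
  have L'[measurable]: "L' \<in> borel_measurable lebesgue"
    unfolding L'_def using assms(1) by (subst borel_measurable_if) (auto simp: slowly_varying_def)
  have sc[measurable]: "(\<lambda>v. L' (c * v)) \<in> borel_measurable lebesgue" for c :: real
    using measurable_compose[OF lebesgue_measurable_scaling[of c] L'] by simp
  have Vset: "V n = {1..M} \<inter> (\<Inter>k\<in>{n..}. {v\<in>space lebesgue. \<bar>ln (L' (y k * v)) - ln (L (y k))\<bar> < \<epsilon>})" for n
  proof -
    have "1 \<le> y k * v" if "v \<in> {1..M}" for k v using y1[of k] that mult_mono[of 1 "y k" 1 v] by auto
    then show ?thesis by (auto simp: V_def L'_def mult.commute)
  qed
  have "{v\<in>space lebesgue. \<bar>ln (L' (y k * v)) - ln (L (y k))\<bar> < \<epsilon>} \<in> sets lebesgue" for k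
    by measurable
  then have "(\<Inter>k\<in>{n..}. {v\<in>space lebesgue. \<bar>ln (L' (y k * v)) - ln (L (y k))\<bar> < \<epsilon>}) \<in> sets lebesgue" for n
    by (intro sets.countable_INT') auto
  then have sets: "V n \<in> sets lebesgue" for n unfolding Vset by (intro sets.Int) auto
  have sub: "V n \<subseteq> {1..M}" for n by (auto simp: V_def)
  show "V n \<in> lmeasurable" for n
    by (rule fmeasurableI2[OF _ sub sets]) simp 
  \<comment> \<open>The sets increase with \<open>n\<close>, and pointwise convergence makes them
    exhaust the interval, so continuity of measure from below yields the limit.\<close>
  have inc: "incseq V" by (auto simp: incseq_def V_def)
  have un: "(\<Union>n. V n) = {1..M}"
  proof (intro equalityI subsetI)
    fix v assume v: "v \<in> {1..M}"
    have "((\<lambda>x. L (v * x) / L x) \<longlongrightarrow> 1) at_top" using assms(1) v by (auto simp: slowly_varying_def)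
    then have "(\<lambda>n. ln (L (v * y n) / L (y n))) \<longlonglongrightarrow> ln 1"
      by (intro tendsto_ln filterlim_compose[OF _ y]) auto
    then have "eventually (\<lambda>n. \<bar>ln (L (v * y n) / L (y n))\<bar> < \<epsilon>) sequentially"
      using \<open>\<epsilon> > 0\<close> by (auto simp: tendsto_iff)
    then obtain n where "\<forall>k\<ge>n. \<bar>ln (L (v * y k) / L (y k))\<bar> < \<epsilon>" by (auto simp: eventually_sequentially)
    moreover have "ln (L (v * y k) / L (y k)) = ln (L (v * y k)) - ln (L (y k))" for k
    proof (rule ln_divide_pos)
      have "1 \<le> v * y k" using y1[of k] v mult_mono[of 1 v 1 "y k"] by auto
      then show "L (v * y k) > 0" by (rule pos)
    qed (use pos y1 in auto)
    ultimately show "v \<in> (\<Union>n. V n)" using v by (auto simp: V_def)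
  next
    fix v assume "v \<in> (\<Union>n. V n)"
    then show "v \<in> {1..M}" using sub by fast
  qed
  have "(\<lambda>n. measure lebesgue (V n)) \<longlonglongrightarrow> measure lebesgue (\<Union>n. V n)"
    by (rule Lim_measure_incseq) (use sets inc un \<open>M \<ge> 1\<close> in auto)
  then show "(\<lambda>n. measure lebesgue (V n)) \<longlonglongrightarrow> M - 1" using \<open>M \<ge> 1\<close> by (simp add: un)
qed

text \<open>A measure argument. If uniformity failed along x_n and u_n, then for large n most v in
  [1, 2K] would still be good multipliers for x_n, and most w in [1, 2] good multipliers for u_n
  x_n. Stretching the second set by u_n gives a subset of [1, 2K] of measure above 1/2, too large to
  avoid the first set. At a common point v = u_n w the two estimates combine to contradict the
  choice of u_n.\<close>

lemma slowly_varying_uniform: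
  fixes L :: "real \<Rightarrow> real"
  assumes sv: "slowly_varying L" and "\<epsilon> > 0" "K \<ge> 1"
  shows "\<exists>X\<ge>1. \<forall>x\<ge>X. \<forall>u\<in>{1..K}. \<bar>ln (L (u * x)) - ln (L x)\<bar> < \<epsilon>"
proof (rule ccontr)
  assume "\<not> ?thesis"
  then have "\<exists>x u. x \<ge> real n + 1 \<and> u \<in> {1..K} \<and> \<bar>ln (L (u * x)) - ln (L x)\<bar> \<ge> \<epsilon>" for n
    by (auto simp: not_less Bex_def dest!: spec[of _ "real n + 1"])
  then obtain x u where x: "\<And>n. x n \<ge> real n + 1" and u: "\<And>n. u n \<in> {1..K}"
    and bad: "\<And>n. \<bar>ln (L (u n * x n)) - ln (L (x n))\<bar> \<ge> \<epsilon>" by metis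
  have x1: "x n \<ge> 1" for n using x[of n] by linarith
  have "x n \<ge> real n" for n using x[of n] by linarith
  then have xlim: "filterlim x at_top sequentially"
    by (intro filterlim_at_top_mono[OF filterlim_real_sequentially]) auto
  have ux: "u n * x n \<ge> x n" for n using u[of n] x1[of n] mult_right_mono[of 1 "u n" "x n"] by auto
  have ux1: "u n * x n \<ge> 1" for n using ux[of n] x1[of n] by linarith
  have uxlim: "filterlim (\<lambda>n. u n * x n) at_top sequentially"
    by (intro filterlim_at_top_mono[OF xlim] always_eventually allI ux)
  define V where "V = (\<lambda>n. {v\<in>{1..2*K}. \<forall>k\<ge>n. \<bar>ln (L (v * x k)) - ln (L (x k))\<bar> < \<epsilon>/2})"
  define W where "W = (\<lambda>n. {w\<in>{1..2}. \<forall>k\<ge>n. \<bar>ln (L (w * (u k * x k))) - ln (L (u k * x k))\<bar> < \<epsilon>/2})"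
  have e2: "\<epsilon>/2 > 0" "2 * K \<ge> 1" using \<open>\<epsilon> > 0\<close> \<open>K \<ge> 1\<close> by auto
  have V: "V n \<in> lmeasurable" "(\<lambda>n. measure lebesgue (V n)) \<longlonglongrightarrow> 2 * K - 1" for n
    unfolding V_def by (rule slowly_varying_good_set[OF sv x1 xlim e2])+
  have W: "W n \<in> lmeasurable" "(\<lambda>n. measure lebesgue (W n)) \<longlonglongrightarrow> 2 - 1" for n
    unfolding W_def by (rule slowly_varying_good_set[OF sv ux1 uxlim e2(1)], simp)+
  have "eventually (\<lambda>n. measure lebesgue (V n) > 2 * K - 1 - 1/2) sequentially"
       "eventually (\<lambda>n. measure lebesgue (W n) > 1/2) sequentially"
    using order_tendstoD(1)[OF V(2), of "2*K-1-1/2"] order_tendstoD(1)[OF W(2), of "1/2"] by auto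
  then have "eventually (\<lambda>n. measure lebesgue (V n) > 2 * K - 1 - 1/2 \<and> measure lebesgue (W n) > 1/2) sequentially"
    by (rule eventually_conj)
  then obtain n where n: "measure lebesgue (V n) > 2 * K - 1 - 1/2" "measure lebesgue (W n) > 1/2"
    by (auto simp: eventually_sequentially)
  define U where "U = (\<lambda>w. u n *\<^sub>R w + 0) ` W n"
  have "measure lebesgue U = \<bar>u n\<bar> * measure lebesgue (W n)"
    unfolding U_def using measure_lebesgue_affine[of "u n" 0 "W n"] by simp
  also have "\<dots> \<ge> 1 * measure lebesgue (W n)"
    using u[of n] by (intro mult_right_mono) auto
  finally have mU: "measure lebesgue U > 1/2" using n by linarith
  have Usub: "U \<subseteq> {1..2*K}"
  proof
    fix z assume "z \<in> U"
    then obtain w where w: "w \<in> {1..2}" "z = u n * w" by (auto simp: U_def W_def)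
    with u[of n] mult_mono[of 1 "u n" 1 w] mult_mono[of "u n" K w 2] show "z \<in> {1..2*K}" by auto
  qed
  \<comment> \<open>\<open>W n\<close> is only Lebesgue measurable, so its stretched copy is written
    as a preimage under the inverse scaling to obtain measurability.\<close>
  have Uv: "U = (*\<^sub>R) (inverse (u n)) -` W n \<inter> space lebesgue"
    using u[of n] by (force simp: U_def image_iff field_simps)
  have "U \<in> sets lebesgue"
    unfolding Uv by (rule measurable_sets[OF lebesgue_measurable_scaling]) (use W(1) in auto)
  then have Um: "U \<in> lmeasurable"
    by (intro fmeasurableI2[OF _ Usub]) simp_all
  have "V n \<inter> U = {}"
  proof (rule ccontr)
    assume "V n \<inter> U \<noteq> {}"
    then obtain w where w: "w \<in> W n" "u n * w \<in> V n" by (auto simp: U_def)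
    have "\<bar>ln (L (u n * w * x n)) - ln (L (x n))\<bar> < \<epsilon>/2" using w(2) by (auto simp: V_def)
    moreover have "\<bar>ln (L (w * (u n * x n))) - ln (L (u n * x n))\<bar> < \<epsilon>/2" using w(1) by (auto simp: W_def)
    moreover have "u n * w * x n = w * (u n * x n)" by simp
    ultimately show False using bad[of n] by (auto simp: abs_if split: if_splits)
  qed
  then have "AE z in lebesgue. z \<notin> V n \<or> z \<notin> U" by blast
  then have "measure lebesgue (V n \<union> U) = measure lebesgue (V n) + measure lebesgue U"
    by (rule measure_Un_AE[OF _ V(1) Um])
  moreover have "V n \<subseteq> {1..2*K}" by (auto simp: V_def)
  then have "measure lebesgue (V n \<union> U) \<le> measure lebesgue {1..2*K}"
    using fmeasurableD[OF V(1)[of n]] fmeasurableD[OF Um] Usub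
    by (intro measure_mono_fmeasurable sets.Un Un_least lmeasurable_cbox[of 1 "2*K", unfolded cbox_interval])
  ultimately show False using n mU assms(3) by simp
qed


text \<open>Halving \<open>n\<close> until it is comparable with \<open>j\<close> costs a factor
  2^\<eta> per step, and the number of halvings is at most the binary logarithm of n/j, so the total
  cost is (n/j)^\<eta>. The extra factor 2^\<eta> pays for the last comparison.\<close>

lemma slowly_varying_potter:
  fixes L :: "real \<Rightarrow> real"
  assumes sv: "slowly_varying L" and "\<eta> > 0"
  shows "\<exists>j0\<ge>1. \<forall>n. \<forall>j\<ge>j0. j \<le> n \<longrightarrow> L (real j) \<le> 2 powr \<eta> * (real n / real j) powr \<eta> * L (real n)"
proof -
  have pos: "L x > 0" if "x \<ge> 1" for x using sv that by (auto simp: slowly_varying_def)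
  obtain X where X: "X \<ge> 1" "\<And>x u. x \<ge> X \<Longrightarrow> u \<in> {1..4} \<Longrightarrow> \<bar>ln (L (u * x)) - ln (L x)\<bar> < \<eta> * ln 2"
    using slowly_varying_uniform[OF sv, of "\<eta> * ln 2" 4] assms by auto
  define j0 where "j0 = nat \<lceil>X\<rceil>"
  have j0: "j0 \<ge> 1" "real j \<ge> X" if "j \<ge> j0" for j using X that by (auto simp: j0_def nat_le_iff ceiling_le_iff le_nat_iff)
  \<comment> \<open>Ratios up to 4 leave room for the rounding in \<open>n div 2\<close>.\<close>
  have near: "L (real j) \<le> 2 powr \<eta> * L (real n)" if "j0 \<le> j" "j \<le> n" "n \<le> 4 * j" for j n
  proof -
    have j: "real j \<ge> X" "j \<ge> 1" using j0[of j] that by auto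
    define u where "u = real n / real j"
    have u: "u \<in> {1..4}" "u * real j = real n" using that j by (auto simp: u_def field_simps)
    have "\<bar>ln (L (real n)) - ln (L (real j))\<bar> < \<eta> * ln 2" using X(2)[OF j(1) u(1)] by (simp add: u(2))
    then have "ln (L (real j)) \<le> ln (2 powr \<eta> * L (real n))"
      using pos[of "real n"] j that by (auto simp: ln_mult_pos ln_powr)
    then show ?thesis using pos[of "real n"] pos[of "real j"] j that by simp
  qed
  have "L (real j) \<le> 2 powr \<eta> * (real n / real j) powr \<eta> * L (real n)" if "j0 \<le> j" "j \<le> n" for j n
    using that(2)
  proof (induction n rule: less_induct)
    case (less n)
    have j1: "j \<ge> 1" using j0(1)[of j0] that by simp
    show ?case
    proof (cases "n \<le> 4 * j")
      case True
      have "2 powr \<eta> * 1 \<le> 2 powr \<eta> * (real n / real j) powr \<eta>"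
        using less j1 \<open>\<eta> > 0\<close> by (intro mult_left_mono) (auto intro!: ge_one_powr_ge_zero)
      then have "2 powr \<eta> * L (real n) \<le> 2 powr \<eta> * (real n / real j) powr \<eta> * L (real n)"
        using pos[of "real n"] less j1 by (intro mult_right_mono) auto
      then show ?thesis using near[OF that(1) less.prems True] by linarith
    next
      case False
      define n' where "n' = n div 2"
      have n': "n' < n" "j \<le> n'" "n \<le> 4 * n'" "2 * n' \<le> n" using False j1 by (auto simp: n'_def)
      have "L (real j) \<le> 2 powr \<eta> * (real n' / real j) powr \<eta> * L (real n')"
        using less.IH n' by blast
      also have "\<dots> \<le> 2 powr \<eta> * (real n' / real j) powr \<eta> * (2 powr \<eta> * L (real n))"
        using near[of n' n] that n' by (intro mult_left_mono) auto
      also have "\<dots> = 2 powr \<eta> * (2 * (real n' / real j)) powr \<eta> * L (real n)"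
        using powr_mult[of 2 "real n' / real j" \<eta>] by simp
      also have "\<dots> \<le> 2 powr \<eta> * (real n / real j) powr \<eta> * L (real n)"
        using n' pos[of "real n"] j1 less \<open>\<eta> > 0\<close>
        by (intro mult_right_mono mult_left_mono powr_mono2) (auto simp: divide_simps)
      finally show ?thesis .
    qed
  qed
  then show ?thesis using j0(1) by blast
qed

text \<open>Potter's bound with exponent \<beta>/2 makes both ratios small as long as j is at most
  \<delta> n. On the remaining range n/j stays in the compact interval [1, 1/\<delta>], where the
  convergence for \<open>L\<close> is uniform.\<close>

lemma regularly_varying_uniform:
  fixes L :: "real \<Rightarrow> real"
  assumes sv: "slowly_varying L" and "\<beta> > 0"
    and w: "\<And>n. n \<ge> 1 \<Longrightarrow> w n = real n powr \<beta> * L (real n)" and "\<epsilon> > 0"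
  shows "eventually (\<lambda>n. \<forall>j\<le>n. \<bar>w j / w n - (real j / real n) powr \<beta>\<bar> \<le> \<epsilon>) sequentially"
proof -
  have pos: "L x > 0" if "x \<ge> 1" for x using sv that by (auto simp: slowly_varying_def)
  obtain j0 where j0: "j0 \<ge> 1" and
    potter: "\<And>n j. j \<ge> j0 \<Longrightarrow> j \<le> n \<Longrightarrow> L (real j) \<le> 2 powr (\<beta>/2) * (real n / real j) powr (\<beta>/2) * L (real n)"
    using slowly_varying_potter[OF sv, of "\<beta>/2"] \<open>\<beta> > 0\<close> by auto
  have w_ratio: "w j / w n \<le> 2 powr (\<beta>/2) * (real j / real n) powr (\<beta>/2)" if "j0 \<le> j" "j \<le> n" for j n
  proof -
    have jn: "j \<ge> 1" "n \<ge> 1" using that j0 by auto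
    have Ln: "L (real n) > 0" using pos jn by auto
    have "w j / w n = (real j / real n) powr \<beta> * (L (real j) / L (real n))"
      using jn by (simp add: w powr_divide)
    also have "L (real j) / L (real n) \<le> 2 powr (\<beta>/2) * (real n / real j) powr (\<beta>/2)"
      using potter[OF that] Ln by (simp add: divide_simps)
    then have "(real j / real n) powr \<beta> * (L (real j) / L (real n)) \<le>
        (real j / real n) powr \<beta> * (2 powr (\<beta>/2) * (real n / real j) powr (\<beta>/2))"
      by (intro mult_left_mono) auto
    also have "(real n / real j) powr (\<beta>/2) = (real j / real n) powr (-(\<beta>/2))"
      using jn by (simp add: powr_minus powr_divide divide_simps)
    also have "(real j / real n) powr \<beta> * (2 powr (\<beta>/2) * (real j / real n) powr (-(\<beta>/2))) = 
        2 powr (\<beta>/2) * (real j / real n) powr (\<beta> + -(\<beta>/2))"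
      using jn by (subst powr_add) auto
    finally show ?thesis by simp
  qed
  have w_pos: "w n > 0" if "n \<ge> 1" for n using pos[of "real n"] that by (simp add: w)
  \<comment> \<open>Chosen so that 2^(\<beta>/2) \<delta>^(\<beta>/2) is at most \<epsilon>/4; the
    minimum with 1/2 keeps 1/\<delta> above 1.\<close>
  define \<delta> where "\<delta> = min (1/2) ((\<epsilon> / (4 * 2 powr (\<beta>/2))) powr (2/\<beta>))"
  have \<delta>: "\<delta> > 0" "\<delta> < 1" using \<open>\<epsilon> > 0\<close> by (auto simp: \<delta>_def)
  have \<delta>2: "\<delta> powr (\<beta>/2) \<le> \<epsilon> / (4 * 2 powr (\<beta>/2))"
  proof -
    have "\<delta> powr (\<beta>/2) \<le> ((\<epsilon> / (4 * 2 powr (\<beta>/2))) powr (2/\<beta>)) powr (\<beta>/2)"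
      using \<delta> \<open>\<beta> > 0\<close> by (intro powr_mono2) (auto simp: \<delta>_def)
    also have "\<dots> = \<epsilon> / (4 * 2 powr (\<beta>/2))" using \<open>\<epsilon> > 0\<close> \<open>\<beta> > 0\<close> by (simp add: powr_powr)
    finally show ?thesis .
  qed
  \<comment> \<open>The finitely many indices below the threshold of Potter's bound are compared
    with \<open>j0\<close>, to which the bound applies.\<close>
  have "((\<lambda>n. w j / w n) \<longlongrightarrow> 0) sequentially" for j
  proof -
    have "((\<lambda>n. \<bar>w j / w j0\<bar> * (2 powr (\<beta>/2) * (real j0 / real n) powr (\<beta>/2))) \<longlongrightarrow> \<bar>w j / w j0\<bar> * (2 powr (\<beta>/2) * 0)) sequentially"
      using \<open>\<beta> > 0\<close> tendsto_powr'[OF lim_const_over_n[of "real j0"] tendsto_const[of "\<beta>/2"]]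
      by (intro tendsto_intros) auto
    moreover have "eventually (\<lambda>n. norm (w j / w n) \<le> \<bar>w j / w j0\<bar> * (2 powr (\<beta>/2) * (real j0 / real n) powr (\<beta>/2))) sequentially"
      using eventually_ge_at_top[of j0]
    proof eventually_elim
      case (elim n)
      have "norm (w j / w n) = \<bar>w j / w j0\<bar> * (w j0 / w n)"
        using w_pos[of j0] w_pos[of n] elim j0 by (simp add: abs_mult)
      also have "\<dots> \<le> \<bar>w j / w j0\<bar> * (2 powr (\<beta>/2) * (real j0 / real n) powr (\<beta>/2))"
        using w_ratio[of j0 n] elim by (intro mult_left_mono) auto
      finally show ?case .
    qed
    ultimately show ?thesis by (auto intro: Lim_null_comparison)
  qed
  then have "eventually (\<lambda>n. \<bar>w j / w n\<bar> < \<epsilon>/2) sequentially" for j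
    using tendstoD[of "\<lambda>n. w j / w n" 0 sequentially "\<epsilon>/2"] \<open>\<epsilon> > 0\<close> by (simp only: dist_real_def diff_zero)
  then have small: "eventually (\<lambda>n. \<forall>j\<in>{..<j0}. \<bar>w j / w n\<bar> < \<epsilon>/2) sequentially"
    by (intro eventually_ball_finite) auto
  obtain X where X: "X \<ge> 1" "\<And>x u. x \<ge> X \<Longrightarrow> u \<in> {1..1/\<delta>} \<Longrightarrow> \<bar>ln (L (u * x)) - ln (L x)\<bar> < ln (1 + \<epsilon>)"
    using slowly_varying_uniform[OF sv, of "ln (1+\<epsilon>)" "1/\<delta>"] \<open>\<epsilon> > 0\<close> \<delta> by (auto simp: divide_simps)
  have "eventually (\<lambda>n. real n \<ge> X / \<delta>) sequentially"
    using filterlim_real_sequentially by (auto simp: filterlim_at_top)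
  with small eventually_ge_at_top[of j0] show ?thesis
  proof eventually_elim
    case (elim n)
    show ?case
    proof (intro allI impI)
      fix j assume j: "j \<le> n"
      have n1: "n \<ge> 1" using elim j0 by auto
      have rn: "real j / real n \<le> 1" using j n1 by auto
      show "\<bar>w j / w n - (real j / real n) powr \<beta>\<bar> \<le> \<epsilon>"
      proof (cases "real j \<le> \<delta> * real n")
        case True
        then have jn: "real j / real n \<le> \<delta>" using n1 by (simp add: divide_simps)
        have p2: "(real j / real n) powr (\<beta>/2) \<le> \<epsilon> / (4 * 2 powr (\<beta>/2))"
          using powr_mono2[of "\<beta>/2" "real j / real n" \<delta>] jn \<delta>2 \<open>\<beta> > 0\<close> by auto
        then have p3: "2 powr (\<beta>/2) * (real j / real n) powr (\<beta>/2) \<le> \<epsilon>/4"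
          by (simp add: field_simps)
        have "1 * (real j / real n) powr (\<beta>/2) \<le> 2 powr (\<beta>/2) * (real j / real n) powr (\<beta>/2)"
          using \<open>\<beta> > 0\<close> by (intro mult_right_mono ge_one_powr_ge_zero) auto
        moreover have "(real j / real n) powr \<beta> \<le> (real j / real n) powr (\<beta>/2)"
          using rn \<open>\<beta> > 0\<close> by (intro powr_mono') auto
        ultimately have 1: "(real j / real n) powr \<beta> \<le> \<epsilon>/4" using p3 by linarith
        have 2: "\<bar>w j / w n\<bar> \<le> \<epsilon>/2"
        proof (cases "j < j0")
          case True
          then show ?thesis using elim by (auto intro: less_imp_le)
        next
          case False
          then show ?thesis using w_ratio[of j n] p3 w_pos[of j] w_pos[of n] j j0 n1 \<open>\<epsilon> > 0\<close> by auto
        qed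
        have "0 \<le> (real j / real n) powr \<beta>" by simp
        with 1 2 \<open>\<epsilon> > 0\<close> show ?thesis by linarith
      next
        case False
        then have jX: "real j \<ge> X" "j \<ge> 1" using elim \<delta> X by (auto simp: divide_simps mult.commute)
        define u where "u = real n / real j"
        have u: "u \<in> {1..1/\<delta>}" "u * real j = real n" using False j jX \<delta> by (auto simp: u_def field_simps)
        have *: "\<bar>ln (L (real n)) - ln (L (real j))\<bar> < ln (1 + \<epsilon>)" using X(2)[OF jX(1) u(1)] by (simp add: u(2))
        have Lp: "L (real n) > 0" "L (real j) > 0" using pos jX n1 by auto
        have "L (real j) / L (real n) < 1 + \<epsilon>"
          using * Lp \<open>\<epsilon> > 0\<close> by (subst ln_less_cancel_iff[symmetric]) (auto simp: ln_divide_pos)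
        moreover have "L (real j) / L (real n) > inverse (1+\<epsilon>)"
          using * Lp \<open>\<epsilon> > 0\<close> by (subst ln_less_cancel_iff[symmetric]) (auto simp: ln_divide_pos ln_inverse)
        moreover have "inverse (1+\<epsilon>) \<ge> 1 - \<epsilon>" using \<open>\<epsilon> > 0\<close> by (simp add: field_simps)
        ultimately have "\<bar>L (real j) / L (real n) - 1\<bar> \<le> \<epsilon>" by linarith
        moreover have "w j / w n - (real j / real n) powr \<beta> = (real j / real n) powr \<beta> * (L (real j) / L (real n) - 1)"
          using jX n1 by (simp add: w powr_divide right_diff_distrib)
        moreover have "(real j / real n) powr \<beta> \<le> 1"
          using rn \<open>\<beta> > 0\<close> by (intro powr_le1) auto
        ultimately show ?thesis
          using mult_mono[of "(real j / real n) powr \<beta>" 1 "\<bar>L (real j) / L (real n) - 1\<bar>" \<epsilon>] by (simp add: abs_mult)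
      qed
    qed
  qed
qed

section \<open>First-order recursions with regularly varying right-hand side\<close>

text \<open>Once e_n < c \<epsilon>/2, the excess of \<open>r\<close> over \<epsilon>/2 is
  multiplied by at most 1 - c/(n+1) in each step. The product of these factors vanishes because the
  harmonic series diverges.\<close>

lemma ratio_recursion_tendsto_0:
  fixes r e :: "nat \<Rightarrow> real"
  assumes r: "\<And>n. r n \<ge> 0" and c: "c > 0"
    and rec: "eventually (\<lambda>n. r (Suc n) \<le> (1 - c / real (Suc n)) * r n + e n / real (Suc n)) sequentially"
    and e: "e \<longlonglongrightarrow> 0"
  shows "r \<longlonglongrightarrow> 0"
proof (rule LIMSEQ_I)
  fix \<epsilon> :: real assume \<epsilon>: "\<epsilon> > 0"
  have "eventually (\<lambda>n. e n < c * (\<epsilon>/2)) sequentially"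
    using order_tendstoD(2)[OF e, of "c * (\<epsilon>/2)"] c \<epsilon> by simp
  moreover have "eventually (\<lambda>n. real n \<ge> c) sequentially"
    using filterlim_real_sequentially by (simp add: filterlim_at_top)
  ultimately have "eventually (\<lambda>n. r (Suc n) \<le> (1 - c / real (Suc n)) * r n + e n / real (Suc n) \<and>
      e n < c * (\<epsilon>/2) \<and> real n \<ge> c) sequentially"
    using rec by (auto intro: eventually_conj)
  then obtain N where N: "\<And>n. n \<ge> N \<Longrightarrow> r (Suc n) \<le> (1 - c / real (Suc n)) * r n + e n / real (Suc n) \<and>
      e n < c * (\<epsilon>/2) \<and> real n \<ge> c"
    by (auto simp: eventually_sequentially)
  define s where "s = (\<lambda>n. max 0 (r n - \<epsilon>/2))"
  have s0: "s n \<ge> 0" for n by (simp add: s_def)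
  have step: "s (Suc n) \<le> (1 - c / real (Suc n)) * s n" if "n \<ge> N" for n
  proof -
    have q: "1 - c / real (Suc n) \<ge> 0" using N[OF that] by (simp add: field_simps)
    have "r (Suc n) \<le> (1 - c / real (Suc n)) * r n + c * (\<epsilon>/2) / real (Suc n)"
      using N[OF that] divide_right_mono[of "e n" "c * (\<epsilon>/2)" "real (Suc n)"] by linarith
    also have "\<dots> = (1 - c / real (Suc n)) * (r n - \<epsilon>/2) + \<epsilon>/2" by (simp add: algebra_simps)
    also have "\<dots> \<le> (1 - c / real (Suc n)) * s n + \<epsilon>/2"
      using q by (intro add_right_mono mult_left_mono) (auto simp: s_def)
    finally show ?thesis using q s0[of n] mult_nonneg_nonneg[OF q s0[of n]] by (auto simp: s_def)
  qed
  have bound: "s n \<le> s N * exp (- c * (harm n - harm N))" if "n \<ge> N" for n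
    using that
  proof (induction n rule: dec_induct)
    case (step n)
    have "s (Suc n) \<le> (1 - c / real (Suc n)) * s n" by (rule \<open>n \<ge> N \<Longrightarrow> s (Suc n) \<le> (1 - c / real (Suc n)) * s n\<close>) fact
    also have "\<dots> \<le> exp (- c / real (Suc n)) * s n"
      using exp_ge_add_one_self[of "- c / real (Suc n)"] by (intro mult_right_mono s0) simp
    also have "\<dots> \<le> exp (- c / real (Suc n)) * (s N * exp (- c * (harm n - harm N)))"
      by (intro mult_left_mono step) simp
    also have "\<dots> = s N * exp (- c / real (Suc n) + - c * (harm n - harm N))" unfolding exp_add by (simp only: mult_ac)
    also have "- c / real (Suc n) + - c * (harm n - harm N) = - c * (harm (Suc n) - harm N)"
      by (simp add: harm_Suc algebra_simps divide_inverse)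
    finally show ?case .
  qed simp
  have "((\<lambda>n. s N * exp (- c * (harm n - harm N))) \<longlongrightarrow> 0) sequentially"
  proof -
    have "filterlim (\<lambda>n. - (harm N::real) + harm n) at_top sequentially"
      by (intro filterlim_tendsto_add_at_top[OF tendsto_const] harm_at_top)
    then have "filterlim (\<lambda>n. c * (- (harm N::real) + harm n)) at_top sequentially"
      by (rule filterlim_tendsto_pos_mult_at_top[OF tendsto_const c])
    then have "filterlim (\<lambda>n. - (c * (- (harm N::real) + harm n))) at_bot sequentially"
      by (simp add: filterlim_uminus_at_bot)
    then have "((\<lambda>n. exp (- (c * (- (harm N::real) + harm n)))) \<longlongrightarrow> 0) sequentially"
      by (rule filterlim_compose[OF exp_at_bot])
    then show ?thesis
      by (intro tendsto_mult_right_zero) (simp add: algebra_simps)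
  qed
  then have "eventually (\<lambda>n. s N * exp (- c * (harm n - harm N)) < \<epsilon>/2) sequentially"
    using \<epsilon> by (intro order_tendstoD(2)) auto
  then have "eventually (\<lambda>n. norm (r n - 0) < \<epsilon>) sequentially"
    using eventually_ge_at_top[of N]
  proof eventually_elim
    case (elim n)
    then have "s n < \<epsilon>/2" using bound[of n] by linarith
    then show ?case using r[of n] by (auto simp: s_def max_def split: if_splits)
  qed
  then show "\<exists>no. \<forall>n\<ge>no. norm (r n - 0) < \<epsilon>" by (simp add: eventually_sequentially)
qed

text \<open>By the mean value theorem the increment of x^(1+\<beta>) over [k, k+1] lies between
  (1+\<beta>) k^\<beta> and (1+\<beta>) (k+1)^\<beta>. Telescoping then determines the power sum up
  to an error n^\<beta>.\<close>

lemma riemann_sum_powr: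
  assumes "\<beta> > (0::real)"
  shows "(\<lambda>n. (\<Sum>k<n. (real k / real n) powr \<beta>) / real n) \<longlonglongrightarrow> 1 / (1 + \<beta>)"
proof -
  have mvt: "(1 + \<beta>) * real k powr \<beta> \<le> real (Suc k) powr (1 + \<beta>) - real k powr (1 + \<beta>)"
       "real (Suc k) powr (1 + \<beta>) - real k powr (1 + \<beta>) \<le> (1 + \<beta>) * real (Suc k) powr \<beta>" for k
  proof -
    have d: "((\<lambda>x. x powr (1+\<beta>)) has_real_derivative (1 + \<beta>) * x powr \<beta>) (at x)" if "x > 0" for x
      using that by (auto intro!: derivative_eq_intros simp: powr_diff)
    have "\<exists>l z. real k < z \<and> z < real (Suc k) \<and> ((\<lambda>x. x powr (1+\<beta>)) has_real_derivative l) (at z) \<and>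
        real (Suc k) powr (1 + \<beta>) - real k powr (1 + \<beta>) = (real (Suc k) - real k) * l"
    proof (rule MVT)
      show "continuous_on {real k..real (Suc k)} (\<lambda>x. x powr (1 + \<beta>))"
        using assms by (intro continuous_on_powr' continuous_intros) auto
      show "(\<lambda>x. x powr (1 + \<beta>)) differentiable at x" if "real k < x" for x
        using d[of x] that by (auto simp: real_differentiable_def)
    qed simp
    then obtain l z where lz: "real k < z" "z < real (Suc k)"
        "((\<lambda>x. x powr (1+\<beta>)) has_real_derivative l) (at z)"
        "real (Suc k) powr (1 + \<beta>) - real k powr (1 + \<beta>) = (real (Suc k) - real k) * l"
      by blast
    have "l = (1 + \<beta>) * z powr \<beta>" using DERIV_unique[OF lz(3) d] lz(1) by simp
    with lz have "\<exists>z. real k < z \<and> z < real (Suc k) \<and>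
      real (Suc k) powr (1 + \<beta>) - real k powr (1 + \<beta>) = (1 + \<beta>) * z powr \<beta>" by auto
    then obtain z where z: "real k < z" "z < real (Suc k)"
       "real (Suc k) powr (1 + \<beta>) - real k powr (1 + \<beta>) = (1 + \<beta>) * z powr \<beta>" by auto
    show "(1 + \<beta>) * real k powr \<beta> \<le> real (Suc k) powr (1 + \<beta>) - real k powr (1 + \<beta>)"
       "real (Suc k) powr (1 + \<beta>) - real k powr (1 + \<beta>) \<le> (1 + \<beta>) * real (Suc k) powr \<beta>"
      unfolding z(3) using z assms by (auto intro!: mult_left_mono powr_mono2)
  qed
  have up: "(1 + \<beta>) * (\<Sum>k<n. real k powr \<beta>) \<le> real n powr (1 + \<beta>)" for n
  proof -
    have "(1 + \<beta>) * (\<Sum>k<n. real k powr \<beta>) \<le> (\<Sum>k<n. real (Suc k) powr (1 + \<beta>) - real k powr (1 + \<beta>))"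
      unfolding sum_distrib_left by (intro sum_mono mvt)
    also have "\<dots> = real n powr (1 + \<beta>)" by (subst sum_lessThan_telescope) simp
    finally show ?thesis .
  qed
  have low: "real n powr (1 + \<beta>) \<le> (1 + \<beta>) * ((\<Sum>k<n. real k powr \<beta>) + real n powr \<beta>)" for n
  proof -
    have "real n powr (1 + \<beta>) = (\<Sum>k<n. real (Suc k) powr (1 + \<beta>) - real k powr (1 + \<beta>))"
      by (subst sum_lessThan_telescope) simp
    also have "\<dots> \<le> (\<Sum>k<n. (1 + \<beta>) * real (Suc k) powr \<beta>)" by (intro sum_mono mvt)
    also have "\<dots> = (1 + \<beta>) * (\<Sum>k<n. real (Suc k) powr \<beta>)" by (simp add: sum_distrib_left)
    also have "(\<Sum>k<n. real (Suc k) powr \<beta>) = (\<Sum>k<n. real k powr \<beta>) + real n powr \<beta>"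
      by (induction n) auto
    finally show ?thesis .
  qed
  have eq: "(\<Sum>k<n. (real k / real n) powr \<beta>) / real n = (\<Sum>k<n. real k powr \<beta>) / real n powr (1 + \<beta>)" if "n > 0" for n
    using that by (simp add: powr_divide powr_add sum_divide_distrib mult.commute)
  show ?thesis
  proof (rule tendsto_sandwich)
    show "eventually (\<lambda>n. 1 / (1 + \<beta>) - 1 / real n \<le> (\<Sum>k<n. (real k / real n) powr \<beta>) / real n) sequentially"
      using eventually_gt_at_top[of 0]
    proof eventually_elim
      case (elim n)
      have p: "real n powr (1 + \<beta>) = real n * real n powr \<beta>" using elim by (simp add: powr_add)
      have "1 / (1 + \<beta>) * real n powr (1+\<beta>) - real n powr \<beta> \<le> (\<Sum>k<n. real k powr \<beta>)"
        using low[of n] assms by (simp add: field_simps)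
      then have "(1 / (1 + \<beta>) * real n powr (1+\<beta>) - real n powr \<beta>) / real n powr (1+\<beta>) \<le> (\<Sum>k<n. real k powr \<beta>) / real n powr (1+\<beta>)"
        by (rule divide_right_mono) simp
      also have "(1 / (1 + \<beta>) * real n powr (1+\<beta>) - real n powr \<beta>) / real n powr (1+\<beta>) = 1 / (1 + \<beta>) - 1 / real n"
        using elim by (simp add: p diff_divide_distrib)
      finally show ?case using elim by (simp add: eq)
    qed
    show "eventually (\<lambda>n. (\<Sum>k<n. (real k / real n) powr \<beta>) / real n \<le> 1 / (1 + \<beta>)) sequentially"
      using eventually_gt_at_top[of 0]
    proof eventually_elim
      case (elim n)
      then show ?case using up[of n] assms by (simp add: eq field_simps)
    qed
    show "(\<lambda>n. 1 / (1 + \<beta>) - 1 / real n) \<longlonglongrightarrow> 1 / (1 + \<beta>)"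
      using tendsto_diff[OF tendsto_const[of "1/(1+\<beta>)"] lim_const_over_n[of 1]] by simp
  qed simp
qed


section \<open>Weight sequences that behave like a power of the index under rescaling\<close>

locale rv_weight =
  fixes w :: "nat \<Rightarrow> real" and \<beta> :: real
  assumes w_pos: "w n > 0" and \<beta>_pos: "0 < \<beta>" and \<beta>_less: "\<beta> < 1"
    and unif: "\<epsilon> > 0 \<Longrightarrow> eventually (\<lambda>n. \<forall>j\<le>n. \<bar>w j / w n - (real j / real n) powr \<beta>\<bar> \<le> \<epsilon>) sequentially"
begin

lemma w_nz [simp]: "w n \<noteq> 0" using w_pos[of n] by simp
lemma w_nonneg [simp]: "w n \<ge> 0" using w_pos[of n] by simp

lemma w_fixed_ratio: "(\<lambda>n. w j / w n) \<longlonglongrightarrow> 0"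
proof (rule LIMSEQ_I)
  fix \<epsilon> :: real assume "\<epsilon> > 0"
  have "(\<lambda>n. (real j / real n) powr \<beta>) \<longlonglongrightarrow> 0 powr \<beta>"
    using \<beta>_pos by (intro tendsto_powr' lim_const_over_n tendsto_const) auto
  then have "eventually (\<lambda>n. (real j / real n) powr \<beta> < \<epsilon>/2) sequentially"
    using \<open>\<epsilon> > 0\<close> by (intro order_tendstoD(2)) auto
  moreover have "eventually (\<lambda>n. \<forall>j\<le>n. \<bar>w j / w n - (real j / real n) powr \<beta>\<bar> \<le> \<epsilon>/2) sequentially"
    using \<open>\<epsilon> > 0\<close> by (intro unif) simp
  ultimately have "eventually (\<lambda>n. norm (w j / w n - 0) < \<epsilon>) sequentially"
    using eventually_ge_at_top[of j]
  proof eventually_elim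
    case (elim n)
    then have "\<bar>w j / w n - (real j / real n) powr \<beta>\<bar> \<le> \<epsilon>/2" by blast
    moreover have "(real j / real n) powr \<beta> \<ge> 0" by simp
    ultimately have "\<bar>w j / w n\<bar> < \<epsilon>" using elim by linarith
    then show ?case by (metis diff_zero real_norm_def)
  qed
  then show "\<exists>no. \<forall>n\<ge>no. norm (w j / w n - 0) < \<epsilon>" by (simp add: eventually_sequentially)
qed

lemma const_over_w: "(\<lambda>n. c / w n) \<longlonglongrightarrow> 0"
  using tendsto_mult[OF tendsto_const[of "c / w 0"] w_fixed_ratio[of 0]] by simp

lemma w_bound: "\<exists>C>0. \<forall>n. \<forall>j\<le>n. w j \<le> C * w n"
proof -
  obtain N where N: "\<And>n j. n \<ge> N \<Longrightarrow> j \<le> n \<Longrightarrow> \<bar>w j / w n - (real j / real n) powr \<beta>\<bar> \<le> 1"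
    using unif[of 1] by (auto simp: eventually_sequentially)
  \<comment> \<open>The 2 covers large \<open>n\<close>, where w_j/w_n is within 1 of a number at
    most 1; the double sum covers the finitely many remaining pairs.\<close>
  define C where "C = 2 + (\<Sum>n<N. \<Sum>j\<le>n. w j / w n)"
  have *: "w j / w n \<le> C" if "j \<le> n" for n j
  proof (cases "n \<ge> N")
    case True
    have "(real j / real n) powr \<beta> \<le> 1" using that \<beta>_pos by (intro powr_le1) (auto simp: divide_simps)
    then have "w j / w n \<le> 2" using N[OF True that] by linarith
    moreover have "(\<Sum>n<N. \<Sum>j\<le>n. w j / w n) \<ge> 0" by (intro sum_nonneg) auto
    ultimately show ?thesis by (simp add: C_def)
  next
    case False
    have "w j / w n \<le> (\<Sum>j\<le>n. w j / w n)" using that by (intro member_le_sum) auto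
    also have "\<dots> \<le> (\<Sum>n<N. \<Sum>j\<le>n. w j / w n)"
      using False by (intro member_le_sum[of n "{..<N}" "\<lambda>n. \<Sum>j\<le>n. w j / w n"]) (auto intro!: sum_nonneg)
    finally show ?thesis by (simp add: C_def)
  qed
  have "w j \<le> C * w n" if "j \<le> n" for j n
    using *[OF that] w_pos[of n] by (simp add: divide_simps)
  moreover have "C > 0" using *[of 0 0] by simp
  ultimately show ?thesis by blast
qed

definition wt :: "nat \<Rightarrow> real" where "wt n = (1 + \<beta>) / real n * (\<Sum>k<n. w k)"

lemma wt_nonneg [simp]: "wt n \<ge> 0"
  using \<beta>_pos unfolding wt_def by (intro mult_nonneg_nonneg sum_nonneg) auto

lemma wt_Suc: "real (Suc n) * wt (Suc n) = real n * wt n + (1 + \<beta>) * w n"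
proof -
  have *: "real n * wt n = (1 + \<beta>) * (\<Sum>k<n. w k)" for n by (cases "n = 0") (auto simp: wt_def)
  show ?thesis unfolding * by (simp add: algebra_simps)
qed

text \<open>The average \<open>wt\<close> replaces \<open>w\<close> by an equivalent sequence with a first-order recursion.\<close>

lemma wt_over_w: "(\<lambda>n. wt n / w n) \<longlonglongrightarrow> 1"
proof -
  have "(\<lambda>n. (\<Sum>k<n. w k / w n) / real n - (\<Sum>k<n. (real k / real n) powr \<beta>) / real n) \<longlonglongrightarrow> 0"
  proof (rule LIMSEQ_I)
    fix \<epsilon> :: real assume "\<epsilon> > 0"
    have "eventually (\<lambda>n. \<forall>j\<le>n. \<bar>w j / w n - (real j / real n) powr \<beta>\<bar> \<le> \<epsilon>/2) sequentially"
      using \<open>\<epsilon> > 0\<close> by (intro unif) simp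
    then have "eventually (\<lambda>n. norm ((\<Sum>k<n. w k / w n) / real n - (\<Sum>k<n. (real k / real n) powr \<beta>) / real n - 0) < \<epsilon>) sequentially"
      using eventually_gt_at_top[of 0]
    proof eventually_elim
      case (elim n)
      have "\<bar>\<Sum>k<n. w k / w n - (real k / real n) powr \<beta>\<bar> \<le> (\<Sum>k<n. \<epsilon>/2)"
        using elim by (intro order.trans[OF sum_abs] sum_mono) auto
      then have "\<bar>\<Sum>k<n. w k / w n - (real k / real n) powr \<beta>\<bar> / real n \<le> \<epsilon>/2"
        using elim by (simp add: divide_simps mult.commute)
      then have "\<bar>(\<Sum>k<n. w k / w n - (real k / real n) powr \<beta>)\<bar> / real n < \<epsilon>" using \<open>\<epsilon> > 0\<close> by linarith
      then have "\<bar>(\<Sum>k<n. w k / w n - (real k / real n) powr \<beta>) / real n\<bar> < \<epsilon>"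
        using \<open>\<epsilon> > 0\<close> by (simp only: abs_divide abs_of_nat)
      then show ?case by (simp add: sum_subtractf diff_divide_distrib)
    qed
    then show "\<exists>no. \<forall>n\<ge>no. norm ((\<Sum>k<n. w k / w n) / real n - (\<Sum>k<n. (real k / real n) powr \<beta>) / real n - 0) < \<epsilon>"
      by (simp add: eventually_sequentially)
  qed
  from tendsto_add[OF this riemann_sum_powr[OF \<beta>_pos]]
  have "(\<lambda>n. (\<Sum>k<n. w k / w n) / real n) \<longlonglongrightarrow> 1 / (1 + \<beta>)" by simp
  from tendsto_mult[OF tendsto_const[of "1+\<beta>"] this]
  have "(\<lambda>n. (1 + \<beta>) * ((\<Sum>k<n. w k / w n) / real n)) \<longlonglongrightarrow> 1" using \<beta>_pos by simp
  moreover have "(1 + \<beta>) * ((\<Sum>k<n. w k / w n) / real n) = wt n / w n" for n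
    by (simp add: wt_def sum_divide_distrib[symmetric])
  ultimately show ?thesis by simp
qed

lemma w_over_wt: "(\<lambda>n. w n / wt n) \<longlonglongrightarrow> 1"
  using tendsto_inverse[OF wt_over_w] by simp

lemma wt_pos: "n > 0 \<Longrightarrow> wt n > 0"
  using \<beta>_pos unfolding wt_def by (intro mult_pos_pos sum_pos w_pos) auto

text \<open>In one step |F| grows by a factor of about (n+\<sigma>)/(n+1) with any \<sigma> > Re
  \<zeta>, whereas \<open>wt\<close> grows by at least (n+\<tau>)/(n+1) for any \<tau> < 1+\<beta>.
  The quotient therefore shrinks by 1 - (\<tau>-\<sigma>)/(n+\<tau>) up to a vanishing
  error.\<close>

lemma first_order_negligible:
  fixes F G :: "nat \<Rightarrow> complex" and \<zeta> :: complex
  assumes rec: "\<And>n. of_nat (Suc n) * F (Suc n) = (of_nat n + \<zeta>) * F n + G n"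
    and lam: "Re \<zeta> < 1 + \<beta>" and G: "(\<lambda>n. G n / w n) \<longlonglongrightarrow> 0"
  shows "(\<lambda>n. F n / w n) \<longlonglongrightarrow> 0"
proof -
  \<comment> \<open>The numbers satisfy Re \<zeta> < \<sigma> < \<tau> < 1+\<beta>. The maximum with
    1 and \<beta> < 1 place \<tau> between 1 and 2, so n+\<tau> lies between n+1 and 2(n+1); this is
    the origin of the half in the contraction rate (\<tau>-\<sigma>)/2.\<close>
  define \<sigma> where "\<sigma> = (max (Re \<zeta>) 1 + (1 + \<beta>)) / 2"
  define \<tau> where "\<tau> = (\<sigma> + (1 + \<beta>)) / 2"
  have \<sigma>: "Re \<zeta> < \<sigma>" "1 < \<sigma>" "\<sigma> < 1 + \<beta>" using lam \<beta>_pos by (auto simp: \<sigma>_def)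
  have \<tau>: "\<sigma> < \<tau>" "\<tau> < 1 + \<beta>" "\<tau> < 2" using \<sigma> \<beta>_less by (auto simp: \<tau>_def)
  \<comment> \<open>The imaginary part changes the modulus of n+\<zeta> only by a term of order 1/n,
    so the gap between Re \<zeta> and \<sigma> absorbs it for large n.\<close>
  have norm_bd: "eventually (\<lambda>n. cmod (of_nat n + \<zeta>) \<le> real n + \<sigma>) sequentially"
  proof -
    have "eventually (\<lambda>n. real n \<ge> (Im \<zeta>)\<^sup>2 / (\<sigma> - Re \<zeta>) + \<bar>\<sigma>\<bar> + \<bar>Re \<zeta>\<bar>) sequentially"
      using filterlim_real_sequentially by (simp add: filterlim_at_top)
    then show ?thesis
    proof eventually_elim
      case (elim n)
      have "(Im \<zeta>)\<^sup>2 / (\<sigma> - Re \<zeta>) \<le> 2 * real n + \<sigma> + Re \<zeta>" using elim by linarith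
      then have "(Im \<zeta>)\<^sup>2 \<le> (\<sigma> - Re \<zeta>) * (2 * real n + \<sigma> + Re \<zeta>)"
        using \<sigma> by (simp add: pos_divide_le_eq mult.commute)
      then have "(real n + Re \<zeta>)\<^sup>2 + (Im \<zeta>)\<^sup>2 \<le> (real n + \<sigma>)\<^sup>2" by (simp add: power2_eq_square algebra_simps)
      then show ?case using \<sigma> unfolding cmod_def by (intro real_le_lsqrt) auto
    qed
  qed
  define r where "r = (\<lambda>n. cmod (F n) / wt n)"
  define e where "e = (\<lambda>n. cmod (G n / w n) * (w n / wt n))"
  have "e \<longlonglongrightarrow> 0" unfolding e_def
    using tendsto_mult[OF tendsto_norm[OF G] w_over_wt] by simp
  have "(\<lambda>n. (1 + \<beta>) * (w n / wt n)) \<longlonglongrightarrow> (1 + \<beta>) * 1"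
    by (intro tendsto_mult tendsto_const w_over_wt)
  then have ev\<tau>: "eventually (\<lambda>n. (1 + \<beta>) * (w n / wt n) > \<tau>) sequentially"
    using \<tau> by (intro order_tendstoD(1)) auto
  have "r \<longlonglongrightarrow> 0"
  proof (rule ratio_recursion_tendsto_0[where c = "(\<tau> - \<sigma>) / 2" and e = e])
    show "eventually (\<lambda>n. r (Suc n) \<le> (1 - (\<tau> - \<sigma>) / 2 / real (Suc n)) * r n + e n / real (Suc n)) sequentially"
      using norm_bd ev\<tau> eventually_gt_at_top[of 0]
    proof eventually_elim
      case (elim n)
      have wtp: "wt n > 0" "wt (Suc n) > 0" using wt_pos elim by auto
      have eG: "cmod (G n) = e n * wt n" using wtp by (simp add: e_def norm_divide)
      have "real (Suc n) * cmod (F (Suc n)) = cmod (of_nat (Suc n) * F (Suc n))"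
        by (simp only: norm_mult norm_of_nat)
      also have "\<dots> \<le> cmod (of_nat n + \<zeta>) * cmod (F n) + cmod (G n)"
        unfolding rec norm_mult[symmetric] by (rule norm_triangle_ineq)
      also have "\<dots> \<le> (real n + \<sigma>) * cmod (F n) + cmod (G n)"
        using elim by (intro add_right_mono mult_right_mono) auto
      also have "\<dots> = ((real n + \<sigma>) * r n + e n) * wt n" using wtp by (simp add: eG r_def field_simps)
      finally have up: "real (Suc n) * cmod (F (Suc n)) \<le> ((real n + \<sigma>) * r n + e n) * wt n" .
      have "\<tau> * wt n \<le> (1 + \<beta>) * w n" using elim wtp by (simp add: field_simps)
      then have low: "(real n + \<tau>) * wt n \<le> real (Suc n) * wt (Suc n)" by (simp only: wt_Suc) (simp add: algebra_simps)
      have nn: "(real n + \<sigma>) * r n + e n \<ge> 0" using \<sigma> wtp by (auto simp: r_def e_def)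
      have "r (Suc n) = (real (Suc n) * cmod (F (Suc n))) / (real (Suc n) * wt (Suc n))"
        by (simp only: r_def) (simp del: of_nat_Suc)
      also have "\<dots> \<le> (((real n + \<sigma>) * r n + e n) * wt n) / ((real n + \<tau>) * wt n)"
        using up low wtp \<tau> \<sigma> nn by (intro frac_le) auto
      also have "\<dots> = (1 - (\<tau> - \<sigma>) / (real n + \<tau>)) * r n + e n / (real n + \<tau>)"
      proof -
        have "((real n + \<sigma>) * r n + e n) * wt n / ((real n + \<tau>) * wt n) = (((real n + \<tau>) - (\<tau> - \<sigma>)) * r n + e n) / (real n + \<tau>)"
          using wtp by simp
        also have "((b - d) * x + y) / b = (1 - d / b) * x + y / b" if "b \<noteq> 0" for b d x y :: real
          using that by (simp add: field_simps)
        then have "(((real n + \<tau>) - (\<tau> - \<sigma>)) * r n + e n) / (real n + \<tau>) = (1 - (\<tau> - \<sigma>) / (real n + \<tau>)) * r n + e n / (real n + \<tau>)"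
          using \<tau> \<sigma> by (metis add_nonneg_pos less_trans of_nat_0_le_iff order_less_irrefl zero_less_one)
        finally show ?thesis .
      qed
      also have "\<dots> \<le> (1 - (\<tau> - \<sigma>) / 2 / real (Suc n)) * r n + e n / real (Suc n)"
      proof (intro add_mono mult_right_mono)
        have "(\<tau> - \<sigma>) / (2 * real (Suc n)) \<le> (\<tau> - \<sigma>) / (real n + \<tau>)"
          using \<tau> \<sigma> elim by (intro divide_left_mono) auto
        then show "1 - (\<tau> - \<sigma>) / (real n + \<tau>) \<le> 1 - (\<tau> - \<sigma>) / 2 / real (Suc n)" by simp
        show "e n / (real n + \<tau>) \<le> e n / real (Suc n)"
          using \<tau> \<sigma> wtp by (intro divide_left_mono) (auto simp: e_def)
      qed (use wtp in \<open>auto simp: r_def\<close>)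
      finally show ?case .
    qed
    show "r n \<ge> 0" for n by (simp add: r_def)
    show "(\<tau> - \<sigma>) / 2 > 0" using \<tau> by simp
  qed fact
  from tendsto_mult[OF this wt_over_w]
  have "(\<lambda>n. r n * (wt n / w n)) \<longlonglongrightarrow> 0" by simp
  then have "(\<lambda>n. norm (F n / w n)) \<longlonglongrightarrow> 0"
  proof (rule Lim_transform_eventually)
    show "eventually (\<lambda>n. r n * (wt n / w n) = norm (F n / w n)) sequentially"
      using eventually_gt_at_top[of 0]
      by eventually_elim (use wt_pos in \<open>auto simp: r_def norm_divide less_imp_neq[symmetric]\<close>)
  qed
  then show ?thesis by (rule tendsto_norm_zero_cancel)
qed

text \<open>Subtracting h \<open>wt\<close> from \<open>F\<close> replaces G_n by G_n - h
  ((1+\<beta>) w_n - \<zeta> wt_n), and h = g/(1+\<beta>-\<zeta>) is the value that makes this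
  o(w_n). The homogeneous part is negligible anyway.\<close>

lemma first_order_asymp:
  fixes F G :: "nat \<Rightarrow> complex" and \<zeta> :: complex and g :: complex
  assumes rec: "\<And>n. of_nat (Suc n) * F (Suc n) = (of_nat n + \<zeta>) * F n + G n"
    and lam: "Re \<zeta> < 1 + \<beta>" and G: "(\<lambda>n. G n / w n) \<longlonglongrightarrow> g"
  shows "(\<lambda>n. F n / w n) \<longlonglongrightarrow> g / (1 + \<beta> - \<zeta>)"
proof -
  define h where "h = g / (1 + \<beta> - \<zeta>)"
  have nz: "1 + \<beta> - \<zeta> \<noteq> 0" using lam by (auto simp: complex_eq_iff)
  have wtw: "(\<lambda>n. complex_of_real (wt n / w n)) \<longlonglongrightarrow> 1" using tendsto_of_real[OF wt_over_w, where 'a = complex] by (simp only: of_real_1)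
  have "(\<lambda>n. (F n - h * wt n) / w n) \<longlonglongrightarrow> 0"
  proof (rule first_order_negligible)
    fix n
    have "complex_of_real (real (Suc n) * wt (Suc n)) = of_real (real n * wt n + (1 + \<beta>) * w n)"
      by (simp only: wt_Suc)
    then have wtS: "of_nat (Suc n) * complex_of_real (wt (Suc n)) = of_nat n * wt n + (1 + \<beta>) * w n"
      by (simp only: of_real_mult of_real_of_nat_eq of_real_add of_real_1)
    have "of_nat (Suc n) * (F (Suc n) - h * wt (Suc n)) = of_nat (Suc n) * F (Suc n) - h * (of_nat (Suc n) * complex_of_real (wt (Suc n)))"
      by (simp only: right_diff_distrib mult.left_commute)
    also have "\<dots> = (of_nat n + \<zeta>) * (F n - h * wt n) + (G n - h * ((1 + \<beta>) * w n - \<zeta> * wt n))"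
      unfolding rec wtS by (simp add: algebra_simps)
    finally show "of_nat (Suc n) * (F (Suc n) - h * wt (Suc n)) = \<dots>" .
  next
    have "(\<lambda>n. G n / w n - h * ((1 + \<beta>) - \<zeta> * complex_of_real (wt n / w n))) \<longlonglongrightarrow> g - h * ((1 + \<beta>) - \<zeta> * 1)"
      by (intro tendsto_intros G wtw)
    moreover have "G n / w n - h * ((1 + \<beta>) - \<zeta> * complex_of_real (wt n / w n)) =
       (G n - h * ((1 + \<beta>) * w n - \<zeta> * wt n)) / w n" for n
      by (simp add: field_simps)
    moreover have "g - h * ((1 + \<beta>) - \<zeta> * 1) = 0" using nz by (simp add: h_def)
    ultimately show "(\<lambda>n. (G n - h * ((1 + \<beta>) * w n - \<zeta> * wt n)) / w n) \<longlonglongrightarrow> 0" by simp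
  qed fact
  from tendsto_add[OF this tendsto_mult[OF tendsto_const[of h] wtw]]
  have "(\<lambda>n. (F n - h * wt n) / w n + h * complex_of_real (wt n / w n)) \<longlonglongrightarrow> h" by simp
  then show ?thesis by (simp add: h_def diff_divide_distrib)
qed

lemma wt_Suc_diff:
  "wt (Suc n) / real (Suc (Suc n)) - wt n / real (Suc n) = ((1 + \<beta>) * w n - 2 * wt n) / (real (Suc n) * real (Suc (Suc n)))"
proof -
  have "wt (Suc n) / real (Suc (Suc n)) - wt n / real (Suc n) =
      (real (Suc n) * wt (Suc n) - real (Suc (Suc n)) * wt n) / (real (Suc n) * real (Suc (Suc n)))"
    by (simp add: divide_simps del: of_nat_Suc)
  also have "real (Suc n) * wt (Suc n) - real (Suc (Suc n)) * wt n = (1 + \<beta>) * w n - 2 * wt n"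
    unfolding wt_Suc by (simp add: algebra_simps)
  finally show ?thesis .
qed

text \<open>As wt_n is asymptotic to w_n and 2 > 1+\<beta>, the sequence wt_n/(n+1) eventually
  decreases, by at least a multiple of w_n/((n+1)(n+2)). It thus serves as a telescoping majorant
  for sums of such terms.\<close>

lemma wt_Suc_le:
  "eventually (\<lambda>n. (1 - \<beta>) / 2 * (w n / (real (Suc n) * real (Suc (Suc n)))) \<le> wt n / real (Suc n) - wt (Suc n) / real (Suc (Suc n))) sequentially"
proof -
  have "(\<lambda>n. 2 * (wt n / w n)) \<longlonglongrightarrow> 2 * 1" by (intro tendsto_mult wt_over_w tendsto_const)
  then have "eventually (\<lambda>n. 2 * (wt n / w n) > (3 + \<beta>) / 2) sequentially"
    using \<beta>_less by (intro order_tendstoD(1)) auto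
  then show ?thesis
  proof eventually_elim
    case (elim n)
    then have "(3 + \<beta>) / 2 * w n \<le> 2 * wt n" using w_pos[of n] by (simp add: field_simps)
    then have "(1 - \<beta>) / 2 * w n \<le> 2 * wt n - (1 + \<beta>) * w n" by (simp add: field_simps)
    then have "(1 - \<beta>) / 2 * w n / (real (Suc n) * real (Suc (Suc n))) \<le> (2 * wt n - (1 + \<beta>) * w n) / (real (Suc n) * real (Suc (Suc n)))"
      by (rule divide_right_mono) simp
    also have "\<dots> = wt n / real (Suc n) - wt (Suc n) / real (Suc (Suc n))"
      using wt_Suc_diff[of n] by (simp add: diff_divide_distrib del: of_nat_Suc)
    finally show ?case by simp
  qed
qed

text \<open>The additive decrease is turned into a multiplicative one. The 8 is a product of three
  factors 2: one already in the decrease, one from wt_n \<le> 2 w_n, one from n+2 \<le>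
  2(n+1).\<close>

lemma wt_over_n: "(\<lambda>n. wt n / real (Suc n)) \<longlonglongrightarrow> 0"
proof (rule ratio_recursion_tendsto_0[where c = "(1 - \<beta>) / 8" and e = "\<lambda>_. 0"])
  have "eventually (\<lambda>n. wt n / w n < 2) sequentially"
    using order_tendstoD(2)[OF wt_over_w, of 2] by simp
  with wt_Suc_le show "eventually (\<lambda>n. wt (Suc n) / real (Suc (Suc n)) \<le> (1 - (1 - \<beta>) / 8 / real (Suc n)) * (wt n / real (Suc n)) + 0 / real (Suc n)) sequentially"
  proof eventually_elim
    case (elim n)
    have "wt n \<le> 2 * w n" using elim w_pos[of n] by (simp add: field_simps)
    then have "(1 - \<beta>) / 8 * wt n / (real (Suc n) * real (Suc n)) \<le> (1 - \<beta>) / 8 * (2 * w n) / (real (Suc n) * real (Suc n))"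
      using \<beta>_less by (intro divide_right_mono mult_left_mono) auto
    also have "\<dots> = (1 - \<beta>) / 2 * w n / (real (Suc n) * (2 * real (Suc n)))" by (simp del: of_nat_Suc)
    also have "\<dots> \<le> (1 - \<beta>) / 2 * w n / (real (Suc n) * real (Suc (Suc n)))"
      using \<beta>_less by (intro divide_left_mono mult_left_mono mult_nonneg_nonneg) auto
    also have "\<dots> \<le> wt n / real (Suc n) - wt (Suc n) / real (Suc (Suc n))" using elim by simp
    finally have "(1 - \<beta>) / 8 * wt n / (real (Suc n) * real (Suc n)) \<le> wt n / real (Suc n) - wt (Suc n) / real (Suc (Suc n))" .
    then have le: "wt (Suc n) / real (Suc (Suc n)) \<le> wt n / real (Suc n) - (1 - \<beta>) / 8 * wt n / (real (Suc n) * real (Suc n))"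
      by linarith
    have "(1 - a / S) * (x / S) = x / S - a * x / (S * S)" for a x S :: real by (simp add: left_diff_distrib diff_divide_distrib)
    then show ?case using le by (simp only: div_0 add_0_right)
  qed
qed (use \<beta>_less in auto)

lemma summable_over_square:
  fixes G :: "nat \<Rightarrow> complex" and g :: complex
  assumes "(\<lambda>n. G n / w n) \<longlonglongrightarrow> g"
  shows "summable (\<lambda>k. G k / (of_nat (Suc k) * of_nat (Suc (Suc k))))"
proof -
  have "Bseq (\<lambda>n. G n / w n)" using assms by (intro convergent_imp_Bseq) (auto simp: convergent_def)
  then obtain K where K: "K > 0" "\<And>n. norm (G n / w n) \<le> K" by (auto simp: Bseq_def)
  have "summable (\<lambda>n. wt (Suc n) / real (Suc (Suc n)) - wt n / real (Suc n))"
    by (rule telescope_summable[OF wt_over_n])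
  then have "summable (\<lambda>n. 2 * K / (1 - \<beta>) * - (wt (Suc n) / real (Suc (Suc n)) - wt n / real (Suc n)))"
    by (intro summable_mult summable_minus)
  moreover have "eventually (\<lambda>n. norm (G n / (of_nat (Suc n) * of_nat (Suc (Suc n)))) \<le> 2 * K / (1 - \<beta>) * - (wt (Suc n) / real (Suc (Suc n)) - wt n / real (Suc n))) sequentially"
    using wt_Suc_le
  proof eventually_elim
    case (elim n)
    have "norm (G n) \<le> K * w n" using K(2)[of n] w_pos[of n] by (simp add: norm_divide divide_simps)
    then have "norm (G n) / (real (Suc n) * real (Suc (Suc n))) \<le> K * w n / (real (Suc n) * real (Suc (Suc n)))"
      by (rule divide_right_mono) simp
    also have "\<dots> = 2 * K / (1 - \<beta>) * ((1 - \<beta>) / 2 * (w n / (real (Suc n) * real (Suc (Suc n)))))"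
      using \<beta>_less by (simp del: of_nat_Suc)
    also have "\<dots> \<le> 2 * K / (1 - \<beta>) * (wt n / real (Suc n) - wt (Suc n) / real (Suc (Suc n)))"
      using elim K(1) \<beta>_less by (intro mult_left_mono) auto
    finally show ?case by (simp only: norm_divide norm_mult norm_of_nat minus_diff_eq)
  qed
  ultimately show ?thesis by (rule summable_comparison_test_ev[rotated])
qed

text \<open>The sequence n+1 solves the homogeneous recursion exactly, so H_n/(n+1) has the
  increments G_n/((n+1)(n+2)). These are eventually at most \<epsilon>/2 times the decrements of
  wt_n/(n+1). Both quotients tend to 0, and summing from n to infinity transfers the comparison to
  the quotients themselves.\<close>

lemma critical_negligible:
  fixes H G :: "nat \<Rightarrow> complex"
  assumes rec: "\<And>n. of_nat (Suc n) * H (Suc n) = (of_nat n + 2) * H n + G n"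
    and G: "(\<lambda>n. G n / w n) \<longlonglongrightarrow> 0" and H: "(\<lambda>n. H n / of_nat (Suc n)) \<longlonglongrightarrow> 0"
  shows "(\<lambda>n. H n / w n) \<longlonglongrightarrow> 0"
proof -
  define y where "y = (\<lambda>n. H n / of_nat (Suc n))"
  define z where "z = (\<lambda>n. wt n / real (Suc n))"
  have y_Suc: "y (Suc n) - y n = G n / (of_nat (Suc n) * of_nat (Suc (Suc n)))" for n
  proof -
    have nz: "of_nat (Suc n) \<noteq> (0::complex)" "of_nat (Suc (Suc n)) \<noteq> (0::complex)" by (simp_all only: of_nat_eq_0_iff)
    have "y (Suc n) - y n = (of_nat (Suc n) * H (Suc n) - of_nat (Suc (Suc n)) * H n) / (of_nat (Suc n) * of_nat (Suc (Suc n)))"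
      unfolding y_def using nz by (simp add: divide_simps del: of_nat_Suc)
    also have "of_nat (Suc n) * H (Suc n) - of_nat (Suc (Suc n)) * H n = G n"
      unfolding rec by (simp add: algebra_simps)
    finally show ?thesis .
  qed
  have "(\<lambda>n. norm (H n) / wt n) \<longlonglongrightarrow> 0"
  proof (rule LIMSEQ_I)
    fix \<epsilon> :: real assume \<epsilon>: "\<epsilon> > 0"
    have "eventually (\<lambda>n. norm (G n / w n) < \<epsilon>/2 * ((1 - \<beta>) / 2)) sequentially"
      using tendstoD[OF G, of "\<epsilon>/2 * ((1 - \<beta>) / 2)"] \<epsilon> \<beta>_less by simp
    with wt_Suc_le have "eventually (\<lambda>n. norm (y (Suc n) - y n) \<le> \<epsilon>/2 * (z n - z (Suc n))) sequentially"
    proof eventually_elim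
      case (elim n)
      have "norm (G n) \<le> \<epsilon>/2 * ((1 - \<beta>) / 2) * w n" using elim(2) w_pos[of n] by (simp add: norm_divide divide_simps)
      then have "norm (G n) / (real (Suc n) * real (Suc (Suc n))) \<le> \<epsilon>/2 * ((1 - \<beta>) / 2) * w n / (real (Suc n) * real (Suc (Suc n)))"
        by (rule divide_right_mono) simp
      also have "\<dots> = \<epsilon>/2 * ((1 - \<beta>) / 2 * (w n / (real (Suc n) * real (Suc (Suc n)))))" by simp
      also have "\<dots> \<le> \<epsilon>/2 * (z n - z (Suc n))" unfolding z_def using elim \<epsilon> by (intro mult_left_mono) auto
      finally show ?case by (simp only: y_Suc norm_divide norm_mult norm_of_nat)
    qed
    then obtain N where N: "\<And>n. n \<ge> N \<Longrightarrow> norm (y (Suc n) - y n) \<le> \<epsilon>/2 * (z n - z (Suc n))"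
      by (auto simp: eventually_sequentially)
    have step: "norm (y k - y n) \<le> \<epsilon>/2 * (z n - z k)" if "n \<ge> N" "k \<ge> n" for n k
      using that(2)
    proof (induction k rule: dec_induct)
      case (step k)
      have "norm (y (Suc k) - y n) \<le> norm (y (Suc k) - y k) + norm (y k - y n)"
        using norm_triangle_ineq[of "y (Suc k) - y k" "y k - y n"] by simp
      also have "\<dots> \<le> \<epsilon>/2 * (z k - z (Suc k)) + \<epsilon>/2 * (z n - z k)"
        using N[of k] step that by (intro add_mono) auto
      also have "\<dots> = \<epsilon>/2 * (z n - z (Suc k))" by (simp only: distrib_left[symmetric]) simp
      finally show ?case .
    qed simp
    have "norm (y n) \<le> \<epsilon>/2 * z n" if "n \<ge> N" for n
    proof (rule LIMSEQ_le)
      show "(\<lambda>k. norm (y k - y n)) \<longlonglongrightarrow> norm (y n)"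
        using tendsto_norm[OF tendsto_diff[OF H tendsto_const[of "y n"]]] by (simp add: y_def)
      show "(\<lambda>k. \<epsilon>/2 * (z n - z k)) \<longlonglongrightarrow> \<epsilon>/2 * z n"
        using tendsto_mult[OF tendsto_const[of "\<epsilon>/2"] tendsto_diff[OF tendsto_const[of "z n"] wt_over_n]] by (simp add: z_def)
      show "\<exists>N. \<forall>k\<ge>N. norm (y k - y n) \<le> \<epsilon>/2 * (z n - z k)" using step[OF that] by blast
    qed
    then have "norm (norm (H n) / wt n - 0) < \<epsilon>" if "n \<ge> max N 1" for n
    proof -
      have wp: "wt n > 0" using wt_pos that by auto
      have "norm (H n) / real (Suc n) \<le> \<epsilon>/2 * wt n / real (Suc n)"
        using \<open>\<And>n. n \<ge> N \<Longrightarrow> norm (y n) \<le> \<epsilon>/2 * z n\<close>[of n] that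
        by (simp only: y_def z_def norm_divide norm_of_nat) simp
      then have "norm (H n) \<le> \<epsilon>/2 * wt n" unfolding divide_le_cancel by simp
      then have "norm (H n) / wt n \<le> \<epsilon>/2" using wp by (simp add: pos_divide_le_eq)
      then have "norm (H n) / wt n < \<epsilon>" using \<epsilon> by linarith
      then show ?thesis using wp by (simp add: less_imp_le)
    qed
    then show "\<exists>no. \<forall>n\<ge>no. norm (norm (H n) / wt n - 0) < \<epsilon>" by blast
  qed
  from tendsto_mult[OF this wt_over_w]
  have "(\<lambda>n. norm (H n) / wt n * (wt n / w n)) \<longlonglongrightarrow> 0" by simp
  then have "(\<lambda>n. norm (H n / w n)) \<longlonglongrightarrow> 0"
  proof (rule Lim_transform_eventually)
    show "eventually (\<lambda>n. norm (H n) / wt n * (wt n / w n) = norm (H n / w n)) sequentially"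
      using eventually_gt_at_top[of 0]
      by eventually_elim (use wt_pos in \<open>auto simp: norm_divide less_imp_neq[symmetric]\<close>)
  qed
  then show ?thesis by (rule tendsto_norm_zero_cancel)
qed

text \<open>The quotients F_n/(n+1) are the partial sums of the series \<kappa>, so \<kappa>(n+1)
  carries all the linear growth. The remainder is treated as in the noncritical case: g/(\<beta>-1)
  is g/(1+\<beta>-\<zeta>) at \<zeta> = 2.\<close>

lemma critical_asymp:
  fixes F G :: "nat \<Rightarrow> complex" and g :: complex
  assumes rec: "\<And>n. of_nat (Suc n) * F (Suc n) = (of_nat n + 2) * F n + G n"
    and F0: "F 0 = 0" and G: "(\<lambda>n. G n / w n) \<longlonglongrightarrow> g"
  defines "\<kappa> \<equiv> (\<Sum>k. G k / (of_nat (Suc k) * of_nat (Suc (Suc k))))"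
  shows "(\<lambda>n. (F n - \<kappa> * of_nat (Suc n)) / w n) \<longlonglongrightarrow> g / (\<beta> - 1)"
proof -
  define h where "h = g / (\<beta> - 1)"
  define H where "H = (\<lambda>n. F n - \<kappa> * of_nat (Suc n) - h * wt n)"
  have nz: "complex_of_real \<beta> - 1 \<noteq> 0" using \<beta>_less by (auto simp: complex_eq_iff)
  have wtw: "(\<lambda>n. complex_of_real (wt n / w n)) \<longlonglongrightarrow> 1"
    using tendsto_of_real[OF wt_over_w, where 'a = complex] by (simp only: of_real_1)
  have Fsum: "F n / of_nat (Suc n) = (\<Sum>k<n. G k / (of_nat (Suc k) * of_nat (Suc (Suc k))))" for n
  proof (induction n)
    case (Suc n)
    have nz: "of_nat (Suc n) \<noteq> (0::complex)" "of_nat (Suc (Suc n)) \<noteq> (0::complex)" by (simp_all only: of_nat_eq_0_iff)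
    have n2: "of_nat n + 2 = (of_nat (Suc (Suc n)) :: complex)" by simp
    have "F (Suc n) = (of_nat (Suc (Suc n)) * F n + G n) / of_nat (Suc n)"
      using rec[of n] nz unfolding n2 by (simp add: divide_simps mult.commute del: of_nat_Suc)
    then have "F (Suc n) / of_nat (Suc (Suc n)) = F n / of_nat (Suc n) + G n / (of_nat (Suc n) * of_nat (Suc (Suc n)))"
      using nz by (simp add: divide_simps del: of_nat_Suc)
    then show ?case using Suc by simp
  qed (use F0 in simp)
  have "(\<lambda>n. F n / of_nat (Suc n)) \<longlonglongrightarrow> \<kappa>"
    unfolding Fsum \<kappa>_def using summable_over_square[OF G] by (rule summable_LIMSEQ)
  from tendsto_diff[OF tendsto_diff[OF this tendsto_const[of \<kappa>]] tendsto_mult[OF tendsto_const[of h] tendsto_of_real[OF wt_over_n, where 'a = complex]]]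
  have "(\<lambda>n. F n / of_nat (Suc n) - \<kappa> - h * complex_of_real (wt n / real (Suc n))) \<longlonglongrightarrow> 0" by simp
  moreover have "F n / of_nat (Suc n) - \<kappa> - h * complex_of_real (wt n / real (Suc n)) = H n / of_nat (Suc n)" for n
  proof -
    have nz: "of_nat (Suc n) \<noteq> (0::complex)" by (simp only: of_nat_eq_0_iff)
    show ?thesis unfolding H_def of_real_divide of_real_of_nat_eq using nz by (simp add: divide_simps del: of_nat_Suc)
  qed
  ultimately have H0: "(\<lambda>n. H n / of_nat (Suc n)) \<longlonglongrightarrow> 0" by simp
  have "(\<lambda>n. H n / w n) \<longlonglongrightarrow> 0"
  proof (rule critical_negligible[OF _ _ H0])
    fix n
    have "complex_of_real (real (Suc n) * wt (Suc n)) = of_real (real n * wt n + (1 + \<beta>) * w n)"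
      by (simp only: wt_Suc)
    then have wtS: "of_nat (Suc n) * complex_of_real (wt (Suc n)) = of_nat n * wt n + (1 + \<beta>) * w n"
      by (simp only: of_real_mult of_real_of_nat_eq of_real_add of_real_1)
    have "of_nat (Suc n) * H (Suc n) = of_nat (Suc n) * F (Suc n) - of_nat (Suc n) * (\<kappa> * of_nat (Suc (Suc n))) - h * (of_nat (Suc n) * complex_of_real (wt (Suc n)))"
      by (simp only: H_def right_diff_distrib mult.left_commute)
    also have "\<dots> = (of_nat n + 2) * H n + (G n - h * (complex_of_real (1 + \<beta>) * w n - 2 * complex_of_real (wt n)))"
      unfolding rec wtS H_def by (simp add: algebra_simps)
    finally show "of_nat (Suc n) * H (Suc n) = \<dots>" .
  next
    have "(\<lambda>n. G n / w n - h * (complex_of_real (1 + \<beta>) - 2 * complex_of_real (wt n / w n))) \<longlonglongrightarrow> g - h * (complex_of_real (1 + \<beta>) - 2 * 1)"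
      by (intro tendsto_intros G wtw)
    moreover have "G n / w n - h * (complex_of_real (1 + \<beta>) - 2 * complex_of_real (wt n / w n)) =
       (G n - h * (complex_of_real (1 + \<beta>) * w n - 2 * complex_of_real (wt n))) / w n" for n
      by (simp add: field_simps)
    moreover have "g - h * (complex_of_real (1 + \<beta>) - 2 * 1) = g - h * (\<beta> - 1)" by (simp add: algebra_simps)
    then have "g - h * (complex_of_real (1 + \<beta>) - 2 * 1) = 0" using nz by (simp add: h_def)
    ultimately show "(\<lambda>n. (G n - h * (complex_of_real (1 + \<beta>) * w n - 2 * complex_of_real (wt n))) / w n) \<longlonglongrightarrow> 0" by simp
  qed
  from tendsto_add[OF this tendsto_mult[OF tendsto_const[of h] wtw]]
  have "(\<lambda>n. H n / w n + h * complex_of_real (wt n / w n)) \<longlonglongrightarrow> h" by simp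
  moreover have "H n / w n + h * complex_of_real (wt n / w n) = (F n - \<kappa> * of_nat (Suc n)) / w n" for n
    by (simp add: H_def diff_divide_distrib)
  ultimately show ?thesis by (simp add: h_def)
qed

end

section \<open>The mean\<close>

unbundle fps_syntax

section \<open>Polynomials in the operator (1 - z) d/dz on formal power series\<close>

definition theta :: "complex fps \<Rightarrow> complex fps" where
  "theta f = (1 - fps_X) * fps_deriv f"

text \<open>On coefficients, the equation \<open>theta f - fps_const z * f = g\<close> thereby
  becomes the first-order recursion with \<zeta> = z.\<close>

lemma theta_nth: "theta f $ n = of_nat (Suc n) * f $ Suc n - of_nat n * f $ n"
  by (cases n) (auto simp: theta_def left_diff_distrib)

lemma theta_add: "theta (f + g) = theta f + theta g"
  by (simp add: theta_def algebra_simps)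

lemma theta_diff: "theta (f - g) = theta f - theta g"
  by (simp add: theta_def algebra_simps)

lemma theta_const_mult: "theta (fps_const c * f) = fps_const c * theta f"
  by (simp add: theta_def)

text \<open>The operator p(\<open>theta\<close>). The fold applies \<open>theta\<close> to the
  argument of the remaining polynomial, a Horner scheme that involves no operator powers.\<close>

definition poly_theta :: "complex poly \<Rightarrow> complex fps \<Rightarrow> complex fps" where
  "poly_theta p = fold_coeffs (\<lambda>a h f. fps_const a * f + h (theta f)) p (\<lambda>_. 0)"

lemma poly_theta_0 [simp]: "poly_theta 0 f = 0"
  by (simp add: poly_theta_def)

lemma poly_theta_pCons [simp]: "poly_theta (pCons a p) f = fps_const a * f + poly_theta p (theta f)"
  by (cases "a = 0"; cases "p = 0") (auto simp: poly_theta_def)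

lemma poly_theta_add_poly: "poly_theta (p + q) f = poly_theta p f + poly_theta q f"
  by (induction p q arbitrary: f rule: poly_induct2) (simp_all add: algebra_simps flip: fps_const_add)

lemma poly_theta_smult: "poly_theta (smult c p) f = fps_const c * poly_theta p f"
  by (induction p arbitrary: f) (simp_all add: algebra_simps flip: fps_const_mult)

lemma poly_theta_commute: "poly_theta p (theta f) = theta (poly_theta p f)"
proof (induction p arbitrary: f)
  case 0
  then show ?case by (simp add: theta_def)
next
  case (pCons a p)
  then show ?case by (simp add: theta_add theta_const_mult)
qed

lemma poly_theta_linear_factor:
  "poly_theta ([:-z, 1:] * p) f = theta (poly_theta p f) - fps_const z * poly_theta p f"
proof -
  have eq: "[:-z, 1:] * p = smult (-z) p + pCons 0 p" by simp
  show ?thesis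
    unfolding eq poly_theta_add_poly poly_theta_smult poly_theta_pCons poly_theta_commute
    by (simp flip: fps_const_neg)
qed

text \<open>Applying (1 - z) d/dz to (1 - z)^r gives -r (1 - z)^r, which the next factor
  \<open>theta\<close> + r cancels. Only the term with one more derivative of \<open>f\<close>
  survives.\<close>

lemma poly_theta_pochhammer:
  "poly_theta (\<Prod>k<r. [:of_nat k, 1:]) f = (1 - fps_X) ^ r * (fps_deriv ^^ r) f"
proof (induction r)
  case 0
  have "poly_theta 1 f = f" unfolding one_pCons poly_theta_pCons by simp
  then show ?case by simp
next
  case (Suc r)
  have "poly_theta (\<Prod>k<Suc r. [:of_nat k, 1:]) f = poly_theta ([:- (- of_nat r), 1:] * (\<Prod>k<r. [:of_nat k, 1:])) f"
    by (simp only: prod.lessThan_Suc minus_minus mult.commute)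
  also have "\<dots> = theta ((1 - fps_X) ^ r * (fps_deriv ^^ r) f) + fps_const (of_nat r) * ((1 - fps_X) ^ r * (fps_deriv ^^ r) f)"
    unfolding poly_theta_linear_factor Suc by (simp flip: fps_const_neg)
  also have "\<dots> = (1 - fps_X) ^ Suc r * (fps_deriv ^^ Suc r) f"
  proof -
    have d: "(1 - fps_X) * fps_deriv ((1 - fps_X) ^ r) = - fps_const (of_nat r) * (1 - fps_X :: complex fps) ^ r"
    proof (induction r)
      case (Suc r)
      have "(1 - fps_X) * fps_deriv ((1 - fps_X) ^ Suc r) =
          (1 - fps_X) * ((1 - fps_X) * fps_deriv ((1 - fps_X :: complex fps) ^ r) - (1 - fps_X) ^ r)"
        by simp
      also have "\<dots> = - (fps_const (of_nat r) + 1) * (1 - fps_X) ^ Suc r"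
        unfolding Suc by (simp add: algebra_simps)
      also have "fps_const (of_nat r) + 1 = fps_const (of_nat (Suc r) :: complex)"
        by (simp flip: fps_const_add add: add.commute)
      finally show ?case .
    qed simp
    have "theta ((1 - fps_X) ^ r * (fps_deriv ^^ r) f) =
        (1 - fps_X) ^ Suc r * (fps_deriv ^^ Suc r) f + (1 - fps_X) * fps_deriv ((1 - fps_X) ^ r) * (fps_deriv ^^ r) f"
      by (simp add: theta_def distrib_left mult_ac)
    then show ?thesis unfolding d by (simp add: mult.assoc flip: fps_const_neg)
  qed
  finally show ?case .
qed

text \<open>The product of the operators \<open>theta\<close> - z over a list of roots; in list form
  it can be inverted one root at a time by induction.\<close>

fun root_op :: "complex list \<Rightarrow> complex fps \<Rightarrow> complex fps" where
  "root_op [] f = f"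
| "root_op (z # zs) f = root_op zs (theta f - fps_const z * f)"

lemma root_op_diff: "root_op zs (f - g) = root_op zs f - root_op zs g"
proof (induction zs arbitrary: f g)
  case (Cons z zs)
  have "theta (f - g) - fps_const z * (f - g) = (theta f - fps_const z * f) - (theta g - fps_const z * g)"
    by (simp add: theta_diff algebra_simps)
  then show ?case by (simp only: root_op.simps Cons)
qed simp

lemma root_op_const_mult: "root_op zs (fps_const c * f) = fps_const c * root_op zs f"
proof (induction zs arbitrary: f)
  case (Cons z zs)
  have "theta (fps_const c * f) - fps_const z * (fps_const c * f) = fps_const c * (theta f - fps_const z * f)"
    by (simp only: theta_const_mult right_diff_distrib mult.left_commute)
  then show ?case by (simp only: root_op.simps Cons)
qed simp

lemma theta_root_op: "theta (root_op zs f) = root_op zs (theta f)"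
proof (induction zs arbitrary: f)
  case (Cons z zs)
  show ?case by (simp add: Cons theta_diff theta_const_mult)
qed simp

lemma poly_theta_roots: "poly_theta (\<Prod>z\<leftarrow>zs. [:-z, 1:]) f = root_op zs f"
proof (induction zs arbitrary: f)
  case Nil
  have "poly_theta 1 f = f" unfolding one_pCons poly_theta_pCons by simp
  then show ?case by simp
next
  case (Cons z zs)
  show ?case
    by (simp only: list.map prod_list.Cons poly_theta_linear_factor Cons root_op.simps
        theta_root_op root_op_diff root_op_const_mult)
qed

text \<open>Each factor looks one coefficient ahead, so every root costs one of the initial
  zeros.\<close>

lemma root_op_nth_eq_0:
  assumes "\<And>i. i \<le> length zs + k \<Longrightarrow> f $ i = 0" "i \<le> k"
  shows "root_op zs f $ i = 0"
  using assms
proof (induction zs arbitrary: f)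
  case (Cons z zs)
  show ?case unfolding root_op.simps
    by (rule Cons.IH) (use Cons.prems in \<open>auto simp: theta_nth\<close>)
qed simp

text \<open>The series with coefficients n+1 is 1/(1 - z)^2, an eigenvector of \<open>theta\<close>
  with eigenvalue 2.\<close>

lemma root_op_linear:
  "root_op zs (Abs_fps (\<lambda>n. of_nat (Suc n))) = fps_const (\<Prod>z\<leftarrow>zs. 2 - z) * Abs_fps (\<lambda>n. of_nat (Suc n))"
proof (induction zs)
  case (Cons z zs)
  have *: "theta (Abs_fps (\<lambda>n. of_nat (Suc n))) - fps_const z * Abs_fps (\<lambda>n. of_nat (Suc n)) = fps_const (2 - z) * Abs_fps (\<lambda>n. of_nat (Suc n))"
    by (rule fps_ext) (simp add: theta_nth algebra_simps)
  show ?case by (simp only: root_op.simps * root_op_const_mult Cons list.map prod_list.Cons fps_const_mult[symmetric] mult.assoc)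
qed simp

lemma fps_nth_deriv_pochhammer:
  "(fps_deriv ^^ r) f $ n = pochhammer (of_nat (Suc n)) r * (f :: complex fps) $ (n + r)"
proof (induction r arbitrary: n)
  case (Suc r)
  have "(fps_deriv ^^ Suc r) f $ n = of_nat (Suc n) * (pochhammer (of_nat (Suc (Suc n))) r * f $ (Suc n + r))"
    by (simp add: Suc)
  also have "\<dots> = pochhammer (of_nat (Suc n)) (Suc r) * f $ (n + Suc r)"
    by (simp add: pochhammer_rec algebra_simps)
  finally show ?case .
qed simp

text \<open>For a fixed position i this is a Cauchy product in which position i carries
  \<open>A\<close> and each other position the geometric series. The factor m counts the
  positions.\<close>

lemma fps_natpermute_sum:
  fixes A :: "complex fps"
  assumes "m > 0"
  shows "(\<Sum>v\<in>natpermute n m. \<Sum>i<m. A $ (v ! i)) = (fps_const (of_nat m) * A * Abs_fps (\<lambda>_. 1) ^ (m - 1)) $ n"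
proof -
  have "(\<Sum>v\<in>natpermute n m. A $ (v ! i)) = (A * Abs_fps (\<lambda>_. 1) ^ (m - 1)) $ n" if i: "i < m" for i
  proof -
    define F where "F = (\<lambda>j::nat. if j = i then A else Abs_fps (\<lambda>_. 1))"
    have "prod F {0..m-1} = F i * prod F ({0..m-1} - {i})" using i by (intro prod.remove) auto
    also have "prod F ({0..m-1} - {i}) = Abs_fps (\<lambda>_. 1) ^ (m - 1)"
    proof -
      have "prod F ({0..m-1} - {i}) = prod (\<lambda>_. Abs_fps (\<lambda>_. 1)) ({0..m-1} - {i})"
        by (intro prod.cong) (auto simp: F_def)
      moreover have "card ({0..m-1} - {i}) = m - 1" using i by (subst card_Diff_singleton) auto
      ultimately show ?thesis by (simp only: prod_constant)
    qed
    finally have "prod F {0..m-1} = A * Abs_fps (\<lambda>_. 1) ^ (m - 1)" by (simp add: F_def)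
    moreover have "prod F {0..m-1} $ n = (\<Sum>v\<in>natpermute n (m - 1 + 1). \<Prod>j\<in>{0..m-1}. F j $ (v ! j))"
      by (rule fps_prod_nth)
    moreover have "(\<Prod>j\<in>{0..m-1}. F j $ (v ! j)) = A $ (v ! i)" for v
    proof -
      have "(\<Prod>j\<in>{0..m-1}. F j $ (v ! j)) = (\<Prod>j\<in>{0..m-1}. if j = i then A $ (v ! i) else 1)"
        by (intro prod.cong) (auto simp: F_def)
      then show ?thesis using i by auto
    qed
    ultimately show ?thesis using assms by simp
  qed
  then have "(\<Sum>v\<in>natpermute n m. \<Sum>i<m. A $ (v ! i)) = (\<Sum>i<m. (A * Abs_fps (\<lambda>_. 1) ^ (m - 1)) $ n)"
    by (subst sum.swap) (intro sum.cong, auto)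
  then show ?thesis by (simp add: mult.assoc)
qed

lemma one_minus_X_mult_geometric: "(1 - fps_X) * Abs_fps (\<lambda>_. 1 :: complex) = 1"
  by (rule fps_ext) (auto simp: left_diff_distrib)

context rv_weight begin

lemma root_op_asymp:
  fixes g :: complex
  assumes "\<And>z. z \<in> set zs \<Longrightarrow> Re z < 1 + \<beta>" and "(\<lambda>n. root_op zs f $ n / of_real (w n)) \<longlonglongrightarrow> g"
  shows "(\<lambda>n. f $ n / of_real (w n)) \<longlonglongrightarrow> g / (\<Prod>z\<leftarrow>zs. of_real (1 + \<beta>) - z)"
  using assms
proof (induction zs arbitrary: f)
  case (Cons z zs)
  have "(\<lambda>n. (theta f - fps_const z * f) $ n / of_real (w n)) \<longlonglongrightarrow> g / (\<Prod>z\<leftarrow>zs. of_real (1 + \<beta>) - z)"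
    using Cons.prems by (intro Cons.IH) auto
  then have "(\<lambda>n. f $ n / of_real (w n)) \<longlonglongrightarrow> g / (\<Prod>z\<leftarrow>zs. of_real (1 + \<beta>) - z) / (1 + \<beta> - z)"
    using Cons.prems(1)[of z]
    by (intro first_order_asymp[where G = "\<lambda>n. (theta f - fps_const z * f) $ n"]) (auto simp: theta_nth algebra_simps)
  then show ?case by (simp add: mult.commute)
qed simp

end

section \<open>Roots and factorisation of the polynomial psi_m\<close>

lemma poly_prod_linear: "poly (\<Prod>z\<leftarrow>zs. [:-z, 1:]) x = (\<Prod>z\<leftarrow>zs. x - (z::complex))"
  by (induction zs) (simp_all del: mult_pCons_left mult_pCons_right)

definition psi_poly :: "nat \<Rightarrow> complex poly" where
  "psi_poly m = (\<Prod>k<m-1. [:of_nat k, 1:]) - [:fact m:]"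

lemma poly_psi_poly: "poly (psi_poly m) z = psi m z"
  by (simp add: psi_poly_def psi_def poly_prod pochhammer_prod lessThan_atLeast0 add.commute)

lemma pochhammer_2: "m \<ge> 2 \<Longrightarrow> pochhammer (2::'a::{comm_semiring_1,semiring_char_0}) (m - 1) = fact m"
proof -
  assume "m \<ge> 2"
  then have m: "Suc (m - 1) = m" by simp
  have "fact m = (pochhammer 1 (Suc (m - 1)) :: 'a)" by (simp only: m pochhammer_fact)
  also have "\<dots> = pochhammer 2 (m - 1)" unfolding pochhammer_rec by (simp only: one_add_one mult_1)
  finally show "pochhammer (2::'a) (m - 1) = fact m" by (rule sym)
qed

lemma psi_2: "m \<ge> 2 \<Longrightarrow> psi m 2 = 0"
  unfolding psi_def by (simp only: pochhammer_2 diff_self)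

text \<open>By the product rule the derivative is m! times the sum of the 1/(k+2), that is 1/2 + ...
  + 1/m. This is the origin of H_m - 1 in the slope.\<close>

lemma pderiv_psi_poly_2:
  assumes "m \<ge> 2"
  shows "poly (pderiv (psi_poly m)) 2 = of_real (fact m * (harm m - 1))"
proof -
  have "poly (pderiv (psi_poly m)) 2 = (\<Sum>k<m-1. \<Prod>j\<in>{..<m-1}-{k}. of_nat j + 2)"
    by (simp add: psi_poly_def pderiv_diff pderiv_prod poly_sum poly_prod pderiv_pCons)
  also have "\<dots> = (\<Sum>k<m-1. fact m / (of_nat k + 2))"
  proof (rule sum.cong)
    fix k assume k: "k \<in> {..<m-1}"
    have "of_nat k + (2::complex) \<noteq> 0" by (metis of_nat_add of_nat_eq_0_iff of_nat_numeral add_is_0 zero_neq_numeral)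
    moreover have "(\<Prod>j<m-1. of_nat j + (2::complex)) = fact m"
      using pochhammer_2[OF assms, where 'a = complex] by (simp add: pochhammer_prod lessThan_atLeast0 add.commute)
    then have "(of_nat k + 2) * (\<Prod>j\<in>{..<m-1}-{k}. of_nat j + (2::complex)) = fact m"
      using k prod.remove[of "{..<m-1}" k "\<lambda>j. of_nat j + (2::complex)"] by simp
    ultimately show "(\<Prod>j\<in>{..<m-1}-{k}. of_nat j + (2::complex)) = fact m / (of_nat k + 2)"
      by (simp add: field_simps)
  qed simp
  also have "\<dots> = of_real (fact m * (\<Sum>k<m-1. 1 / (real k + 2)))"
    by (simp add: sum_distrib_left)
  also have "(\<Sum>k<m-1. 1 / (real k + 2)) = harm m - 1"
  proof -
    have "harm (Suc n) - 1 = (\<Sum>k<n. 1 / (real k + 2))" for n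
      by (induction n) (auto simp: harm_Suc divide_inverse add.commute harm_expand)
    from this[of "m - 1"] show ?thesis using assms by simp
  qed
  finally show ?thesis .
qed

lemma harm_gt_1: "m \<ge> 2 \<Longrightarrow> harm m > (1::real)"
proof -
  assume "m \<ge> 2"
  then have "(3/2::real) \<le> harm m"
    using harm_mono[of 2 m, where 'a = real] by (simp add: harm_expand)
  then show ?thesis by simp
qed

text \<open>The derivative at 2 equals the leading coefficient times the product of the 2 - z over
  the other roots. Since it is positive, 2 is a simple root and does not occur in \<open>zs\<close>;
  its value is kept because it fixes the coefficient of the linear term of the mean.\<close>

lemma psi_factorization:
  assumes "m \<ge> 2"
  obtains c zs where "c \<noteq> 0" "psi_poly m = smult c ([:-2, 1:] * (\<Prod>z\<leftarrow>zs. [:-z, 1:]))" "length zs \<le> m - 2"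
    "\<And>z. z \<in> set zs \<Longrightarrow> psi m z = 0 \<and> z \<noteq> 2" "c * (\<Prod>z\<leftarrow>zs. 2 - z) = of_real (fact m * (harm m - 1))"
proof -
  have "psi m 0 \<noteq> 0" using assms by (simp add: psi_def pochhammer_0_left)
  then have nz: "psi_poly m \<noteq> 0" using poly_psi_poly[of m 0] by auto
  obtain A where A: "size A = degree (psi_poly m)"
    "psi_poly m = smult (lead_coeff (psi_poly m)) (\<Prod>x\<in>#A. [:-x, 1:])"
    using alg_closed_imp_factorization[OF nz] by blast
  have rootA: "psi m z = 0 \<longleftrightarrow> z \<in># A" for z
  proof -
    have "psi m z = poly (psi_poly m) z" by (simp add: poly_psi_poly)
    also have "\<dots> = lead_coeff (psi_poly m) * (\<Prod>x\<in>#A. z - x)"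
      by (subst A(2)) (simp add: poly_prod_mset image_mset.compositionality o_def)
    finally show ?thesis using nz by (auto simp: prod_mset_zero_iff)
  qed
  then have "2 \<in># A" using psi_2[OF assms] by simp
  then obtain B where B: "A = add_mset 2 B" by (metis mset_add)
  obtain zs where zs: "mset zs = B" using ex_mset by blast
  define c where "c = lead_coeff (psi_poly m)"
  have c: "c \<noteq> 0" using nz by (simp add: c_def)
  have fac: "psi_poly m = smult c ([:-2, 1:] * (\<Prod>z\<leftarrow>zs. [:-z, 1:]))"
    using A(2) unfolding c_def[symmetric] B zs[symmetric] by (simp flip: prod_mset_prod_list)
  have "degree (psi_poly m) \<le> m - 1"
    unfolding psi_poly_def using degree_prod_sum_le[of "{..<m-1}" "\<lambda>k. [:of_nat k, 1::complex:]"]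
    by (intro degree_diff_le) auto
  then have len: "length zs \<le> m - 2" using A(1) zs B by auto
  have der: "c * (\<Prod>z\<leftarrow>zs. 2 - z) = of_real (fact m * (harm m - 1))"
  proof -
    have "poly (pderiv (psi_poly m)) 2 = c * (\<Prod>z\<leftarrow>zs. 2 - z)"
      unfolding fac pderiv_smult pderiv_mult by (simp add: pderiv_pCons poly_prod_linear del: mult_pCons_left mult_pCons_right)
    then show ?thesis using pderiv_psi_poly_2[OF assms] by simp
  qed
  have "harm m > (1::real)" by (rule harm_gt_1[OF assms])
  then have "c * (\<Prod>z\<leftarrow>zs. 2 - z) \<noteq> 0" unfolding der by (subst of_real_eq_0_iff) auto
  then have "2 \<notin> set zs" by (auto simp: prod_list_zero_iff)
  moreover have "psi m z = 0" if "z \<in> set zs" for z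
    using that rootA[of z] B zs by auto
  ultimately show ?thesis using that[OF c fac len _ der] by blast
qed

lemma psi_of_real:
  assumes "m \<ge> 2"
  shows "psi m (of_real (1 + \<beta>)) = of_real (rho m \<beta> - fact m)"
proof -
  have "{0..m-2} = {..<m-1}" using assms by auto
  then have "rho m \<beta> = pochhammer (1 + \<beta>) (m - 1)" by (simp add: rho_def pochhammer_prod lessThan_atLeast0)
  then show ?thesis by (simp add: psi_def pochhammer_of_real del: of_real_add)
qed

section \<open>Asymptotic expansion of the mean\<close>

lemma (in rv_weight) mean_asymp:
  fixes t a :: "nat \<Rightarrow> real"
  assumes m: "m \<ge> 2" and t: "(\<lambda>n. t n / w n) \<longlonglongrightarrow> 1"
    and init: "\<And>n. n < m - 1 \<Longrightarrow> a n = t n"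
    and rec: "\<And>n. n \<ge> m - 1 \<Longrightarrow> real (n choose (m - 1)) * (a n - t n) = (\<Sum>v\<in>natpermute (n - (m - 1)) m. \<Sum>i<m. a (v ! i))"
    and roots: "\<And>z. psi m z = 0 \<Longrightarrow> z \<noteq> 2 \<Longrightarrow> Re z < 1 + \<beta>"
  shows "summable (\<lambda>j. t j / ((real j + 1) * (real j + 2)))"
    and "(\<lambda>n. (a n - slope m t * real (Suc n)) / w n) \<longlonglongrightarrow> - rho m \<beta> / (fact m - rho m \<beta>)"
proof -
  obtain c zs where c: "c \<noteq> 0" and fac: "psi_poly m = smult c ([:-2, 1:] * (\<Prod>z\<leftarrow>zs. [:-z, 1:]))"
    and len: "length zs \<le> m - 2" and zs: "\<And>z. z \<in> set zs \<Longrightarrow> psi m z = 0 \<and> z \<noteq> 2"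
    and der: "c * (\<Prod>z\<leftarrow>zs. 2 - z) = of_real (fact m * (harm m - 1))"
    using psi_factorization[OF m] by metis
  define T where "T = Abs_fps (\<lambda>n. complex_of_real (t n))"
  define A where "A = Abs_fps (\<lambda>n. complex_of_real (a n))"
  define C where "C = A - T"
  \<comment> \<open>Multiplied by (m-1)!, the binomial coefficient in the recursion becomes the
    Pochhammer factor of an (m-1)-fold derivative. The sum over compositions is a coefficient of m
    A/(1 - z)^(m-1).\<close>
  have "(fps_deriv ^^ (m - 1)) C = fps_const (fact m) * A * Abs_fps (\<lambda>_. 1) ^ (m - 1)"
  proof (rule fps_ext)
    fix n
    have "pochhammer (of_nat (Suc n)) (m - 1) = (fact (m - 1) * of_nat ((n + (m - 1)) choose (m - 1)) :: complex)"
    proof -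
      have "fact (n + (m-1)) = (fact n * pochhammer (of_nat (Suc n)) (m - 1) :: complex)"
        by (metis pochhammer_fact pochhammer_product' of_nat_Suc add.commute)
      moreover have "of_nat ((n + (m - 1)) choose (m - 1)) = (fact (n + (m-1)) / (fact (m - 1) * fact n) :: complex)"
        by (subst binomial_fact) auto
      ultimately show ?thesis by simp
    qed
    then have "(fps_deriv ^^ (m - 1)) C $ n = fact (m - 1) * of_real (real ((n + (m - 1)) choose (m - 1)) * (a (n + (m - 1)) - t (n + (m - 1))))"
      by (simp add: fps_nth_deriv_pochhammer C_def A_def T_def)
    also have "real ((n + (m - 1)) choose (m - 1)) * (a (n + (m - 1)) - t (n + (m - 1))) = (\<Sum>v\<in>natpermute n m. \<Sum>i<m. a (v ! i))"
      by (subst rec) auto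
    also have "of_real \<dots> = (\<Sum>v\<in>natpermute n m. \<Sum>i<m. A $ (v ! i))" by (simp add: A_def)
    also have "\<dots> = (fps_const (of_nat m) * A * Abs_fps (\<lambda>_. 1) ^ (m - 1)) $ n"
      using m by (intro fps_natpermute_sum) simp
    also have "fact (m - 1) * \<dots> = (fps_const (fact m) * A * Abs_fps (\<lambda>_. 1) ^ (m - 1)) $ n"
    proof -
      have "fact m = (of_nat m * fact (m - 1) :: complex)" using m by (subst fact_reduce) auto
      then show ?thesis by (simp add: mult.assoc)
    qed
    finally show "(fps_deriv ^^ (m - 1)) C $ n = (fps_const (fact m) * A * Abs_fps (\<lambda>_. 1) ^ (m - 1)) $ n" .
  qed
  then have "poly_theta (\<Prod>k<m-1. [:of_nat k, 1:]) C = fps_const (fact m) * A * ((1 - fps_X) * Abs_fps (\<lambda>_. 1)) ^ (m - 1)"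
    unfolding poly_theta_pochhammer by (simp add: power_mult_distrib)
  then have "poly_theta (\<Prod>k<m-1. [:of_nat k, 1:]) C = fps_const (fact m) * A"
    unfolding one_minus_X_mult_geometric by simp
  moreover have "(\<Prod>k<m-1. [:of_nat k, 1:]) = psi_poly m + [:fact m:]" by (simp add: psi_poly_def)
  ultimately have "poly_theta (psi_poly m) C + fps_const (fact m) * C = fps_const (fact m) * A"
    by (simp only: poly_theta_add_poly poly_theta_pCons poly_theta_0 add_0_right)
  then have psiC: "poly_theta (psi_poly m) C = fps_const (fact m) * T"
    by (simp add: C_def algebra_simps)
  \<comment> \<open>All factors except the one for the root 2 are collected in \<open>F\<close>,
    which leaves \<open>F\<close> with the critical recursion. The other roots are inverted only
    after the linear part has been removed.\<close>
  define F where "F = root_op zs C"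
  have "fps_const c * (theta F - fps_const 2 * F) = fps_const (fact m) * T"
    using psiC unfolding fac poly_theta_smult poly_theta_linear_factor poly_theta_roots F_def .
  then have "(fps_const c * (theta F - fps_const 2 * F)) $ n = (fps_const (fact m) * T) $ n" for n by simp
  then have Feq: "c * (theta F $ n - 2 * F $ n) = fact m * of_real (t n)" for n by (simp add: T_def)
  define G where "G = (\<lambda>n. fact m / c * complex_of_real (t n))"
  have Frec: "of_nat (Suc n) * F $ Suc n = (of_nat n + 2) * F $ n + G n" for n
  proof -
    have "theta F $ n - 2 * F $ n = G n" using Feq[of n] c by (simp add: G_def field_simps)
    then show ?thesis by (simp add: theta_nth algebra_simps)
  qed
  \<comment> \<open>Up to index m-2 the means equal the tolls, so the first m-1 coefficients of
    \<open>C\<close> vanish. There are at most m-2 roots in \<open>zs\<close>, hence the coefficient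
    at 0 still vanishes in \<open>F\<close>.\<close>
  have "C $ i = 0" if "i \<le> m - 2" for i using that m init[of i] by (simp add: C_def A_def T_def)
  then have F0: "F $ 0 = 0" unfolding F_def using len by (intro root_op_nth_eq_0[where k = 0]) auto
  have tw: "(\<lambda>n. complex_of_real (t n) / of_real (w n)) \<longlonglongrightarrow> 1"
    using tendsto_of_real[OF t, where 'a = complex] by simp
  have "(\<lambda>n. fact m / c * (complex_of_real (t n) / of_real (w n))) \<longlonglongrightarrow> fact m / c * 1"
    by (intro tendsto_mult tendsto_const tw)
  then have Gw: "(\<lambda>n. G n / of_real (w n)) \<longlonglongrightarrow> fact m / c" by (simp add: G_def)
  have Sc: "summable (\<lambda>k. complex_of_real (t k) / (of_nat (Suc k) * of_nat (Suc (Suc k))))"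
    by (rule summable_over_square[OF tw])
  have tt: "complex_of_real (t k / ((real k + 1) * (real k + 2))) = complex_of_real (t k) / (of_nat (Suc k) * of_nat (Suc (Suc k)))" for k
    by (simp add: add.commute)
  have "summable (\<lambda>k. Re (complex_of_real (t k / ((real k + 1) * (real k + 2)))))"
    unfolding tt by (rule summable_Re[OF Sc])
  then show sm: "summable (\<lambda>j. t j / ((real j + 1) * (real j + 2)))" by (simp only: Re_complex_of_real)
  have K1: "(\<Sum>k. G k / (of_nat (Suc k) * of_nat (Suc (Suc k)))) = fact m / c * of_real (K1 t)"
  proof -
    have "(\<Sum>k. G k / (of_nat (Suc k) * of_nat (Suc (Suc k)))) = (\<Sum>k. fact m / c * (complex_of_real (t k) / (of_nat (Suc k) * of_nat (Suc (Suc k)))))"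
      by (simp add: G_def)
    also have "\<dots> = fact m / c * (\<Sum>k. complex_of_real (t k) / (of_nat (Suc k) * of_nat (Suc (Suc k))))"
      by (rule suminf_mult[OF Sc])
    also have "(\<Sum>k. complex_of_real (t k) / (of_nat (Suc k) * of_nat (Suc (Suc k)))) = of_real (K1 t)"
      unfolding K1_def suminf_of_real[OF sm] tt ..
    finally show ?thesis .
  qed
  have Fas: "(\<lambda>n. (F $ n - fact m / c * of_real (K1 t) * of_nat (Suc n)) / of_real (w n)) \<longlonglongrightarrow> fact m / c / (of_real \<beta> - 1)"
    using critical_asymp[OF Frec F0 Gw] unfolding K1 by simp
  define C' where "C' = C - fps_const (of_real (slope m t)) * Abs_fps (\<lambda>n. of_nat (Suc n))"
  \<comment> \<open>Applying \<open>root_op zs\<close> to the series with coefficients n+1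
    multiplies it by the product of the 2 - z. The value of the derivative of psi_m at 2 turns the
    quotient by this product into \<open>slope\<close>.\<close>
  have mu: "of_real (slope m t) * (\<Prod>z\<leftarrow>zs. 2 - z) = fact m / c * complex_of_real (K1 t)"
  proof -
    have "harm m - 1 \<noteq> (0::real)" using harm_gt_1[OF m] by simp
    then have "of_real (slope m t * (fact m * (harm m - 1))) = complex_of_real (fact m * K1 t)"
      by (simp add: slope_def)
    then have "of_real (slope m t) * (c * (\<Prod>z\<leftarrow>zs. 2 - z)) = complex_of_real (fact m * K1 t)"
      unfolding der by simp
    then show ?thesis using c by (simp add: field_simps)
  qed
  have "root_op zs C' $ n = F $ n - fact m / c * of_real (K1 t) * of_nat (Suc n)" for n
    unfolding C'_def root_op_diff root_op_const_mult root_op_linear F_def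
    by (simp add: mu mult.assoc[symmetric] del: of_nat_Suc)
  with Fas have "(\<lambda>n. root_op zs C' $ n / of_real (w n)) \<longlonglongrightarrow> fact m / c / (of_real \<beta> - 1)" by simp
  then have C'as: "(\<lambda>n. C' $ n / of_real (w n)) \<longlonglongrightarrow> fact m / c / (of_real \<beta> - 1) / (\<Prod>z\<leftarrow>zs. of_real (1 + \<beta>) - z)"
    using zs roots by (intro root_op_asymp) auto
  \<comment> \<open>The factor \<beta> - 1 belongs to the root 2, so all denominators together with
    c make up psi_m(1 + \<beta>) = \<rho> - m!.\<close>
  have "psi m (of_real (1 + \<beta>)) = c * ((of_real \<beta> - 1) * (\<Prod>z\<leftarrow>zs. of_real (1 + \<beta>) - z))"
    unfolding poly_psi_poly[symmetric] fac by (simp add: poly_prod_linear del: mult_pCons_left mult_pCons_right)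
  then have "fact m / c / (of_real \<beta> - 1) / (\<Prod>z\<leftarrow>zs. of_real (1 + \<beta>) - z) = complex_of_real (fact m / (rho m \<beta> - fact m))"
    unfolding psi_of_real[OF m] by (simp add: mult.assoc)
  with C'as have "(\<lambda>n. C' $ n / of_real (w n)) \<longlonglongrightarrow> complex_of_real (fact m / (rho m \<beta> - fact m))" by simp
  from tendsto_Re[OF this] have "(\<lambda>n. Re (C' $ n / of_real (w n))) \<longlonglongrightarrow> fact m / (rho m \<beta> - fact m)"
    by (simp only: Re_complex_of_real)
  moreover have "Re (C' $ n / of_real (w n)) = (a n - t n - slope m t * real (Suc n)) / w n" for n
    by (simp add: C'_def C_def A_def T_def Re_divide_of_real)
  \<comment> \<open>\<open>C\<close> generates mean minus toll, so the toll is added back here and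
    contributes the summand 1.\<close>
  ultimately have "(\<lambda>n. (a n - t n - slope m t * real (Suc n)) / w n + t n / w n) \<longlonglongrightarrow> fact m / (rho m \<beta> - fact m) + 1"
    using t by (intro tendsto_add) auto
  moreover have "rho m \<beta> < fact m"
  proof -
    have "rho m \<beta> < (\<Prod>i=0..m-2. 2 + real i)"
      unfolding rho_def using \<beta>_less \<beta>_pos by (intro prod_mono_strict) auto
    also have "{0..m-2} = {0..<m-1}" using m by auto
    also have "(\<Prod>i=0..<m-1. 2 + real i) = fact m" using pochhammer_2[OF m, where 'a = real] by (simp add: pochhammer_prod)
    finally show ?thesis .
  qed
  then have "fact m / (rho m \<beta> - fact m) + 1 = - rho m \<beta> / (fact m - rho m \<beta>)"
    by (simp add: field_simps)
  moreover have "(a n - t n - slope m t * real (Suc n)) / w n + t n / w n = (a n - slope m t * real (Suc n)) / w n" for n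
    by (simp add: add_divide_distrib[symmetric])
  ultimately show "(\<lambda>n. (a n - slope m t * real (Suc n)) / w n) \<longlonglongrightarrow> - rho m \<beta> / (fact m - rho m \<beta>)"
    by simp
qed

section \<open>The recursion for the law\<close>

text \<open>The rank of \<open>x\<close> relative to the separators, which is the zero-based index
  of the subtree receiving \<open>x\<close>; the index in \<open>between_keys\<close> is one larger.
  Unlike \<open>between_keys\<close> it needs only the set of separators and is visibly invariant
  under monotone relabelling.\<close>

definition key_class :: "'a::linorder set \<Rightarrow> 'a \<Rightarrow> nat" where
  "key_class S x = card {k \<in> S. k < x}"

text \<open>In a sorted list the entries below \<open>x\<close> form an initial segment, and its
  length is the rank of \<open>x\<close>.\<close>

lemma nth_less_iff_key_class:
  fixes S :: "'a::linorder set"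
  assumes "finite S" "x \<notin> S" "i < card S"
  shows "sorted_list_of_set S ! i < x \<longleftrightarrow> i < key_class S x"
proof -
  let ?ks = "sorted_list_of_set S"
  have len: "length ?ks = card S" and S: "set ?ks = S" and srt: "sorted ?ks" and dst: "distinct ?ks"
    using assms by auto
  show ?thesis
  proof
    assume less: "?ks ! i < x"
    have "set (take (Suc i) ?ks) \<subseteq> {k \<in> S. k < x}"
    proof
      fix k assume "k \<in> set (take (Suc i) ?ks)"
      then obtain l where l: "l < Suc i" "l < card S" "k = ?ks ! l"
        by (auto simp: in_set_conv_nth len)
      then have "k \<le> ?ks ! i" using srt assms len by (auto intro: sorted_nth_mono)
      then show "k \<in> {k \<in> S. k < x}" using less l S len by (metis (mono_tags, lifting) le_less_trans mem_Collect_eq nth_mem)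
    qed
    then have "card (set (take (Suc i) ?ks)) \<le> key_class S x"
      unfolding key_class_def using assms(1) by (intro card_mono) auto
    then show "i < key_class S x" using dst assms(3) len by (simp add: distinct_card)
  next
    assume kc: "i < key_class S x"
    show "?ks ! i < x"
    proof (rule ccontr)
      assume "\<not> ?ks ! i < x"
      then have ge: "x \<le> ?ks ! i" by simp
      have "{k \<in> S. k < x} \<subseteq> set (take i ?ks)"
      proof
        fix k assume k: "k \<in> {k \<in> S. k < x}"
        then obtain l where l: "l < card S" "k = ?ks ! l" using S len by (metis (no_types, lifting) in_set_conv_nth mem_Collect_eq)
        have "l < i"
        proof (rule ccontr)
          assume "\<not> l < i"
          then have "?ks ! i \<le> ?ks ! l" using srt l len by (intro sorted_nth_mono) auto
          then show False using k l ge by auto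
        qed
        then show "k \<in> set (take i ?ks)" using l len assms(3) by (auto simp: in_set_conv_nth)
      qed
      then have "key_class S x \<le> card (set (take i ?ks))" unfolding key_class_def by (intro card_mono) auto
      also have "\<dots> \<le> i" using card_length[of "take i ?ks"] by simp
      finally show False using kc by simp
    qed
  qed
qed

lemma key_class_le: "finite S \<Longrightarrow> key_class S x \<le> card S"
  unfolding key_class_def by (intro card_mono) auto

lemma between_keys_iff_key_class:
  assumes "finite S" "x \<notin> S" "j \<le> card S"
  shows "between_keys (sorted_list_of_set S) (Suc j) x \<longleftrightarrow> key_class S x = j"
proof -
  let ?ks = "sorted_list_of_set S"
  have len: "length ?ks = card S" using assms by simp
  have 1: "(1 < Suc j \<longrightarrow> ?ks ! (Suc j - 2) < x) \<longleftrightarrow> j \<le> key_class S x"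
  proof (cases j)
    case (Suc i)
    then show ?thesis using nth_less_iff_key_class[of S x i] assms by auto
  qed simp
  have "?ks ! j \<noteq> x" if "j < card S" using that assms len by (metis nth_mem set_sorted_list_of_set)
  then have 2: "(Suc j \<le> length ?ks \<longrightarrow> x < ?ks ! (Suc j - 1)) \<longleftrightarrow> key_class S x \<le> j"
    using nth_less_iff_key_class[of S x j] assms len key_class_le[of S x] by (cases "j < card S") auto
  show ?thesis unfolding between_keys_def 1 2 by auto
qed

lemma sum_list_upt_Suc: "sum_list (map g [1..<m+1]) = (\<Sum>j<m. g (Suc j))" for g :: "nat \<Rightarrow> 'a::comm_monoid_add"
proof -
  have "sum_list (map g [1..<m+1]) = sum g {1..<m+1}" by (simp add: interv_sum_list_conv_sum_set_nat)
  also have "\<dots> = (\<Sum>j<m. g (Suc j))"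
    using sum.shift_bounds_Suc_ivl[of g 0 m] by (simp add: lessThan_atLeast0)
  finally show ?thesis .
qed

lemma sum_filter_key_class:
  assumes "finite S" "card S < m"
  shows "(\<Sum>j<m. length (filter (\<lambda>x. key_class S x = j) ys)) = length ys"
proof (induction ys)
  case (Cons y ys)
  have "(\<Sum>j<m. length (filter (\<lambda>x. key_class S x = j) (y # ys))) =
      (\<Sum>j<m. (if j = key_class S y then 1 else 0) + length (filter (\<lambda>x. key_class S x = j) ys))"
    by (intro sum.cong) auto
  also have "\<dots> = 1 + length ys"
    using key_class_le[OF assms(1), of y] assms(2) by (simp add: sum.distrib Cons)
  finally show ?case by simp
qed simp

lemma search_tree_Node:
  assumes "m \<ge> 2" "length xs \<ge> m" "distinct xs"
  defines "S \<equiv> set (take (m - 1) xs)"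
  shows "search_tree m xs = Node (sorted_list_of_set S)
    (map (\<lambda>j. search_tree m (filter (\<lambda>x. key_class S x = j - 1) (drop (m - 1) xs))) [1..<m+1])"
proof -
  have ks: "sort (take (m - 1) xs) = sorted_list_of_set S"
    using assms by (simp add: sorted_list_of_set_sort_remdups distinct_remdups_id)
  have card: "card S = m - 1" using assms by (simp add: distinct_card)
  have fin: "finite S" by (simp add: S_def)
  have disj: "x \<notin> S" if "x \<in> set (drop (m - 1) xs)" for x
    using that \<open>distinct xs\<close> unfolding S_def by (metis append_take_drop_id disjoint_iff distinct_append)
  have "search_tree m xs = Node (sorted_list_of_set S)
    (map (\<lambda>j. search_tree m (filter (between_keys (sorted_list_of_set S) j) (drop (m - 1) xs))) [1..<m+1])"
    using assms(1,2) by (subst search_tree.simps) (auto simp: Let_def ks simp del: One_nat_def)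
  also have "map (\<lambda>j. search_tree m (filter (between_keys (sorted_list_of_set S) j) (drop (m - 1) xs))) [1..<m+1] =
     map (\<lambda>j. search_tree m (filter (\<lambda>x. key_class S x = j - 1) (drop (m - 1) xs))) [1..<m+1]"
  proof (rule map_cong[OF refl])
    fix j assume "j \<in> set [1..<m+1]"
    then have "1 \<le> j" "j < m + 1" by (simp_all only: set_upt atLeastLessThan_iff)
    then obtain i where i: "j = Suc i" "i \<le> card S" using card by (cases j) auto
    have "filter (between_keys (sorted_list_of_set S) j) (drop (m - 1) xs) = filter (\<lambda>x. key_class S x = j - 1) (drop (m - 1) xs)"
      using between_keys_iff_key_class[OF fin disj i(2)] i(1) by (intro filter_cong) auto
    then show "search_tree m (filter (between_keys (sorted_list_of_set S) j) (drop (m - 1) xs)) =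
      search_tree m (filter (\<lambda>x. key_class S x = j - 1) (drop (m - 1) xs))" by simp
  qed
  finally show ?thesis .
qed

lemma search_tree_leaf:
  assumes "m \<ge> 2" "length xs < m" "xs \<noteq> []"
  shows "search_tree m xs = Node (sort xs) (replicate m Empty)"
  using assms by (subst search_tree.simps) auto

text \<open>The functional evaluates the toll at the number of keys of a tree; by this identity the
  toll at the root depends only on the length of the input and is not random.\<close>

lemma num_keys_search_tree:
  assumes "m \<ge> 2" "distinct xs"
  shows "num_keys (search_tree m xs) = length xs"
  using assms(2)
proof (induction xs rule: length_induct)
  case (1 xs)
  consider "xs = []" | "xs \<noteq> []" "length xs < m" | "length xs \<ge> m" by linarith
  then show ?case
  proof cases
    case 1
    then show ?thesis by (subst search_tree.simps) auto
  next
    case 2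
    then show ?thesis using assms by (simp add: search_tree_leaf sum_list_replicate)
  next
    case 3
    define S where "S = set (take (m - 1) xs)"
    have S: "finite S" "card S = m - 1" using 3 1 by (auto simp: S_def distinct_card)
    have len: "length (filter P (drop (m - 1) xs)) < length xs" for P
      using length_filter_le[of P "drop (m - 1) xs"] 3 assms(1) by simp
    have IH: "num_keys (search_tree m (filter P (drop (m - 1) xs))) = length (filter P (drop (m - 1) xs))" for P
      using 1 len by auto
    have "num_keys (search_tree m xs) = card S + sum_list (map (\<lambda>j. length (filter (\<lambda>x. key_class S x = j - 1) (drop (m - 1) xs))) [1..<m+1])"
      unfolding search_tree_Node[OF assms(1) 3 1(2)[rule_format]] S_def[symmetric]
      by (simp only: num_keys.simps map_map o_def IH length_sorted_list_of_set)
    also have "\<dots> = m - 1 + length (drop (m - 1) xs)"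
      unfolding sum_list_upt_Suc using S sum_filter_key_class[of S m "drop (m - 1) xs"] assms(1) by simp
    finally show ?thesis using 3 by simp
  qed
qed

lemma X_small:
  assumes "m \<ge> 2" "length xs < m - 1"
  shows "X m t xs = t (length xs)"
proof (cases "xs = []")
  case True
  then show ?thesis unfolding X_def by (subst search_tree.simps) simp
next
  case False
  then show ?thesis using assms unfolding X_def
    by (simp add: search_tree_leaf sum_list_replicate)
qed

lemma X_rec:
  assumes "m \<ge> 2" "length xs \<ge> m - 1" "distinct xs"
  shows "X m t xs = (\<Sum>j<m. X m t (filter (\<lambda>x. key_class (set (take (m - 1) xs)) x = j) (drop (m - 1) xs))) + t (length xs)"
proof -
  have nk: "num_keys (search_tree m xs) = length xs" by (rule num_keys_search_tree) fact+
  show ?thesis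
  proof (cases "length xs < m")
    \<comment> \<open>With exactly m-1 keys the tree comes from the leaf branch. Its m empty
      subtrees contribute m t_0, the same as the recursion applied to empty key lists.\<close>
    case True
    have "xs \<noteq> []" using assms by auto
    note st = search_tree_leaf[OF assms(1) True this]
    have "drop (m - 1) xs = []" using True by simp
    moreover have "X m t [] = t 0" unfolding X_def by (subst search_tree.simps) simp
    moreover have "X m t xs = real m * t 0 + t (length xs)"
      using nk assms(2) unfolding X_def st by (simp add: sum_list_replicate)
    ultimately show ?thesis by simp
  next
    case False
    then have "m \<le> length xs" by simp
    note st = search_tree_Node[OF assms(1) this assms(3)]
    show ?thesis
      using nk assms(2) unfolding X_def st additive_functional.simps
      by (simp only: if_not_P not_less if_False map_map o_def sum_list_upt_Suc diff_Suc_1)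
  qed
qed

text \<open>A monotone relabelling preserves the rank of every key among the separators, so it
  commutes with the splitting into subtrees. The law belonging to a random permutation of a key set
  hence depends on the size of the set alone.\<close>

lemma X_map_strict_mono:
  fixes f :: "nat \<Rightarrow> nat"
  assumes "m \<ge> 2" "distinct xs" "strict_mono_on (set xs) f"
  shows "X m t (map f xs) = X m t xs"
  using assms(2,3)
proof (induction xs rule: length_induct)
  case (1 xs)
  have inj: "inj_on f (set xs)" using 1 by (auto intro: strict_mono_on_imp_inj_on)
  show ?case
  proof (cases "length xs < m - 1")
    case True
    then show ?thesis using assms(1) by (simp add: X_small)
  next
    case False
    define S where "S = set (take (m - 1) xs)"
    have Sx: "S \<subseteq> set xs" by (auto simp: S_def dest: in_set_takeD)
    have kc: "key_class (f ` S) (f x) = key_class S x" if "x \<in> set xs" for x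
    proof -
      have "{k \<in> f ` S. k < f x} = f ` {k \<in> S. k < x}"
        using Sx that 1(3) by (auto simp: strict_mono_on_less)
      moreover have "inj_on f {k \<in> S. k < x}" using inj Sx by (auto intro: inj_on_subset)
      ultimately show ?thesis by (simp add: key_class_def card_image)
    qed
    have "distinct (map f xs)" using 1 inj by (simp add: distinct_map)
    then have "X m t (map f xs) = (\<Sum>j<m. X m t (filter (\<lambda>x. key_class (f ` S) x = j) (map f (drop (m - 1) xs)))) + t (length xs)"
      using False assms(1) by (subst X_rec) (auto simp: S_def take_map drop_map)
    also have "(\<Sum>j<m. X m t (filter (\<lambda>x. key_class (f ` S) x = j) (map f (drop (m - 1) xs)))) =
        (\<Sum>j<m. X m t (filter (\<lambda>x. key_class S x = j) (drop (m - 1) xs)))"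
    proof (rule sum.cong[OF refl])
      fix j
      define ys where "ys = filter (\<lambda>x. key_class S x = j) (drop (m - 1) xs)"
      have "filter (\<lambda>x. key_class (f ` S) x = j) (map f (drop (m - 1) xs)) = map f ys"
        unfolding filter_map ys_def using kc by (auto simp: o_def dest: in_set_dropD intro!: arg_cong[of _ _ "map f"] filter_cong)
      moreover have "length ys < length xs"
        using length_filter_le[of "\<lambda>x. key_class S x = j" "drop (m - 1) xs"] False assms(1) by (simp add: ys_def)
      moreover have "set ys \<subseteq> set xs" by (auto simp: ys_def dest: in_set_dropD)
      moreover have "distinct ys" using 1 by (simp add: ys_def)
      ultimately show "X m t (filter (\<lambda>x. key_class (f ` S) x = j) (map f (drop (m - 1) xs))) =
        X m t (filter (\<lambda>x. key_class S x = j) (drop (m - 1) xs))"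
        using 1 unfolding ys_def[symmetric] by (metis monotone_on_subset)
    qed
    also have "\<dots> + t (length xs) = X m t xs"
      unfolding S_def using X_rec[OF assms(1) _ 1(2)[rule_format], of t] False by simp
    finally show ?thesis .
  qed
qed

section \<open>Distribution of the pieces of a random permutation\<close>

definition X_law :: "nat \<Rightarrow> (nat \<Rightarrow> real) \<Rightarrow> nat \<Rightarrow> real pmf" where
  "X_law m t n = map_pmf (X m t) (random_perm n)"

lemma X_law_permutations:
  assumes "m \<ge> 2" "finite A"
  shows "map_pmf (X m t) (pmf_of_set (permutations_of_set A)) = X_law m t (card A)"
proof -
  define f where "f = (\<lambda>i. sorted_list_of_set A ! (i - 1))"
  have mono: "strict_mono_on {1..card A} f"
  proof (rule strict_mono_onI)
    fix r s assume "r \<in> {1..card A}" "s \<in> {1..card A}" "r < s"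
    then show "f r < f s"
      unfolding f_def using strict_sorted_list_of_set[of A] by (intro sorted_wrt_nth_less[where P = "(<)"]) auto
  qed
  then have inj: "inj_on f {1..card A}" by (rule strict_mono_on_imp_inj_on)
  have "f ` {1..card A} = (\<lambda>i. sorted_list_of_set A ! i) ` (\<lambda>i. i - 1) ` {1..card A}"
    by (simp add: f_def image_image)
  also have "(\<lambda>i. i - 1) ` {1..card A} = {..<card A}"
    by (force simp: image_iff intro: bexI[of _ "Suc _"])
  also have "(\<lambda>i. sorted_list_of_set A ! i) ` {..<card A} = A"
    using assms(2) by (metis length_sorted_list_of_set lessThan_atLeast0 list.set_map map_nth set_sorted_list_of_set set_upt)
  finally have img: "f ` {1..card A} = A" .
  have injm: "inj_on (map f) (permutations_of_set {1..card A})"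
  proof (rule inj_onI)
    fix xs ys assume *: "xs \<in> permutations_of_set {1..card A}" "ys \<in> permutations_of_set {1..card A}" "map f xs = map f ys"
    have "inj_on f (set xs \<union> set ys)" using inj permutations_of_setD(1)[OF *(1)] permutations_of_setD(1)[OF *(2)] by simp
    with *(3) show "xs = ys" by (rule map_inj_on)
  qed
  have "map_pmf (map f) (pmf_of_set (permutations_of_set {1..card A})) = pmf_of_set (map f ` permutations_of_set {1..card A})"
    by (rule map_pmf_of_set_inj[OF injm]) auto
  also have "map f ` permutations_of_set {1..card A} = permutations_of_set A"
    using permutations_of_set_image_inj[OF inj] by (simp only: img)
  finally have "pmf_of_set (permutations_of_set A) = map_pmf (map f) (pmf_of_set (permutations_of_set {1..card A}))" ..
  then have "map_pmf (X m t) (pmf_of_set (permutations_of_set A)) = map_pmf (\<lambda>xs. X m t (map f xs)) (pmf_of_set (permutations_of_set {1..card A}))"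
    by (simp add: pmf.map_comp o_def)
  also have "\<dots> = map_pmf (X m t) (pmf_of_set (permutations_of_set {1..card A}))"
    using mono assms by (intro pmf.map_cong refl X_map_strict_mono) (auto dest: permutations_of_setD)
  finally show ?thesis by (simp add: X_law_def random_perm_def)
qed

text \<open>Point masses are compared: a pair of a k-set and an ordering of its complement comes
  from k! permutations out of n!, and k!/n! is the product of the probabilities 1/(n choose k) and
  1/(n-k)!.\<close>

lemma random_permutation_take_drop:
  assumes "finite A" "k \<le> card A"
  shows "map_pmf (\<lambda>xs. (set (take k xs), drop k xs)) (pmf_of_set (permutations_of_set A)) =
    bind_pmf (pmf_of_set {S. S \<subseteq> A \<and> card S = k}) (\<lambda>S. map_pmf (Pair S) (pmf_of_set (permutations_of_set (A - S))))"
    (is "?L = ?R")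
proof (rule pmf_eqI)
  fix p :: "'a set \<times> 'a list"
  obtain S ys where p: "p = (S, ys)" by (cases p)
  let ?B = "{S. S \<subseteq> A \<and> card S = k}"
  have fB: "finite ?B" using assms by (auto intro: finite_subset[of _ "Pow A"])
  have cB: "card ?B = card A choose k" using n_subsets[OF assms(1), of k] by simp
  then have "card ?B > 0" using assms(2) by (simp only: zero_less_binomial_iff)
  then have neB: "?B \<noteq> {}" by (metis card.empty less_irrefl)
  have "pmf ?L p = measure_pmf.prob (pmf_of_set (permutations_of_set A)) ((\<lambda>xs. (set (take k xs), drop k xs)) -` {p})"
    by (simp add: pmf_map)
  also have "\<dots> = real (card {xs \<in> permutations_of_set A. set (take k xs) = S \<and> drop k xs = ys}) / fact (card A)"
    using assms by (subst measure_pmf_of_set) (auto simp: p Int_def vimage_def intro!: arg_cong[of _ _ card])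
  finally have L: "pmf ?L p = real (card {xs \<in> permutations_of_set A. set (take k xs) = S \<and> drop k xs = ys}) / fact (card A)" .
  have "pmf ?R p = (\<Sum>S'\<in>?B. pmf (map_pmf (Pair S') (pmf_of_set (permutations_of_set (A - S')))) p) / card ?B"
    using fB neB by (subst pmf_bind_pmf_of_set) auto
  also have "(\<Sum>S'\<in>?B. pmf (map_pmf (Pair S') (pmf_of_set (permutations_of_set (A - S')))) p) =
     (\<Sum>S'\<in>?B. if S' = S then pmf (pmf_of_set (permutations_of_set (A - S))) ys else 0)"
  proof (rule sum.cong[OF refl])
    fix S' assume "S' \<in> ?B"
    show "pmf (map_pmf (Pair S') (pmf_of_set (permutations_of_set (A - S')))) p = (if S' = S then pmf (pmf_of_set (permutations_of_set (A - S))) ys else 0)"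
    proof (cases "S' = S")
      case True
      then show ?thesis unfolding p using pmf_map_inj'[of "Pair S" _ ys] by (simp add: inj_def)
    next
      case False
      then have "p \<notin> set_pmf (map_pmf (Pair S') (pmf_of_set (permutations_of_set (A - S'))))" by (auto simp: p)
      then have "pmf (map_pmf (Pair S') (pmf_of_set (permutations_of_set (A - S')))) p = 0"
        by (simp only: set_pmf_iff not_not)
      then show ?thesis using False by simp
    qed
  qed
  also have "\<dots> = (if S \<in> ?B then pmf (pmf_of_set (permutations_of_set (A - S))) ys else 0)"
    using fB by simp
  finally have R: "pmf ?R p = (if S \<in> ?B then pmf (pmf_of_set (permutations_of_set (A - S))) ys else 0) / card ?B" .
  show "pmf ?L p = pmf ?R p"
  proof (cases "S \<in> ?B \<and> ys \<in> permutations_of_set (A - S)")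
    case True
    then have S: "S \<subseteq> A" "card S = k" "finite S" and ys: "set ys = A - S" "distinct ys"
      using assms(1) by (auto dest: permutations_of_setD finite_subset)
    have "{xs \<in> permutations_of_set A. set (take k xs) = S \<and> drop k xs = ys} = (\<lambda>zs. zs @ ys) ` permutations_of_set S"
    proof (intro equalityI subsetI)
      fix xs assume xs: "xs \<in> {xs \<in> permutations_of_set A. set (take k xs) = S \<and> drop k xs = ys}"
      then have "take k xs \<in> permutations_of_set S" by (auto intro!: permutations_of_setI dest: permutations_of_setD)
      moreover have "xs = take k xs @ ys" using xs append_take_drop_id[of k xs] by auto
      ultimately show "xs \<in> (\<lambda>zs. zs @ ys) ` permutations_of_set S" by (rule rev_image_eqI)
    next
      fix xs assume "xs \<in> (\<lambda>zs. zs @ ys) ` permutations_of_set S"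
      then obtain zs where zs: "xs = zs @ ys" "set zs = S" "distinct zs" by (auto dest: permutations_of_setD)
      then have "length zs = k" using S distinct_card by metis
      then show "xs \<in> {xs \<in> permutations_of_set A. set (take k xs) = S \<and> drop k xs = ys}"
        using zs ys S by (auto intro!: permutations_of_setI)
    qed
    then have "card {xs \<in> permutations_of_set A. set (take k xs) = S \<and> drop k xs = ys} = fact k"
      using S by (simp add: card_image inj_on_def)
    then have "pmf ?L p = fact k / fact (card A)" unfolding L by simp
    moreover have "pmf ?R p = 1 / fact (card A - k) / (card A choose k)"
      unfolding R cB using True S assms(1) by (simp add: card_Diff_subset)
    moreover have "real (card A choose k) = fact (card A) / (fact k * fact (card A - k))"
      using assms(2) by (rule binomial_fact)
    ultimately show ?thesis by simp
  next
    case False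
    have emp: "{xs \<in> permutations_of_set A. set (take k xs) = S \<and> drop k xs = ys} = {}"
    proof (rule ccontr)
      assume "{xs \<in> permutations_of_set A. set (take k xs) = S \<and> drop k xs = ys} \<noteq> {}"
      then obtain xs where xs: "set xs = A" "distinct xs" "set (take k xs) = S" "drop k xs = ys"
        by (auto dest: permutations_of_setD)
      have un: "set (take k xs) \<union> set (drop k xs) = A" "set (take k xs) \<inter> set (drop k xs) = {}"
        using xs(1,2) append_take_drop_id[of k xs] distinct_append[of "take k xs" "drop k xs"] set_append[of "take k xs" "drop k xs"] by auto
      have "length xs = card A" using xs distinct_card by metis
      then have "card S = k" using xs assms(2) distinct_card[of "take k xs"] by auto
      moreover have "S \<subseteq> A" "set ys = A - S" using un xs by auto
      moreover have "distinct ys" using xs by auto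
      ultimately show False using False by (auto intro!: permutations_of_setI)
    qed
    show ?thesis unfolding L R emp using False assms(1) by auto
  qed
qed

text \<open>Splitting off one class leaves two independent uniform permutations, and the other
  classes can be read off the remainder. Induction on the number of classes gives independence of
  all pieces.\<close>

lemma random_permutation_classes:
  fixes cl :: "'a \<Rightarrow> 'b"
  assumes "finite J" "finite A" "cl ` A \<subseteq> J"
  shows "map_pmf (\<lambda>xs j. filter (\<lambda>x. cl x = j) xs) (pmf_of_set (permutations_of_set A)) =
    Pi_pmf J [] (\<lambda>j. pmf_of_set (permutations_of_set {x \<in> A. cl x = j}))"
  using assms
proof (induction J arbitrary: A rule: finite_induct)
  case empty
  then have "A = {}" by auto
  then show ?case by (simp add: pmf_of_set_singleton)
next
  case (insert j J)
  let ?P = "\<lambda>x. cl x = j"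
  let ?A' = "{x \<in> A. \<not> ?P x}"
  have IH: "map_pmf (\<lambda>xs j. filter (\<lambda>x. cl x = j) xs) (pmf_of_set (permutations_of_set ?A')) =
    Pi_pmf J [] (\<lambda>i. pmf_of_set (permutations_of_set {x \<in> ?A'. cl x = i}))"
    using insert.prems by (intro insert.IH) auto
  have Jeq: "Pi_pmf J [] (\<lambda>i. pmf_of_set (permutations_of_set {x \<in> ?A'. cl x = i})) =
     Pi_pmf J [] (\<lambda>i. pmf_of_set (permutations_of_set {x \<in> A. cl x = i}))"
    using insert.hyps by (intro Pi_pmf_cong refl arg_cong[of _ _ pmf_of_set] arg_cong[of _ _ permutations_of_set]) auto
  have "Pi_pmf (insert j J) [] (\<lambda>j. pmf_of_set (permutations_of_set {x \<in> A. cl x = j})) =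
     map_pmf (\<lambda>(y, f). f(j := y)) (pair_pmf (pmf_of_set (permutations_of_set {x \<in> A. ?P x}))
       (map_pmf (\<lambda>xs j. filter (\<lambda>x. cl x = j) xs) (pmf_of_set (permutations_of_set ?A'))))"
    unfolding IH Jeq by (rule Pi_pmf_insert) fact+
  also have "\<dots> = map_pmf (\<lambda>(y, xs). (\<lambda>i. filter (\<lambda>x. cl x = i) xs)(j := y))
      (pair_pmf (pmf_of_set (permutations_of_set {x \<in> A. ?P x})) (pmf_of_set (permutations_of_set ?A')))"
    by (subst pair_map_pmf2) (simp add: pmf.map_comp o_def case_prod_unfold)
  also have "\<dots> = map_pmf (\<lambda>(y, xs). (\<lambda>i. filter (\<lambda>x. cl x = i) xs)(j := y)) (map_pmf (partition ?P) (pmf_of_set (permutations_of_set A)))"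
    using insert.prems by (subst partition_random_permutations) auto
  also have "\<dots> = map_pmf (\<lambda>xs i. filter (\<lambda>x. cl x = i) xs) (pmf_of_set (permutations_of_set A))"
  proof -
    have "(\<lambda>i. filter (\<lambda>x. cl x = i) (filter (Not \<circ> ?P) xs))(j := filter ?P xs) = (\<lambda>i. filter (\<lambda>x. cl x = i) xs)" for xs
      by (rule ext) (auto intro!: filter_cong)
    then show ?thesis by (simp add: pmf.map_comp o_def case_prod_unfold)
  qed
  finally show ?case ..
qed

section \<open>Subtree sizes as uniform weak compositions\<close>

definition gap_sizes :: "nat \<Rightarrow> nat \<Rightarrow> nat set \<Rightarrow> nat list" where
  "gap_sizes m n S = map (\<lambda>j. card {x \<in> {1..n} - S. key_class S x = j}) [0..<m]"

lemma card_key_class_le: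
  assumes "finite B"
  shows "card {x \<in> B. key_class S x \<le> i} = (\<Sum>l\<le>i. card {x \<in> B. key_class S x = l})"
proof -
  have "{x \<in> B. key_class S x \<le> i} = (\<Union>l\<in>{..i}. {x \<in> B. key_class S x = l})" by auto
  then show ?thesis using assms by (simp only:) (subst card_UN_disjoint, auto)
qed

text \<open>A key in {1..n} equals the number of keys not exceeding it: i+1 separators and the
  members of the gaps 0 to i.\<close>

lemma nth_key_gap_sizes:
  assumes "S \<subseteq> {1..n}" "card S = m - 1" "i < m - 1"
  shows "sorted_list_of_set S ! i = Suc i + (\<Sum>l\<le>i. gap_sizes m n S ! l)"
proof -
  let ?ks = "sorted_list_of_set S"
  have fin: "finite S" using assms(1) finite_subset by auto
  have len: "length ?ks = m - 1" using assms fin by simp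
  define x where "x = ?ks ! i"
  have xS: "x \<in> S" unfolding x_def using assms len fin by (metis nth_mem set_sorted_list_of_set)
  have xn: "x \<in> {1..n}" using xS assms by auto
  have S1: "{k \<in> S. k \<le> x} = set (take (Suc i) ?ks)"
  proof (intro equalityI subsetI)
    fix k assume "k \<in> {k \<in> S. k \<le> x}"
    then obtain l where l: "l < m - 1" "k = ?ks ! l" "k \<le> x" using len fin by (metis (no_types, lifting) in_set_conv_nth mem_Collect_eq set_sorted_list_of_set)
    have "l \<le> i"
    proof (rule ccontr)
      assume "\<not> l \<le> i"
      then have "?ks ! i < ?ks ! l"
        using strict_sorted_list_of_set[of S] l len by (intro sorted_wrt_nth_less[where P = "(<)"]) auto
      then show False using l by (simp add: x_def)
    qed
    then show "k \<in> set (take (Suc i) ?ks)" using l len by (auto simp: in_set_conv_nth)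
  next
    fix k assume "k \<in> set (take (Suc i) ?ks)"
    then obtain l where "l < Suc i" "l < m - 1" and l: "k = ?ks ! l" by (auto simp: in_set_conv_nth len assms)
    then have l: "l \<le> i" "k = ?ks ! l" by auto
    then have "k \<le> x" unfolding x_def using len assms by (auto intro!: sorted_nth_mono)
    moreover have "k \<in> S" using l len assms fin by (metis le_less_trans nth_mem set_sorted_list_of_set)
    ultimately show "k \<in> {k \<in> S. k \<le> x}" by simp
  qed
  have "{1..x} = {k \<in> S. k \<le> x} \<union> {y \<in> {1..n} - S. key_class S y \<le> i}"
  proof -
    have iff: "y \<le> x \<longleftrightarrow> key_class S y \<le> i" if "y \<notin> S" for y
      using nth_less_iff_key_class[of S y i] that assms fin by (auto simp: x_def not_less[symmetric])
    show ?thesis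
    proof (rule set_eqI)
      fix y
      show "y \<in> {1..x} \<longleftrightarrow> y \<in> {k \<in> S. k \<le> x} \<union> {y \<in> {1..n} - S. key_class S y \<le> i}"
      proof (cases "y \<in> S")
        case True
        then show ?thesis using assms(1) by auto
      next
        case False
        then show ?thesis using iff[OF False] xn by auto
      qed
    qed
  qed
  then have "card {1..x} = card {k \<in> S. k \<le> x} + card {y \<in> {1..n} - S. key_class S y \<le> i}"
    using fin by (simp add: card_Un_disjoint disjoint_iff)
  also have "card {k \<in> S. k \<le> x} = Suc i" unfolding S1 using len assms by (subst distinct_card) auto
  also have "card {y \<in> {1..n} - S. key_class S y \<le> i} = (\<Sum>l\<le>i. card {y \<in> {1..n} - S. key_class S y = l})"
    by (rule card_key_class_le) simp
  also have "\<dots> = (\<Sum>l\<le>i. gap_sizes m n S ! l)"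
    using assms by (intro sum.cong) (auto simp: gap_sizes_def)
  finally show ?thesis by (simp add: x_def)
qed

text \<open>The sizes determine the separators, which gives injectivity. Surjectivity follows by
  counting, as both sides have n choose (m-1) elements, so no inverse is constructed. The vector of
  subtree sizes is thereby uniform on the weak compositions of n-(m-1) into m parts.\<close>

lemma gap_sizes_bij:
  assumes "m \<ge> 2" "n \<ge> m - 1"
  shows "bij_betw (gap_sizes m n) {S. S \<subseteq> {1..n} \<and> card S = m - 1} (natpermute (n - (m - 1)) m)"
proof -
  let ?B = "{S. S \<subseteq> {1..n} \<and> card S = m - 1}"
  let ?N = "natpermute (n - (m - 1)) m"
  have fin: "finite S" if "S \<in> ?B" for S using that finite_subset[of S "{1..n}"] by auto
  have inj: "inj_on (gap_sizes m n) ?B"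
  proof (rule inj_onI)
    fix S S' assume S: "S \<in> ?B" "S' \<in> ?B" "gap_sizes m n S = gap_sizes m n S'"
    have fS: "finite S" "finite S'" using fin S(1,2) by blast+
    have "sorted_list_of_set S = sorted_list_of_set S'"
    proof (rule nth_equalityI)
      show len: "length (sorted_list_of_set S) = length (sorted_list_of_set S')" using S(1,2) fS by simp
      fix i assume "i < length (sorted_list_of_set S)"
      then have i: "i < m - 1" using S(1) fS by simp
      have "sorted_list_of_set S ! i = Suc i + (\<Sum>l\<le>i. gap_sizes m n S ! l)"
        using S(1) i by (intro nth_key_gap_sizes) simp_all
      moreover have "sorted_list_of_set S' ! i = Suc i + (\<Sum>l\<le>i. gap_sizes m n S' ! l)"
        using S(2) i by (intro nth_key_gap_sizes) simp_all
      ultimately show "sorted_list_of_set S ! i = sorted_list_of_set S' ! i" by (simp only: S(3))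
    qed
    then show "S = S'" using fS by (metis set_sorted_list_of_set)
  qed
  have sub: "gap_sizes m n ` ?B \<subseteq> ?N"
  proof
    fix v assume "v \<in> gap_sizes m n ` ?B"
    then obtain S where S: "S \<subseteq> {1..n}" "card S = m - 1" "v = gap_sizes m n S" by auto
    have fS: "finite S" using S finite_subset by auto
    have "sum_list v = (\<Sum>l\<le>m-1. card {x \<in> {1..n} - S. key_class S x = l})"
    proof -
      have "{..m-1} = {0..<m}" using assms by auto
      then show ?thesis by (simp add: S gap_sizes_def interv_sum_list_conv_sum_set_nat)
    qed
    also have "\<dots> = card {x \<in> {1..n} - S. key_class S x \<le> m - 1}" by (subst card_key_class_le) auto
    also have "{x \<in> {1..n} - S. key_class S x \<le> m - 1} = {1..n} - S"
      using key_class_le[OF fS] S by auto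
    also have "card ({1..n} - S) = n - (m - 1)" using S fS by (simp add: card_Diff_subset)
    finally show "v \<in> ?N" by (simp add: natpermute_def S gap_sizes_def)
  qed
  have "card ?N = (n - (m - 1) + m - 1) choose (n - (m - 1))"
    unfolding natpermute_def by (rule card_length_sum_list)
  also have "n - (m - 1) + m - 1 = n" using assms by simp
  also have "n choose (n - (m - 1)) = n choose (m - 1)" using assms by (intro binomial_symmetric[symmetric]) auto
  finally have cN: "card ?N = card ?B" using n_subsets[of "{1..n}" "m - 1"] by simp
  have "gap_sizes m n ` ?B = ?N"
    by (rule card_subset_eq[OF natpermute_finite sub]) (simp only: card_image[OF inj] cN)
  then show ?thesis using inj by (simp add: bij_betw_def)
qed

lemma card_natpermute_gaps:
  assumes "m \<ge> 2" "n \<ge> m - 1"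
  shows "card (natpermute (n - (m - 1)) m) = n choose (m - 1)"
  using bij_betw_same_card[OF gap_sizes_bij[OF assms]] n_subsets[of "{1..n}" "m - 1"] by simp

lemma X_law_small: "m \<ge> 2 \<Longrightarrow> n < m - 1 \<Longrightarrow> X_law m t n = return_pmf (t n)"
proof -
  assume "m \<ge> 2" "n < m - 1"
  have "X_law m t n = map_pmf (\<lambda>_. t n) (random_perm n)"
    unfolding X_law_def
  proof (rule pmf.map_cong[OF refl])
    fix xs assume "xs \<in> set_pmf (random_perm n)"
    then have "set xs = {1..n}" "distinct xs" by (auto simp: random_perm_def dest: permutations_of_setD)
    then have "length xs = n" using distinct_card[of xs] by simp
    then show "X m t xs = t n" using \<open>m \<ge> 2\<close> \<open>n < m - 1\<close> by (simp add: X_small)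
  qed
  then show ?thesis by simp
qed

text \<open>The separators form a uniform subset; given them, the keys of each rank arrive in
  independent uniform orders, and only their numbers matter. The default \<open>d\<close> is free so
  that it can be matched to the one in \<open>sum_law\<close>.\<close>

theorem X_law_rec:
  assumes m: "m \<ge> 2" and n: "n \<ge> m - 1"
  shows "X_law m t n = bind_pmf (pmf_of_set (natpermute (n - (m - 1)) m))
    (\<lambda>v. map_pmf (\<lambda>f. (\<Sum>j<m. f j) + t n) (Pi_pmf {..<m} d (\<lambda>j. X_law m t (v ! j))))"
proof -
  let ?perm = "\<lambda>A. pmf_of_set (permutations_of_set A)"
  let ?B = "{S. S \<subseteq> {1..n} \<and> card S = m - 1}"
  define h where "h = (\<lambda>(S, ys). (\<Sum>j<m. X m t (filter (\<lambda>x. key_class S x = j) ys)) + t n)"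
  have finB: "finite ?B" by (rule finite_subset[of _ "Pow {1..n}"]) auto
  have "card ?B = n choose (m - 1)" using n_subsets[of "{1..n}" "m - 1"] by simp
  then have "card ?B \<noteq> 0" using n by simp
  then have neB: "?B \<noteq> {}" by (metis card.empty)
  have "X_law m t n = map_pmf (\<lambda>xs. h (set (take (m - 1) xs), drop (m - 1) xs)) (?perm {1..n})"
    unfolding X_law_def random_perm_def
  proof (rule pmf.map_cong[OF refl])
    fix xs assume "xs \<in> set_pmf (?perm {1..n})"
    then have xs: "set xs = {1..n}" "distinct xs" by (auto dest: permutations_of_setD)
    then have "length xs = n" using distinct_card[of xs] by simp
    then show "X m t xs = h (set (take (m - 1) xs), drop (m - 1) xs)"
      using X_rec[OF m _ xs(2), of t] n by (simp add: h_def)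
  qed
  also have "\<dots> = map_pmf h (map_pmf (\<lambda>xs. (set (take (m - 1) xs), drop (m - 1) xs)) (?perm {1..n}))"
    by (simp add: pmf.map_comp o_def)
  also have "\<dots> = bind_pmf (pmf_of_set ?B) (\<lambda>S. map_pmf (\<lambda>ys. h (S, ys)) (?perm ({1..n} - S)))"
    using n by (subst random_permutation_take_drop) (auto simp: map_bind_pmf pmf.map_comp o_def)
  also have "\<dots> = bind_pmf (pmf_of_set ?B) (\<lambda>S. map_pmf (\<lambda>f. (\<Sum>j<m. f j) + t n) (Pi_pmf {..<m} d (\<lambda>j. X_law m t (gap_sizes m n S ! j))))"
  proof (rule bind_pmf_cong[OF refl])
    fix S assume "S \<in> set_pmf (pmf_of_set ?B)"
    then have S: "S \<subseteq> {1..n}" "card S = m - 1" using finB neB by auto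
    have fS: "finite S" using S finite_subset by auto
    have cl: "key_class S ` ({1..n} - S) \<subseteq> {..<m}"
    proof
      fix i assume "i \<in> key_class S ` ({1..n} - S)"
      then show "i \<in> {..<m}" using key_class_le[OF fS] S m by (metis (no_types, lifting) Suc_pred' image_iff less_Suc_eq_le lessThan_iff less_le_trans pos2)
    qed
    have "map_pmf (\<lambda>ys. h (S, ys)) (?perm ({1..n} - S)) =
        map_pmf (\<lambda>F. (\<Sum>j<m. X m t (F j)) + t n) (map_pmf (\<lambda>ys j. filter (\<lambda>x. key_class S x = j) ys) (?perm ({1..n} - S)))"
      by (simp add: h_def pmf.map_comp o_def)
    also have "\<dots> = map_pmf (\<lambda>F. (\<Sum>j<m. X m t (F j)) + t n) (Pi_pmf {..<m} [] (\<lambda>j. ?perm {x \<in> {1..n} - S. key_class S x = j}))"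
      by (subst random_permutation_classes[OF _ _ cl]) auto
    also have "\<dots> = map_pmf (\<lambda>f. (\<Sum>j<m. f j) + t n) (map_pmf (\<lambda>F. X m t \<circ> F) (Pi_pmf {..<m} [] (\<lambda>j. ?perm {x \<in> {1..n} - S. key_class S x = j})))"
      by (simp add: pmf.map_comp o_def)
    also have "map_pmf (\<lambda>F. X m t \<circ> F) (Pi_pmf {..<m} [] (\<lambda>j. ?perm {x \<in> {1..n} - S. key_class S x = j})) =
       Pi_pmf {..<m} (X m t []) (\<lambda>j. X_law m t (card {x \<in> {1..n} - S. key_class S x = j}))"
      by (subst Pi_pmf_map[symmetric]) (auto intro!: Pi_pmf_cong X_law_permutations[OF m])
    also have "\<dots> = Pi_pmf {..<m} (X m t []) (\<lambda>j. X_law m t (gap_sizes m n S ! j))"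
      by (intro Pi_pmf_cong) (auto simp: gap_sizes_def)
    \<comment> \<open>The default outside the index set is exchanged for \<open>d\<close>, which is
      harmless because the sum reads only indices below m.\<close>
    also have "map_pmf (\<lambda>f. (\<Sum>j<m. f j) + t n) \<dots> =
      map_pmf (\<lambda>f. (\<Sum>j<m. f j) + t n) (map_pmf (\<lambda>f x. if x \<in> {..<m} then f x else d) (Pi_pmf {..<m} (X m t []) (\<lambda>j. X_law m t (gap_sizes m n S ! j))))"
      by (simp add: pmf.map_comp o_def)
    also have "\<dots> = map_pmf (\<lambda>f. (\<Sum>j<m. f j) + t n) (Pi_pmf {..<m} d (\<lambda>j. X_law m t (gap_sizes m n S ! j)))"
      by (subst Pi_pmf_default_swap) auto
    finally show "map_pmf (\<lambda>ys. h (S, ys)) (?perm ({1..n} - S)) = \<dots>" .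
  qed
  also have "\<dots> = bind_pmf (map_pmf (gap_sizes m n) (pmf_of_set ?B)) (\<lambda>v. map_pmf (\<lambda>f. (\<Sum>j<m. f j) + t n) (Pi_pmf {..<m} d (\<lambda>j. X_law m t (v ! j))))"
    by (simp add: bind_map_pmf)
  also have "map_pmf (gap_sizes m n) (pmf_of_set ?B) = pmf_of_set (natpermute (n - (m - 1)) m)"
    by (rule map_pmf_of_set_bij_betw[OF gap_sizes_bij[OF m n] neB finB])
  finally show ?thesis .
qed

section \<open>Subtree sizes and the uniform distribution on the simplex\<close>

abbreviation simplex_base :: "nat \<Rightarrow> (nat \<Rightarrow> real) measure" where
  "simplex_base m \<equiv> (\<Pi>\<^sub>M j\<in>{1..m-1}. lborel)"

definition simplex_completion :: "nat \<Rightarrow> (nat \<Rightarrow> real) \<Rightarrow> nat \<Rightarrow> real" where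
  "simplex_completion m s = (\<lambda>j\<in>{1..m}. if j = m then 1 - (\<Sum>i=1..m-1. s i) else s j)"

definition composition_point :: "nat \<Rightarrow> nat \<Rightarrow> nat list \<Rightarrow> nat \<Rightarrow> real" where
  "composition_point m n v = (\<lambda>j\<in>{1..m}. real (v ! (j - 1)) / real n)"

text \<open>Half-open cubes of side 1/n in the m-1 free coordinates, with lower corner at the scaled
  sizes. Each has volume n^(1-m), so a sum over compositions becomes the integral of a step
  function.\<close>

definition composition_box :: "nat \<Rightarrow> nat \<Rightarrow> nat list \<Rightarrow> (nat \<Rightarrow> real) set" where
  "composition_box m n v = (\<Pi>\<^sub>E j\<in>{1..m-1}. {real (v ! (j - 1)) / real n ..< (real (v ! (j - 1)) + 1) / real n})"

lemma emeasure_composition_box: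
  assumes "n > 0"
  shows "emeasure (simplex_base m) (composition_box m n v) = ennreal ((1 / real n) ^ (m - 1))"
proof -
  interpret product_sigma_finite "\<lambda>_::nat. lborel :: real measure" ..
  have "emeasure (simplex_base m) (composition_box m n v) = (\<Prod>j\<in>{1..m-1}. emeasure lborel {real (v ! (j - 1)) / real n ..< (real (v ! (j - 1)) + 1) / real n})"
    unfolding composition_box_def by (intro emeasure_PiM) auto
  also have "\<dots> = (\<Prod>j\<in>{1..m-1}. ennreal (1 / real n))"
  proof (rule prod.cong[OF refl])
    fix j
    have "real (v ! (j - 1)) / real n \<le> (real (v ! (j - 1)) + 1) / real n" by (intro divide_right_mono) auto
    then show "emeasure lborel {real (v ! (j - 1)) / real n ..< (real (v ! (j - 1)) + 1) / real n} = ennreal (1 / real n)"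
      by (simp add: diff_divide_distrib[symmetric])
  qed
  also have "\<dots> = ennreal ((1 / real n) ^ (m - 1))" by (simp add: ennreal_power)
  finally show ?thesis .
qed

lemma composition_box_sets [measurable]: "composition_box m n v \<in> sets (simplex_base m)"
  unfolding composition_box_def by (intro sets_PiM_I_finite) auto

lemma composition_box_iff:
  assumes "n > 0"
  shows "x \<in> composition_box m n v \<longleftrightarrow> x \<in> space (simplex_base m) \<and> (\<forall>j\<in>{1..m-1}. 0 \<le> x j \<and> nat \<lfloor>real n * x j\<rfloor> = v ! (j - 1))"
proof -
  have "(y \<in> {real k / real n ..< (real k + 1) / real n}) \<longleftrightarrow> 0 \<le> y \<and> nat \<lfloor>real n * y\<rfloor> = k" for y k
  proof -
    have "(y \<in> {real k / real n ..< (real k + 1) / real n}) \<longleftrightarrow> real k \<le> real n * y \<and> real n * y < real k + 1"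
      using assms by (simp add: field_simps)
    also have "\<dots> \<longleftrightarrow> \<lfloor>real n * y\<rfloor> = int k" by (auto simp: floor_eq_iff)
    also have "\<dots> \<longleftrightarrow> 0 \<le> y \<and> nat \<lfloor>real n * y\<rfloor> = k"
    proof
      assume *: "\<lfloor>real n * y\<rfloor> = int k"
      then have "0 \<le> real n * y" by (metis of_nat_0_le_iff zero_le_floor)
      then have "0 \<le> y" using assms by (simp add: zero_le_mult_iff)
      then show "0 \<le> y \<and> nat \<lfloor>real n * y\<rfloor> = k" using * by simp
    next
      assume "0 \<le> y \<and> nat \<lfloor>real n * y\<rfloor> = k"
      then show "\<lfloor>real n * y\<rfloor> = int k" by auto
    qed
    finally show ?thesis .
  qed
  then show ?thesis unfolding composition_box_def by (auto simp: PiE_iff space_PiM)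
qed

text \<open>The point determines the first m-1 sizes by rounding down, and the common total
  determines the last one.\<close>

lemma composition_box_unique:
  assumes "n > 0" "m \<ge> 2" "v \<in> natpermute k m" "v' \<in> natpermute k m"
    "x \<in> composition_box m n v" "x \<in> composition_box m n v'"
  shows "v = v'"
proof -
  have len: "length v = m" "length v' = m" "sum_list v = k" "sum_list v' = k"
    using assms by (auto simp: natpermute_def)
  have eq: "v ! i = v' ! i" if "i < m - 1" for i
  proof -
    have "Suc i \<in> {1..m-1}" using that by auto
    then show ?thesis using assms by (auto simp: composition_box_iff dest!: bspec[of _ _ "Suc i"])
  qed
  have spl: "{0..<m} = insert (m - 1) {0..<m-1}" using assms by auto
  have "v ! (m - 1) + (\<Sum>i=0..<m-1. v ! i) = k" "v' ! (m - 1) + (\<Sum>i=0..<m-1. v' ! i) = k"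
    using len by (auto simp: sum_list_sum_nth spl)
  moreover have "(\<Sum>i=0..<m-1. v ! i) = (\<Sum>i=0..<m-1. v' ! i)" using eq by (intro sum.cong) auto
  ultimately have "v ! (m - 1) = v' ! (m - 1)" by simp
  with eq have "v ! i = v' ! i" if "i < m" for i using that by (cases "i = m - 1") auto
  then show ?thesis using len by (intro nth_equalityI) auto
qed

text \<open>The sizes sum to n-(m-1), so raising each of the m-1 free ones by a full unit still
  gives at most n. The keys stored in the root provide exactly the slack that the rounding
  needs.\<close>

lemma composition_box_subset_simplex:
  assumes "n \<ge> m - 1" "n > 0" "m \<ge> 2" "v \<in> natpermute (n - (m - 1)) m" "x \<in> composition_box m n v"
  shows "x \<in> simplex_coords m"
proof -
  have x: "x \<in> space (simplex_base m)" "\<And>j. j \<in> {1..m-1} \<Longrightarrow> 0 \<le> x j \<and> nat \<lfloor>real n * x j\<rfloor> = v ! (j - 1)"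
    using assms(2,5) by (auto simp: composition_box_iff)
  have len: "length v = m" "sum_list v = n - (m - 1)" using assms(4) by (auto simp: natpermute_def)
  have "real n * (\<Sum>j=1..m-1. x j) = (\<Sum>j=1..m-1. real n * x j)" by (simp add: sum_distrib_left)
  also have "\<dots> \<le> (\<Sum>j=1..m-1. real (v ! (j - 1)) + 1)"
  proof (rule sum_mono)
    fix j assume j: "j \<in> {1..m-1}"
    have "real n * x j \<le> real (nat \<lfloor>real n * x j\<rfloor>) + 1" by linarith
    then show "real n * x j \<le> real (v ! (j - 1)) + 1" using x(2)[OF j] by simp
  qed
  also have "\<dots> = real (\<Sum>j=1..m-1. v ! (j - 1)) + real (m - 1)" by (simp add: sum.distrib)
  also have "(\<Sum>j=1..m-1. v ! (j - 1)) = (\<Sum>j=0..<m-1. v ! j)"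
    by (rule sum.reindex_bij_witness[of _ Suc "\<lambda>j. j - 1"]) auto
  also have "(\<Sum>j=0..<m-1. v ! j) \<le> (\<Sum>j=0..<m. v ! j)" by (intro sum_mono2) auto
  also have "\<dots> = n - (m - 1)" using len by (simp add: sum_list_sum_nth)
  finally have "real n * (\<Sum>j=1..m-1. x j) \<le> real n" using assms(1) by (simp add: of_nat_diff)
  then have "(\<Sum>j=1..m-1. x j) \<le> 1" using assms(2) by (simp add: field_simps)
  then show ?thesis using x by (auto simp: simplex_coords_def)
qed

text \<open>The face lies between the unit simplex and its copies scaled by r < 1, whose volumes
  carry the factor r^(m-1). It has to be discarded because only points with coordinate sum below 1
  are certain to lie in a box eventually.\<close>

lemma simplex_boundary_null:
  assumes "m \<ge> 2"
  shows "AE x in simplex_base m. x \<in> simplex_coords m \<longrightarrow> (\<Sum>j=1..m-1. x j) < 1"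
proof -
  note One_nat_def [simp del]
  let ?P = "simplex_base m"
  define A where "A = (\<lambda>r. {x \<in> space ?P. (\<forall>j\<in>{1..m-1}. 0 \<le> x j) \<and> (\<Sum>j=1..m-1. x j) \<le> r})"
  have A_sets[measurable]: "A r \<in> sets ?P" for r unfolding A_def by measurable
  have emA: "emeasure ?P (A r) = ennreal (r ^ (m-1) / fact (m - 1))" if "r \<ge> 0" for r
    using emeasure_std_simplex_aux[of "{1..m-1}" r] that by (simp add: A_def Int_def conj_commute)
  define Z where "Z = {x \<in> space ?P. (\<forall>j\<in>{1..m-1}. 0 \<le> x j) \<and> (\<Sum>j=1..m-1. x j) = 1}"
  have Z_sets[measurable]: "Z \<in> sets ?P" unfolding Z_def by measurable
  have fin: "emeasure ?P (A r) \<noteq> \<infinity>" if "r \<ge> 0" for r using emA[OF that] by simp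
  have "measure ?P Z \<le> (1 - r ^ (m-1)) / fact (m - 1)" if r: "0 \<le> r" "r < 1" for r
  proof -
    have sub: "A r \<subseteq> A 1" using r by (auto simp: A_def)
    have "Z \<subseteq> A 1 - A r" using r by (auto simp: Z_def A_def)
    moreover have "A r \<in> fmeasurable ?P" if "r \<ge> 0" for r
      using fin[OF that] by (intro fmeasurableI A_sets) (simp add: less_top)
    then have "A 1 - A r \<in> fmeasurable ?P" using r by (intro fmeasurable.Diff) auto
    ultimately have "measure ?P Z \<le> measure ?P (A 1 - A r)"
      by (intro measure_mono_fmeasurable Z_sets)
    also have "\<dots> = measure ?P (A 1) - measure ?P (A r)"
      using sub fin[of 1] by (intro measure_Diff A_sets) simp_all
    also have "\<dots> = (1 - r ^ (m-1)) / fact (m - 1)"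
      using r by (simp add: measure_def emA diff_divide_distrib)
    finally show ?thesis .
  qed
  then have le: "measure ?P Z \<le> (1 - (1 - 1 / real (Suc k)) ^ (m-1)) / fact (m - 1)" for k by simp
  have lim: "(\<lambda>k. (1 - (1 - 1 / real (Suc k)) ^ (m-1)) / fact (m - 1)) \<longlonglongrightarrow> (1 - (1 - 0) ^ (m-1)) / fact (m - 1)"
    by (intro tendsto_intros LIMSEQ_Suc lim_const_over_n) auto
  have "measure ?P Z \<le> (1 - (1 - 0) ^ (m-1)) / fact (m - 1)" by (rule LIMSEQ_le_const[OF lim]) (use le in blast)
  then have "measure ?P Z \<le> 0" by simp
  moreover have "Z \<subseteq> A 1" by (auto simp: Z_def A_def)
  then have "emeasure ?P Z \<noteq> \<infinity>" using fin[of 1] emeasure_mono[of Z "A 1" ?P] by (auto simp: top_unique)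
  ultimately have "emeasure ?P Z = 0"
    by (metis emeasure_eq_ennreal_measure ennreal_0 infinity_ennreal_def measure_nonneg order_antisym)
  then have "AE x in ?P. x \<notin> Z" by (intro AE_not_in) (auto simp: null_sets_def)
  then show ?thesis by eventually_elim (auto simp: Z_def simplex_coords_def)
qed

text \<open>Dominated convergence for step functions. The boxes lie in the simplex, which gives the
  dominating function. A point off the face with coordinate sum 1 eventually lies in a box, and the
  scaled composition of that box converges to the completed point.\<close>

lemma composition_sum_tendsto:
  fixes G :: "(nat \<Rightarrow> real) \<Rightarrow> 'b::{banach, second_countable_topology}"
  assumes m: "m \<ge> 2" and [measurable]: "G \<in> borel_measurable (\<Pi>\<^sub>M j\<in>{1..m}. borel)"
    and bdd: "\<And>s. (\<And>j. j \<in> {1..m} \<Longrightarrow> 0 \<le> s j \<and> s j \<le> 1) \<Longrightarrow> norm (G s) \<le> B"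
    and cont: "\<And>X s. (\<And>k j. j \<in> {1..m} \<Longrightarrow> 0 \<le> X k j \<and> X k j \<le> 1) \<Longrightarrow>
       (\<And>j. j \<in> {1..m} \<Longrightarrow> (\<lambda>k. X k j) \<longlonglongrightarrow> s j) \<Longrightarrow> (\<lambda>k. G (X k)) \<longlonglongrightarrow> G s"
  shows "(\<lambda>n. (1 / real n) ^ (m - 1) *\<^sub>R (\<Sum>v\<in>natpermute (n - (m - 1)) m. G (composition_point m n v)))
     \<longlonglongrightarrow> (\<integral>x. indicator (simplex_coords m) x *\<^sub>R G (simplex_completion m x) \<partial>simplex_base m)"
proof -
  note One_nat_def [simp del]
  let ?P = "simplex_base m" and ?d = "m - 1"
  let ?N = "\<lambda>n. natpermute (n - ?d) m"
  define g where "g = (\<lambda>n x. if n < m then 0 else \<Sum>v\<in>?N n. indicator (composition_box m n v) x *\<^sub>R G (composition_point m n v))"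
  have point_range: "0 \<le> composition_point m n v j \<and> composition_point m n v j \<le> 1"
    if "v \<in> ?N n" "j \<in> {1..m}" for n v j
  proof -
    have "v ! (j - 1) \<in> set v" using that by (intro nth_mem) (auto simp: natpermute_def)
    then have "v ! (j - 1) \<le> sum_list v" by (rule member_le_sum_list) simp
    also have "\<dots> \<le> n" using that by (auto simp: natpermute_def)
    finally show ?thesis using that by (auto simp: composition_point_def divide_le_eq_1)
  qed
  have g_box: "g n x = G (composition_point m n v)" if "n \<ge> m" "v \<in> ?N n" "x \<in> composition_box m n v" for n x v
  proof -
    have "n > 0" using that m by simp
    have "g n x = (\<Sum>v'\<in>?N n. indicator (composition_box m n v') x *\<^sub>R G (composition_point m n v'))"
      using that by (simp add: g_def)
    also have "\<dots> = (\<Sum>v'\<in>?N n. if v' = v then G (composition_point m n v) else 0)"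
    proof (rule sum.cong[OF refl])
      fix v' assume v': "v' \<in> ?N n"
      have "v' = v" if "x \<in> composition_box m n v'"
        by (rule composition_box_unique[OF \<open>n > 0\<close> m v' \<open>v \<in> ?N n\<close> that \<open>x \<in> composition_box m n v\<close>])
      then show "indicator (composition_box m n v') x *\<^sub>R G (composition_point m n v') = (if v' = v then G (composition_point m n v) else 0)"
        using \<open>x \<in> composition_box m n v\<close> by (cases "v' = v") (auto simp: indicator_def)
    qed
    also have "\<dots> = G (composition_point m n v)" using \<open>v \<in> ?N n\<close> by (simp add: natpermute_finite)
    finally show ?thesis .
  qed
  have g_0: "g n x = 0" if "\<And>v. v \<in> ?N n \<Longrightarrow> x \<notin> composition_box m n v" for n x
    using that by (auto simp: g_def intro!: sum.neutral)
  have "0 \<le> norm (G (\<lambda>_. 0))" by simp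
  also have "\<dots> \<le> B" by (intro bdd) auto
  finally have B: "B \<ge> 0" .
  have completion: "simplex_completion m \<in> simplex_base m \<rightarrow>\<^sub>M (\<Pi>\<^sub>M j\<in>{1..m}. borel)"
    unfolding simplex_completion_def by (rule measurable_simplex_completion)
  note [measurable] = completion
  have emS: "emeasure ?P (simplex_coords m) < \<infinity>" unfolding emeasure_simplex_coords by simp
  have "(\<lambda>n. \<integral>x. g n x \<partial>?P) \<longlonglongrightarrow> (\<integral>x. indicator (simplex_coords m) x *\<^sub>R G (simplex_completion m x) \<partial>?P)"
  proof (rule integral_dominated_convergence)
    show "integrable ?P (\<lambda>x. indicator (simplex_coords m) x *\<^sub>R B)"
      by (intro integrable_scaleR_left integrable_real_indicator simplex_coords_sets emS)
    show "AE x in ?P. norm (g n x) \<le> indicator (simplex_coords m) x *\<^sub>R B" for n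
    proof -
      have "norm (g n x) \<le> indicator (simplex_coords m) x *\<^sub>R B" for x
      proof (cases "n \<ge> m \<and> (\<exists>v\<in>?N n. x \<in> composition_box m n v)")
        case True
        then obtain v where "n \<ge> m" and v: "v \<in> ?N n" "x \<in> composition_box m n v" by auto
        then have "x \<in> simplex_coords m" using composition_box_subset_simplex[of m n v x] \<open>n \<ge> m\<close> m by auto
        moreover have "norm (g n x) \<le> B" using g_box[of n v x] v \<open>n \<ge> m\<close> point_range[OF v(1)] by (auto intro!: bdd)
        ultimately show ?thesis by simp
      next
        case False
        then have "g n x = 0" by (cases "n \<ge> m") (auto intro: g_0 simp: g_def)
        then show ?thesis using B by (simp add: indicator_def)
      qed
      then show ?thesis by simp
    qed
    show "AE x in ?P. (\<lambda>n. g n x) \<longlonglongrightarrow> indicator (simplex_coords m) x *\<^sub>R G (simplex_completion m x)"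
      using simplex_boundary_null[OF m] AE_space
    proof eventually_elim
      case (elim x)
      show ?case
      proof (cases "x \<in> simplex_coords m")
        case False
        have "eventually (\<lambda>n. g n x = 0) sequentially"
          using eventually_ge_at_top[of m]
        proof eventually_elim
          case (elim n)
          have "m - 1 \<le> n" "n > 0" using elim m by auto
          then show ?case using False composition_box_subset_simplex[OF _ _ m] by (intro g_0) blast
        qed
        then show ?thesis using False by (simp add: tendsto_eventually)
      next
        case True
        then have x: "\<And>j. j \<in> {1..?d} \<Longrightarrow> 0 \<le> x j" and sum1: "(\<Sum>j=1..?d. x j) < 1" using elim by (auto simp: simplex_coords_def)
        define fl where "fl = (\<lambda>n j. nat \<lfloor>real n * x j\<rfloor>)"
        \<comment> \<open>The composition of the box that contains x: the free coordinates are
          rounded down, and the last size takes what remains of n-(m-1).\<close>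
        define V where "V = (\<lambda>n. map (\<lambda>i. fl n (Suc i)) [0..<?d] @ [n - ?d - (\<Sum>j=1..?d. fl n j)])"
        have flle: "real (fl n j) \<le> real n * x j" if "j \<in> {1..?d}" for n j
          unfolding fl_def using x[OF that] by (simp add: of_nat_floor)
        have flge: "real n * x j - 1 \<le> real (fl n j)" for n j unfolding fl_def by linarith
        have "eventually (\<lambda>n. real n \<ge> real ?d / (1 - (\<Sum>j=1..?d. x j))) sequentially"
          using filterlim_real_sequentially by (simp add: filterlim_at_top)
        \<comment> \<open>The gap between the coordinate sum and 1 eventually pays for the m-1 keys
          in the root, so the truncated subtraction in the last size is genuine.\<close>
        then have sumfl: "eventually (\<lambda>n. (\<Sum>j=1..?d. fl n j) + ?d \<le> n) sequentially"
        proof eventually_elim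
          case (elim n)
          have "real (\<Sum>j=1..?d. fl n j) \<le> (\<Sum>j=1..?d. real n * x j)" unfolding of_nat_sum by (intro sum_mono flle)
          also have "\<dots> = real n * (\<Sum>j=1..?d. x j)" by (simp add: sum_distrib_left)
          also have "\<dots> \<le> real n - real ?d" using elim sum1 by (simp add: field_simps)
          finally show ?case by linarith
        qed
        define Y where "Y = (\<lambda>n. composition_point m n (V n))"
        have VN: "V n \<in> ?N n" if "(\<Sum>j=1..?d. fl n j) + ?d \<le> n" for n
        proof -
          have "sum_list (map (\<lambda>i. fl n (Suc i)) [0..<?d]) = (\<Sum>j=1..?d. fl n j)"
            unfolding interv_sum_list_conv_sum_set_nat set_upt
            by (rule sum.reindex_bij_witness[of _ "\<lambda>j. j - 1" Suc]) auto
          then show ?thesis using that m by (simp add: natpermute_def V_def)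
        qed
        have Vnth: "V n ! (j - 1) = fl n j" if "j \<in> {1..?d}" for n j
          using that by (auto simp: V_def nth_append)
        have Vlast: "V n ! (m - 1) = n - ?d - (\<Sum>j=1..?d. fl n j)" for n
          by (simp add: V_def nth_append)
        have gY: "eventually (\<lambda>n. g n x = G (Y n)) sequentially"
          using sumfl eventually_ge_at_top[of m]
        proof eventually_elim
          case (elim n)
          have "x \<in> composition_box m n (V n)"
            using elim m x \<open>x \<in> space ?P\<close> Vnth by (subst composition_box_iff) (auto simp: fl_def)
          then show ?case unfolding Y_def using elim m VN by (intro g_box) auto
        qed
        have fl_lim: "(\<lambda>n. real (fl n j) / real n) \<longlonglongrightarrow> x j" if j: "j \<in> {1..?d}" for j
        proof (rule tendsto_sandwich)
          show "eventually (\<lambda>n. x j - 1 / real n \<le> real (fl n j) / real n) sequentially"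
            using eventually_gt_at_top[of 0]
          proof eventually_elim
            case (elim n)
            have "(real n * x j - 1) / real n \<le> real (fl n j) / real n" using flge by (rule divide_right_mono) simp
            then show ?case using elim by (simp add: diff_divide_distrib)
          qed
          show "eventually (\<lambda>n. real (fl n j) / real n \<le> x j) sequentially"
            using eventually_gt_at_top[of 0]
          proof eventually_elim
            case (elim n)
            have "real (fl n j) / real n \<le> (real n * x j) / real n" using flle[OF j] by (rule divide_right_mono) simp
            then show ?case using elim by simp
          qed
          show "(\<lambda>n. x j - 1 / real n) \<longlonglongrightarrow> x j"
            using tendsto_diff[OF tendsto_const[of "x j"] lim_const_over_n[of 1]] by simp
        qed simp
        have Ylim: "(\<lambda>n. Y n j) \<longlonglongrightarrow> simplex_completion m x j" if "j \<in> {1..m}" for j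
        proof (cases "j = m")
          case False
          then have j: "j \<in> {1..?d}" using that by auto
          then show ?thesis using fl_lim[OF j] that False Vnth[OF j] by (simp add: Y_def composition_point_def simplex_completion_def)
        next
          case True
          have "(\<lambda>n. 1 - real ?d / real n - (\<Sum>j=1..?d. real (fl n j) / real n)) \<longlonglongrightarrow> 1 - 0 - (\<Sum>j=1..?d. x j)"
            by (intro tendsto_intros lim_const_over_n fl_lim)
          then have "(\<lambda>n. real (n - ?d - (\<Sum>j=1..?d. fl n j)) / real n) \<longlonglongrightarrow> 1 - 0 - (\<Sum>j=1..?d. x j)"
          proof (rule Lim_transform_eventually)
            show "eventually (\<lambda>n. 1 - real ?d / real n - (\<Sum>j=1..?d. real (fl n j) / real n) = real (n - ?d - (\<Sum>j=1..?d. fl n j)) / real n) sequentially"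
              using sumfl eventually_ge_at_top[of m]
            proof eventually_elim
              case (elim n)
              have "real (n - ?d - (\<Sum>j=1..?d. fl n j)) = real n - real ?d - real (\<Sum>j=1..?d. fl n j)" using elim by linarith
              moreover have "1 - D / N - S / N = (N - D - S) / N" if "N \<noteq> 0" for D S N :: real
                using that by (simp add: diff_divide_distrib)
              ultimately show ?case using elim m by (simp only: sum_divide_distrib[symmetric] of_nat_sum[symmetric])
            qed
          qed
          then show ?thesis using True m Vlast by (simp add: Y_def composition_point_def simplex_completion_def)
        qed
        \<comment> \<open>The continuity hypothesis asks for a sequence with all terms in the unit
          cube, so the initial terms that are not compositions are shifted away.\<close>
        obtain n0 where n0: "\<And>n. n \<ge> n0 \<Longrightarrow> (\<Sum>j=1..?d. fl n j) + ?d \<le> n" using sumfl by (auto simp: eventually_sequentially)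
        have "(\<lambda>k. G (Y (k + n0))) \<longlonglongrightarrow> G (simplex_completion m x)"
        proof (rule cont)
          show "0 \<le> Y (k + n0) j \<and> Y (k + n0) j \<le> 1" if "j \<in> {1..m}" for k j
            unfolding Y_def using that n0[of "k + n0"] by (intro point_range VN) auto
          show "(\<lambda>k. Y (k + n0) j) \<longlonglongrightarrow> simplex_completion m x j" if "j \<in> {1..m}" for j
            using Ylim[OF that] by (rule LIMSEQ_ignore_initial_segment)
        qed
        then have "(\<lambda>n. G (Y n)) \<longlonglongrightarrow> G (simplex_completion m x)" by (rule LIMSEQ_offset)
        then have "(\<lambda>n. g n x) \<longlonglongrightarrow> G (simplex_completion m x)"
          by (rule Lim_transform_eventually) (use gY in \<open>auto elim: eventually_mono\<close>)
        then show ?thesis using True by simp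
      qed
    qed
    show "g n \<in> borel_measurable ?P" for n unfolding g_def by measurable
  qed measurable
  then show ?thesis
  proof (rule Lim_transform_eventually)
    show "eventually (\<lambda>n. (\<integral>x. g n x \<partial>?P) = (1 / real n) ^ ?d *\<^sub>R (\<Sum>v\<in>?N n. G (composition_point m n v))) sequentially"
      using eventually_ge_at_top[of m]
    proof eventually_elim
      case (elim n)
      have "n > 0" using elim m by simp
      note em = emeasure_composition_box[OF this, of m]
      have me: "measure ?P (composition_box m n v) = (1 / real n) ^ ?d" for v unfolding measure_def em by (rule enn2real_ennreal) simp
      have "(\<integral>x. g n x \<partial>?P) = (\<Sum>v\<in>?N n. \<integral>x. indicator (composition_box m n v) x *\<^sub>R G (composition_point m n v) \<partial>?P)"
        unfolding g_def if_not_P[OF leD[OF elim]] using em by (intro Bochner_Integration.integral_sum integrable_scaleR_left integrable_real_indicator) auto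
      also have "\<dots> = (\<Sum>v\<in>?N n. (1 / real n) ^ ?d *\<^sub>R G (composition_point m n v))"
        using em me by (intro sum.cong refl) (simp add: integral_scaleR_left)
      finally show ?case by (simp add: scaleR_sum_right)
    qed
  qed
qed


lemma integral_uniform_simplex:
  fixes G :: "(nat \<Rightarrow> real) \<Rightarrow> 'b::{banach, second_countable_topology}"
  assumes [measurable]: "G \<in> borel_measurable (\<Pi>\<^sub>M j\<in>{1..m}. borel)"
  shows "(\<integral>s. G s \<partial>uniform_simplex m) =
    fact (m - 1) *\<^sub>R (\<integral>x. indicator (simplex_coords m) x *\<^sub>R G (simplex_completion m x) \<partial>simplex_base m)"
proof -
  note One_nat_def [simp del]
  let ?P = "simplex_base m"
  have completion: "simplex_completion m \<in> ?P \<rightarrow>\<^sub>M (\<Pi>\<^sub>M j\<in>{1..m}. borel)"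
    unfolding simplex_completion_def by (rule measurable_simplex_completion)
  note [measurable] = completion
  have dens: "indicator (simplex_coords m) x / emeasure ?P (simplex_coords m) = ennreal (fact (m - 1) * indicator (simplex_coords m) x)" for x
  proof (cases "x \<in> simplex_coords m")
    case True
    have "1 / ennreal (1 / fact (m - 1)) = ennreal (1 / (1 / fact (m - 1)))"
      by (subst ennreal_1[symmetric], subst divide_ennreal) auto
    then show ?thesis using True by (simp only: emeasure_simplex_coords indicator_simps) simp
  qed simp
  have um: "uniform_measure ?P (simplex_coords m) = density ?P (\<lambda>x. ennreal (fact (m - 1) * indicator (simplex_coords m) x))"
    unfolding uniform_measure_def dens ..
  have "(\<integral>s. G s \<partial>uniform_simplex m) = (\<integral>x. G (simplex_completion m x) \<partial>uniform_measure ?P (simplex_coords m))"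
    unfolding uniform_simplex_def simplex_completion_def[symmetric]
    by (intro integral_distr assms) (use completion in \<open>simp add: measurable_def\<close>)
  also have "\<dots> = (\<integral>x. (fact (m - 1) * indicator (simplex_coords m) x) *\<^sub>R G (simplex_completion m x) \<partial>?P)"
    unfolding um by (intro integral_density) (auto simp: indicator_def)
  also have "\<dots> = (\<integral>x. fact (m - 1) *\<^sub>R (indicator (simplex_coords m) x *\<^sub>R G (simplex_completion m x)) \<partial>?P)"
    by simp
  also have "\<dots> = fact (m - 1) *\<^sub>R (\<integral>x. indicator (simplex_coords m) x *\<^sub>R G (simplex_completion m x) \<partial>?P)"
    by (rule integral_scaleR_right)
  finally show ?thesis .
qed

text \<open>The case of a constant function gives the asymptotic number of compositions. Dividing by
  it turns sums into averages and cancels the volume factor (m-1)!.\<close>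

lemma composition_average_tendsto:
  fixes G :: "(nat \<Rightarrow> real) \<Rightarrow> 'b::{banach, second_countable_topology}"
  assumes m: "m \<ge> 2" and meas: "G \<in> borel_measurable (\<Pi>\<^sub>M j\<in>{1..m}. borel)"
    and bdd: "\<And>s. (\<And>j. j \<in> {1..m} \<Longrightarrow> 0 \<le> s j \<and> s j \<le> 1) \<Longrightarrow> norm (G s) \<le> B"
    and cont: "\<And>X s. (\<And>k j. j \<in> {1..m} \<Longrightarrow> 0 \<le> X k j \<and> X k j \<le> 1) \<Longrightarrow>
       (\<And>j. j \<in> {1..m} \<Longrightarrow> (\<lambda>k. X k j) \<longlonglongrightarrow> s j) \<Longrightarrow> (\<lambda>k. G (X k)) \<longlonglongrightarrow> G s"
  shows "(\<lambda>n. (\<Sum>v\<in>natpermute (n - (m - 1)) m. G (composition_point m n v)) /\<^sub>R real (n choose (m - 1)))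
     \<longlonglongrightarrow> (\<integral>s. G s \<partial>uniform_simplex m)"
proof -
  let ?d = "m - 1"
  let ?N = "\<lambda>n. natpermute (n - ?d) m"
  have 1: "(\<lambda>n. (1 / real n) ^ ?d *\<^sub>R (\<Sum>v\<in>?N n. G (composition_point m n v)))
     \<longlonglongrightarrow> (\<integral>x. indicator (simplex_coords m) x *\<^sub>R G (simplex_completion m x) \<partial>simplex_base m)"
    by (rule composition_sum_tendsto[OF m meas bdd cont])
  have "(\<lambda>n. (1 / real n) ^ ?d *\<^sub>R (\<Sum>v\<in>?N n. 1::real))
     \<longlonglongrightarrow> (\<integral>x. indicator (simplex_coords m) x *\<^sub>R (1::real) \<partial>simplex_base m)"
    by (rule composition_sum_tendsto[OF m, of "\<lambda>_. 1" 1]) auto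
  also have "(\<integral>x. indicator (simplex_coords m) x *\<^sub>R (1::real) \<partial>simplex_base m) = 1 / fact ?d"
    by (simp add: measure_def emeasure_simplex_coords del: One_nat_def)
  finally have "(\<lambda>n. (1 / real n) ^ ?d *\<^sub>R real (card (?N n))) \<longlonglongrightarrow> 1 / fact ?d" by simp
  from tendsto_inverse[OF this]
  have 2: "(\<lambda>n. inverse ((1 / real n) ^ ?d *\<^sub>R real (card (?N n)))) \<longlonglongrightarrow> fact ?d" by simp
  have "(\<lambda>n. inverse ((1 / real n) ^ ?d *\<^sub>R real (card (?N n))) *\<^sub>R ((1 / real n) ^ ?d *\<^sub>R (\<Sum>v\<in>?N n. G (composition_point m n v))))
     \<longlonglongrightarrow> (\<integral>s. G s \<partial>uniform_simplex m)"
    unfolding integral_uniform_simplex[OF meas] by (rule tendsto_scaleR[OF 2 1])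
  then show ?thesis
  proof (rule Lim_transform_eventually)
    show "eventually (\<lambda>n. inverse ((1 / real n) ^ ?d *\<^sub>R real (card (?N n))) *\<^sub>R ((1 / real n) ^ ?d *\<^sub>R (\<Sum>v\<in>?N n. G (composition_point m n v)))
      = (\<Sum>v\<in>?N n. G (composition_point m n v)) /\<^sub>R real (n choose ?d)) sequentially"
      using eventually_ge_at_top[of m]
    proof eventually_elim
      case (elim n)
      then have "card (?N n) = n choose ?d" using m by (intro card_natpermute_gaps) auto
      moreover have "(1 / real n) ^ ?d \<noteq> 0" using elim m by simp
      ultimately show ?case by simp
    qed
  qed
qed

section \<open>Weak convergence and moments\<close>

lemma power_minus_truncation_bound:
  fixes x R :: real
  assumes "R > 0"
  shows "\<bar>x ^ k - (max (-R) (min R x)) ^ k\<bar> \<le> \<bar>x\<bar> ^ Suc k / R"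
proof (cases "\<bar>x\<bar> \<le> R")
  case True
  then have "max (-R) (min R x) = x" by auto
  then show ?thesis using assms by simp
next
  case False
  define z where "z = max (-R) (min R x)"
  have z: "\<bar>z\<bar> = R" "sgn z = sgn x" using False assms by (auto simp: z_def sgn_real_def)
  have "x ^ k = (sgn x) ^ k * \<bar>x\<bar> ^ k" by (metis mult_sgn_abs power_mult_distrib)
  moreover have "z ^ k = (sgn x) ^ k * R ^ k" using z by (metis mult_sgn_abs power_mult_distrib)
  moreover have "\<bar>sgn x\<bar> = 1" using False assms by (auto simp: sgn_real_def)
  ultimately have "\<bar>x ^ k - z ^ k\<bar> = \<bar>\<bar>x\<bar> ^ k - R ^ k\<bar>"
    by (simp add: right_diff_distrib[symmetric] abs_mult power_abs)
  also have "\<dots> \<le> \<bar>x\<bar> ^ k"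
    using power_mono[of R "\<bar>x\<bar>" k] False assms by auto
  also have "\<dots> \<le> \<bar>x\<bar> ^ Suc k / R"
    using False assms mult_right_mono[of R "\<bar>x\<bar>" "\<bar>x\<bar> ^ k"] by (simp add: field_simps)
  finally show ?thesis by (simp add: z_def)
qed

text \<open>A bound on the moment of order k+1 makes the error of truncating x^k at height R at most
  C'/R, uniformly in n and also for the limit. The truncated powers are bounded and continuous, so
  weak convergence handles them.\<close>

lemma weak_conv_moments:
  fixes M :: "nat \<Rightarrow> real measure"
  assumes M: "\<And>n. real_distribution (M n)" and D: "real_distribution D" and weak: "weak_conv_m M D"
    and bnd: "\<And>k. \<exists>C. \<forall>n. integrable (M n) (\<lambda>x. \<bar>x\<bar> ^ k) \<and> (\<integral>x. \<bar>x\<bar> ^ k \<partial>M n) \<le> C"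
  shows "integrable D (\<lambda>x. x ^ k)" "(\<lambda>n. \<integral>x. x ^ k \<partial>M n) \<longlonglongrightarrow> (\<integral>x. x ^ k \<partial>D)"
proof -
  interpret M: real_distribution "M n" for n by (rule M)
  interpret D: real_distribution D by (rule D)
  have absD: "integrable D (\<lambda>x. \<bar>x\<bar> ^ k)" for k
  proof -
    obtain C where C: "\<And>n. integrable (M n) (\<lambda>x. \<bar>x\<bar> ^ k)" "\<And>n. (\<integral>x. \<bar>x\<bar> ^ k \<partial>M n) \<le> C"
      using bnd by blast
    \<comment> \<open>Moment bounds pass to the limit law through these bounded continuous
      truncations; monotone convergence removes the truncation.\<close>
    define f where "f = (\<lambda>(i::nat) (x::real). min (\<bar>x\<bar> ^ k) (real i))"
    have bd: "norm (f i x) \<le> real i" for i x by (simp add: f_def)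
    have fm: "f i \<in> borel_measurable borel" for i unfolding f_def by measurable
    have fint: "integrable D (f i)" for i
      by (rule D.integrable_const_bound[where B = "real i"]) (use bd fm in auto)
    have fC: "(\<integral>x. f i x \<partial>D) \<le> C" for i
    proof (rule LIMSEQ_le_const2)
      show "(\<lambda>n. \<integral>x. f i x \<partial>M n) \<longlonglongrightarrow> (\<integral>x. f i x \<partial>D)"
        by (rule weak_conv_imp_integral_bdd_continuous_conv[OF M D weak _ bd])
           (auto simp: f_def intro!: continuous_intros)
      have "(\<integral>x. f i x \<partial>M n) \<le> (\<integral>x. \<bar>x\<bar> ^ k \<partial>M n)" for n
      proof (rule integral_mono)
        show "integrable (M n) (f i)"
          by (rule M.integrable_const_bound[where B = "real i"]) (use bd fm in auto)
      qed (use C in \<open>auto simp: f_def\<close>)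
      then show "\<exists>N. \<forall>n\<ge>N. (\<integral>x. f i x \<partial>M n) \<le> C" using C(2) order_trans by blast
    qed
    have "incseq (\<lambda>i. \<integral>x. f i x \<partial>D)"
      by (intro monoI integral_mono fint) (auto simp: f_def)
    then obtain l where l: "(\<lambda>i. \<integral>x. f i x \<partial>D) \<longlonglongrightarrow> l" using incseq_convergent[of "\<lambda>i. \<integral>x. f i x \<partial>D" C] fC by metis
    show ?thesis
    proof (rule integrable_monotone_convergence[OF fint _ _ l])
      show "AE x in D. mono (\<lambda>n. f n x)" by (auto simp: f_def mono_def)
      show "AE x in D. (\<lambda>i. f i x) \<longlonglongrightarrow> \<bar>x\<bar> ^ k"
      proof (rule AE_I2)
        fix x :: real
        obtain N :: nat where N: "\<bar>x\<bar> ^ k \<le> real N" using real_arch_simple by blast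
        have "eventually (\<lambda>i. \<bar>x\<bar> ^ k = f i x) sequentially"
          using eventually_ge_at_top[of N] by eventually_elim (use N in \<open>auto simp: f_def min_def\<close>)
        then show "(\<lambda>i. f i x) \<longlonglongrightarrow> \<bar>x\<bar> ^ k"
          by (rule Lim_transform_eventually[OF tendsto_const])
      qed
    qed measurable
  qed
  have powint: "integrable N (\<lambda>x. x ^ k)" if "integrable N (\<lambda>x. \<bar>x\<bar> ^ k)" "sets N = sets borel" for N :: "real measure" and k
    by (rule Bochner_Integration.integrable_bound[OF that(1)])
       (auto simp: power_abs measurable_cong_sets[OF that(2) refl])
  show Dk: "integrable D (\<lambda>x. x ^ k)" by (rule powint[OF absD]) simp
  obtain C where C: "\<And>n. integrable (M n) (\<lambda>x. \<bar>x\<bar> ^ Suc k)" "\<And>n. (\<integral>x. \<bar>x\<bar> ^ Suc k \<partial>M n) \<le> C"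
    using bnd[of "Suc k"] by blast
  have Mk: "integrable (M n) (\<lambda>x. x ^ k)" for n
    using bnd[of k] by (intro powint) auto
  define C' where "C' = max C (\<integral>x. \<bar>x\<bar> ^ Suc k \<partial>D) + 1"
  have "0 \<le> (\<integral>x. \<bar>x\<bar> ^ Suc k \<partial>D)" by (rule integral_nonneg_AE) simp
  then have C'pos: "C' > 0" unfolding C'_def by linarith
  define g where "g = (\<lambda>R x. (max (-R) (min R x)) ^ k :: real)"
  have gbd: "norm (g R x) \<le> R ^ k" if "R > 0" for R x
    unfolding g_def norm_power using that by (intro power_mono) auto
  have gm[measurable]: "g R \<in> borel_measurable borel" for R unfolding g_def by measurable
  have err: "\<bar>(\<integral>x. x ^ k \<partial>N) - (\<integral>x. g R x \<partial>N)\<bar> \<le> C' / R"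
    if "R > 0" "real_distribution N" "integrable N (\<lambda>x. x ^ k)" "integrable N (\<lambda>x. \<bar>x\<bar> ^ Suc k)" "(\<integral>x. \<bar>x\<bar> ^ Suc k \<partial>N) \<le> C'" for R N
  proof -
    interpret N: real_distribution N by fact
    have gi: "integrable N (g R)"
      by (rule N.integrable_const_bound[where B = "R ^ k"]) (use gbd that in auto)
    have "\<bar>(\<integral>x. x ^ k \<partial>N) - (\<integral>x. g R x \<partial>N)\<bar> = \<bar>\<integral>x. x ^ k - g R x \<partial>N\<bar>"
      using that gi by simp
    also have "\<dots> \<le> (\<integral>x. \<bar>x ^ k - g R x\<bar> \<partial>N)" by (rule integral_abs_bound)
    also have "\<dots> \<le> (\<integral>x. \<bar>x\<bar> ^ Suc k / R \<partial>N)"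
    proof (rule integral_mono)
      show "integrable N (\<lambda>x. \<bar>x\<bar> ^ Suc k / R)" using that(4) by (rule integrable_divide_zero[rotated]) 
      show "\<bar>x ^ k - g R x\<bar> \<le> \<bar>x\<bar> ^ Suc k / R" for x
        unfolding g_def by (rule power_minus_truncation_bound[OF that(1)])
    qed (use that gi in auto)
    also have "\<dots> = (\<integral>x. \<bar>x\<bar> ^ Suc k \<partial>N) / R" by simp
    also have "\<dots> \<le> C' / R" using that by (intro divide_right_mono) auto
    finally show ?thesis .
  qed
  show "(\<lambda>n. \<integral>x. x ^ k \<partial>M n) \<longlonglongrightarrow> (\<integral>x. x ^ k \<partial>D)"
  proof (rule LIMSEQ_I)
    fix \<epsilon> :: real assume \<epsilon>: "\<epsilon> > 0"
    define R where "R = 4 * C' / \<epsilon>"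
    have R: "R > 0" using C'pos \<epsilon> by (simp add: R_def)
    have CR: "C' / R = \<epsilon> / 4" using C'pos \<epsilon> by (simp add: R_def)
    have "(\<lambda>n. \<integral>x. g R x \<partial>M n) \<longlonglongrightarrow> (\<integral>x. g R x \<partial>D)"
      by (rule weak_conv_imp_integral_bdd_continuous_conv[OF M D weak _ gbd[OF R]])
         (auto simp: g_def intro!: continuous_intros)
    then have "eventually (\<lambda>n. dist (\<integral>x. g R x \<partial>M n) (\<integral>x. g R x \<partial>D) < \<epsilon>/4) sequentially"
      by (rule tendstoD) (use \<epsilon> in simp)
    then have "eventually (\<lambda>n. \<bar>(\<integral>x. g R x \<partial>M n) - (\<integral>x. g R x \<partial>D)\<bar> < \<epsilon>/4) sequentially"
      by (simp only: dist_real_def)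
    then have "eventually (\<lambda>n. norm ((\<integral>x. x ^ k \<partial>M n) - (\<integral>x. x ^ k \<partial>D)) < \<epsilon>) sequentially"
    proof eventually_elim
      case (elim n)
      have 1: "\<bar>(\<integral>x. x ^ k \<partial>M n) - (\<integral>x. g R x \<partial>M n)\<bar> \<le> \<epsilon> / 4"
        unfolding CR[symmetric] using C(2)[of n] by (intro err R M Mk C) (simp add: C'_def)
      have 2: "\<bar>(\<integral>x. x ^ k \<partial>D) - (\<integral>x. g R x \<partial>D)\<bar> \<le> \<epsilon> / 4"
        unfolding CR[symmetric] by (intro err R D Dk absD) (simp add: C'_def)
      have "\<bar>(\<integral>x. x ^ k \<partial>M n) - (\<integral>x. x ^ k \<partial>D)\<bar> < \<epsilon>" using 1 2 elim \<epsilon> by linarith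
      then show ?case by simp
    qed
    then show "\<exists>no. \<forall>n\<ge>no. norm ((\<integral>x. x ^ k \<partial>M n) - (\<integral>x. x ^ k \<partial>D)) < \<epsilon>" by (simp add: eventually_sequentially)
  qed
qed

lemma tight_second_moment:
  fixes M :: "nat \<Rightarrow> real measure"
  assumes M: "\<And>n. real_distribution (M n)"
    and int: "\<And>n. integrable (M n) (\<lambda>x. x\<^sup>2)" and bnd: "\<And>n. (\<integral>x. x\<^sup>2 \<partial>M n) \<le> C"
  shows "tight M"
  unfolding tight_def
proof (intro conjI allI impI M)
  fix \<epsilon> :: real assume \<epsilon>: "\<epsilon> > 0"
  interpret M: real_distribution "M n" for n by (rule M)
  \<comment> \<open>With this R > 1, the Chebyshev bound |C|/R^2 \<le> |C|/R is below
    \<epsilon>.\<close>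
  define R where "R = (\<bar>C\<bar> + 1) / \<epsilon> + 1"
  have R: "R > 1" using \<epsilon> by (simp add: R_def)
  have "measure (M n) {-R<..R} > 1 - \<epsilon>" for n
  proof -
    have "measure (M n) {x \<in> space (M n). R\<^sup>2 \<le> x\<^sup>2} \<le> (\<integral>x. x\<^sup>2 \<partial>M n) / R\<^sup>2"
      using R by (intro integral_Markov_inequality_measure[where A = "space (M n)"] int) auto
    also have "\<dots> \<le> \<bar>C\<bar> / R\<^sup>2" using bnd[of n] by (intro divide_right_mono) auto
    also have "\<dots> \<le> \<bar>C\<bar> / R" using R by (intro divide_left_mono) (auto simp: power2_eq_square)
    also have "\<dots> < \<epsilon>"
    proof -
      have "\<epsilon> * R = \<bar>C\<bar> + 1 + \<epsilon>" using \<epsilon> by (simp add: R_def field_simps)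
      then have "\<bar>C\<bar> < \<epsilon> * R" using \<epsilon> by linarith
      then show ?thesis using R by (simp add: divide_less_eq)
    qed
    finally have small: "measure (M n) {x \<in> space (M n). R\<^sup>2 \<le> x\<^sup>2} < \<epsilon>" .
    have "measure (M n) (space (M n) - {-R<..R}) \<le> measure (M n) {x \<in> space (M n). R\<^sup>2 \<le> x\<^sup>2}"
    proof (rule M.finite_measure_mono)
      show "space (M n) - {-R<..R} \<subseteq> {x \<in> space (M n). R\<^sup>2 \<le> x\<^sup>2}"
      proof
        fix x assume "x \<in> space (M n) - {-R<..R}"
        then have "R \<le> \<bar>x\<bar>" by auto
        then show "x \<in> {x \<in> space (M n). R\<^sup>2 \<le> x\<^sup>2}" using R by (simp add: abs_le_square_iff[symmetric])
      qed
    qed measurable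
    moreover have "measure (M n) (space (M n) - {-R<..R}) = 1 - measure (M n) {-R<..R}"
      by (rule M.prob_compl) simp
    ultimately show ?thesis using small by linarith
  qed
  then show "\<exists>a b. a < b \<and> (\<forall>n. 1 - \<epsilon> < measure (M n) {a<..b})" using R by (intro exI[of _ "-R"] exI[of _ R]) auto
qed

lemma norm_iexp_diff_le: "cmod (iexp x - iexp y) \<le> \<bar>x - y\<bar>"
proof -
  have "iexp x - iexp y = iexp y * (iexp (x - y) - 1)"
    by (simp add: algebra_simps flip: exp_add)
  then have "cmod (iexp x - iexp y) = cmod (iexp (x - y) - 1)" by (simp add: norm_mult)
  also have "\<dots> \<le> \<bar>x - y\<bar>" using iexp_approx1[of "x - y" 0] by simp
  finally show ?thesis .
qed

lemma norm_iexp_linear: "cmod (iexp x - 1 - \<i> * x) \<le> x\<^sup>2"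
proof -
  have "cmod (iexp x - (1 + \<i> * x)) \<le> \<bar>x\<bar>\<^sup>2 / 2" using iexp_approx1[of x 1] by (simp add: numeral_2_eq_2)
  also have "\<dots> \<le> x\<^sup>2" by simp
  finally show ?thesis by (simp add: diff_diff_eq)
qed

lemma (in real_distribution) char_linear_approx:
  assumes "integrable M (\<lambda>x. x\<^sup>2)"
  shows "cmod (char M t - 1 - \<i> * t * expectation (\<lambda>x. x)) \<le> t\<^sup>2 * expectation (\<lambda>x. x\<^sup>2)"
proof -
  have i1: "integrable M (\<lambda>x. x)"
  proof (rule Bochner_Integration.integrable_bound[where f = "\<lambda>x. 1 + x\<^sup>2"])
    show "AE x in M. norm x \<le> norm (1 + x\<^sup>2)"
    proof (rule AE_I2)
      fix x :: real
      have "0 \<le> (\<bar>x\<bar> - 1)\<^sup>2" by simp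
      then have "2 * \<bar>x\<bar> \<le> x\<^sup>2 + 1" by (simp add: power2_eq_square algebra_simps)
      then show "norm x \<le> norm (1 + x\<^sup>2)" by (simp add: abs_if split: if_splits)
    qed
  qed (use assms in auto)
  have ic: "integrable M (\<lambda>x. complex_of_real x)" using i1 by simp
  have univ: "prob UNIV = 1" using prob_space by simp
  have "char M t - 1 - \<i> * t * expectation (\<lambda>x. x) = (CLINT x|M. iexp (t * x) - 1 - \<i> * t * x)"
    unfolding char_def using ic integrable_iexp[of "\<lambda>x. t * x"] by (simp add: univ)
  also have "cmod \<dots> \<le> (\<integral>x. t\<^sup>2 * x\<^sup>2 \<partial>M)"
  proof (rule Bochner_Integration.integral_norm_bound_integral)
    show "integrable M (\<lambda>x. iexp (t * x) - 1 - \<i> * t * x)"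
      using ic integrable_iexp[of "\<lambda>x. t * x"] by (intro Bochner_Integration.integrable_diff integrable_mult_right) auto
    show "cmod (iexp (t * x) - 1 - \<i> * t * x) \<le> t\<^sup>2 * x\<^sup>2" for x
      using norm_iexp_linear[of "t * x"] by (simp add: power_mult_distrib mult.assoc)
  qed (use assms in auto)
  finally show ?thesis by simp
qed

text \<open>A finite \<delta>-net of the interval suffices, since the common Lipschitz constant
  controls everything between its points.\<close>

lemma equi_lipschitz_uniform:
  fixes f :: "nat \<Rightarrow> real \<Rightarrow> 'b::real_normed_vector"
  assumes lip: "\<And>n x y. norm (f n x - f n y) \<le> \<Lambda> * \<bar>x - y\<bar>"
    and lim: "\<And>x. (\<lambda>n. f n x) \<longlonglongrightarrow> 0" and \<epsilon>: "\<epsilon> > 0"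
  shows "eventually (\<lambda>n. \<forall>x. \<bar>x\<bar> \<le> T \<longrightarrow> norm (f n x) \<le> \<epsilon>) sequentially"
proof -
  define \<delta> where "\<delta> = \<epsilon> / (2 * (\<bar>\<Lambda>\<bar> + 1))"
  have \<delta>: "\<delta> > 0" using \<epsilon> by (simp add: \<delta>_def)
  have "cball (0::real) T \<subseteq> (\<Union>x\<in>UNIV. ball x \<delta>)" using centre_in_ball[of _ \<delta>] \<delta> by blast
  then obtain F where F: "finite F" "cball (0::real) T \<subseteq> (\<Union>x\<in>F. ball x \<delta>)"
    using compactE_image[of "cball (0::real) T" UNIV "\<lambda>x. ball x \<delta>"] by (metis compact_cball open_ball)
  have "eventually (\<lambda>n. norm (f n x) < \<epsilon>/2) sequentially" for x
    using tendstoD[OF lim[of x], of "\<epsilon>/2"] \<epsilon> by simp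
  then have "eventually (\<lambda>n. \<forall>x\<in>F. norm (f n x) < \<epsilon>/2) sequentially"
    using F(1) by (intro eventually_ball_finite) auto
  then show ?thesis
  proof eventually_elim
    case (elim n)
    show ?case
    proof (intro allI impI)
      fix x :: real assume "\<bar>x\<bar> \<le> T"
      then obtain y where y: "y \<in> F" "\<bar>y - x\<bar> < \<delta>" using F(2) by (auto simp: dist_real_def subset_iff)
      have "norm (f n x) \<le> norm (f n x - f n y) + norm (f n y)"
        using norm_triangle_ineq[of "f n x - f n y" "f n y"] by simp
      also have "\<dots> \<le> \<Lambda> * \<bar>x - y\<bar> + \<epsilon>/2" using lip[of n x y] elim y by (intro add_mono) (auto intro: less_imp_le)
      also have "\<Lambda> * \<bar>x - y\<bar> \<le> (\<bar>\<Lambda>\<bar> + 1) * \<delta>" using y by (intro mult_mono) auto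
      also have "(\<bar>\<Lambda>\<bar> + 1) * \<delta> = \<epsilon>/2" by (simp add: \<delta>_def field_simps)
      finally show "norm (f n x) \<le> \<epsilon>" by simp
    qed
  qed
qed

section \<open>The fixed-point equation\<close>

lemma measurable_uniform_simplex_eq:
  "measurable (uniform_simplex m) N = measurable (\<Pi>\<^sub>M j\<in>{1..m}. (borel :: real measure)) N"
  by (rule measurable_cong_sets[OF sets_uniform_simplex refl])

lemma AE_uniform_simplex:
  assumes "m \<ge> 2"
  shows "AE s in uniform_simplex m. (\<forall>j\<in>{1..m}. 0 \<le> s j \<and> s j \<le> 1) \<and> (\<Sum>j=1..m. s j) = 1"
proof -
  note One_nat_def [simp del]
  have completion: "simplex_completion m \<in> simplex_base m \<rightarrow>\<^sub>M (\<Pi>\<^sub>M j\<in>{1..m}. borel)"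
    unfolding simplex_completion_def by (rule measurable_simplex_completion)
  have meas: "{s \<in> space (\<Pi>\<^sub>M j\<in>{1..m}. (borel :: real measure)). (\<forall>j\<in>{1..m}. 0 \<le> s j \<and> s j \<le> 1) \<and> (\<Sum>j=1..m. s j) = 1}
    \<in> sets (\<Pi>\<^sub>M j\<in>{1..m}. borel)" by measurable
  have "(\<forall>j\<in>{1..m}. 0 \<le> simplex_completion m x j \<and> simplex_completion m x j \<le> 1) \<and> (\<Sum>j=1..m. simplex_completion m x j) = 1"
    if x: "x \<in> simplex_coords m" for x
  proof -
    have nn: "\<And>j. j \<in> {1..m-1} \<Longrightarrow> 0 \<le> x j" and le: "(\<Sum>j=1..m-1. x j) \<le> 1"
      using x by (auto simp: simplex_coords_def)
    have le1: "x j \<le> 1" if "j \<in> {1..m-1}" for j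
      using member_le_sum[of j "{1..m-1}" x] that nn le by force
    have sp: "{1..m} = insert m {1..m-1}" using assms by auto
    have "(\<Sum>j\<in>{1..m-1}. simplex_completion m x j) = (\<Sum>j\<in>{1..m-1}. x j)"
      using assms by (intro sum.cong) (auto simp: simplex_completion_def)
    then have "(\<Sum>j=1..m. simplex_completion m x j) = simplex_completion m x m + (\<Sum>j\<in>{1..m-1}. x j)"
      unfolding sp using assms by (subst sum.insert) auto
    also have "\<dots> = 1" using assms by (simp add: simplex_completion_def)
    finally have "(\<Sum>j=1..m. simplex_completion m x j) = 1" .
    moreover have "0 \<le> simplex_completion m x j \<and> simplex_completion m x j \<le> 1" if "j \<in> {1..m}" for j
    proof (cases "j = m")
      case True
      then show ?thesis using le sum_nonneg[of "{1..m-1}" x] nn that by (simp add: simplex_completion_def)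
    next
      case False
      then have "j \<in> {1..m-1}" using that by auto
      then show ?thesis using nn le1 False that by (simp add: simplex_completion_def)
    qed
    ultimately show ?thesis by blast
  qed
  then have "AE x in uniform_measure (simplex_base m) (simplex_coords m).
      (\<forall>j\<in>{1..m}. 0 \<le> simplex_completion m x j \<and> simplex_completion m x j \<le> 1) \<and> (\<Sum>j=1..m. simplex_completion m x j) = 1"
    by (intro AE_uniform_measureI simplex_coords_sets AE_I2) blast
  then show ?thesis
    unfolding uniform_simplex_def simplex_completion_def[symmetric]
    by (subst AE_distr_iff[OF _ meas]) (use completion in \<open>simp_all add: measurable_def\<close>)
qed

lemma integrable_uniform_simplex:
  fixes G :: "(nat \<Rightarrow> real) \<Rightarrow> 'b::{banach, second_countable_topology}"
  assumes m: "m \<ge> 2" and [measurable]: "G \<in> borel_measurable (\<Pi>\<^sub>M j\<in>{1..m}. borel)"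
    and bdd: "\<And>s. (\<And>j. j \<in> {1..m} \<Longrightarrow> 0 \<le> s j \<and> s j \<le> 1) \<Longrightarrow> norm (G s) \<le> B"
  shows "integrable (uniform_simplex m) G"
proof -
  interpret S: prob_space "uniform_simplex m" by (rule prob_space_uniform_simplex)
  show ?thesis
  proof (rule S.integrable_const_bound[where B = B])
    show "AE s in uniform_simplex m. norm (G s) \<le> B"
      using AE_uniform_simplex[OF m] by eventually_elim (auto intro: bdd)
  qed (unfold measurable_uniform_simplex_eq, fact)
qed

section \<open>Expected power sums of a uniform point of the simplex\<close>

definition power_sum :: "nat \<Rightarrow> real \<Rightarrow> real" where
  "power_sum m p = (\<integral>s. (\<Sum>j=1..m. s j powr p) \<partial>uniform_simplex m)"

lemma measurable_power_sum [measurable]: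
  "(\<lambda>s. \<Sum>j=1..m. s j powr p) \<in> borel_measurable (\<Pi>\<^sub>M j\<in>{1..m}. (borel :: real measure))"
  by measurable

lemma power_sum_bound:
  assumes "p > 0" "\<And>j. j \<in> {1..m} \<Longrightarrow> 0 \<le> s j \<and> s j \<le> (1::real)"
  shows "norm (\<Sum>j=1..m. s j powr p) \<le> real m"
proof -
  have "norm (\<Sum>j=1..m. s j powr p) \<le> (\<Sum>j=1..m. norm (s j powr p))" by (rule norm_sum)
  also have "\<dots> \<le> (\<Sum>j=1..m. 1)" using assms by (intro sum_mono) (auto intro!: powr_le1)
  finally show ?thesis by simp
qed

lemma integrable_power_sum:
  "m \<ge> 2 \<Longrightarrow> p > 0 \<Longrightarrow> integrable (uniform_simplex m) (\<lambda>s. \<Sum>j=1..m. s j powr p)"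
  by (rule integrable_uniform_simplex[OF _ _ power_sum_bound]) auto

lemma power_sum_nonneg: "power_sum m p \<ge> 0"
  unfolding power_sum_def by (intro integral_nonneg_AE AE_I2 sum_nonneg) auto

lemma null_coordinate:
  assumes "m \<ge> 2"
  shows "AE x in simplex_base m. x 1 \<noteq> c"
proof -
  note One_nat_def [simp del]
  interpret product_sigma_finite "\<lambda>_::nat. lborel :: real measure" ..
  let ?A = "\<Pi>\<^sub>E j\<in>{1..m-1}. if j = 1 then {c} else UNIV :: real set"
  have mem: "1 \<in> {1..m-1}" using assms by auto
  have sets: "?A \<in> sets (simplex_base m)" by (intro sets_PiM_I_finite) auto
  have "emeasure (simplex_base m) ?A = (\<Prod>j\<in>{1..m-1}. emeasure lborel (if j = 1 then {c} else UNIV))"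
    by (intro emeasure_PiM) auto
  also have "\<dots> = 0" by (rule prod_zero) (use mem in \<open>auto intro!: bexI[of _ 1]\<close>)
  finally have "AE x in simplex_base m. x \<notin> ?A" using sets by (intro AE_not_in) (auto simp: null_sets_def)
  with AE_space show ?thesis
  proof eventually_elim
    case (elim x)
    show ?case
    proof
      assume "x 1 = c"
      then have "x \<in> ?A" using elim(1) by (auto simp: space_PiM PiE_iff)
      then show False using elim(2) by simp
    qed
  qed
qed

text \<open>On [0, 1] one has s^p \<le> s with equality only at 0 and 1, and the coordinates sum to
  1. An integral equal to 1 would force the first coordinate into {0, 1} almost surely, which is a
  null event.\<close>

lemma power_sum_less_1:
  assumes m: "m \<ge> 2" and p: "p > 1"
  shows "power_sum m p < 1"
proof -
  note One_nat_def [simp del]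
  interpret S: prob_space "uniform_simplex m" by (rule prob_space_uniform_simplex)
  define h where "h = (\<lambda>s::nat \<Rightarrow> real. 1 - (\<Sum>j=1..m. s j powr p))"
  have hint: "integrable (uniform_simplex m) h"
    unfolding h_def using integrable_power_sum[OF m, of p] p by simp
  have hI: "(\<integral>s. h s \<partial>uniform_simplex m) = 1 - power_sum m p"
    unfolding h_def power_sum_def using integrable_power_sum[OF m, of p] p by (simp add: S.prob_space)
  have pw: "x powr p \<le> x" if "0 \<le> x" "x \<le> 1" for x :: real
    using powr_mono'[of 1 p x] that p by (cases "x = 0") auto
  have h_eq: "h s = (\<Sum>j=1..m. s j - s j powr p)" if "(\<Sum>j=1..m. s j) = 1" for s
    using that by (simp add: h_def sum_subtractf)
  have h_nn: "AE s in uniform_simplex m. 0 \<le> h s"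
    using AE_uniform_simplex[OF m]
    by eventually_elim (auto simp: h_eq intro!: sum_nonneg pw)
  have "(\<integral>s. h s \<partial>uniform_simplex m) \<ge> 0" by (rule integral_nonneg_AE[OF h_nn])
  moreover have "(\<integral>s. h s \<partial>uniform_simplex m) \<noteq> 0"
  proof
    assume "(\<integral>s. h s \<partial>uniform_simplex m) = 0"
    then have "AE s in uniform_simplex m. h s = 0" using integral_nonneg_eq_0_iff_AE[OF hint h_nn] by simp
    with AE_uniform_simplex[OF m] have AE1: "AE s in uniform_simplex m. s 1 = 0 \<or> s 1 = 1"
    proof eventually_elim
      case (elim s)
      have "(\<Sum>j=1..m. s j - s j powr p) = 0" using elim h_eq by simp
      moreover have "0 \<le> s j - s j powr p" if "j \<in> {1..m}" for j using elim pw that by auto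
      ultimately have "s 1 - s 1 powr p = 0"
        using sum_nonneg_eq_0_iff[of "{1..m}" "\<lambda>j. s j - s j powr p"] m by auto
      then have eq: "s 1 powr p = s 1" by simp
      have r: "0 \<le> s 1" "s 1 \<le> 1" using elim m by auto
      show ?case
      proof (rule ccontr)
        assume "\<not> (s 1 = 0 \<or> s 1 = 1)"
        then have "0 < s 1" "s 1 < 1" using r by auto
        then have "s 1 powr p < s 1 powr 1" using p by (intro powr_less_mono') auto
        then show False using eq r by simp
      qed
    qed
    have completion: "simplex_completion m \<in> simplex_base m \<rightarrow>\<^sub>M (\<Pi>\<^sub>M j\<in>{1..m}. borel)"
      unfolding simplex_completion_def by (rule measurable_simplex_completion)
    have mem1: "1 \<in> {1..m}" using m by auto
    have ms: "{s \<in> space (\<Pi>\<^sub>M j\<in>{1..m}. (borel :: real measure)). s 1 = 0 \<or> s 1 = 1} \<in> sets (\<Pi>\<^sub>M j\<in>{1..m}. borel)"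
      using mem1 by measurable
    have "AE x in uniform_measure (simplex_base m) (simplex_coords m). simplex_completion m x 1 = 0 \<or> simplex_completion m x 1 = 1"
      using AE1 unfolding uniform_simplex_def simplex_completion_def[symmetric]
      by (subst (asm) AE_distr_iff[OF _ ms]) (use completion in \<open>simp_all add: measurable_def\<close>)
    moreover have "simplex_completion m x 1 = x 1" for x using m by (simp add: simplex_completion_def)
    ultimately have "AE x in uniform_measure (simplex_base m) (simplex_coords m). x 1 = 0 \<or> x 1 = 1" by simp
    then have "AE x in simplex_base m. x \<in> simplex_coords m \<longrightarrow> x 1 = 0 \<or> x 1 = 1"
      by (subst (asm) AE_uniform_measure) (simp_all only: emeasure_simplex_coords simplex_coords_sets, simp_all add: ennreal_eq_0_iff not_le)
    with null_coordinate[OF m, of 0] null_coordinate[OF m, of 1]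
    have "AE x in simplex_base m. x \<notin> simplex_coords m" by eventually_elim auto
    then have "emeasure (simplex_base m) (simplex_coords m) = 0"
      by (subst (asm) AE_iff_measurable[OF simplex_coords_sets]) (use sets.sets_into_space[OF simplex_coords_sets[of m]] in auto)
    then show False using fact_gt_zero[of "m - 1", where 'a = real] unfolding emeasure_simplex_coords by (simp add: ennreal_eq_0_iff not_le)
  qed
  ultimately show ?thesis unfolding hI by simp
qed

text \<open>The action of \<open>fixed_point_map\<close> on characteristic functions. It is defined
  for arbitrary functions, so it can be iterated without exhibiting the laws behind the
  iterates.\<close>

definition smoothing :: "nat \<Rightarrow> real \<Rightarrow> (real \<Rightarrow> complex) \<Rightarrow> real \<Rightarrow> complex" where
  "smoothing m \<beta> \<phi> t = iexp t * (CLINT s|uniform_simplex m. \<Prod>j=1..m. \<phi> (s j powr \<beta> * t))"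

lemma measurable_smoothing_integrand:
  fixes \<phi> :: "real \<Rightarrow> complex"
  assumes [measurable]: "\<phi> \<in> borel_measurable borel"
  shows "(\<lambda>s. \<Prod>j=1..m. \<phi> (s j powr \<beta> * t)) \<in> borel_measurable (\<Pi>\<^sub>M j\<in>{1..m}. (borel :: real measure))"
  by measurable

lemma norm_prod_le_1:
  fixes f :: "'a \<Rightarrow> complex"
  assumes "\<And>j. j \<in> A \<Longrightarrow> norm (f j) \<le> 1"
  shows "norm (\<Prod>j\<in>A. f j) \<le> 1"
  unfolding prod_norm[symmetric] using assms by (intro prod_le_1) auto

lemma integrable_smoothing_integrand:
  fixes \<phi> :: "real \<Rightarrow> complex"
  assumes "m \<ge> 2" "\<phi> \<in> borel_measurable borel" "\<And>x. norm (\<phi> x) \<le> 1"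
  shows "integrable (uniform_simplex m) (\<lambda>s. \<Prod>j=1..m. \<phi> (s j powr \<beta> * t))"
  by (rule integrable_uniform_simplex[OF assms(1) measurable_smoothing_integrand[OF assms(2)], where B = 1])
     (intro norm_prod_le_1 assms)

lemma norm_smoothing_le_1:
  fixes \<phi> :: "real \<Rightarrow> complex"
  assumes "m \<ge> 2" "\<phi> \<in> borel_measurable borel" "\<And>x. norm (\<phi> x) \<le> 1"
  shows "norm (smoothing m \<beta> \<phi> t) \<le> 1"
proof -
  interpret S: prob_space "uniform_simplex m" by (rule prob_space_uniform_simplex)
  have "norm (smoothing m \<beta> \<phi> t) = norm (CLINT s|uniform_simplex m. \<Prod>j=1..m. \<phi> (s j powr \<beta> * t))"
    by (simp add: smoothing_def norm_mult)
  also have "\<dots> \<le> (\<integral>s. norm (\<Prod>j=1..m. \<phi> (s j powr \<beta> * t)) \<partial>uniform_simplex m)"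
    by (rule integral_norm_bound)
  also have "\<dots> \<le> (\<integral>s. 1 \<partial>uniform_simplex m)"
    by (intro integral_mono integrable_norm integrable_smoothing_integrand norm_prod_le_1 assms) simp
  finally show ?thesis by (simp add: S.prob_space)
qed

text \<open>Both the functions and the arguments may differ: equal arguments give the contraction,
  equal functions the Lipschitz bound. For factors in the unit disc, the difference of products is
  at most the sum of the differences.\<close>

lemma norm_smoothing_diff_le:
  assumes m: "m \<ge> 2" and \<phi>: "\<phi> \<in> borel_measurable borel" "\<And>x. norm (\<phi> x) \<le> 1"
    and \<psi>: "\<psi> \<in> borel_measurable borel" "\<And>x. norm (\<psi> x) \<le> 1" and h: "integrable (uniform_simplex m) h"
    and le: "\<And>s. (\<And>j. j \<in> {1..m} \<Longrightarrow> 0 \<le> s j \<and> s j \<le> 1) \<Longrightarrow> (\<Sum>j=1..m. norm (\<phi> (s j powr \<beta> * t) - \<psi> (s j powr \<beta> * u))) \<le> h s"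
  shows "norm ((CLINT s|uniform_simplex m. \<Prod>j=1..m. \<phi> (s j powr \<beta> * t)) - (CLINT s|uniform_simplex m. \<Prod>j=1..m. \<psi> (s j powr \<beta> * u)))
    \<le> (\<integral>s. h s \<partial>uniform_simplex m)"
proof -
  note I\<phi> = integrable_smoothing_integrand[OF m \<phi>, of \<beta> t]
  note I\<psi> = integrable_smoothing_integrand[OF m \<psi>, of \<beta> u]
  have "norm ((CLINT s|uniform_simplex m. \<Prod>j=1..m. \<phi> (s j powr \<beta> * t)) - (CLINT s|uniform_simplex m. \<Prod>j=1..m. \<psi> (s j powr \<beta> * u)))
    = norm (CLINT s|uniform_simplex m. (\<Prod>j=1..m. \<phi> (s j powr \<beta> * t)) - (\<Prod>j=1..m. \<psi> (s j powr \<beta> * u)))"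
    by (subst Bochner_Integration.integral_diff[OF I\<phi> I\<psi>]) simp
  also have "\<dots> \<le> (\<integral>s. norm ((\<Prod>j=1..m. \<phi> (s j powr \<beta> * t)) - (\<Prod>j=1..m. \<psi> (s j powr \<beta> * u))) \<partial>uniform_simplex m)"
    by (rule integral_norm_bound)
  also have "\<dots> \<le> (\<integral>s. h s \<partial>uniform_simplex m)"
  proof (rule integral_mono_AE)
    show "integrable (uniform_simplex m) (\<lambda>s. norm ((\<Prod>j=1..m. \<phi> (s j powr \<beta> * t)) - (\<Prod>j=1..m. \<psi> (s j powr \<beta> * u))))"
      using I\<phi> I\<psi> by (intro integrable_norm Bochner_Integration.integrable_diff)
    show "AE s in uniform_simplex m. norm ((\<Prod>j=1..m. \<phi> (s j powr \<beta> * t)) - (\<Prod>j=1..m. \<psi> (s j powr \<beta> * u))) \<le> h s"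
      using AE_uniform_simplex[OF m]
    proof eventually_elim
      case (elim s)
      have "norm ((\<Prod>j=1..m. \<phi> (s j powr \<beta> * t)) - (\<Prod>j=1..m. \<psi> (s j powr \<beta> * u))) \<le> (\<Sum>j=1..m. norm (\<phi> (s j powr \<beta> * t) - \<psi> (s j powr \<beta> * u)))"
        by (rule norm_prod_diff) (use \<phi> \<psi> in auto)
      also have "\<dots> \<le> h s" by (rule le) (use elim in blast)
      finally show ?case .
    qed
  qed fact
  finally show ?thesis .
qed

text \<open>Replacing x by s_j^\<beta> t in a quadratic bound produces the factor s_j^(2\<beta>);
  integrating the sum over j gives the rate.\<close>

lemma smoothing_contraction:
  assumes m: "m \<ge> 2" and \<beta>: "\<beta> > 0" and \<phi>: "\<phi> \<in> borel_measurable borel" "\<And>x. norm (\<phi> x) \<le> 1"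
    and \<psi>: "\<psi> \<in> borel_measurable borel" "\<And>x. norm (\<psi> x) \<le> 1"
    and le: "\<And>x. norm (\<phi> x - \<psi> x) \<le> C * x\<^sup>2"
  shows "norm (smoothing m \<beta> \<phi> t - smoothing m \<beta> \<psi> t) \<le> C * power_sum m (2 * \<beta>) * t\<^sup>2"
proof -
  have sq: "(x powr \<beta> * t)\<^sup>2 = x powr (2 * \<beta>) * t\<^sup>2" for x :: real
    by (simp add: power_mult_distrib power2_eq_square flip: powr_add)
  have ip: "integrable (uniform_simplex m) (\<lambda>s. \<Sum>j=1..m. s j powr (2 * \<beta>))"
    using integrable_power_sum[OF m] \<beta> by simp
  have "norm (smoothing m \<beta> \<phi> t - smoothing m \<beta> \<psi> t) =
    norm ((CLINT s|uniform_simplex m. \<Prod>j=1..m. \<phi> (s j powr \<beta> * t)) - (CLINT s|uniform_simplex m. \<Prod>j=1..m. \<psi> (s j powr \<beta> * t)))"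
    unfolding smoothing_def right_diff_distrib[symmetric] norm_mult by simp
  also have "\<dots> \<le> (\<integral>s. C * t\<^sup>2 * (\<Sum>j=1..m. s j powr (2 * \<beta>)) \<partial>uniform_simplex m)"
  proof (rule norm_smoothing_diff_le[OF m \<phi> \<psi>])
    show "integrable (uniform_simplex m) (\<lambda>s. C * t\<^sup>2 * (\<Sum>j=1..m. s j powr (2 * \<beta>)))"
      by (rule integrable_mult_right) (use ip in simp)
    fix s :: "nat \<Rightarrow> real"
    have "(\<Sum>j=1..m. norm (\<phi> (s j powr \<beta> * t) - \<psi> (s j powr \<beta> * t))) \<le> (\<Sum>j=1..m. C * (s j powr \<beta> * t)\<^sup>2)"
      by (intro sum_mono le)
    also have "\<dots> = C * t\<^sup>2 * (\<Sum>j=1..m. s j powr (2 * \<beta>))"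
      unfolding sq by (simp add: sum_distrib_left mult_ac)
    finally show "(\<Sum>j=1..m. norm (\<phi> (s j powr \<beta> * t) - \<psi> (s j powr \<beta> * t))) \<le> C * t\<^sup>2 * (\<Sum>j=1..m. s j powr (2 * \<beta>))" .
  qed
  also have "\<dots> = C * power_sum m (2 * \<beta>) * t\<^sup>2"
    unfolding power_sum_def by simp
  finally show ?thesis .
qed

lemma smoothing_fixed_point_unique:
  assumes m: "m \<ge> 2" and \<beta>: "\<beta> > 1/2" and \<phi>: "\<phi> \<in> borel_measurable borel" "\<And>x. norm (\<phi> x) \<le> 1" "smoothing m \<beta> \<phi> = \<phi>"
    and \<psi>: "\<psi> \<in> borel_measurable borel" "\<And>x. norm (\<psi> x) \<le> 1" "smoothing m \<beta> \<psi> = \<psi>"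
    and le: "\<And>x. norm (\<phi> x - \<psi> x) \<le> C * x\<^sup>2"
  shows "\<phi> = \<psi>"
proof
  fix t
  define q where "q = power_sum m (2 * \<beta>)"
  have q: "0 \<le> q" "q < 1" using power_sum_less_1[OF m, of "2 * \<beta>"] \<beta> power_sum_nonneg by (auto simp: q_def)
  have iter: "norm (\<phi> x - \<psi> x) \<le> C * q ^ i * x\<^sup>2" for x i
  proof (induction i arbitrary: x)
    case (Suc i)
    have "norm (smoothing m \<beta> \<phi> x - smoothing m \<beta> \<psi> x) \<le> (C * q ^ i) * power_sum m (2 * \<beta>) * x\<^sup>2"
      using \<beta> by (intro smoothing_contraction m \<phi> \<psi> Suc) auto
    then show ?case by (simp add: \<phi>(3) \<psi>(3) q_def mult_ac)
  qed (use le in simp)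
  have "(\<lambda>i. C * q ^ i * t\<^sup>2) \<longlonglongrightarrow> C * 0 * t\<^sup>2"
    using q by (intro tendsto_intros LIMSEQ_realpow_zero) auto
  from LIMSEQ_le_const[OF this, of "norm (\<phi> t - \<psi> t)"] iter have "norm (\<phi> t - \<psi> t) \<le> 0" by auto
  then show "\<phi> t = \<psi> t" by simp
qed

lemma char_fixed_point_map:
  assumes "real_distribution D"
  shows "char (fixed_point_map m \<beta> D) = smoothing m \<beta> (char D)"
proof
  fix t
  interpret D: real_distribution D by fact
  interpret S: prob_space "uniform_simplex m" by (rule prob_space_uniform_simplex)
  interpret Y: product_prob_space "\<lambda>_. D" "{1..m}" ..
  interpret SY: pair_prob_space "uniform_simplex m" "\<Pi>\<^sub>M j\<in>{1..m}. D" ..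
  have meas: "(\<lambda>(s, y). (\<Sum>j=1..m. s j powr \<beta> * y j) + 1)
          \<in> borel_measurable (uniform_simplex m \<Otimes>\<^sub>M (\<Pi>\<^sub>M j\<in>{1..m}. D))"
    by measurable
  have "char (fixed_point_map m \<beta> D) t = (CLINT z|(uniform_simplex m \<Otimes>\<^sub>M (\<Pi>\<^sub>M j\<in>{1..m}. D)). iexp (t * (case z of (s, y) \<Rightarrow> (\<Sum>j=1..m. s j powr \<beta> * y j) + 1)))"
    unfolding char_def fixed_point_map_def by (rule integral_distr[OF meas]) measurable
  also have "\<dots> = (CLINT s|uniform_simplex m. CLINT y|(\<Pi>\<^sub>M j\<in>{1..m}. D). iexp (t * ((\<Sum>j=1..m. s j powr \<beta> * y j) + 1)))"
    by (subst SY.integral_fst'[symmetric]) (use SY.integrable_iexp meas in \<open>auto simp: case_prod_unfold\<close>)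
  also have "\<dots> = (CLINT s|uniform_simplex m. iexp t * (\<Prod>j=1..m. char D (s j powr \<beta> * t)))"
  proof (rule Bochner_Integration.integral_cong[OF refl])
    fix s :: "nat \<Rightarrow> real"
    have "iexp (t * ((\<Sum>j=1..m. s j powr \<beta> * y j) + 1)) = iexp t * (\<Prod>j=1..m. iexp ((s j powr \<beta> * t) * y j))" for y
    proof -
      have "iexp (t * ((\<Sum>j=1..m. s j powr \<beta> * y j) + 1)) = iexp t * exp (\<Sum>j=1..m. \<i> * ((s j powr \<beta> * t) * y j))"
        by (simp add: exp_add[symmetric] distrib_left sum_distrib_left mult_ac add.commute)
      then show ?thesis by (simp add: exp_sum)
    qed
    then have "(CLINT y|(\<Pi>\<^sub>M j\<in>{1..m}. D). iexp (t * ((\<Sum>j=1..m. s j powr \<beta> * y j) + 1))) =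
      iexp t * (CLINT y|(\<Pi>\<^sub>M j\<in>{1..m}. D). (\<Prod>j=1..m. iexp ((s j powr \<beta> * t) * y j)))" by simp
    also have "(CLINT y|(\<Pi>\<^sub>M j\<in>{1..m}. D). (\<Prod>j=1..m. iexp ((s j powr \<beta> * t) * y j))) = (\<Prod>j=1..m. char D (s j powr \<beta> * t))"
      unfolding char_def by (rule Y.product_integral_prod) (auto intro: D.integrable_iexp)
    finally show "(CLINT y|(\<Pi>\<^sub>M j\<in>{1..m}. D). iexp (t * ((\<Sum>j=1..m. s j powr \<beta> * y j) + 1))) = iexp t * (\<Prod>j=1..m. char D (s j powr \<beta> * t))" .
  qed
  also have "\<dots> = smoothing m \<beta> (char D) t" unfolding smoothing_def by simp
  finally show "char (fixed_point_map m \<beta> D) t = smoothing m \<beta> (char D) t" .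
qed

lemma fixed_point_map_eq_iff:
  assumes "real_distribution D"
  shows "D = fixed_point_map m \<beta> D \<longleftrightarrow> smoothing m \<beta> (char D) = char D"
  using Levy_uniqueness[OF assms real_distribution_fixed_point_map[OF assms, of m \<beta>]]
    char_fixed_point_map[OF assms, of m \<beta>] by metis

text \<open>Comparing the two first-order expansions of the fixed-point equation at \<open>0\<close> determines the mean.\<close>

lemma solves_fixed_point_char_bound:
  assumes m: "m \<ge> 2" and \<beta>: "\<beta> > 0" and D: "solves_fixed_point m \<beta> D"
    and c: "c = 1 + power_sum m \<beta> * c"
  shows "\<exists>C. \<forall>t. norm (char D t - iexp (t * c)) \<le> C * t\<^sup>2"
proof -
  interpret D: real_distribution D using D by (simp add: solves_fixed_point_def)
  interpret S: prob_space "uniform_simplex m" by (rule prob_space_uniform_simplex)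
  have sq: "integrable D (\<lambda>x. x\<^sup>2)" and fp: "D = fixed_point_map m \<beta> D"
    using D by (auto simp: solves_fixed_point_def)
  have smooth: "smoothing m \<beta> (char D) = char D" using fixed_point_map_eq_iff[of D m \<beta>] fp D.real_distribution_axioms by blast
  define \<mu> where "\<mu> = D.expectation (\<lambda>x. x)"
  define C where "C = D.expectation (\<lambda>x. x\<^sup>2)"
  define a where "a = power_sum m \<beta>"
  have C: "norm (char D t - 1 - \<i> * t * \<mu>) \<le> C * t\<^sup>2" for t
    using D.char_linear_approx[OF sq, of t] by (simp add: \<mu>_def C_def mult.commute)
  have E: "norm (iexp (t * b) - 1 - \<i> * t * b) \<le> b\<^sup>2 * t\<^sup>2" for t b
    using norm_iexp_linear[of "t * b"] by (simp add: power_mult_distrib mult_ac)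
  have CE: "norm (char D t - iexp (t * b)) \<le> (C + b\<^sup>2) * t\<^sup>2" if "b = \<mu>" for t b
  proof -
    have "char D t - iexp (t * b) = (char D t - 1 - \<i> * t * \<mu>) - (iexp (t * b) - 1 - \<i> * t * b)" using that by simp
    also have "norm \<dots> \<le> C * t\<^sup>2 + b\<^sup>2 * t\<^sup>2" by (rule order_trans[OF norm_triangle_ineq4 add_mono[OF C E]])
    finally show ?thesis by (simp add: distrib_right)
  qed
  define \<psi> where "\<psi> = (\<lambda>t. iexp (t * \<mu>))"
  have \<psi>: "\<psi> \<in> borel_measurable borel" "\<And>x. norm (\<psi> x) \<le> 1" by (simp_all add: \<psi>_def)
  have s1: "norm (char D t - smoothing m \<beta> \<psi> t) \<le> (C + \<mu>\<^sup>2) * power_sum m (2 * \<beta>) * t\<^sup>2" for t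
    unfolding smooth[symmetric, THEN fun_cong, of t]
    by (intro smoothing_contraction m \<beta> D.char_measurable D.cmod_char_le_1 \<psi>) (use CE[OF refl] in \<open>simp add: \<psi>_def\<close>)
  have ip: "integrable (uniform_simplex m) (\<lambda>s. \<Sum>j=1..m. s j powr \<beta>)" using integrable_power_sum[OF m \<beta>] .
  \<comment> \<open>Smoothing the point mass at \<mu> yields the law of 1 + \<mu> sum S_j^\<beta>,
    whose characteristic function has an explicit linear term 1 + a \<mu>.\<close>
  have s2: "norm (smoothing m \<beta> \<psi> t - 1 - \<i> * t * (1 + a * \<mu>)) \<le> (1 + \<bar>\<mu>\<bar> * m)\<^sup>2 * t\<^sup>2" for t
  proof -
    let ?b = "\<lambda>s::nat \<Rightarrow> real. 1 + \<mu> * (\<Sum>j=1..m. s j powr \<beta>)"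
    have eq: "iexp t * (\<Prod>j=1..m. \<psi> (s j powr \<beta> * t)) = iexp (t * ?b s)" for s :: "nat \<Rightarrow> real"
    proof -
      have "(\<Prod>j=1..m. \<psi> (s j powr \<beta> * t)) = exp (\<Sum>j=1..m. \<i> * ((s j powr \<beta> * t) * \<mu>))"
        by (simp add: \<psi>_def exp_sum)
      then show ?thesis by (simp add: exp_add[symmetric] distrib_left sum_distrib_left mult_ac)
    qed
    have i1: "integrable (uniform_simplex m) (\<lambda>s. iexp (t * ?b s))"
      unfolding eq[symmetric] by (intro integrable_mult_right integrable_smoothing_integrand m \<psi>)
    have ib: "integrable (uniform_simplex m) ?b" using ip by (intro Bochner_Integration.integrable_add integrable_mult_right) auto
    have eb: "(\<integral>s. ?b s \<partial>uniform_simplex m) = 1 + a * \<mu>"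
      using ip by (subst Bochner_Integration.integral_add) (auto simp: S.prob_space a_def power_sum_def)
    have ibc: "integrable (uniform_simplex m) (\<lambda>s. complex_of_real (?b s))" using ib by (rule integrable_of_real)
    have ic: "integrable (uniform_simplex m) (\<lambda>s. 1 :: complex)" by simp
    have iB: "integrable (uniform_simplex m) (\<lambda>s. \<i> * t * complex_of_real (?b s))"
      by (rule integrable_mult_right[OF ibc])
    have ebc: "(CLINT s|uniform_simplex m. complex_of_real (?b s)) = of_real (1 + a * \<mu>)"
      by (subst integral_complex_of_real) (simp only: eb)
    have S1: "smoothing m \<beta> \<psi> t = (CLINT s|uniform_simplex m. iexp (t * ?b s))"
      unfolding smoothing_def eq[symmetric] by simp
    have S2: "(CLINT s|uniform_simplex m. 1) = 1" by (simp add: S.prob_space)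
    have S3: "(CLINT s|uniform_simplex m. \<i> * t * complex_of_real (?b s)) = \<i> * t * complex_of_real (1 + a * \<mu>)"
      unfolding ebc[symmetric] by simp
    have "(CLINT s|uniform_simplex m. iexp (t * ?b s) - 1 - \<i> * t * complex_of_real (?b s)) = smoothing m \<beta> \<psi> t - 1 - \<i> * t * complex_of_real (1 + a * \<mu>)"
      by (simp only: Bochner_Integration.integral_diff[OF Bochner_Integration.integrable_diff[OF i1 ic] iB]
          Bochner_Integration.integral_diff[OF i1 ic] S1 S2 S3)
    then have "norm (smoothing m \<beta> \<psi> t - 1 - \<i> * t * complex_of_real (1 + a * \<mu>)) = norm (CLINT s|uniform_simplex m. iexp (t * ?b s) - 1 - \<i> * t * complex_of_real (?b s))"
      by (simp only:)
    also have "\<dots> \<le> (\<integral>s. norm (iexp (t * ?b s) - 1 - \<i> * t * of_real (?b s)) \<partial>uniform_simplex m)"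
      by (rule integral_norm_bound)
    also have "\<dots> \<le> (\<integral>s. (1 + \<bar>\<mu>\<bar> * m)\<^sup>2 * t\<^sup>2 \<partial>uniform_simplex m)"
    proof (rule integral_mono_AE)
      show "integrable (uniform_simplex m) (\<lambda>s. norm (iexp (t * ?b s) - 1 - \<i> * t * of_real (?b s)))"
        by (intro integrable_norm Bochner_Integration.integrable_diff i1 ic iB)
      show "AE s in uniform_simplex m. norm (iexp (t * ?b s) - 1 - \<i> * t * of_real (?b s)) \<le> (1 + \<bar>\<mu>\<bar> * m)\<^sup>2 * t\<^sup>2"
        using AE_uniform_simplex[OF m]
      proof eventually_elim
        case (elim s)
        have "\<bar>?b s\<bar> \<le> 1 + \<bar>\<mu>\<bar> * \<bar>\<Sum>j=1..m. s j powr \<beta>\<bar>" using abs_triangle_ineq[of 1 "\<mu> * (\<Sum>j=1..m. s j powr \<beta>)"] by (simp add: abs_mult)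
        also have "\<dots> \<le> 1 + \<bar>\<mu>\<bar> * m" using power_sum_bound[OF \<beta>, of m s] elim by (intro add_left_mono mult_left_mono) auto
        finally have "\<bar>?b s\<bar> \<le> \<bar>1 + \<bar>\<mu>\<bar> * m\<bar>" by simp
        then have "(?b s)\<^sup>2 \<le> (1 + \<bar>\<mu>\<bar> * m)\<^sup>2" by (simp only: abs_le_square_iff)
        then have "(?b s)\<^sup>2 * t\<^sup>2 \<le> (1 + \<bar>\<mu>\<bar> * m)\<^sup>2 * t\<^sup>2" by (rule mult_right_mono) simp
        then show ?case using E[of t "?b s"] by linarith
      qed
    qed simp
    also have "\<dots> = (1 + \<bar>\<mu>\<bar> * m)\<^sup>2 * t\<^sup>2" by (simp add: S.prob_space)
    finally show ?thesis by simp
  qed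
  define B where "B = C + (C + \<mu>\<^sup>2) * power_sum m (2 * \<beta>) + (1 + \<bar>\<mu>\<bar> * m)\<^sup>2"
  \<comment> \<open>Two expansions with quadratic remainders are subtracted. A linear term bounded
    by B t^2 for all t must vanish, which is tested at t = d/(2(|B|+1)) below.\<close>
  have key: "\<bar>t\<bar> * \<bar>\<mu> - (1 + a * \<mu>)\<bar> \<le> B * t\<^sup>2" for t
  proof -
    have "\<bar>t\<bar> * \<bar>\<mu> - (1 + a * \<mu>)\<bar> = norm (\<i> * complex_of_real (t * (\<mu> - (1 + a * \<mu>))))" by (simp only: norm_mult norm_of_real abs_mult norm_ii mult_1)
    also have "\<i> * complex_of_real (t * (\<mu> - (1 + a * \<mu>))) = - (char D t - 1 - \<i> * t * \<mu>) + (char D t - smoothing m \<beta> \<psi> t) + (smoothing m \<beta> \<psi> t - 1 - \<i> * t * (1 + a * \<mu>))"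
      by (simp add: algebra_simps)
    also have "norm \<dots> \<le> norm (char D t - 1 - \<i> * t * \<mu>) + norm (char D t - smoothing m \<beta> \<psi> t) + norm (smoothing m \<beta> \<psi> t - 1 - \<i> * t * (1 + a * \<mu>))"
      using norm_triangle_ineq[of "- (char D t - 1 - \<i> * t * \<mu>) + (char D t - smoothing m \<beta> \<psi> t)" "smoothing m \<beta> \<psi> t - 1 - \<i> * t * (1 + a * \<mu>)"]
        norm_triangle_ineq[of "- (char D t - 1 - \<i> * t * \<mu>)" "char D t - smoothing m \<beta> \<psi> t"]
      unfolding norm_minus_cancel by linarith
    also have "\<dots> \<le> C * t\<^sup>2 + (C + \<mu>\<^sup>2) * power_sum m (2 * \<beta>) * t\<^sup>2 + (1 + \<bar>\<mu>\<bar> * m)\<^sup>2 * t\<^sup>2"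
      by (intro add_mono C s1 s2)
    finally show ?thesis by (simp add: B_def distrib_right)
  qed
  have "\<mu> - (1 + a * \<mu>) = 0"
  proof (rule ccontr)
    assume nz: "\<mu> - (1 + a * \<mu>) \<noteq> 0"
    define d where "d = \<bar>\<mu> - (1 + a * \<mu>)\<bar>"
    have d: "d > 0" using nz by (simp add: d_def)
    define t where "t = d / (2 * (\<bar>B\<bar> + 1))"
    have t: "t > 0" using d by (simp add: t_def)
    have "t * d \<le> B * t\<^sup>2" using key[of t] t by (simp add: d_def)
    then have "d \<le> B * t" using t by (simp add: power2_eq_square)
    also have "\<dots> \<le> (\<bar>B\<bar> + 1) * t" using t by (intro mult_right_mono) auto
    also have "\<dots> = d / 2" by (simp add: t_def field_simps)
    finally show False using d by simp
  qed
  then have "(\<mu> - c) * (1 - a) = 0" using c by (simp add: a_def algebra_simps)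
  \<comment> \<open>With a = 1 the equation for c would read 0 = 1.\<close>
  moreover have "1 - a \<noteq> 0" using c by (auto simp: a_def)
  ultimately have "c = \<mu>" by simp
  then show ?thesis using CE by blast
qed

section \<open>Sums of independent variables\<close>

text \<open>The number \<open>r\<close> of summands is a parameter so that moment bounds go by
  induction on it; the deterministic summand \<tau>, later the toll, is the starting value.\<close>

definition sum_law :: "(nat \<Rightarrow> real pmf) \<Rightarrow> real \<Rightarrow> nat \<Rightarrow> real pmf" where
  "sum_law qs \<tau> r = map_pmf (\<lambda>f. (\<Sum>j<r. f j) + \<tau>) (Pi_pmf {..<r} 0 qs)"

lemma sum_law_0: "sum_law qs \<tau> 0 = return_pmf \<tau>"
  by (simp add: sum_law_def)

lemma sum_law_Suc: "sum_law qs \<tau> (Suc r) = map_pmf (\<lambda>(y, s). y + s) (pair_pmf (qs r) (sum_law qs \<tau> r))"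
proof -
  have "sum_law qs \<tau> (Suc r) = map_pmf (\<lambda>f. (\<Sum>j<Suc r. f j) + \<tau>) (Pi_pmf (insert r {..<r}) 0 qs)"
    by (simp add: sum_law_def lessThan_Suc)
  also have "\<dots> = map_pmf (\<lambda>(y, f). (\<Sum>j<Suc r. (f(r := y)) j) + \<tau>) (pair_pmf (qs r) (Pi_pmf {..<r} 0 qs))"
    by (subst Pi_pmf_insert) (auto simp: pmf.map_comp o_def case_prod_unfold)
  also have "\<dots> = map_pmf (\<lambda>(y, f). y + ((\<Sum>j<r. f j) + \<tau>)) (pair_pmf (qs r) (Pi_pmf {..<r} 0 qs))"
    by (intro pmf.map_cong refl) (auto simp: add_ac)
  also have "\<dots> = map_pmf (\<lambda>(y, s). y + s) (pair_pmf (qs r) (sum_law qs \<tau> r))"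
    unfolding sum_law_def by (subst pair_map_pmf2) (simp add: pmf.map_comp o_def case_prod_unfold)
  finally show ?thesis .
qed

lemma finite_set_sum_law:
  "(\<And>j. j < r \<Longrightarrow> finite (set_pmf (qs j))) \<Longrightarrow> finite (set_pmf (sum_law qs \<tau> r))"
  by (induction r) (auto simp: sum_law_0 sum_law_Suc)

text \<open>All laws that occur have finite support, so independence is a rearrangement of finite
  sums and integrability is automatic.\<close>

lemma expectation_pair_prod:
  fixes g :: "'a \<Rightarrow> 'c::{real_normed_field, banach, second_countable_topology}" and h :: "'b \<Rightarrow> 'c"
  assumes "finite (set_pmf p)" "finite (set_pmf q)"
  shows "measure_pmf.expectation (pair_pmf p q) (\<lambda>(x, y). g x * h y) =
    measure_pmf.expectation p g * measure_pmf.expectation q h"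
proof -
  have "measure_pmf.expectation (pair_pmf p q) (\<lambda>(x, y). g x * h y) =
      (\<Sum>(x, y)\<in>set_pmf p \<times> set_pmf q. (pmf p x * pmf q y) *\<^sub>R (g x * h y))"
    using assms by (subst integral_measure_pmf[of "set_pmf p \<times> set_pmf q"]) (auto simp: case_prod_unfold pmf_pair intro!: sum.cong)
  also have "\<dots> = (\<Sum>x\<in>set_pmf p. pmf p x *\<^sub>R g x) * (\<Sum>y\<in>set_pmf q. pmf q y *\<^sub>R h y)"
    by (simp add: sum_product sum.cartesian_product scaleR_conv_of_real mult_ac)
  also have "\<dots> = measure_pmf.expectation p g * measure_pmf.expectation q h"
    using assms by (simp add: integral_measure_pmf[of "set_pmf p"] integral_measure_pmf[of "set_pmf q"])
  finally show ?thesis .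
qed

lemma expectation_sum_law_Suc:
  fixes h :: "real \<Rightarrow> 'c::{banach, second_countable_topology}"
  shows "measure_pmf.expectation (sum_law qs \<tau> (Suc r)) h =
    measure_pmf.expectation (pair_pmf (qs r) (sum_law qs \<tau> r)) (\<lambda>(y, s). h (y + s))"
  by (simp add: sum_law_Suc case_prod_unfold)

lemma char_sum_law:
  assumes "\<And>j. j < r \<Longrightarrow> finite (set_pmf (qs j))"
  shows "measure_pmf.expectation (sum_law qs \<tau> r) (\<lambda>x. iexp (u * x)) =
    iexp (u * \<tau>) * (\<Prod>j<r. measure_pmf.expectation (qs j) (\<lambda>x. iexp (u * x)))"
  using assms
proof (induction r)
  case (Suc r)
  have fin: "finite (set_pmf (qs r))" "finite (set_pmf (sum_law qs \<tau> r))"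
    using Suc.prems by (auto intro!: finite_set_sum_law)
  have "measure_pmf.expectation (sum_law qs \<tau> (Suc r)) (\<lambda>x. iexp (u * x)) =
    measure_pmf.expectation (pair_pmf (qs r) (sum_law qs \<tau> r)) (\<lambda>(y, s). iexp (u * y) * iexp (u * s))"
    unfolding expectation_sum_law_Suc by (simp add: distrib_left exp_add)
  also have "\<dots> = measure_pmf.expectation (qs r) (\<lambda>x. iexp (u * x)) * measure_pmf.expectation (sum_law qs \<tau> r) (\<lambda>x. iexp (u * x))"
    by (rule expectation_pair_prod[OF fin])
  finally show ?case using Suc by simp
qed (simp add: sum_law_0)

lemma expectation_pair_fst_snd:
  fixes g :: "'a \<Rightarrow> real" and h :: "'b \<Rightarrow> real"
  assumes "finite (set_pmf p)" "finite (set_pmf q)"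
  shows "measure_pmf.expectation (pair_pmf p q) (\<lambda>(x, y). g x) = measure_pmf.expectation p g"
    "measure_pmf.expectation (pair_pmf p q) (\<lambda>(x, y). h y) = measure_pmf.expectation q h"
  using expectation_pair_prod[OF assms, of g "\<lambda>_. 1"] expectation_pair_prod[OF assms, of "\<lambda>_. 1" h] by simp_all

lemma integrable_finite_pair:
  fixes f :: "'a \<times> 'b \<Rightarrow> real"
  assumes "finite (set_pmf p)" "finite (set_pmf q)"
  shows "integrable (measure_pmf (pair_pmf p q)) f"
  using assms by (intro integrable_measure_pmf_finite) auto

lemma mean_sum_law:
  assumes "\<And>j. j < r \<Longrightarrow> finite (set_pmf (qs j))"
  shows "measure_pmf.expectation (sum_law qs \<tau> r) (\<lambda>x. x) =
    (\<Sum>j<r. measure_pmf.expectation (qs j) (\<lambda>x. x)) + \<tau>"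
  using assms
proof (induction r)
  case (Suc r)
  have fin: "finite (set_pmf (qs r))" "finite (set_pmf (sum_law qs \<tau> r))"
    using Suc.prems by (auto intro!: finite_set_sum_law)
  have "measure_pmf.expectation (sum_law qs \<tau> (Suc r)) (\<lambda>x. x) =
    measure_pmf.expectation (pair_pmf (qs r) (sum_law qs \<tau> r)) (\<lambda>z. (case z of (y, s) \<Rightarrow> y) + (case z of (y, s) \<Rightarrow> s))"
    unfolding expectation_sum_law_Suc by (simp add: case_prod_unfold)
  also have "\<dots> = measure_pmf.expectation (qs r) (\<lambda>x. x) + measure_pmf.expectation (sum_law qs \<tau> r) (\<lambda>x. x)"
    by (subst Bochner_Integration.integral_add) (simp_all add: integrable_finite_pair[OF fin] expectation_pair_fst_snd[OF fin])
  finally show ?case using Suc by simp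
qed (simp add: sum_law_0)

text \<open>Cross terms are products of means and hence of order W^2. What matters is the
  coefficient 1 in front of the individual second moments: any larger constant would spoil the
  contraction.\<close>

lemma second_moment_sum_law:
  assumes "\<And>j. j < r \<Longrightarrow> finite (set_pmf (qs j))" and "W \<ge> 0" "b \<ge> 0"
    and "\<bar>\<tau>\<bar> \<le> b * W" "\<And>j. j < r \<Longrightarrow> \<bar>measure_pmf.expectation (qs j) (\<lambda>x. x)\<bar> \<le> b * W"
  shows "measure_pmf.expectation (sum_law qs \<tau> r) (\<lambda>x. x\<^sup>2) \<le>
    (\<Sum>j<r. measure_pmf.expectation (qs j) (\<lambda>x. x\<^sup>2)) + (real r + 1)\<^sup>2 * (b * W)\<^sup>2"
  using assms
proof (induction r)
  case (Suc r)
  let ?q = "qs r" and ?s = "sum_law qs \<tau> r"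
  let ?E = measure_pmf.expectation
  have fin: "finite (set_pmf ?q)" "finite (set_pmf ?s)"
    using Suc.prems by (auto intro!: finite_set_sum_law)
  have "?E (sum_law qs \<tau> (Suc r)) (\<lambda>x. x\<^sup>2) =
    ?E (pair_pmf ?q ?s) (\<lambda>z. ((case z of (y, s) \<Rightarrow> y\<^sup>2) + (case z of (y, s) \<Rightarrow> s\<^sup>2)) + (case z of (y, s) \<Rightarrow> (2 * y) * s))"
    unfolding expectation_sum_law_Suc by (simp add: case_prod_unfold power2_sum)
  also have "\<dots> = ?E ?q (\<lambda>x. x\<^sup>2) + ?E ?s (\<lambda>x. x\<^sup>2) + ?E ?q (\<lambda>x. 2 * x) * ?E ?s (\<lambda>x. x)"
    by (subst Bochner_Integration.integral_add, rule integrable_finite_pair[OF fin], rule integrable_finite_pair[OF fin])+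
       (simp only: expectation_pair_fst_snd[OF fin] expectation_pair_prod[OF fin])
  also have "?E ?q (\<lambda>x. 2 * x) * ?E ?s (\<lambda>x. x) \<le> 2 * (real r + 1) * (b * W)\<^sup>2"
  proof -
    have "\<bar>?E ?s (\<lambda>x. x)\<bar> \<le> (\<Sum>j<r. \<bar>?E (qs j) (\<lambda>x. x)\<bar>) + \<bar>\<tau>\<bar>"
      using Suc.prems(1) by (subst mean_sum_law) (auto intro!: order_trans[OF abs_triangle_ineq] add_mono sum_abs)
    also have "\<dots> \<le> (\<Sum>j<r. b * W) + b * W" using Suc.prems by (intro add_mono sum_mono) auto
    also have "\<dots> = (real r + 1) * (b * W)" by (simp add: algebra_simps)
    finally have "\<bar>?E ?q (\<lambda>x. x)\<bar> * \<bar>?E ?s (\<lambda>x. x)\<bar> \<le> (b * W) * ((real r + 1) * (b * W))"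
      using Suc.prems by (intro mult_mono) auto
    moreover have "?E ?q (\<lambda>x. 2 * x) * ?E ?s (\<lambda>x. x) \<le> 2 * (\<bar>?E ?q (\<lambda>x. x)\<bar> * \<bar>?E ?s (\<lambda>x. x)\<bar>)"
      by (simp flip: abs_mult)
    ultimately have "?E ?q (\<lambda>x. 2 * x) * ?E ?s (\<lambda>x. x) \<le> 2 * ((b * W) * ((real r + 1) * (b * W)))" by linarith
    then show ?thesis by (simp add: power2_eq_square mult_ac)
  qed
  also have "?E ?s (\<lambda>x. x\<^sup>2) \<le> (\<Sum>j<r. ?E (qs j) (\<lambda>x. x\<^sup>2)) + (real r + 1)\<^sup>2 * (b * W)\<^sup>2"
    using Suc.prems by (intro Suc.IH) auto
  finally have "?E (sum_law qs \<tau> (Suc r)) (\<lambda>x. x\<^sup>2) \<le> (\<Sum>j<Suc r. ?E (qs j) (\<lambda>x. x\<^sup>2)) + ((real r + 1)\<^sup>2 + 2 * (real r + 1)) * (b * W)\<^sup>2"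
    by (simp add: algebra_simps)
  also have "((real r + 1)\<^sup>2 + 2 * (real r + 1)) * (b * W)\<^sup>2 \<le> (real (Suc r) + 1)\<^sup>2 * (b * W)\<^sup>2"
  proof (rule mult_right_mono)
    show "(real r + 1)\<^sup>2 + 2 * (real r + 1) \<le> (real (Suc r) + 1)\<^sup>2" by (simp add: power2_eq_square algebra_simps)
  qed simp
  finally show ?case by simp
qed (simp add: sum_law_0 abs_le_square_iff[symmetric])

text \<open>Crude bounds on a power of a sum put a factor above 1 on the pure powers. Here they keep
  the coefficient 1: if b \<le> a, then (a+b)^(n+1) - a^(n+1) is b times n+1 terms, each at most
  (2a)^n.\<close>

lemma power_add_le:
  fixes a b :: real
  assumes "a \<ge> 0" "b \<ge> 0"
  shows "(a + b) ^ Suc n \<le> a ^ Suc n + b ^ Suc n + (real (Suc n) * 2 ^ n) * (a ^ n * b + a * b ^ n)"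
proof -
  have *: "(a + b) ^ Suc n \<le> a ^ Suc n + (real (Suc n) * 2 ^ n) * (a ^ n * b)" if "0 \<le> b" "b \<le> a" for a b :: real
  proof -
    have "(a + b) ^ Suc n - a ^ Suc n = b * (\<Sum>i<Suc n. a ^ (Suc n - Suc i) * (a + b) ^ i)"
      using power_diff_sumr2[of "a + b" "Suc n" a] by simp
    also have "\<dots> \<le> b * (\<Sum>i<Suc n. (2 * a) ^ n)"
    proof (intro mult_left_mono sum_mono)
      fix i assume i: "i \<in> {..<Suc n}"
      have "a ^ (Suc n - Suc i) * (a + b) ^ i \<le> (2 * a) ^ (Suc n - Suc i) * (2 * a) ^ i"
        using that by (intro mult_mono power_mono) auto
      also have "Suc n - Suc i + i = n" using i by simp
      then have "(2 * a) ^ (Suc n - Suc i) * (2 * a) ^ i = (2 * a) ^ n" by (metis power_add)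
      finally show "a ^ (Suc n - Suc i) * (a + b) ^ i \<le> (2 * a) ^ n" .
    qed fact
    also have "\<dots> = (real (Suc n) * 2 ^ n) * (a ^ n * b)" by (simp add: power_mult_distrib algebra_simps)
    finally show ?thesis by simp
  qed
  show ?thesis
  proof (cases "b \<le> a")
    case True
    have "(real (Suc n) * 2 ^ n) * (a ^ n * b) \<le> (real (Suc n) * 2 ^ n) * (a ^ n * b + a * b ^ n)"
      using assms by (intro mult_left_mono) auto
    moreover have "b ^ Suc n \<ge> 0" using assms by (intro zero_le_power)
    ultimately show ?thesis using *[OF assms(2) True] by linarith
  next
    case False
    have "(real (Suc n) * 2 ^ n) * (b ^ n * a) \<le> (real (Suc n) * 2 ^ n) * (a ^ n * b + a * b ^ n)"
      using assms by (intro mult_left_mono) (auto simp: mult.commute)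
    moreover have "a ^ Suc n \<ge> 0" using assms by (intro zero_le_power)
    moreover have "(b + a) ^ Suc n \<le> b ^ Suc n + (real (Suc n) * 2 ^ n) * (b ^ n * a)"
      using assms False by (intro *) auto
    ultimately show ?thesis unfolding add.commute[of a b] by linarith
  qed
qed

lemma abs_moment_pair_sum:
  fixes p q :: "real pmf"
  assumes fin: "finite (set_pmf p)" "finite (set_pmf q)"
  shows "measure_pmf.expectation (pair_pmf p q) (\<lambda>(x, y). \<bar>x + y\<bar> ^ Suc n) \<le>
    measure_pmf.expectation p (\<lambda>x. \<bar>x\<bar> ^ Suc n) + measure_pmf.expectation q (\<lambda>x. \<bar>x\<bar> ^ Suc n) +
    (real (Suc n) * 2 ^ n) * (measure_pmf.expectation p (\<lambda>x. \<bar>x\<bar> ^ n) * measure_pmf.expectation q (\<lambda>x. \<bar>x\<bar>) +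
      measure_pmf.expectation p (\<lambda>x. \<bar>x\<bar>) * measure_pmf.expectation q (\<lambda>x. \<bar>x\<bar> ^ n))"
proof -
  let ?E = "measure_pmf.expectation (pair_pmf p q)" and ?K = "real (Suc n) * 2 ^ n"
  have "?E (\<lambda>(x, y). \<bar>x + y\<bar> ^ Suc n) \<le> ?E (\<lambda>z. ((case z of (x, y) \<Rightarrow> \<bar>x\<bar> ^ Suc n) + (case z of (x, y) \<Rightarrow> \<bar>y\<bar> ^ Suc n)) +
      ((case z of (x, y) \<Rightarrow> (?K * \<bar>x\<bar> ^ n) * \<bar>y\<bar>) + (case z of (x, y) \<Rightarrow> (?K * \<bar>x\<bar>) * \<bar>y\<bar> ^ n)))"
  proof (rule integral_mono[OF integrable_finite_pair[OF fin] integrable_finite_pair[OF fin]])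
    fix z :: "real \<times> real"
    obtain x y where z: "z = (x, y)" by (cases z)
    have "\<bar>x + y\<bar> ^ Suc n \<le> (\<bar>x\<bar> + \<bar>y\<bar>) ^ Suc n" by (intro power_mono abs_triangle_ineq) auto
    also have "\<dots> \<le> \<bar>x\<bar> ^ Suc n + \<bar>y\<bar> ^ Suc n + ?K * (\<bar>x\<bar> ^ n * \<bar>y\<bar> + \<bar>x\<bar> * \<bar>y\<bar> ^ n)"
      by (rule power_add_le) auto
    finally show "(case z of (x, y) \<Rightarrow> \<bar>x + y\<bar> ^ Suc n) \<le> ((case z of (x, y) \<Rightarrow> \<bar>x\<bar> ^ Suc n) + (case z of (x, y) \<Rightarrow> \<bar>y\<bar> ^ Suc n)) +
      ((case z of (x, y) \<Rightarrow> (?K * \<bar>x\<bar> ^ n) * \<bar>y\<bar>) + (case z of (x, y) \<Rightarrow> (?K * \<bar>x\<bar>) * \<bar>y\<bar> ^ n))"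
      unfolding z by (simp add: algebra_simps)
  qed
  also have "\<dots> = measure_pmf.expectation p (\<lambda>x. \<bar>x\<bar> ^ Suc n) + measure_pmf.expectation q (\<lambda>x. \<bar>x\<bar> ^ Suc n) +
     (measure_pmf.expectation p (\<lambda>x. ?K * \<bar>x\<bar> ^ n) * measure_pmf.expectation q (\<lambda>x. \<bar>x\<bar>) +
      measure_pmf.expectation p (\<lambda>x. ?K * \<bar>x\<bar>) * measure_pmf.expectation q (\<lambda>x. \<bar>x\<bar> ^ n))"
    by (subst Bochner_Integration.integral_add, rule integrable_finite_pair[OF fin], rule integrable_finite_pair[OF fin])+
       (simp only: expectation_pair_fst_snd[OF fin] expectation_pair_prod[OF fin])
  also have "\<dots> = measure_pmf.expectation p (\<lambda>x. \<bar>x\<bar> ^ Suc n) + measure_pmf.expectation q (\<lambda>x. \<bar>x\<bar> ^ Suc n) +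
     ?K * (measure_pmf.expectation p (\<lambda>x. \<bar>x\<bar> ^ n) * measure_pmf.expectation q (\<lambda>x. \<bar>x\<bar>) +
      measure_pmf.expectation p (\<lambda>x. \<bar>x\<bar>) * measure_pmf.expectation q (\<lambda>x. \<bar>x\<bar> ^ n))"
    by (simp only: integral_mult_right_zero distrib_left mult.assoc)
  finally show ?thesis .
qed

lemma expectation_abs_power_nonneg: "measure_pmf.expectation p (\<lambda>x::real. \<bar>x\<bar> ^ l) \<ge> 0"
  by (rule integral_nonneg_AE) simp

text \<open>Both moment bounds are uniform in the laws; only the number of summands enters the constants.\<close>

lemma low_abs_moment_sum_law:
  assumes "b \<ge> 0"
  shows "\<exists>C\<ge>0. \<forall>qs \<tau> W. W \<ge> 0 \<longrightarrow> \<bar>\<tau>\<bar> \<le> b * W \<longrightarrow> (\<forall>j<r. finite (set_pmf (qs j))) \<longrightarrow>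
    (\<forall>j<r. measure_pmf.expectation (qs j) (\<lambda>x. \<bar>x\<bar> ^ l) \<le> b * W ^ l) \<longrightarrow>
    measure_pmf.expectation (sum_law qs \<tau> r) (\<lambda>x. \<bar>x\<bar> ^ l) \<le> C * W ^ l"
proof (induction r)
  case 0
  show ?case
  proof (intro exI[of _ "b ^ l"] conjI allI impI)
    fix \<tau> W :: real and qs assume "W \<ge> 0" "\<bar>\<tau>\<bar> \<le> b * W"
    then have "\<bar>\<tau>\<bar> ^ l \<le> (b * W) ^ l" by (intro power_mono) auto
    then show "measure_pmf.expectation (sum_law qs \<tau> 0) (\<lambda>x. \<bar>x\<bar> ^ l) \<le> b ^ l * W ^ l"
      by (simp add: sum_law_0 power_mult_distrib)
  qed (use assms in simp)
next
  case (Suc r)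
  then obtain C where C: "C \<ge> 0" "\<And>qs \<tau> W. W \<ge> 0 \<Longrightarrow> \<bar>\<tau>\<bar> \<le> b * W \<Longrightarrow> (\<And>j. j < r \<Longrightarrow> finite (set_pmf (qs j))) \<Longrightarrow>
    (\<And>j. j < r \<Longrightarrow> measure_pmf.expectation (qs j) (\<lambda>x. \<bar>x\<bar> ^ l) \<le> b * W ^ l) \<Longrightarrow>
    measure_pmf.expectation (sum_law qs \<tau> r) (\<lambda>x. \<bar>x\<bar> ^ l) \<le> C * W ^ l" by blast
  show ?case
  proof (intro exI[of _ "2 ^ l * (b + C)"] conjI allI impI)
    fix qs \<tau> and W :: real
    assume W: "W \<ge> 0" and \<tau>: "\<bar>\<tau>\<bar> \<le> b * W" and finq: "\<forall>j<Suc r. finite (set_pmf (qs j))"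
      and q: "\<forall>j<Suc r. measure_pmf.expectation (qs j) (\<lambda>x. \<bar>x\<bar> ^ l) \<le> b * W ^ l"
    let ?p = "pair_pmf (qs r) (sum_law qs \<tau> r)"
    have fin: "finite (set_pmf (qs r))" "finite (set_pmf (sum_law qs \<tau> r))"
      using finq by (auto intro!: finite_set_sum_law)
    have "measure_pmf.expectation (sum_law qs \<tau> (Suc r)) (\<lambda>x. \<bar>x\<bar> ^ l) = measure_pmf.expectation ?p (\<lambda>(x, y). \<bar>x + y\<bar> ^ l)"
      by (rule expectation_sum_law_Suc)
    also have "\<dots> \<le> measure_pmf.expectation ?p (\<lambda>z. (case z of (x, y) \<Rightarrow> 2 ^ l * \<bar>x\<bar> ^ l) + (case z of (x, y) \<Rightarrow> 2 ^ l * \<bar>y\<bar> ^ l))"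
    proof (rule integral_mono[OF integrable_finite_pair[OF fin] integrable_finite_pair[OF fin]])
      fix z :: "real \<times> real"
      obtain x y where z: "z = (x, y)" by (cases z)
      have "\<bar>x + y\<bar> \<le> 2 * max \<bar>x\<bar> \<bar>y\<bar>" by linarith
      then have "\<bar>x + y\<bar> ^ l \<le> (2 * max \<bar>x\<bar> \<bar>y\<bar>) ^ l" by (intro power_mono) auto
      also have "\<dots> \<le> 2 ^ l * \<bar>x\<bar> ^ l + 2 ^ l * \<bar>y\<bar> ^ l" by (auto simp: max_def power_mult_distrib)
      finally show "(case z of (x, y) \<Rightarrow> \<bar>x + y\<bar> ^ l) \<le> (case z of (x, y) \<Rightarrow> 2 ^ l * \<bar>x\<bar> ^ l) + (case z of (x, y) \<Rightarrow> 2 ^ l * \<bar>y\<bar> ^ l)"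
        by (simp add: z)
    qed
    also have "\<dots> = 2 ^ l * measure_pmf.expectation (qs r) (\<lambda>x. \<bar>x\<bar> ^ l) + 2 ^ l * measure_pmf.expectation (sum_law qs \<tau> r) (\<lambda>x. \<bar>x\<bar> ^ l)"
      by (subst Bochner_Integration.integral_add, rule integrable_finite_pair[OF fin], rule integrable_finite_pair[OF fin])
         (simp only: expectation_pair_fst_snd[OF fin] integral_mult_right_zero)
    also have "\<dots> \<le> 2 ^ l * (b * W ^ l) + 2 ^ l * (C * W ^ l)"
      using q finq W \<tau> by (intro add_mono mult_left_mono C(2)) auto
    finally show "measure_pmf.expectation (sum_law qs \<tau> (Suc r)) (\<lambda>x. \<bar>x\<bar> ^ l) \<le> 2 ^ l * (b + C) * W ^ l"
      by (simp add: algebra_simps)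
  qed (use C assms in simp)
qed

text \<open>Adding one summand creates mixed terms that contain only moments of order 1 and n. These
  may be estimated with lossy constants by \<open>low_abs_moment_sum_law\<close>, while the moments
  of order n+1 keep the coefficient 1.\<close>

lemma abs_moment_sum_law:
  assumes b: "b \<ge> 0" and n: "n \<ge> 1"
  shows "\<exists>C\<ge>0. \<forall>qs \<tau> W. W \<ge> 0 \<longrightarrow> \<bar>\<tau>\<bar> \<le> b * W \<longrightarrow> (\<forall>j<r. finite (set_pmf (qs j))) \<longrightarrow>
    (\<forall>j<r. measure_pmf.expectation (qs j) (\<lambda>x. \<bar>x\<bar>) \<le> b * W \<and> measure_pmf.expectation (qs j) (\<lambda>x. \<bar>x\<bar> ^ n) \<le> b * W ^ n) \<longrightarrow>
    measure_pmf.expectation (sum_law qs \<tau> r) (\<lambda>x. \<bar>x\<bar> ^ Suc n) \<le>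
      (\<Sum>j<r. measure_pmf.expectation (qs j) (\<lambda>x. \<bar>x\<bar> ^ Suc n)) + C * W ^ Suc n"
proof (induction r)
  case 0
  show ?case
  proof (intro exI[of _ "b ^ Suc n"] conjI allI impI)
    fix \<tau> W :: real and qs assume "W \<ge> 0" "\<bar>\<tau>\<bar> \<le> b * W"
    then have "\<bar>\<tau>\<bar> ^ Suc n \<le> (b * W) ^ Suc n" by (intro power_mono) auto
    then show "measure_pmf.expectation (sum_law qs \<tau> 0) (\<lambda>x. \<bar>x\<bar> ^ Suc n) \<le> (\<Sum>j<0. measure_pmf.expectation (qs j) (\<lambda>x. \<bar>x\<bar> ^ Suc n)) + b ^ Suc n * W ^ Suc n"
      by (simp add: sum_law_0 power_mult_distrib mult_ac)
  qed (use b in simp)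
next
  case (Suc r)
  obtain C where C: "C \<ge> 0" "\<And>qs \<tau> W. W \<ge> 0 \<Longrightarrow> \<bar>\<tau>\<bar> \<le> b * W \<Longrightarrow> (\<And>j. j < r \<Longrightarrow> finite (set_pmf (qs j))) \<Longrightarrow>
    (\<And>j. j < r \<Longrightarrow> measure_pmf.expectation (qs j) (\<lambda>x. \<bar>x\<bar>) \<le> b * W \<and> measure_pmf.expectation (qs j) (\<lambda>x. \<bar>x\<bar> ^ n) \<le> b * W ^ n) \<Longrightarrow>
    measure_pmf.expectation (sum_law qs \<tau> r) (\<lambda>x. \<bar>x\<bar> ^ Suc n) \<le>
      (\<Sum>j<r. measure_pmf.expectation (qs j) (\<lambda>x. \<bar>x\<bar> ^ Suc n)) + C * W ^ Suc n" using Suc by blast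
  obtain C1 where C1: "C1 \<ge> 0" "\<And>qs \<tau> W. W \<ge> 0 \<Longrightarrow> \<bar>\<tau>\<bar> \<le> b * W \<Longrightarrow> (\<And>j. j < r \<Longrightarrow> finite (set_pmf (qs j))) \<Longrightarrow>
    (\<And>j. j < r \<Longrightarrow> measure_pmf.expectation (qs j) (\<lambda>x. \<bar>x\<bar> ^ 1) \<le> b * W ^ 1) \<Longrightarrow>
    measure_pmf.expectation (sum_law qs \<tau> r) (\<lambda>x. \<bar>x\<bar> ^ 1) \<le> C1 * W ^ 1"
    using low_abs_moment_sum_law[OF b, of r 1] by blast
  obtain C2 where C2: "C2 \<ge> 0" "\<And>qs \<tau> W. W \<ge> 0 \<Longrightarrow> \<bar>\<tau>\<bar> \<le> b * W \<Longrightarrow> (\<And>j. j < r \<Longrightarrow> finite (set_pmf (qs j))) \<Longrightarrow>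
    (\<And>j. j < r \<Longrightarrow> measure_pmf.expectation (qs j) (\<lambda>x. \<bar>x\<bar> ^ n) \<le> b * W ^ n) \<Longrightarrow>
    measure_pmf.expectation (sum_law qs \<tau> r) (\<lambda>x. \<bar>x\<bar> ^ n) \<le> C2 * W ^ n"
    using low_abs_moment_sum_law[OF b, of r n] by blast
  let ?K = "real (Suc n) * 2 ^ n"
  show ?case
  proof (intro exI[of _ "C + ?K * (b * C1 + b * C2)"] conjI allI impI)
    fix qs \<tau> and W :: real
    assume W: "W \<ge> 0" and \<tau>: "\<bar>\<tau>\<bar> \<le> b * W" and finq: "\<forall>j<Suc r. finite (set_pmf (qs j))"
      and q: "\<forall>j<Suc r. measure_pmf.expectation (qs j) (\<lambda>x. \<bar>x\<bar>) \<le> b * W \<and> measure_pmf.expectation (qs j) (\<lambda>x. \<bar>x\<bar> ^ n) \<le> b * W ^ n"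
    let ?q = "qs r" and ?s = "sum_law qs \<tau> r"
    let ?E = measure_pmf.expectation
    have fin: "finite (set_pmf ?q)" "finite (set_pmf ?s)"
      using finq by (auto intro!: finite_set_sum_law)
    have s1: "?E ?s (\<lambda>x. \<bar>x\<bar>) \<le> C1 * W" using C1(2)[OF W \<tau>, of qs] q finq by simp
    have s2: "?E ?s (\<lambda>x. \<bar>x\<bar> ^ n) \<le> C2 * W ^ n" using C2(2)[OF W \<tau>, of qs] q finq by simp
    have s3: "?E ?s (\<lambda>x. \<bar>x\<bar> ^ Suc n) \<le> (\<Sum>j<r. ?E (qs j) (\<lambda>x. \<bar>x\<bar> ^ Suc n)) + C * W ^ Suc n"
      using q finq by (intro C(2) W \<tau>) auto
    have nn: "?E ?s (\<lambda>x. \<bar>x\<bar>) \<ge> 0" using expectation_abs_power_nonneg[of ?s 1] by simp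
    have nn2: "?E ?s (\<lambda>x. \<bar>x\<bar> ^ n) \<ge> 0" by (rule expectation_abs_power_nonneg)
    have m1: "?E ?q (\<lambda>x. \<bar>x\<bar> ^ n) * ?E ?s (\<lambda>x. \<bar>x\<bar>) \<le> (b * W ^ n) * (C1 * W)"
      using q s1 nn b W by (intro mult_mono) auto
    have m2: "?E ?q (\<lambda>x. \<bar>x\<bar>) * ?E ?s (\<lambda>x. \<bar>x\<bar> ^ n) \<le> (b * W) * (C2 * W ^ n)"
      using q s2 nn2 b W by (intro mult_mono) auto
    have "?E (sum_law qs \<tau> (Suc r)) (\<lambda>x. \<bar>x\<bar> ^ Suc n) = ?E (pair_pmf ?q ?s) (\<lambda>(x, y). \<bar>x + y\<bar> ^ Suc n)"
      by (rule expectation_sum_law_Suc)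
    also have "\<dots> \<le> ?E ?q (\<lambda>x. \<bar>x\<bar> ^ Suc n) + ?E ?s (\<lambda>x. \<bar>x\<bar> ^ Suc n) +
      ?K * (?E ?q (\<lambda>x. \<bar>x\<bar> ^ n) * ?E ?s (\<lambda>x. \<bar>x\<bar>) + ?E ?q (\<lambda>x. \<bar>x\<bar>) * ?E ?s (\<lambda>x. \<bar>x\<bar> ^ n))"
      by (rule abs_moment_pair_sum[OF fin])
    also have "\<dots> \<le> ?E ?q (\<lambda>x. \<bar>x\<bar> ^ Suc n) + ((\<Sum>j<r. ?E (qs j) (\<lambda>x. \<bar>x\<bar> ^ Suc n)) + C * W ^ Suc n) +
      ?K * ((b * W ^ n) * (C1 * W) + (b * W) * (C2 * W ^ n))"
      by (intro add_mono mult_left_mono s3 m1 m2 order_refl) auto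
    also have "\<dots> = (\<Sum>j<Suc r. ?E (qs j) (\<lambda>x. \<bar>x\<bar> ^ Suc n)) + (C + ?K * (b * C1 + b * C2)) * W ^ Suc n"
      by (simp add: algebra_simps)
    finally show "?E (sum_law qs \<tau> (Suc r)) (\<lambda>x. \<bar>x\<bar> ^ Suc n) \<le> (\<Sum>j<Suc r. ?E (qs j) (\<lambda>x. \<bar>x\<bar> ^ Suc n)) + (C + ?K * (b * C1 + b * C2)) * W ^ Suc n" .
  qed (use C C1 C2 b in \<open>auto intro!: add_nonneg_nonneg mult_nonneg_nonneg\<close>)
qed

section \<open>Moment bounds\<close>

text \<open>\<open>Q n\<close> stands for the law of the centred variable X_n - \<mu>(n+1), which
  obeys the same recursion as the original laws; c is the limit of its normalised mean. Nothing
  about trees remains beyond the recursion.\<close>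

locale tree_limit = rv_weight w \<beta> for w :: "nat \<Rightarrow> real" and \<beta> :: real +
  fixes m :: nat and Q :: "nat \<Rightarrow> real pmf" and t :: "nat \<Rightarrow> real" and c :: real
  assumes m_ge: "m \<ge> 2" and \<beta>_half: "1 / 2 < \<beta>"
    and fin: "finite (set_pmf (Q n))"
    and Q_rec: "n \<ge> m - 1 \<Longrightarrow> Q n = bind_pmf (pmf_of_set (natpermute (n - (m - 1)) m)) (\<lambda>v. sum_law (\<lambda>j. Q (v ! j)) (t n) m)"
    and toll: "(\<lambda>n. t n / w n) \<longlonglongrightarrow> 1"
    and mean: "(\<lambda>n. measure_pmf.expectation (Q n) (\<lambda>x. x) / w n) \<longlonglongrightarrow> c"
begin

abbreviation E :: "nat \<Rightarrow> (real \<Rightarrow> 'b::{banach, second_countable_topology}) \<Rightarrow> 'b" where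
  "E n h \<equiv> measure_pmf.expectation (Q n) h"

abbreviation comps :: "nat \<Rightarrow> nat list set" where
  "comps n \<equiv> natpermute (n - (m - 1)) m"

text \<open>Expectation over the uniform vector of subtree sizes. The binomial coefficient is the
  number of compositions as soon as n \<ge> m-1.\<close>

definition avg :: "nat \<Rightarrow> (nat list \<Rightarrow> 'b::real_normed_vector) \<Rightarrow> 'b" where
  "avg n h = (\<Sum>v\<in>comps n. h v) /\<^sub>R real (n choose (m - 1))"

lemma comps_nth_le: "v \<in> comps n \<Longrightarrow> j < m \<Longrightarrow> v ! j \<le> n - (m - 1)"
proof -
  assume v: "v \<in> comps n" "j < m"
  then have "v ! j \<in> set v" by (intro nth_mem) (auto simp: natpermute_def)
  then have "v ! j \<le> sum_list v" by (rule member_le_sum_list) simp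
  then show ?thesis using v by (simp add: natpermute_def)
qed

lemma card_comps: "n \<ge> m - 1 \<Longrightarrow> card (comps n) = n choose (m - 1)"
  using m_ge by (intro card_natpermute_gaps) auto

lemma comps_nonempty: "n \<ge> m - 1 \<Longrightarrow> comps n \<noteq> {}"
  using card_comps[of n] by (metis card.empty zero_less_binomial less_irrefl)

lemma choose_pos: "n \<ge> m - 1 \<Longrightarrow> real (n choose (m - 1)) > 0"
  by simp

lemma avg_const: "n \<ge> m - 1 \<Longrightarrow> avg n (\<lambda>_. x) = x"
  using choose_pos[of n] unfolding avg_def sum_constant_scaleR by (subst card_comps) auto

lemma avg_mono: "(\<And>v. v \<in> comps n \<Longrightarrow> h v \<le> g v) \<Longrightarrow> avg n h \<le> (avg n g :: real)"
  by (auto simp: avg_def intro!: mult_left_mono sum_mono)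

lemma avg_add: "avg n (\<lambda>v. h v + g v) = avg n h + avg n g"
  by (simp add: avg_def sum.distrib scaleR_add_right)

lemma avg_diff: "avg n (\<lambda>v. h v - g v) = avg n h - avg n g"
  by (simp add: avg_def sum_subtractf scaleR_diff_right)

lemma avg_mult: "avg n (\<lambda>v. a * h v) = a * (avg n h :: 'a::real_normed_field)"
  by (simp add: avg_def sum_distrib_left[symmetric])

lemma norm_avg_le: "norm (avg n h) \<le> avg n (\<lambda>v. norm (h v))"
  by (simp add: avg_def mult_left_mono norm_sum)

lemma avg_cong: "(\<And>v. v \<in> comps n \<Longrightarrow> h v = g v) \<Longrightarrow> avg n h = avg n g"
  by (simp add: avg_def)

lemma E_rec:
  fixes h :: "real \<Rightarrow> 'b::{banach, second_countable_topology}"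
  assumes "n \<ge> m - 1"
  shows "E n h = avg n (\<lambda>v. measure_pmf.expectation (sum_law (\<lambda>j. Q (v ! j)) (t n) m) h)"
  unfolding Q_rec[OF assms] avg_def
  using comps_nonempty[OF assms] card_comps[OF assms]
  by (subst pmf_expectation_bind_pmf_of_set) (auto simp: natpermute_finite fin scaleR_sum_right intro!: finite_set_sum_law)

lemma composition_point_sum: "(\<Sum>j=1..m. f (composition_point m n v j)) = (\<Sum>j<m. f (real (v ! j) / real n))"
  by (rule sum.reindex_bij_witness[of _ Suc "\<lambda>j. j - 1"]) (auto simp: composition_point_def)

lemma composition_point_prod: "(\<Prod>j=1..m. f (composition_point m n v j)) = (\<Prod>j<m. f (real (v ! j) / real n))"
  by (rule prod.reindex_bij_witness[of _ Suc "\<lambda>j. j - 1"]) (auto simp: composition_point_def)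

lemma avg_power_sum:
  assumes p: "p > 0"
  shows "(\<lambda>n. avg n (\<lambda>v. \<Sum>j<m. (real (v ! j) / real n) powr p)) \<longlonglongrightarrow> power_sum m p"
proof -
  have "(\<lambda>n. avg n (\<lambda>v. \<Sum>j=1..m. (composition_point m n v j) powr p)) \<longlonglongrightarrow> power_sum m p"
    unfolding avg_def power_sum_def
  proof (rule composition_average_tendsto[OF m_ge measurable_power_sum])
    fix s :: "nat \<Rightarrow> real" assume "\<And>j. j \<in> {1..m} \<Longrightarrow> 0 \<le> s j \<and> s j \<le> 1"
    then show "norm (\<Sum>j=1..m. s j powr p) \<le> real m" by (rule power_sum_bound[OF p])
  next
    fix X :: "nat \<Rightarrow> nat \<Rightarrow> real" and s
    assume X: "\<And>k j. j \<in> {1..m} \<Longrightarrow> 0 \<le> X k j \<and> X k j \<le> 1"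
      and lim: "\<And>j. j \<in> {1..m} \<Longrightarrow> (\<lambda>k. X k j) \<longlonglongrightarrow> s j"
    show "(\<lambda>k. \<Sum>j=1..m. X k j powr p) \<longlonglongrightarrow> (\<Sum>j=1..m. s j powr p)"
      using X lim p by (intro tendsto_sum tendsto_powr' tendsto_const) auto
  qed
  then show ?thesis by (simp only: composition_point_sum[where f = "\<lambda>x. x powr p"])
qed

lemma avg_tendsto_close:
  fixes h :: "nat \<Rightarrow> nat list \<Rightarrow> real"
  assumes "(\<lambda>n. avg n (g n)) \<longlonglongrightarrow> l"
    and close: "\<And>\<epsilon>. \<epsilon> > 0 \<Longrightarrow> eventually (\<lambda>n. \<forall>v\<in>comps n. \<bar>h n v - g n v\<bar> \<le> \<epsilon>) sequentially"
  shows "(\<lambda>n. avg n (h n)) \<longlonglongrightarrow> l"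
proof -
  have "(\<lambda>n. avg n (h n) - avg n (g n)) \<longlonglongrightarrow> 0"
  proof (rule LIMSEQ_I)
    fix \<epsilon> :: real assume "\<epsilon> > 0"
    then have "eventually (\<lambda>n. \<forall>v\<in>comps n. \<bar>h n v - g n v\<bar> \<le> \<epsilon>/2) sequentially" by (intro close) simp
    then have "eventually (\<lambda>n. norm (avg n (h n) - avg n (g n) - 0) < \<epsilon>) sequentially"
      using eventually_ge_at_top[of "m - 1"]
    proof eventually_elim
      case (elim n)
      have "norm (avg n (h n) - avg n (g n)) \<le> avg n (\<lambda>v. norm (h n v - g n v))"
        unfolding avg_diff[symmetric] by (rule norm_avg_le)
      also have "\<dots> \<le> avg n (\<lambda>_. \<epsilon>/2)" using elim by (intro avg_mono) auto
      also have "\<dots> < \<epsilon>" using elim \<open>\<epsilon> > 0\<close> by (simp add: avg_const)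
      finally show ?case by simp
    qed
    then show "\<exists>no. \<forall>n\<ge>no. norm (avg n (h n) - avg n (g n) - 0) < \<epsilon>" by (simp add: eventually_sequentially)
  qed
  from tendsto_add[OF this assms(1)] show ?thesis by simp
qed

lemma ratio_le_1: "j \<le> n \<Longrightarrow> real j / real n \<le> 1"
  by (cases "n = 0") (auto simp: divide_le_eq_1)

lemma ratio_powr_le_1: "j \<le> n \<Longrightarrow> p > 0 \<Longrightarrow> (real j / real n) powr p \<le> 1"
  by (intro powr_le1) (auto simp: ratio_le_1)

text \<open>For small j the value d_j need not be near b, but there w_j/w_n is already small and d
  is bounded. For larger j both factors are under control.\<close>

lemma unif_times:
  assumes d: "d \<longlonglongrightarrow> b" and \<epsilon>: "\<epsilon> > 0"
  shows "eventually (\<lambda>n. \<forall>j\<le>n. \<bar>w j / w n * d j - (real j / real n) powr \<beta> * b\<bar> \<le> \<epsilon>) sequentially"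
proof -
  have "Bseq d" using d by (intro convergent_imp_Bseq) (auto simp: convergent_def)
  then obtain K where K: "K > 0" "\<And>n. \<bar>d n\<bar> \<le> K" by (auto simp: Bseq_def)
  obtain N where N: "\<And>j. j \<ge> N \<Longrightarrow> \<bar>d j - b\<bar> < \<epsilon>/4"
    using LIMSEQ_D[OF d, of "\<epsilon>/4"] \<epsilon> by auto
  define K' where "K' = K + \<bar>b\<bar> + 1"
  have K': "K' > 0" "K' \<ge> 1" using K by (auto simp: K'_def)
  have small: "eventually (\<lambda>n. \<forall>j\<in>{..<N}. \<bar>w j / w n\<bar> < \<epsilon> / (2 * K')) sequentially"
  proof (rule eventually_ball_finite, simp, intro ballI)
    fix j
    have "eventually (\<lambda>n. dist (w j / w n) 0 < \<epsilon> / (2 * K')) sequentially"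
      by (rule tendstoD[OF w_fixed_ratio]) (use \<epsilon> K' in auto)
    then show "eventually (\<lambda>n. \<bar>w j / w n\<bar> < \<epsilon> / (2 * K')) sequentially" by (simp only: dist_real_def diff_zero)
  qed
  have u1: "eventually (\<lambda>n. \<forall>j\<le>n. \<bar>w j / w n - (real j / real n) powr \<beta>\<bar> \<le> 1) sequentially" by (rule unif) simp
  have u2: "eventually (\<lambda>n. \<forall>j\<le>n. \<bar>w j / w n - (real j / real n) powr \<beta>\<bar> \<le> \<epsilon> / (2 * K')) sequentially"
    by (rule unif) (use \<epsilon> K' in auto)
  from small u1 u2 show ?thesis
  proof eventually_elim
    case (elim n)
    show ?case
    proof (intro allI impI)
      fix j assume j: "j \<le> n"
      let ?x = "w j / w n" and ?y = "(real j / real n) powr \<beta>"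
      have xy: "\<bar>?x - ?y\<bar> \<le> \<epsilon> / (2 * K')" "\<bar>?x - ?y\<bar> \<le> 1" using elim j by auto
      have y: "0 \<le> ?y" "?y \<le> 1" using ratio_powr_le_1[OF j] \<beta>_pos by auto
      have "x * d' - y * b = x * (d' - b) + (x - y) * b" for x y d' :: real by (simp add: algebra_simps)
      then have eq: "?x * d j - ?y * b = ?x * (d j - b) + (?x - ?y) * b" .
      have "\<bar>?x * (d j - b)\<bar> \<le> \<epsilon>/2"
      proof (cases "j < N")
        case True
        then have "\<bar>?x\<bar> \<le> \<epsilon> / (2 * K')" using elim(1) by (auto intro: less_imp_le)
        moreover have "\<bar>d j - b\<bar> \<le> K'" using K(2)[of j] by (simp add: K'_def)
        ultimately have "\<bar>?x\<bar> * \<bar>d j - b\<bar> \<le> \<epsilon> / (2 * K') * K'" by (intro mult_mono) (use \<epsilon> K' in auto)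
        then show ?thesis using K' by (simp only: abs_mult) simp
      next
        case False
        have "\<bar>?x\<bar> \<le> 2" using xy y by linarith
        moreover have "\<bar>d j - b\<bar> \<le> \<epsilon>/4" using N[of j] False by simp
        ultimately have "\<bar>?x\<bar> * \<bar>d j - b\<bar> \<le> 2 * (\<epsilon>/4)" by (intro mult_mono) auto
        then show ?thesis by (simp only: abs_mult)
      qed
      moreover have "\<bar>(?x - ?y) * b\<bar> \<le> \<epsilon>/2"
      proof -
        have "\<bar>?x - ?y\<bar> * \<bar>b\<bar> \<le> \<epsilon> / (2 * K') * K'" using xy K by (intro mult_mono) (use \<epsilon> K' in \<open>auto simp: K'_def\<close>)
        then show ?thesis using K' by (simp only: abs_mult) simp
      qed
      ultimately show "\<bar>?x * d j - ?y * b\<bar> \<le> \<epsilon>" unfolding eq by linarith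
    qed
  qed
qed

text \<open>The excluded case reflects the conventions 0^0 = 1 for natural exponents and 0 for
  \<open>powr\<close>.\<close>

lemma unif_power:
  assumes \<epsilon>: "\<epsilon> > 0"
  shows "eventually (\<lambda>n. \<forall>j\<le>n. \<bar>(w j / w n) ^ k - (real j / real n) powr (real k * \<beta>)\<bar> \<le> \<epsilon> \<or> j = 0 \<and> k = 0) sequentially"
proof -
  define \<delta> where "\<delta> = min 1 (\<epsilon> / (2 ^ k * real (Suc k)))"
  have \<delta>: "\<delta> > 0" "\<delta> \<le> 1" using \<epsilon> by (auto simp: \<delta>_def)
  have d2: "2 ^ k * real k * \<delta> \<le> \<epsilon>"
  proof -
    have "2 ^ k * real k * \<delta> \<le> 2 ^ k * real (Suc k) * (\<epsilon> / (2 ^ k * real (Suc k)))"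
      using \<delta> by (intro mult_mono) (auto simp: \<delta>_def)
    then show ?thesis by simp
  qed
  have "eventually (\<lambda>n. \<forall>j\<le>n. \<bar>w j / w n - (real j / real n) powr \<beta>\<bar> \<le> \<delta>) sequentially" by (rule unif) fact
  then show ?thesis
  proof eventually_elim
    case (elim n)
    show ?case
    proof (intro allI impI)
      fix j assume j: "j \<le> n"
      let ?x = "w j / w n" and ?y = "(real j / real n) powr \<beta>"
      have xy: "\<bar>?x - ?y\<bar> \<le> \<delta>" using elim j by auto
      have y: "0 \<le> ?y" "?y \<le> 1" using ratio_powr_le_1[OF j] \<beta>_pos by auto
      have x: "0 \<le> ?x" "?x \<le> 2" using xy y \<delta> by (auto simp: abs_le_iff)
      \<comment> \<open>Both ratios are at most 2; halving brings them into the unit ball, where the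
        k-th power is Lipschitz with constant k. The factor 2^k in \<delta> compensates.\<close>
      have "\<bar>(?x/2) ^ k - (?y/2) ^ k\<bar> \<le> real k * \<bar>?x/2 - ?y/2\<bar>"
        using norm_power_diff[of "?x/2" "?y/2" k] x y by simp
      also have "(?x/2) ^ k - (?y/2) ^ k = (?x ^ k - ?y ^ k) / 2 ^ k" by (simp only: power_divide diff_divide_distrib)
      finally have "2 ^ k * \<bar>(?x ^ k - ?y ^ k) / 2 ^ k\<bar> \<le> 2 ^ k * (real k * \<bar>?x/2 - ?y/2\<bar>)" by (rule mult_left_mono) simp
      moreover have "2 ^ k * \<bar>z / 2 ^ k\<bar> = \<bar>z\<bar>" for z :: real by (simp add: abs_divide)
      ultimately have "\<bar>?x ^ k - ?y ^ k\<bar> \<le> 2 ^ k * (real k * \<bar>?x/2 - ?y/2\<bar>)" by (simp only:)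
      also have "\<dots> \<le> 2 ^ k * (real k * \<delta>)"
      proof (intro mult_left_mono)
        have "\<bar>x / 2 - y / 2\<bar> \<le> \<bar>x - y\<bar>" for x y :: real by linarith
        then show "\<bar>?x/2 - ?y/2\<bar> \<le> \<delta>" using xy order_trans by blast
      qed auto
      finally have le: "\<bar>?x ^ k - ?y ^ k\<bar> \<le> \<epsilon>" using d2 by (simp add: mult.assoc)
      have "?y ^ k = (real j / real n) powr (real k * \<beta>) \<or> j = 0 \<and> k = 0"
      proof (cases "real j / real n = 0")
        case True
        then show ?thesis using j by (cases "k = 0") auto
      next
        case False
        then show ?thesis using powr_power[of "real j / real n" \<beta> k] by blast
      qed
      then show "\<bar>?x ^ k - (real j / real n) powr (real k * \<beta>)\<bar> \<le> \<epsilon> \<or> j = 0 \<and> k = 0" using le by auto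
    qed
  qed
qed

text \<open>By k \<ge> 2 and \<beta> > 1/2 the exponent k\<beta> exceeds 1, so the average of the
  sum of (w_j/w_n)^k over the subtrees is eventually below some q < 1. Induction on n then closes
  for every K with K q + C \<le> K.\<close>

lemma recursive_bound:
  fixes a :: "nat \<Rightarrow> real"
  assumes k: "k \<ge> 2" and C: "C \<ge> 0" and a: "\<And>n. a n \<ge> 0"
    and rec: "\<And>n. n \<ge> m - 1 \<Longrightarrow> a n \<le> avg n (\<lambda>v. \<Sum>j<m. a (v ! j)) + C * w n ^ k"
  shows "\<exists>K\<ge>0. \<forall>n. a n \<le> K * w n ^ k"
proof -
  define p where "p = real k * \<beta>"
  have "real k * \<beta> \<ge> 2 * \<beta>" using k \<beta>_pos by (intro mult_right_mono) auto
  then have p: "p > 1" using \<beta>_half unfolding p_def by linarith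
  define q where "q = (1 + power_sum m p) / 2"
  have q: "power_sum m p < q" "0 < q" "q < 1"
    using power_sum_less_1[OF m_ge p] power_sum_nonneg[of m p] by (auto simp: q_def)
  have "(\<lambda>n. avg n (\<lambda>v. \<Sum>j<m. (w (v ! j) / w n) ^ k)) \<longlonglongrightarrow> power_sum m p"
  proof (rule avg_tendsto_close)
    show "(\<lambda>n. avg n (\<lambda>v. \<Sum>j<m. (real (v ! j) / real n) powr p)) \<longlonglongrightarrow> power_sum m p"
      using p by (intro avg_power_sum) simp
    fix \<epsilon> :: real assume \<epsilon>: "\<epsilon> > 0"
    have "eventually (\<lambda>n. \<forall>j\<le>n. \<bar>(w j / w n) ^ k - (real j / real n) powr (real k * \<beta>)\<bar> \<le> \<epsilon> / real m \<or> j = 0 \<and> k = 0) sequentially"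
      using \<epsilon> m_ge by (intro unif_power) simp
    then show "eventually (\<lambda>n. \<forall>v\<in>comps n. \<bar>(\<Sum>j<m. (w (v ! j) / w n) ^ k) - (\<Sum>j<m. (real (v ! j) / real n) powr p)\<bar> \<le> \<epsilon>) sequentially"
    proof eventually_elim
      case (elim n)
      show ?case
      proof
        fix v assume v: "v \<in> comps n"
        have "\<bar>(\<Sum>j<m. (w (v ! j) / w n) ^ k) - (\<Sum>j<m. (real (v ! j) / real n) powr p)\<bar> \<le> (\<Sum>j<m. \<bar>(w (v ! j) / w n) ^ k - (real (v ! j) / real n) powr p\<bar>)"
          unfolding sum_subtractf[symmetric] by (rule sum_abs)
        also have "\<dots> \<le> (\<Sum>j<m. \<epsilon> / real m)"
        proof (rule sum_mono)
          fix j assume "j \<in> {..<m}"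
          then have "v ! j \<le> n" using comps_nth_le[OF v, of j] by simp
          then show "\<bar>(w (v ! j) / w n) ^ k - (real (v ! j) / real n) powr p\<bar> \<le> \<epsilon> / real m"
            using elim k unfolding p_def by auto
        qed
        also have "\<dots> = \<epsilon>" using m_ge by simp
        finally show "\<bar>(\<Sum>j<m. (w (v ! j) / w n) ^ k) - (\<Sum>j<m. (real (v ! j) / real n) powr p)\<bar> \<le> \<epsilon>" .
      qed
    qed
  qed
  then have "eventually (\<lambda>n. avg n (\<lambda>v. \<Sum>j<m. (w (v ! j) / w n) ^ k) < q) sequentially"
    using q by (intro order_tendstoD(2)) auto
  then obtain N where N: "\<And>n. n \<ge> N \<Longrightarrow> avg n (\<lambda>v. \<Sum>j<m. (w (v ! j) / w n) ^ k) < q" by (auto simp: eventually_sequentially)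
  define N' where "N' = max N (m - 1)"
  \<comment> \<open>The first summand gives K q + C \<le> K, the second covers the indices where the
    average is not yet below q.\<close>
  define K where "K = C / (1 - q) + (\<Sum>n<N'. a n / w n ^ k)"
  have K0: "K \<ge> 0" using C q a by (auto simp: K_def intro!: add_nonneg_nonneg sum_nonneg)
  have KC: "K * q + C \<le> K"
  proof -
    have "C / (1 - q) \<le> K" using a by (auto simp: K_def intro!: sum_nonneg)
    then have "C \<le> K * (1 - q)" using q by (simp add: pos_divide_le_eq)
    then show ?thesis by (simp add: algebra_simps)
  qed
  have "a n \<le> K * w n ^ k" for n
  proof (induction n rule: less_induct)
    case (less n)
    have wk: "w n ^ k > 0" using w_pos by simp
    show ?case
    proof (cases "n < N'")
      case True
      have "a n / w n ^ k \<le> (\<Sum>n<N'. a n / w n ^ k)" using True a by (intro member_le_sum) auto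
      also have "\<dots> \<le> K" using C q by (simp add: K_def)
      finally show ?thesis using wk by (simp add: pos_divide_le_eq)
    next
      case False
      then have n: "n \<ge> N" "n \<ge> m - 1" by (auto simp: N'_def)
      have "a n \<le> avg n (\<lambda>v. \<Sum>j<m. a (v ! j)) + C * w n ^ k" by (rule rec[OF n(2)])
      also have "avg n (\<lambda>v. \<Sum>j<m. a (v ! j)) \<le> avg n (\<lambda>v. (K * w n ^ k) * (\<Sum>j<m. (w (v ! j) / w n) ^ k))"
      proof (rule avg_mono)
        fix v assume v: "v \<in> comps n"
        have "(\<Sum>j<m. a (v ! j)) \<le> (\<Sum>j<m. K * w (v ! j) ^ k)"
        proof (rule sum_mono)
          fix j assume "j \<in> {..<m}"
          then have "v ! j < n" using comps_nth_le[OF v, of j] n m_ge by simp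
          then show "a (v ! j) \<le> K * w (v ! j) ^ k" by (rule less.IH)
        qed
        also have "\<dots> = (K * w n ^ k) * (\<Sum>j<m. (w (v ! j) / w n) ^ k)"
          by (simp add: sum_distrib_left power_divide)
        finally show "(\<Sum>j<m. a (v ! j)) \<le> (K * w n ^ k) * (\<Sum>j<m. (w (v ! j) / w n) ^ k)" .
      qed
      also have "\<dots> = (K * w n ^ k) * avg n (\<lambda>v. \<Sum>j<m. (w (v ! j) / w n) ^ k)" by (rule avg_mult)
      also have "\<dots> \<le> (K * w n ^ k) * q" using N[OF n(1)] K0 wk by (intro mult_left_mono) auto
      finally have "a n \<le> (K * q + C) * w n ^ k" by (simp add: algebra_simps)
      also have "\<dots> \<le> K * w n ^ k" using KC wk by (intro mult_right_mono) auto
      finally show ?thesis .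
    qed
  qed
  then show ?thesis using K0 by blast
qed

lemma convergent_ratio_bound:
  assumes "(\<lambda>n. f n / w n) \<longlonglongrightarrow> l"
  obtains B where "B \<ge> 0" "\<And>n. \<bar>f n\<bar> \<le> B * w n"
proof -
  have "Bseq (\<lambda>n. f n / w n)" using assms by (intro convergent_imp_Bseq) (auto simp: convergent_def)
  then obtain B where B: "B > 0" "\<And>n. norm (f n / w n) \<le> B" by (auto simp: Bseq_def)
  have "\<bar>f n\<bar> \<le> B * w n" for n using B(2)[of n] w_pos[of n] by (simp add: abs_divide pos_divide_le_eq)
  then show ?thesis using that[of B] B(1) by simp
qed

text \<open>The second moment comes before the first absolute moment: the exponent \<beta> is below
  1 and would not contract, whereas the cross terms of the square need only the signed means, which
  are known from the generating function.\<close>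

lemma second_moment_bound: "\<exists>K\<ge>0. \<forall>n. E n (\<lambda>x. x\<^sup>2) \<le> K * (w n)\<^sup>2"
proof -
  obtain B1 where B1: "B1 \<ge> 0" "\<And>n. \<bar>t n\<bar> \<le> B1 * w n" using convergent_ratio_bound[OF toll] by metis
  obtain B2 where B2: "B2 \<ge> 0" "\<And>n. \<bar>E n (\<lambda>x. x)\<bar> \<le> B2 * w n" using convergent_ratio_bound[OF mean] by metis
  obtain B3 where B3: "B3 > 0" "\<And>n j. j \<le> n \<Longrightarrow> w j \<le> B3 * w n" using w_bound by blast
  define b where "b = B1 + B2 * B3"
  have b: "b \<ge> 0" "B1 \<le> b" "B2 * B3 \<le> b" using B1 B2 B3 by (auto simp: b_def)
  show ?thesis
  proof (rule recursive_bound[where C = "(real m + 1)\<^sup>2 * b\<^sup>2"])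
    fix n assume n: "n \<ge> m - 1"
    have "E n (\<lambda>x. x\<^sup>2) = avg n (\<lambda>v. measure_pmf.expectation (sum_law (\<lambda>j. Q (v ! j)) (t n) m) (\<lambda>x. x\<^sup>2))"
      by (rule E_rec[OF n])
    also have "\<dots> \<le> avg n (\<lambda>v. (\<Sum>j<m. E (v ! j) (\<lambda>x. x\<^sup>2)) + (real m + 1)\<^sup>2 * (b * w n)\<^sup>2)"
    proof (rule avg_mono, rule second_moment_sum_law)
      fix v j assume v: "v \<in> comps n" and j: "j < m"
      have "\<bar>E (v ! j) (\<lambda>x. x)\<bar> \<le> B2 * w (v ! j)" by (rule B2)
      also have "\<dots> \<le> B2 * (B3 * w n)" using comps_nth_le[OF v j] B2 by (intro mult_left_mono B3(2)) auto
      also have "\<dots> \<le> b * w n" using b by (simp add: mult.assoc[symmetric] mult_right_mono)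
      finally show "\<bar>E (v ! j) (\<lambda>x. x)\<bar> \<le> b * w n" .
    next
      show "\<bar>t n\<bar> \<le> b * w n" using B1(2)[of n] b mult_right_mono[of B1 b "w n"] by simp
    qed (use b fin in auto)
    also have "\<dots> = avg n (\<lambda>v. \<Sum>j<m. E (v ! j) (\<lambda>x. x\<^sup>2)) + (real m + 1)\<^sup>2 * b\<^sup>2 * (w n)\<^sup>2"
      by (simp add: avg_add avg_const[OF n] power_mult_distrib)
    finally show "E n (\<lambda>x. x\<^sup>2) \<le> avg n (\<lambda>v. \<Sum>j<m. E (v ! j) (\<lambda>x. x\<^sup>2)) + (real m + 1)\<^sup>2 * b\<^sup>2 * (w n)\<^sup>2" .
  qed (auto intro!: integral_nonneg_AE)
qed

text \<open>Deduced from the second moment through |x| \<le> w_n + x^2/w_n, without a recursion of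
  its own.\<close>

lemma first_abs_moment_bound: "\<exists>K\<ge>0. \<forall>n. E n (\<lambda>x. \<bar>x\<bar>) \<le> K * w n"
proof -
  obtain K where K: "K \<ge> 0" "\<And>n. E n (\<lambda>x. x\<^sup>2) \<le> K * (w n)\<^sup>2" using second_moment_bound by blast
  have "E n (\<lambda>x. \<bar>x\<bar>) \<le> (1 + K) * w n" for n
  proof -
    have int: "integrable (measure_pmf (Q n)) f" for f :: "real \<Rightarrow> real" by (rule integrable_measure_pmf_finite[OF fin])
    have "E n (\<lambda>x. \<bar>x\<bar>) \<le> E n (\<lambda>x. w n + x\<^sup>2 / w n)"
    proof (rule integral_mono[OF int int])
      fix x :: real
      have "\<bar>x\<bar> * w n \<le> (w n)\<^sup>2 + x\<^sup>2"
      proof -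
        have "0 \<le> (\<bar>x\<bar> - w n)\<^sup>2" by simp
        then have "2 * (\<bar>x\<bar> * w n) \<le> (w n)\<^sup>2 + x\<^sup>2" by (simp add: power2_eq_square algebra_simps)
        moreover have "0 \<le> (w n)\<^sup>2 + x\<^sup>2" by simp
        ultimately show ?thesis by linarith
      qed
      then show "\<bar>x\<bar> \<le> w n + x\<^sup>2 / w n" using w_pos[of n] by (simp add: field_simps power2_eq_square)
    qed
    also have "\<dots> = w n + E n (\<lambda>x. x\<^sup>2) / w n"
      using int by (subst Bochner_Integration.integral_add) auto
    also have "E n (\<lambda>x. x\<^sup>2) / w n \<le> K * w n" using K(2)[of n] w_pos[of n] by (simp add: pos_divide_le_eq power2_eq_square)
    finally show ?thesis by (simp add: algebra_simps)
  qed
  then show ?thesis using K(1) by (intro exI[of _ "1 + K"]) auto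
qed

text \<open>From order 3 on, the mixed terms involve only absolute moments of lower order, which the
  induction provides. Orders 1 and 2 are the separate bounds above.\<close>

lemma abs_moment_bound: "\<exists>K\<ge>0. \<forall>n. E n (\<lambda>x. \<bar>x\<bar> ^ k) \<le> K * w n ^ k"
proof (induction k)
  case 0
  then show ?case by (intro exI[of _ 1]) simp
next
  case (Suc k)
  consider "k = 0" | "k = 1" | "k \<ge> 2" by linarith
  then show ?case
  proof cases
    case 1
    then show ?thesis using first_abs_moment_bound by simp
  next
    case 2
    have "Suc k = 2" using 2 by simp
    then show ?thesis using second_moment_bound by (simp only: power2_abs)
  next
    case 3
    obtain B1 where B1: "B1 \<ge> 0" "\<And>n. \<bar>t n\<bar> \<le> B1 * w n" using convergent_ratio_bound[OF toll] by metis
    obtain B2 where B2: "B2 \<ge> 0" "\<And>n. E n (\<lambda>x. \<bar>x\<bar>) \<le> B2 * w n" using first_abs_moment_bound by blast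
    obtain B4 where B4: "B4 \<ge> 0" "\<And>n. E n (\<lambda>x. \<bar>x\<bar> ^ k) \<le> B4 * w n ^ k" using Suc by blast
    obtain B3 where B3: "B3 > 0" "\<And>n j. j \<le> n \<Longrightarrow> w j \<le> B3 * w n" using w_bound by blast
    define b where "b = B1 + B2 * B3 + B4 * B3 ^ k"
    have b: "b \<ge> 0" "B1 \<le> b" "B2 * B3 \<le> b" "B4 * B3 ^ k \<le> b" using B1 B2 B3 B4 by (auto simp: b_def)
    have "k \<ge> 1" using 3 by simp
    obtain C where C: "C \<ge> 0" "\<And>qs \<tau> W. W \<ge> 0 \<Longrightarrow> \<bar>\<tau>\<bar> \<le> b * W \<Longrightarrow> (\<And>j. j < m \<Longrightarrow> finite (set_pmf (qs j))) \<Longrightarrow>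
      (\<And>j. j < m \<Longrightarrow> measure_pmf.expectation (qs j) (\<lambda>x. \<bar>x\<bar>) \<le> b * W \<and> measure_pmf.expectation (qs j) (\<lambda>x. \<bar>x\<bar> ^ k) \<le> b * W ^ k) \<Longrightarrow>
      measure_pmf.expectation (sum_law qs \<tau> m) (\<lambda>x. \<bar>x\<bar> ^ Suc k) \<le>
        (\<Sum>j<m. measure_pmf.expectation (qs j) (\<lambda>x. \<bar>x\<bar> ^ Suc k)) + C * W ^ Suc k"
      using abs_moment_sum_law[OF b(1) \<open>k \<ge> 1\<close>, of m] by blast
    show ?thesis
    proof (rule recursive_bound[where C = C])
      fix n assume n: "n \<ge> m - 1"
      have "E n (\<lambda>x. \<bar>x\<bar> ^ Suc k) = avg n (\<lambda>v. measure_pmf.expectation (sum_law (\<lambda>j. Q (v ! j)) (t n) m) (\<lambda>x. \<bar>x\<bar> ^ Suc k))"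
        by (rule E_rec[OF n])
      also have "\<dots> \<le> avg n (\<lambda>v. (\<Sum>j<m. E (v ! j) (\<lambda>x. \<bar>x\<bar> ^ Suc k)) + C * w n ^ Suc k)"
      proof (rule avg_mono, rule C(2))
        fix v j assume v: "v \<in> comps n" and j: "j < m"
        have wj: "w (v ! j) \<le> B3 * w n" using comps_nth_le[OF v j] by (intro B3(2)) auto
        have "E (v ! j) (\<lambda>x. \<bar>x\<bar>) \<le> B2 * w (v ! j)" by (rule B2)
        also have "\<dots> \<le> B2 * (B3 * w n)" using wj B2 by (intro mult_left_mono) auto
        also have "\<dots> \<le> b * w n" using b by (simp add: mult.assoc[symmetric] mult_right_mono)
        finally have 1: "E (v ! j) (\<lambda>x. \<bar>x\<bar>) \<le> b * w n" .
        have "E (v ! j) (\<lambda>x. \<bar>x\<bar> ^ k) \<le> B4 * w (v ! j) ^ k" by (rule B4)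
        also have "\<dots> \<le> B4 * (B3 * w n) ^ k" using wj B4 by (intro mult_left_mono power_mono) auto
        also have "\<dots> \<le> b * w n ^ k" using b by (simp add: power_mult_distrib mult.assoc[symmetric] mult_right_mono)
        finally show "E (v ! j) (\<lambda>x. \<bar>x\<bar>) \<le> b * w n \<and> E (v ! j) (\<lambda>x. \<bar>x\<bar> ^ k) \<le> b * w n ^ k" using 1 by simp
      next
        show "\<bar>t n\<bar> \<le> b * w n" using B1(2)[of n] b mult_right_mono[of B1 b "w n"] by simp
      qed (use b fin in auto)
      also have "\<dots> = avg n (\<lambda>v. \<Sum>j<m. E (v ! j) (\<lambda>x. \<bar>x\<bar> ^ Suc k)) + C * w n ^ Suc k"
        by (simp only: avg_add avg_const[OF n])
      finally show "E n (\<lambda>x. \<bar>x\<bar> ^ Suc k) \<le> avg n (\<lambda>v. \<Sum>j<m. E (v ! j) (\<lambda>x. \<bar>x\<bar> ^ Suc k)) + C * w n ^ Suc k" .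
    qed (use C 3 in \<open>auto intro!: integral_nonneg_AE\<close>)
  qed
qed

lemma limit_mean_eq: "c = 1 + power_sum m \<beta> * c"
proof -
  have lim: "(\<lambda>n. avg n (\<lambda>v. \<Sum>j<m. w (v ! j) / w n * (E (v ! j) (\<lambda>x. x) / w (v ! j)))) \<longlonglongrightarrow> c * power_sum m \<beta>"
  proof (rule avg_tendsto_close)
    have "(\<lambda>n. c * avg n (\<lambda>v. \<Sum>j<m. (real (v ! j) / real n) powr \<beta>)) \<longlonglongrightarrow> c * power_sum m \<beta>"
      by (intro tendsto_mult tendsto_const avg_power_sum \<beta>_pos)
    then show "(\<lambda>n. avg n (\<lambda>v. c * (\<Sum>j<m. (real (v ! j) / real n) powr \<beta>))) \<longlonglongrightarrow> c * power_sum m \<beta>"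
      by (simp only: avg_mult)
    fix \<epsilon> :: real assume \<epsilon>: "\<epsilon> > 0"
    have "eventually (\<lambda>n. \<forall>j\<le>n. \<bar>w j / w n * (E j (\<lambda>x. x) / w j) - (real j / real n) powr \<beta> * c\<bar> \<le> \<epsilon> / real m) sequentially"
      using \<epsilon> m_ge by (intro unif_times mean) simp
    then show "eventually (\<lambda>n. \<forall>v\<in>comps n. \<bar>(\<Sum>j<m. w (v ! j) / w n * (E (v ! j) (\<lambda>x. x) / w (v ! j))) - c * (\<Sum>j<m. (real (v ! j) / real n) powr \<beta>)\<bar> \<le> \<epsilon>) sequentially"
    proof eventually_elim
      case (elim n)
      show ?case
      proof
        fix v assume v: "v \<in> comps n"
        have "\<bar>(\<Sum>j<m. w (v ! j) / w n * (E (v ! j) (\<lambda>x. x) / w (v ! j))) - c * (\<Sum>j<m. (real (v ! j) / real n) powr \<beta>)\<bar>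
           = \<bar>\<Sum>j<m. w (v ! j) / w n * (E (v ! j) (\<lambda>x. x) / w (v ! j)) - (real (v ! j) / real n) powr \<beta> * c\<bar>"
          by (simp add: sum_subtractf sum_distrib_left mult.commute)
        also have "\<dots> \<le> (\<Sum>j<m. \<epsilon> / real m)"
        proof (rule order_trans[OF sum_abs sum_mono])
          fix j assume "j \<in> {..<m}"
          then have "v ! j \<le> n" using comps_nth_le[OF v, of j] by simp
          then show "\<bar>w (v ! j) / w n * (E (v ! j) (\<lambda>x. x) / w (v ! j)) - (real (v ! j) / real n) powr \<beta> * c\<bar> \<le> \<epsilon> / real m"
            using elim by blast
        qed
        also have "\<dots> = \<epsilon>" using m_ge by simp
        finally show "\<bar>(\<Sum>j<m. w (v ! j) / w n * (E (v ! j) (\<lambda>x. x) / w (v ! j))) - c * (\<Sum>j<m. (real (v ! j) / real n) powr \<beta>)\<bar> \<le> \<epsilon>" .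
      qed
    qed
  qed
  have "(\<lambda>n. E n (\<lambda>x. x) / w n) \<longlonglongrightarrow> c * power_sum m \<beta> + 1"
  proof (rule Lim_transform_eventually[OF tendsto_add[OF lim toll]])
    show "eventually (\<lambda>n. avg n (\<lambda>v. \<Sum>j<m. w (v ! j) / w n * (E (v ! j) (\<lambda>x. x) / w (v ! j))) + t n / w n = E n (\<lambda>x. x) / w n) sequentially"
      using eventually_ge_at_top[of "m - 1"]
    proof eventually_elim
      case (elim n)
      have "E n (\<lambda>x. x) = avg n (\<lambda>v. (\<Sum>j<m. E (v ! j) (\<lambda>x. x)) + t n)"
        unfolding E_rec[OF elim] by (intro avg_cong mean_sum_law fin)
      also have "\<dots> = avg n (\<lambda>v. w n * (\<Sum>j<m. w (v ! j) / w n * (E (v ! j) (\<lambda>x. x) / w (v ! j)))) + t n"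
        by (simp add: avg_add avg_const[OF elim] sum_distrib_left)
      finally show ?case by (simp add: avg_mult add_divide_distrib)
    qed
  qed
  with mean have "c = c * power_sum m \<beta> + 1" by (rule LIMSEQ_unique)
  then show ?thesis by (simp add: mult.commute)
qed

end

section \<open>Convergence of the characteristic functions\<close>

context tree_limit begin

abbreviation q :: real where "q \<equiv> power_sum m (2 * \<beta>)"

lemma q_bounds: "0 \<le> q" "q < 1"
  using power_sum_less_1[OF m_ge, of "2 * \<beta>"] power_sum_nonneg[of m "2 * \<beta>"] \<beta>_half by auto

definition Z_law :: "nat \<Rightarrow> real measure" where
  "Z_law n = distr (measure_pmf (Q n)) borel (\<lambda>x. x / w n)"

definition phi :: "nat \<Rightarrow> real \<Rightarrow> complex" where
  "phi n u = char (Z_law n) u"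

lemma real_distribution_Z_law: "real_distribution (Z_law n)"
  unfolding Z_law_def by (rule prob_space.real_distribution_distr) (auto intro: prob_space_measure_pmf)

lemma E_int: "integrable (measure_pmf (Q n)) (f :: real \<Rightarrow> 'b::{banach, second_countable_topology})"
  by (rule integrable_measure_pmf_finite[OF fin])

lemma phi_eq: "phi n u = E n (\<lambda>x. iexp (u * (x / w n)))"
  unfolding phi_def char_def Z_law_def by (subst integral_distr) auto

lemma integral_Z_law:
  fixes h :: "real \<Rightarrow> 'b::{banach, second_countable_topology}"
  assumes "h \<in> borel_measurable borel"
  shows "integrable (Z_law n) h" "integral\<^sup>L (Z_law n) h = E n (\<lambda>x. h (x / w n))"
  using assms unfolding Z_law_def by (auto simp: integrable_distr_eq integral_distr intro: E_int)

lemma norm_phi_le_1: "norm (phi n u) \<le> 1"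
  unfolding phi_def by (rule real_distribution.cmod_char_le_1[OF real_distribution_Z_law])

lemma phi_0: "phi n 0 = 1"
  unfolding phi_def by (rule real_distribution.char_zero[OF real_distribution_Z_law])

lemma phi_lipschitz: "\<exists>\<Lambda>\<ge>0. \<forall>n u v. norm (phi n u - phi n v) \<le> \<Lambda> * \<bar>u - v\<bar>"
proof -
  obtain K where K: "K \<ge> 0" "\<And>n. E n (\<lambda>x. \<bar>x\<bar>) \<le> K * w n" using first_abs_moment_bound by blast
  have "norm (phi n u - phi n v) \<le> K * \<bar>u - v\<bar>" for n u v
  proof -
    have "norm (phi n u - phi n v) = norm (E n (\<lambda>x. iexp (u * (x / w n)) - iexp (v * (x / w n))))"
      unfolding phi_eq by (subst Bochner_Integration.integral_diff[OF E_int E_int]) simp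
    also have "\<dots> \<le> E n (\<lambda>x. norm (iexp (u * (x / w n)) - iexp (v * (x / w n))))" by (rule integral_norm_bound)
    also have "\<dots> \<le> E n (\<lambda>x. (\<bar>u - v\<bar> / w n) * \<bar>x\<bar>)"
    proof (rule integral_mono[OF E_int E_int])
      fix x
      have "norm (iexp (u * (x / w n)) - iexp (v * (x / w n))) \<le> \<bar>u * (x / w n) - v * (x / w n)\<bar>" by (rule norm_iexp_diff_le)
      also have "\<dots> = \<bar>(u - v) * (x / w n)\<bar>" by (simp only: left_diff_distrib)
      also have "\<dots> = (\<bar>u - v\<bar> / w n) * \<bar>x\<bar>" using w_pos[of n] by (simp add: abs_mult)
      finally show "norm (iexp (u * (x / w n)) - iexp (v * (x / w n))) \<le> (\<bar>u - v\<bar> / w n) * \<bar>x\<bar>" .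
    qed
    also have "\<dots> = (\<bar>u - v\<bar> / w n) * E n (\<lambda>x. \<bar>x\<bar>)" by (rule integral_mult_right_zero)
    also have "\<dots> \<le> (\<bar>u - v\<bar> / w n) * (K * w n)" by (intro mult_left_mono K) auto
    also have "\<dots> = K * \<bar>u - v\<bar>" by simp
    finally show ?thesis .
  qed
  then show ?thesis using K(1) by blast
qed

lemma phi_linear: "\<exists>K\<ge>0. \<forall>n u. norm (phi n u - 1 - \<i> * u * (E n (\<lambda>x. x) / w n)) \<le> K * u\<^sup>2"
proof -
  obtain K where K: "K \<ge> 0" "\<And>n. E n (\<lambda>x. x\<^sup>2) \<le> K * (w n)\<^sup>2" using second_moment_bound by blast
  have "norm (phi n u - 1 - \<i> * u * (E n (\<lambda>x. x) / w n)) \<le> K * u\<^sup>2" for n u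
  proof -
    interpret Z: real_distribution "Z_law n" by (rule real_distribution_Z_law)
    have e1: "Z.expectation (\<lambda>x. x) = E n (\<lambda>x. x) / w n" by (subst integral_Z_law(2)) simp_all
    have e2: "Z.expectation (\<lambda>x. x\<^sup>2) = E n (\<lambda>x. x\<^sup>2) / (w n)\<^sup>2" by (subst integral_Z_law(2)) (simp_all add: power_divide)
    have "norm (phi n u - 1 - \<i> * u * (E n (\<lambda>x. x) / w n)) \<le> u\<^sup>2 * (E n (\<lambda>x. x\<^sup>2) / (w n)\<^sup>2)"
      using Z.char_linear_approx[of u] unfolding e1 e2 phi_def by (simp add: integral_Z_law(1))
    also have "\<dots> \<le> u\<^sup>2 * K" using K(2)[of n] w_pos[of n] by (intro mult_left_mono) (auto simp: pos_divide_le_eq)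
    finally show ?thesis by (simp add: mult.commute)
  qed
  then show ?thesis using K(1) by blast
qed

lemma phi_rec:
  assumes "n \<ge> m - 1"
  shows "phi n u = iexp (u * (t n / w n)) * avg n (\<lambda>v. \<Prod>j<m. phi (v ! j) (u * (w (v ! j) / w n)))"
proof -
  have eq: "iexp (u * (x / w n)) = iexp (u / w n * x)" for x by simp
  have "phi n u = avg n (\<lambda>v. iexp (u / w n * t n) * (\<Prod>j<m. E (v ! j) (\<lambda>x. iexp (u / w n * x))))"
    unfolding phi_eq eq E_rec[OF assms] by (intro avg_cong char_sum_law fin)
  also have "\<dots> = iexp (u / w n * t n) * avg n (\<lambda>v. \<Prod>j<m. E (v ! j) (\<lambda>x. iexp (u / w n * x)))" by (rule avg_mult)
  also have "(\<lambda>v. \<Prod>j<m. E (v ! j) (\<lambda>x. iexp (u / w n * x))) = (\<lambda>v. \<Prod>j<m. phi (v ! j) (u * (w (v ! j) / w n)))"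
    unfolding phi_eq by (intro ext prod.cong refl Bochner_Integration.integral_cong) simp
  finally show ?thesis by simp
qed

fun psi_iter :: "nat \<Rightarrow> real \<Rightarrow> complex" where
  "psi_iter 0 u = iexp (u * c)"
| "psi_iter (Suc i) u = smoothing m \<beta> (psi_iter i) u"

lemma borel_measurable_lipschitz:
  fixes f :: "real \<Rightarrow> complex"
  assumes "\<And>x y. norm (f x - f y) \<le> \<Lambda> * \<bar>x - y\<bar>"
  shows "f \<in> borel_measurable borel"
proof -
  have "(max \<Lambda> 0)-lipschitz_on UNIV f"
  proof (rule lipschitz_onI)
    fix x y
    have "dist (f x) (f y) \<le> \<Lambda> * \<bar>x - y\<bar>" using assms by (simp add: dist_norm)
    also have "\<dots> \<le> max \<Lambda> 0 * \<bar>x - y\<bar>" by (intro mult_right_mono) auto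
    finally show "dist (f x) (f y) \<le> max \<Lambda> 0 * dist x y" by (simp add: dist_real_def)
  qed simp
  then show ?thesis by (intro borel_measurable_continuous_onI lipschitz_on_continuous_on)
qed

lemma product_integral_lipschitz:
  fixes \<psi> :: "real \<Rightarrow> complex"
  assumes "\<And>x. norm (\<psi> x) \<le> 1" "\<Lambda> \<ge> 0" "\<And>x y. norm (\<psi> x - \<psi> y) \<le> \<Lambda> * \<bar>x - y\<bar>"
  shows "norm ((CLINT s|uniform_simplex m. \<Prod>j=1..m. \<psi> (s j powr \<beta> * u)) - (CLINT s|uniform_simplex m. \<Prod>j=1..m. \<psi> (s j powr \<beta> * v))) \<le> real m * \<Lambda> * \<bar>u - v\<bar>"
proof -
  interpret S: prob_space "uniform_simplex m" by (rule prob_space_uniform_simplex)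
  have meas: "\<psi> \<in> borel_measurable borel" using assms(3) by (rule borel_measurable_lipschitz)
  have "norm ((CLINT s|uniform_simplex m. \<Prod>j=1..m. \<psi> (s j powr \<beta> * u)) - (CLINT s|uniform_simplex m. \<Prod>j=1..m. \<psi> (s j powr \<beta> * v)))
    \<le> (\<integral>s. real m * \<Lambda> * \<bar>u - v\<bar> \<partial>uniform_simplex m)"
  proof (rule norm_smoothing_diff_le[OF m_ge meas assms(1) meas assms(1)])
    fix s :: "nat \<Rightarrow> real" assume s: "\<And>j. j \<in> {1..m} \<Longrightarrow> 0 \<le> s j \<and> s j \<le> 1"
    have "(\<Sum>j=1..m. norm (\<psi> (s j powr \<beta> * u) - \<psi> (s j powr \<beta> * v))) \<le> (\<Sum>j=1..m. \<Lambda> * \<bar>u - v\<bar>)"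
    proof (rule sum_mono)
      fix j assume "j \<in> {1..m}"
      then have p: "0 \<le> s j powr \<beta>" "s j powr \<beta> \<le> 1" using s[of j] \<beta>_pos by (auto intro!: powr_le1)
      have "norm (\<psi> (s j powr \<beta> * u) - \<psi> (s j powr \<beta> * v)) \<le> \<Lambda> * \<bar>s j powr \<beta> * u - s j powr \<beta> * v\<bar>" by (rule assms(3))
      also have "\<bar>s j powr \<beta> * u - s j powr \<beta> * v\<bar> = s j powr \<beta> * \<bar>u - v\<bar>"
        using p by (simp only: right_diff_distrib[symmetric] abs_mult)
      also have "\<Lambda> * (s j powr \<beta> * \<bar>u - v\<bar>) \<le> \<Lambda> * (1 * \<bar>u - v\<bar>)" using p assms(2) by (intro mult_left_mono mult_right_mono) auto
      finally show "norm (\<psi> (s j powr \<beta> * u) - \<psi> (s j powr \<beta> * v)) \<le> \<Lambda> * \<bar>u - v\<bar>" by simp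
    qed
    then show "(\<Sum>j=1..m. norm (\<psi> (s j powr \<beta> * u) - \<psi> (s j powr \<beta> * v))) \<le> real m * \<Lambda> * \<bar>u - v\<bar>" by simp
  qed simp
  then show ?thesis by (simp add: S.prob_space)
qed

text \<open>The properties support each other in the induction: the bound 1 and measurability, which
  comes from the Lipschitz bound, are needed to smooth once more. The Lipschitz constants may grow
  with i, because i stays fixed while n tends to infinity.\<close>

lemma psi_iter_props:
  "(\<forall>x. norm (psi_iter i x) \<le> 1) \<and> psi_iter i 0 = 1 \<and> (\<exists>\<Lambda>\<ge>0. \<forall>x y. norm (psi_iter i x - psi_iter i y) \<le> \<Lambda> * \<bar>x - y\<bar>)"
proof (induction i)
  case 0
  have "norm (psi_iter 0 x - psi_iter 0 y) \<le> \<bar>c\<bar> * \<bar>x - y\<bar>" for x y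
  proof -
    have "\<bar>x * c - y * c\<bar> = \<bar>c\<bar> * \<bar>x - y\<bar>" unfolding left_diff_distrib[symmetric] abs_mult by (rule mult.commute)
    then show ?thesis using norm_iexp_diff_le[of "x * c" "y * c"] by (simp only: psi_iter.simps)
  qed
  then show ?case by (auto intro!: exI[of _ "\<bar>c\<bar>"])
next
  case (Suc i)
  interpret S: prob_space "uniform_simplex m" by (rule prob_space_uniform_simplex)
  obtain \<Lambda> where \<Lambda>: "\<Lambda> \<ge> 0" "\<And>x y. norm (psi_iter i x - psi_iter i y) \<le> \<Lambda> * \<bar>x - y\<bar>" using Suc by blast
  have le1: "\<And>x. norm (psi_iter i x) \<le> 1" and z: "psi_iter i 0 = 1" using Suc by auto
  have meas: "psi_iter i \<in> borel_measurable borel" using \<Lambda>(2) by (rule borel_measurable_lipschitz)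
  let ?A = "\<lambda>u. CLINT s|uniform_simplex m. \<Prod>j=1..m. psi_iter i (s j powr \<beta> * u)"
  have A1: "norm (?A u) \<le> 1" for u
    using norm_smoothing_le_1[OF m_ge meas le1, of \<beta> u] by (simp add: smoothing_def norm_mult)
  have "norm (psi_iter (Suc i) x) \<le> 1" for x
    unfolding psi_iter.simps by (rule norm_smoothing_le_1[OF m_ge meas le1])
  moreover have "psi_iter (Suc i) 0 = 1" by (simp add: smoothing_def z S.prob_space)
  moreover have "norm (psi_iter (Suc i) x - psi_iter (Suc i) y) \<le> (1 + real m * \<Lambda>) * \<bar>x - y\<bar>" for x y
  proof -
    have "psi_iter (Suc i) x - psi_iter (Suc i) y = (iexp x - iexp y) * ?A x + iexp y * (?A x - ?A y)"
      by (simp add: smoothing_def algebra_simps)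
    then have "norm (psi_iter (Suc i) x - psi_iter (Suc i) y) \<le> norm ((iexp x - iexp y) * ?A x) + norm (iexp y * (?A x - ?A y))"
      by (simp only: norm_triangle_ineq)
    also have "norm ((iexp x - iexp y) * ?A x) \<le> \<bar>x - y\<bar> * 1"
      unfolding norm_mult by (intro mult_mono norm_iexp_diff_le A1) auto
    also have "norm (iexp y * (?A x - ?A y)) = norm (?A x - ?A y)" by (simp add: norm_mult)
    also have "norm (?A x - ?A y) \<le> real m * \<Lambda> * \<bar>x - y\<bar>" by (rule product_integral_lipschitz[OF le1 \<Lambda>])
    finally show ?thesis by (simp add: algebra_simps)
  qed
  ultimately show ?case using \<Lambda>(1) by (auto intro!: exI[of _ "1 + real m * \<Lambda>"] simp del: psi_iter.simps)
qed

lemma norm_psi_iter_le_1: "norm (psi_iter i x) \<le> 1"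
  using psi_iter_props by blast

lemma psi_iter_0: "psi_iter i 0 = 1"
  using psi_iter_props by blast

lemma psi_iter_lipschitz: "\<exists>\<Lambda>\<ge>0. \<forall>x y. norm (psi_iter i x - psi_iter i y) \<le> \<Lambda> * \<bar>x - y\<bar>"
  using psi_iter_props by blast

lemma measurable_psi_iter: "psi_iter i \<in> borel_measurable borel"
  using psi_iter_lipschitz[of i] borel_measurable_lipschitz by blast

text \<open>For fixed u this is convergence of composition averages to the simplex. Both sides are
  Lipschitz in u with a constant that does not depend on n, which makes the convergence uniform on
  bounded sets.\<close>

lemma avg_product_uniform:
  assumes \<epsilon>: "\<epsilon> > 0"
  shows "eventually (\<lambda>n. \<forall>u. \<bar>u\<bar> \<le> T \<longrightarrow> norm (avg n (\<lambda>v. \<Prod>j<m. psi_iter i ((real (v ! j) / real n) powr \<beta> * u)) -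
    (CLINT s|uniform_simplex m. \<Prod>j=1..m. psi_iter i (s j powr \<beta> * u))) \<le> \<epsilon>) sequentially"
proof -
  obtain \<Lambda> where \<Lambda>: "\<Lambda> \<ge> 0" "\<And>x y. norm (psi_iter i x - psi_iter i y) \<le> \<Lambda> * \<bar>x - y\<bar>"
    using psi_iter_lipschitz by blast
  let ?A = "\<lambda>u. CLINT s|uniform_simplex m. \<Prod>j=1..m. psi_iter i (s j powr \<beta> * u)"
  let ?P = "\<lambda>n u v. \<Prod>j<m. psi_iter i ((real (v ! j) / real n) powr \<beta> * u)"
  \<comment> \<open>Below m-1 the binomial coefficient in \<open>avg\<close> is 0 and
    \<open>avg\<close> is no average, so these terms are set to 0.\<close>
  define f where "f = (\<lambda>n u. if n < m - 1 then 0 else avg n (?P n u) - ?A u)"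
  have "eventually (\<lambda>n. \<forall>u. \<bar>u\<bar> \<le> T \<longrightarrow> norm (f n u) \<le> \<epsilon>) sequentially"
  proof (rule equi_lipschitz_uniform[OF _ _ \<epsilon>])
    fix n x y
    show "norm (f n x - f n y) \<le> (2 * (real m * \<Lambda>)) * \<bar>x - y\<bar>"
    proof (cases "n < m - 1")
      case True
      then show ?thesis using \<Lambda>(1) by (simp add: f_def)
    next
      case False
      then have n: "n \<ge> m - 1" by simp
      have "norm (avg n (?P n x) - avg n (?P n y)) \<le> avg n (\<lambda>v. norm (?P n x v - ?P n y v))"
        unfolding avg_diff[symmetric] by (rule norm_avg_le)
      also have "\<dots> \<le> avg n (\<lambda>_. real m * \<Lambda> * \<bar>x - y\<bar>)"
      proof (rule avg_mono)
        fix v assume v: "v \<in> comps n"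
        have "norm (?P n x v - ?P n y v) \<le> (\<Sum>j<m. norm (psi_iter i ((real (v ! j) / real n) powr \<beta> * x) - psi_iter i ((real (v ! j) / real n) powr \<beta> * y)))"
          by (rule norm_prod_diff) (auto intro: norm_psi_iter_le_1)
        also have "\<dots> \<le> (\<Sum>j<m. \<Lambda> * \<bar>x - y\<bar>)"
        proof (rule sum_mono)
          fix j assume "j \<in> {..<m}"
          then have "v ! j \<le> n" using comps_nth_le[OF v, of j] by simp
          then have p: "0 \<le> (real (v ! j) / real n) powr \<beta>" "(real (v ! j) / real n) powr \<beta> \<le> 1"
            using ratio_powr_le_1 \<beta>_pos by auto
          have "norm (psi_iter i ((real (v ! j) / real n) powr \<beta> * x) - psi_iter i ((real (v ! j) / real n) powr \<beta> * y)) \<le>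
             \<Lambda> * \<bar>(real (v ! j) / real n) powr \<beta> * x - (real (v ! j) / real n) powr \<beta> * y\<bar>" by (rule \<Lambda>(2))
          also have "\<dots> = \<Lambda> * ((real (v ! j) / real n) powr \<beta> * \<bar>x - y\<bar>)"
            using p by (simp only: right_diff_distrib[symmetric] abs_mult)
          also have "\<dots> \<le> \<Lambda> * (1 * \<bar>x - y\<bar>)" using p \<Lambda>(1) by (intro mult_left_mono mult_right_mono) auto
          finally show "norm (psi_iter i ((real (v ! j) / real n) powr \<beta> * x) - psi_iter i ((real (v ! j) / real n) powr \<beta> * y)) \<le> \<Lambda> * \<bar>x - y\<bar>" by simp
        qed
        also have "\<dots> = real m * \<Lambda> * \<bar>x - y\<bar>" by simp
        finally show "norm (?P n x v - ?P n y v) \<le> real m * \<Lambda> * \<bar>x - y\<bar>" .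
      qed
      also have "\<dots> = real m * \<Lambda> * \<bar>x - y\<bar>" by (rule avg_const[OF n])
      finally have 1: "norm (avg n (?P n x) - avg n (?P n y)) \<le> real m * \<Lambda> * \<bar>x - y\<bar>" .
      have 2: "norm (?A x - ?A y) \<le> real m * \<Lambda> * \<bar>x - y\<bar>"
        by (rule product_integral_lipschitz[OF norm_psi_iter_le_1 \<Lambda>])
      have "f n x - f n y = (avg n (?P n x) - avg n (?P n y)) - (?A x - ?A y)" using False by (simp add: f_def)
      then have "norm (f n x - f n y) \<le> norm (avg n (?P n x) - avg n (?P n y)) + norm (?A x - ?A y)"
        by (simp only: norm_triangle_ineq4)
      then show ?thesis using 1 2 by (simp add: algebra_simps)
    qed
  next
    fix u
    have "(\<lambda>n. avg n (\<lambda>v. \<Prod>j=1..m. psi_iter i (composition_point m n v j powr \<beta> * u))) \<longlonglongrightarrow> ?A u"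
      unfolding avg_def
    proof (rule composition_average_tendsto[OF m_ge measurable_smoothing_integrand[OF measurable_psi_iter], where B = 1])
      fix s :: "nat \<Rightarrow> real"
      show "norm (\<Prod>j=1..m. psi_iter i (s j powr \<beta> * u)) \<le> 1" by (intro norm_prod_le_1 norm_psi_iter_le_1)
    next
      fix X :: "nat \<Rightarrow> nat \<Rightarrow> real" and s
      assume X: "\<And>k j. j \<in> {1..m} \<Longrightarrow> 0 \<le> X k j \<and> X k j \<le> 1"
        and lim: "\<And>j. j \<in> {1..m} \<Longrightarrow> (\<lambda>k. X k j) \<longlonglongrightarrow> s j"
      have cont: "(\<lambda>k. psi_iter i (a k)) \<longlonglongrightarrow> psi_iter i b" if "a \<longlonglongrightarrow> b" for a b
      proof -
        have "(\<lambda>k. \<Lambda> * \<bar>a k - b\<bar>) \<longlonglongrightarrow> \<Lambda> * \<bar>b - b\<bar>" by (intro tendsto_intros that)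
        then have l: "(\<lambda>k. \<Lambda> * \<bar>a k - b\<bar>) \<longlonglongrightarrow> 0" by simp
        have "(\<lambda>k. psi_iter i (a k) - psi_iter i b) \<longlonglongrightarrow> 0"
          by (rule Lim_null_comparison[OF always_eventually l]) (intro allI \<Lambda>(2))
        then show ?thesis by (rule LIM_zero_cancel)
      qed
      have "(\<lambda>k. X k j powr \<beta> * u) \<longlonglongrightarrow> s j powr \<beta> * u" if "j \<in> {1..m}" for j
        using X[OF that] lim[OF that] \<beta>_pos by (intro tendsto_mult tendsto_const tendsto_powr') auto
      then show "(\<lambda>k. \<Prod>j=1..m. psi_iter i (X k j powr \<beta> * u)) \<longlonglongrightarrow> (\<Prod>j=1..m. psi_iter i (s j powr \<beta> * u))"
        by (intro tendsto_prod cont)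
    qed
    then have "(\<lambda>n. avg n (?P n u) - ?A u) \<longlonglongrightarrow> 0"
      by (simp only: composition_point_prod[where f = "\<lambda>x. psi_iter i (x powr \<beta> * u)"] LIM_zero_iff)
    then show "(\<lambda>n. f n u) \<longlonglongrightarrow> 0"
    proof (rule Lim_transform_eventually)
      show "eventually (\<lambda>n. avg n (?P n u) - ?A u = f n u) sequentially"
        using eventually_ge_at_top[of "m - 1"] by eventually_elim (simp add: f_def)
    qed
  qed
  with eventually_ge_at_top[of "m - 1"] show ?thesis
    by eventually_elim (auto simp: f_def)
qed

text \<open>The contraction multiplies the quadratic part by q in each step, while every error from
  finite n goes into \<epsilon>. The constant C is fixed before i and stems from the start alone: K
  bounds the second-order remainder of \<open>phi\<close>, c^2 that of the point mass at c.
  Uniformity in u is required because the induction hypothesis is used at the rescaled arguments of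
  all subtrees.\<close>

lemma phi_psi_iter:
  "\<exists>C\<ge>0. \<forall>i T \<epsilon>. T > 0 \<longrightarrow> \<epsilon> > 0 \<longrightarrow> eventually (\<lambda>n. \<forall>u. \<bar>u\<bar> \<le> T \<longrightarrow> norm (phi n u - psi_iter i u) \<le> C * q ^ i * u\<^sup>2 + \<epsilon>) sequentially"
proof -
  obtain K where K: "K \<ge> 0" "\<And>n u. norm (phi n u - 1 - \<i> * u * (E n (\<lambda>x. x) / w n)) \<le> K * u\<^sup>2" using phi_linear by blast
  obtain \<Lambda> where \<Lambda>: "\<Lambda> \<ge> 0" "\<And>n u v. norm (phi n u - phi n v) \<le> \<Lambda> * \<bar>u - v\<bar>" using phi_lipschitz by blast
  define C where "C = K + c\<^sup>2"
  have C0: "C \<ge> 0" using K(1) by (simp add: C_def)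
  have "\<forall>T \<epsilon>. T > 0 \<longrightarrow> \<epsilon> > 0 \<longrightarrow> eventually (\<lambda>n. \<forall>u. \<bar>u\<bar> \<le> T \<longrightarrow> norm (phi n u - psi_iter i u) \<le> C * q ^ i * u\<^sup>2 + \<epsilon>) sequentially" for i
  proof (induction i)
    case 0
    show ?case
    proof (intro allI impI)
      fix T \<epsilon> :: real assume T: "T > 0" and \<epsilon>: "\<epsilon> > 0"
      have "(\<lambda>n. T * \<bar>E n (\<lambda>x. x) / w n - c\<bar>) \<longlonglongrightarrow> T * \<bar>c - c\<bar>" by (intro tendsto_intros mean)
      then have "eventually (\<lambda>n. T * \<bar>E n (\<lambda>x. x) / w n - c\<bar> < \<epsilon>) sequentially" using \<epsilon> by (intro order_tendstoD(2)) auto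
      then show "eventually (\<lambda>n. \<forall>u. \<bar>u\<bar> \<le> T \<longrightarrow> norm (phi n u - psi_iter 0 u) \<le> C * q ^ 0 * u\<^sup>2 + \<epsilon>) sequentially"
      proof eventually_elim
        case (elim n)
        show ?case
        proof (intro allI impI)
          fix u :: real assume u: "\<bar>u\<bar> \<le> T"
          let ?\<mu> = "E n (\<lambda>x. x) / w n"
          have "phi n u - psi_iter 0 u = (phi n u - 1 - \<i> * u * ?\<mu>) + \<i> * complex_of_real (u * (?\<mu> - c)) - (iexp (u * c) - 1 - \<i> * complex_of_real (u * c))"
            by (simp add: algebra_simps)
          then have "norm (phi n u - psi_iter 0 u) \<le> norm ((phi n u - 1 - \<i> * u * ?\<mu>) + \<i> * complex_of_real (u * (?\<mu> - c))) + norm (iexp (u * c) - 1 - \<i> * complex_of_real (u * c))"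
            by (simp only: norm_triangle_ineq4)
          also have "norm ((phi n u - 1 - \<i> * u * ?\<mu>) + \<i> * complex_of_real (u * (?\<mu> - c))) \<le> norm (phi n u - 1 - \<i> * u * ?\<mu>) + norm (\<i> * complex_of_real (u * (?\<mu> - c)))"
            by (rule norm_triangle_ineq)
          also have "norm (phi n u - 1 - \<i> * u * ?\<mu>) \<le> K * u\<^sup>2" by (rule K(2))
          also have "norm (\<i> * complex_of_real (u * (?\<mu> - c))) \<le> \<epsilon>"
          proof -
            have "norm (\<i> * complex_of_real (u * (?\<mu> - c))) = \<bar>u\<bar> * \<bar>?\<mu> - c\<bar>" by (simp only: norm_mult norm_of_real abs_mult norm_ii mult_1)
            also have "\<dots> \<le> T * \<bar>?\<mu> - c\<bar>" using u by (intro mult_right_mono) auto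
            finally show ?thesis using elim by linarith
          qed
          also have "norm (iexp (u * c) - 1 - \<i> * complex_of_real (u * c)) \<le> (u * c)\<^sup>2" by (rule norm_iexp_linear)
          finally show "norm (phi n u - psi_iter 0 u) \<le> C * q ^ 0 * u\<^sup>2 + \<epsilon>" by (simp add: C_def power_mult_distrib algebra_simps)
        qed
      qed
    qed
  next
    case (Suc i)
    show ?case
    proof (intro allI impI)
      fix T \<epsilon> :: real assume T: "T > 0" and \<epsilon>: "\<epsilon> > 0"
      obtain \<Lambda>' where \<Lambda>': "\<Lambda>' \<ge> 0" "\<And>x y. norm (psi_iter i x - psi_iter i y) \<le> \<Lambda>' * \<bar>x - y\<bar>" using psi_iter_lipschitz by blast
      define D where "D = C * q ^ i"
      have D0: "D \<ge> 0" using C0 q_bounds by (simp add: D_def)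
      \<comment> \<open>Five errors share \<epsilon>: the induction hypothesis over m subtrees
        (\<epsilon>1), replacing w_j/w_n by (j/n)^\<beta> (\<epsilon>2), the toll, the average of
        the power sums against q, and the average of the products against its integral.\<close>
      define \<epsilon>1 where "\<epsilon>1 = \<epsilon> / (5 * real m)"
      define \<epsilon>2 where "\<epsilon>2 = \<epsilon> / (5 * (real m * (\<Lambda> * T) + 1))"
      have m0: "real m > 0" using m_ge by simp
      have e1: "\<epsilon>1 > 0" "real m * \<epsilon>1 = \<epsilon>/5" using \<epsilon> m0 by (auto simp: \<epsilon>1_def)
      have den: "real m * (\<Lambda> * T) + 1 > 0" using \<Lambda>(1) T by (intro add_nonneg_pos mult_nonneg_nonneg) auto
      have e2: "\<epsilon>2 > 0" "real m * (\<Lambda> * T * \<epsilon>2) \<le> \<epsilon>/5"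
      proof -
        show "\<epsilon>2 > 0" using den \<epsilon> by (simp add: \<epsilon>2_def)
        have "real m * (\<Lambda> * T * \<epsilon>2) \<le> (real m * (\<Lambda> * T) + 1) * \<epsilon>2" using \<open>\<epsilon>2 > 0\<close> by (simp add: algebra_simps)
        also have "x * (y / (5 * x)) = y / 5" if "x > 0" for x y :: real using that by simp
        then have "(real m * (\<Lambda> * T) + 1) * \<epsilon>2 = \<epsilon>/5" unfolding \<epsilon>2_def using den by blast
        finally show "real m * (\<Lambda> * T * \<epsilon>2) \<le> \<epsilon>/5" .
      qed
      obtain N where N: "\<And>j u. j \<ge> N \<Longrightarrow> \<bar>u\<bar> \<le> T \<Longrightarrow> norm (phi j u - psi_iter i u) \<le> D * u\<^sup>2 + \<epsilon>1"
        using Suc[rule_format, OF T e1(1)] unfolding D_def[symmetric] eventually_sequentially by blast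
      have "(\<lambda>n. T * \<bar>t n / w n - 1\<bar>) \<longlonglongrightarrow> T * \<bar>1 - 1\<bar>" by (intro tendsto_intros toll)
      then have evA: "eventually (\<lambda>n. T * \<bar>t n / w n - 1\<bar> < \<epsilon>/5) sequentially" using \<epsilon> by (intro order_tendstoD(2)) auto
      have evB: "eventually (\<lambda>n. \<forall>j\<le>n. \<bar>w j / w n - (real j / real n) powr \<beta>\<bar> \<le> \<epsilon>2) sequentially" by (rule unif) (rule e2)
      have "(\<lambda>n. (\<Lambda> + \<Lambda>') * (T * (real N / real n) powr \<beta>)) \<longlonglongrightarrow> (\<Lambda> + \<Lambda>') * (T * 0 powr \<beta>)"
        using \<beta>_pos by (intro tendsto_mult tendsto_const tendsto_powr' lim_const_over_n) auto
      then have evC: "eventually (\<lambda>n. (\<Lambda> + \<Lambda>') * (T * (real N / real n) powr \<beta>) < \<epsilon>1) sequentially"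
        using e1 by (intro order_tendstoD(2)) auto
      have "(\<lambda>n. D * T\<^sup>2 * \<bar>avg n (\<lambda>v. \<Sum>j<m. (real (v ! j) / real n) powr (2 * \<beta>)) - q\<bar>) \<longlonglongrightarrow> D * T\<^sup>2 * \<bar>q - q\<bar>"
        using \<beta>_pos by (intro tendsto_intros avg_power_sum) auto
      then have evD: "eventually (\<lambda>n. D * T\<^sup>2 * \<bar>avg n (\<lambda>v. \<Sum>j<m. (real (v ! j) / real n) powr (2 * \<beta>)) - q\<bar> < \<epsilon>/5) sequentially"
        using \<epsilon> by (intro order_tendstoD(2)) auto
      have evE: "eventually (\<lambda>n. \<forall>u. \<bar>u\<bar> \<le> T \<longrightarrow> norm (avg n (\<lambda>v. \<Prod>j<m. psi_iter i ((real (v ! j) / real n) powr \<beta> * u)) -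
         (CLINT s|uniform_simplex m. \<Prod>j=1..m. psi_iter i (s j powr \<beta> * u))) \<le> \<epsilon>/5) sequentially"
        using \<epsilon> by (intro avg_product_uniform) simp
      show "eventually (\<lambda>n. \<forall>u. \<bar>u\<bar> \<le> T \<longrightarrow> norm (phi n u - psi_iter (Suc i) u) \<le> C * q ^ Suc i * u\<^sup>2 + \<epsilon>) sequentially"
        using evA evB evC evD evE eventually_ge_at_top[of "m - 1"]
      proof eventually_elim
        case (elim n)
        show ?case
        proof (intro allI impI)
          fix u :: real assume u: "\<bar>u\<bar> \<le> T"
          let ?r = "\<lambda>j. w j / w n" and ?\<rho> = "\<lambda>j. (real j / real n) powr \<beta>"
          let ?A = "CLINT s|uniform_simplex m. \<Prod>j=1..m. psi_iter i (s j powr \<beta> * u)"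
          let ?F = "\<lambda>v. \<Prod>j<m. phi (v ! j) (u * ?r (v ! j))"
          let ?G = "\<lambda>v. \<Prod>j<m. psi_iter i (?\<rho> (v ! j) * u)"
          have point: "norm (phi j (u * ?r j) - psi_iter i (?\<rho> j * u)) \<le> \<Lambda> * T * \<epsilon>2 + \<epsilon>1 + D * u\<^sup>2 * (real j / real n) powr (2 * \<beta>)" if j: "j \<le> n" for j
          proof -
            have \<rho>: "0 \<le> ?\<rho> j" "?\<rho> j \<le> 1" using ratio_powr_le_1[OF j] \<beta>_pos by auto
            have "norm (phi j (u * ?r j) - phi j (?\<rho> j * u)) \<le> \<Lambda> * \<bar>u * ?r j - ?\<rho> j * u\<bar>" by (rule \<Lambda>(2))
            also have "u * ?r j - ?\<rho> j * u = u * (?r j - ?\<rho> j)" by (simp only: right_diff_distrib mult.commute)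
            also have "\<Lambda> * \<bar>u * (?r j - ?\<rho> j)\<bar> \<le> \<Lambda> * (T * \<epsilon>2)"
              unfolding abs_mult using u elim(2) j \<Lambda>(1) T by (intro mult_left_mono mult_mono) auto
            finally have 1: "norm (phi j (u * ?r j) - phi j (?\<rho> j * u)) \<le> \<Lambda> * T * \<epsilon>2" by simp
            have abs: "\<bar>?\<rho> j * u\<bar> \<le> T"
            proof -
              have "\<bar>?\<rho> j * u\<bar> \<le> 1 * T" unfolding abs_mult using \<rho> u by (intro mult_mono) auto
              then show ?thesis by simp
            qed
            have sq: "(?\<rho> j * u)\<^sup>2 = u\<^sup>2 * (real j / real n) powr (2 * \<beta>)"
              by (simp add: power_mult_distrib power2_eq_square flip: powr_add)
            have 2: "norm (phi j (?\<rho> j * u) - psi_iter i (?\<rho> j * u)) \<le> \<epsilon>1 + D * u\<^sup>2 * (real j / real n) powr (2 * \<beta>)"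
            proof (cases "j \<ge> N")
              case True
              then show ?thesis using N[OF True abs] unfolding sq by (simp add: mult.assoc)
            next
              \<comment> \<open>The induction hypothesis says nothing about small subtrees. Both
                functions equal 1 at 0, and the argument is at most T (N/n)^\<beta>, so the
                Lipschitz bounds suffice.\<close>
              case False
              have "norm (phi j (?\<rho> j * u) - psi_iter i (?\<rho> j * u)) = norm ((phi j (?\<rho> j * u) - phi j 0) - (psi_iter i (?\<rho> j * u) - psi_iter i 0))"
                by (simp add: phi_0 psi_iter_0)
              also have "\<dots> \<le> norm (phi j (?\<rho> j * u) - phi j 0) + norm (psi_iter i (?\<rho> j * u) - psi_iter i 0)" by (rule norm_triangle_ineq4)
              also have "\<dots> \<le> \<Lambda> * \<bar>?\<rho> j * u - 0\<bar> + \<Lambda>' * \<bar>?\<rho> j * u - 0\<bar>" by (intro add_mono \<Lambda>(2) \<Lambda>'(2))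
              also have "\<dots> = (\<Lambda> + \<Lambda>') * \<bar>?\<rho> j * u\<bar>" by (simp add: distrib_right)
              also have "\<bar>?\<rho> j * u\<bar> \<le> T * (real N / real n) powr \<beta>"
              proof -
                have "?\<rho> j \<le> (real N / real n) powr \<beta>" using False \<beta>_pos by (intro powr_mono2 divide_right_mono) auto
                then have "\<bar>?\<rho> j\<bar> * \<bar>u\<bar> \<le> (real N / real n) powr \<beta> * T" using \<rho> u by (intro mult_mono) auto
                then show ?thesis by (simp only: abs_mult mult.commute)
              qed
              then have "(\<Lambda> + \<Lambda>') * \<bar>?\<rho> j * u\<bar> \<le> (\<Lambda> + \<Lambda>') * (T * (real N / real n) powr \<beta>)"
                using \<Lambda>(1) \<Lambda>'(1) by (intro mult_left_mono) auto
              finally have "norm (phi j (?\<rho> j * u) - psi_iter i (?\<rho> j * u)) \<le> \<epsilon>1" using elim(3) by linarith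
              moreover have "0 \<le> D * u\<^sup>2 * (real j / real n) powr (2 * \<beta>)" using D0 by simp
              ultimately show ?thesis by linarith
            qed
            show ?thesis using norm_triangle_ineq[of "phi j (u * ?r j) - phi j (?\<rho> j * u)" "phi j (?\<rho> j * u) - psi_iter i (?\<rho> j * u)"] 1 2 by simp
          qed
          have "norm (avg n ?F - avg n ?G) \<le> avg n (\<lambda>v. norm (?F v - ?G v))"
            unfolding avg_diff[symmetric] by (rule norm_avg_le)
          also have "\<dots> \<le> avg n (\<lambda>v. real m * (\<Lambda> * T * \<epsilon>2 + \<epsilon>1) + D * u\<^sup>2 * (\<Sum>j<m. (real (v ! j) / real n) powr (2 * \<beta>)))"
          proof (rule avg_mono)
            fix v assume v: "v \<in> comps n"
            have "norm (?F v - ?G v) \<le> (\<Sum>j<m. norm (phi (v ! j) (u * ?r (v ! j)) - psi_iter i (?\<rho> (v ! j) * u)))"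
              by (rule norm_prod_diff) (auto intro: norm_psi_iter_le_1 norm_phi_le_1)
            also have "\<dots> \<le> (\<Sum>j<m. \<Lambda> * T * \<epsilon>2 + \<epsilon>1 + D * u\<^sup>2 * (real (v ! j) / real n) powr (2 * \<beta>))"
            proof (rule sum_mono)
              fix j assume "j \<in> {..<m}"
              then have "v ! j \<le> n" using comps_nth_le[OF v, of j] by simp
              then show "norm (phi (v ! j) (u * ?r (v ! j)) - psi_iter i (?\<rho> (v ! j) * u)) \<le> \<Lambda> * T * \<epsilon>2 + \<epsilon>1 + D * u\<^sup>2 * (real (v ! j) / real n) powr (2 * \<beta>)" by (rule point)
            qed
            also have "\<dots> = real m * (\<Lambda> * T * \<epsilon>2 + \<epsilon>1) + D * u\<^sup>2 * (\<Sum>j<m. (real (v ! j) / real n) powr (2 * \<beta>))"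
              by (simp add: sum.distrib sum_distrib_left)
            finally show "norm (?F v - ?G v) \<le> \<dots>" .
          qed
          also have "\<dots> = real m * (\<Lambda> * T * \<epsilon>2 + \<epsilon>1) + D * u\<^sup>2 * avg n (\<lambda>v. \<Sum>j<m. (real (v ! j) / real n) powr (2 * \<beta>))"
            by (simp only: avg_add avg_const[OF elim(6)] avg_mult)
          also have "D * u\<^sup>2 * avg n (\<lambda>v. \<Sum>j<m. (real (v ! j) / real n) powr (2 * \<beta>)) \<le> D * u\<^sup>2 * q + \<epsilon>/5"
          proof -
            let ?a = "avg n (\<lambda>v. \<Sum>j<m. (real (v ! j) / real n) powr (2 * \<beta>))"
            have "u\<^sup>2 \<le> T\<^sup>2" using u T by (simp add: abs_le_square_iff[symmetric])
            then have "D * u\<^sup>2 * \<bar>?a - q\<bar> \<le> D * T\<^sup>2 * \<bar>?a - q\<bar>" using D0 by (intro mult_right_mono mult_left_mono) auto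
            moreover have "D * u\<^sup>2 * (?a - q) \<le> D * u\<^sup>2 * \<bar>?a - q\<bar>" using D0 by (intro mult_left_mono) auto
            moreover have "D * u\<^sup>2 * ?a = D * u\<^sup>2 * q + D * u\<^sup>2 * (?a - q)" by (simp add: right_diff_distrib)
            ultimately show ?thesis using elim(4) by linarith
          qed
          finally have FG: "norm (avg n ?F - avg n ?G) \<le> 3 * (\<epsilon>/5) + D * u\<^sup>2 * q" using e1(2) e2(2) by (simp add: distrib_left)
          have F1: "norm (avg n ?F) \<le> 1"
          proof -
            have "norm (avg n ?F) \<le> avg n (\<lambda>v. norm (?F v))" by (rule norm_avg_le)
            also have "\<dots> \<le> avg n (\<lambda>_. 1)" by (intro avg_mono norm_prod_le_1 norm_phi_le_1)
            finally show ?thesis by (simp add: avg_const[OF elim(6)])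
          qed
          have split: "phi n u - psi_iter (Suc i) u = (iexp (u * (t n / w n)) - iexp (u * 1)) * avg n ?F + iexp u * ((avg n ?F - avg n ?G) + (avg n ?G - ?A))"
            unfolding phi_rec[OF elim(6)] psi_iter.simps smoothing_def by (simp add: algebra_simps)
          have "norm (phi n u - psi_iter (Suc i) u) \<le> norm ((iexp (u * (t n / w n)) - iexp (u * 1)) * avg n ?F) + norm (iexp u * ((avg n ?F - avg n ?G) + (avg n ?G - ?A)))"
            unfolding split by (rule norm_triangle_ineq)
          also have "norm ((iexp (u * (t n / w n)) - iexp (u * 1)) * avg n ?F) \<le> \<epsilon>/5 * 1"
            unfolding norm_mult
          proof (intro mult_mono F1)
            have "norm (iexp (u * (t n / w n)) - iexp (u * 1)) \<le> \<bar>u * (t n / w n) - u * 1\<bar>" by (rule norm_iexp_diff_le)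
            also have "\<dots> = \<bar>u\<bar> * \<bar>t n / w n - 1\<bar>" by (simp only: right_diff_distrib[symmetric] abs_mult)
            also have "\<dots> \<le> T * \<bar>t n / w n - 1\<bar>" using u by (intro mult_right_mono) auto
            finally show "norm (iexp (u * (t n / w n)) - iexp (u * 1)) \<le> \<epsilon>/5" using elim(1) by linarith
          qed (use \<epsilon> in auto)
          also have "norm (iexp u * ((avg n ?F - avg n ?G) + (avg n ?G - ?A))) = norm ((avg n ?F - avg n ?G) + (avg n ?G - ?A))"
            by (simp only: norm_mult norm_exp_i_times mult_1)
          also have "norm ((avg n ?F - avg n ?G) + (avg n ?G - ?A)) \<le> norm (avg n ?F - avg n ?G) + norm (avg n ?G - ?A)" by (rule norm_triangle_ineq)
          also have "norm (avg n ?G - ?A) \<le> \<epsilon>/5" using elim(5) u by blast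
          also note FG
          finally have "norm (phi n u - psi_iter (Suc i) u) \<le> \<epsilon> + D * u\<^sup>2 * q" by simp
          then show "norm (phi n u - psi_iter (Suc i) u) \<le> C * q ^ Suc i * u\<^sup>2 + \<epsilon>" by (simp add: D_def mult_ac)
        qed
      qed
    qed
  qed
  then show ?thesis using C0 by blast
qed

end

section \<open>The limit law\<close>

context tree_limit begin

text \<open>For a fixed large i both \<open>phi n u\<close> and \<open>phi n' u\<close> are close to
  \<open>psi_iter i u\<close>, which makes the sequence Cauchy before a limit is known. The estimate
  then passes to the limit with \<epsilon> removed.\<close>

lemma phi_limit:
  obtains \<Phi> C where "\<And>u. (\<lambda>n. phi n u) \<longlonglongrightarrow> \<Phi> u" "C \<ge> 0" "\<And>i u. norm (\<Phi> u - psi_iter i u) \<le> C * q ^ i * u\<^sup>2"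
proof -
  obtain C where C: "C \<ge> 0" and ev: "\<And>i T \<epsilon>. T > 0 \<Longrightarrow> \<epsilon> > 0 \<Longrightarrow>
      eventually (\<lambda>n. \<forall>u. \<bar>u\<bar> \<le> T \<longrightarrow> norm (phi n u - psi_iter i u) \<le> C * q ^ i * u\<^sup>2 + \<epsilon>) sequentially"
    using phi_psi_iter by blast
  have ev1: "eventually (\<lambda>n. norm (phi n u - psi_iter i u) \<le> C * q ^ i * u\<^sup>2 + \<epsilon>) sequentially" if "\<epsilon> > 0" for u i \<epsilon>
  proof -
    have "eventually (\<lambda>n. \<forall>v. \<bar>v\<bar> \<le> \<bar>u\<bar> + 1 \<longrightarrow> norm (phi n v - psi_iter i v) \<le> C * q ^ i * v\<^sup>2 + \<epsilon>) sequentially"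
      by (rule ev) (use that in auto)
    then show ?thesis by (rule eventually_mono) auto
  qed
  have "Cauchy (\<lambda>n. phi n u)" for u
  proof (rule metric_CauchyI)
    fix \<epsilon> :: real assume \<epsilon>: "\<epsilon> > 0"
    have "(\<lambda>i. C * q ^ i * u\<^sup>2) \<longlonglongrightarrow> C * 0 * u\<^sup>2" using q_bounds by (intro tendsto_intros LIMSEQ_realpow_zero) auto
    then have "eventually (\<lambda>i. C * q ^ i * u\<^sup>2 < \<epsilon>/4) sequentially" using \<epsilon> by (intro order_tendstoD(2)) auto
    then obtain i where i: "C * q ^ i * u\<^sup>2 < \<epsilon>/4" by (auto simp: eventually_sequentially)
    obtain N where N: "\<And>n. n \<ge> N \<Longrightarrow> norm (phi n u - psi_iter i u) \<le> C * q ^ i * u\<^sup>2 + \<epsilon>/4"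
      using ev1[of "\<epsilon>/4" u i] \<epsilon> by (auto simp: eventually_sequentially)
    have "dist (phi n u) (phi n' u) < \<epsilon>" if "n \<ge> N" "n' \<ge> N" for n n'
    proof -
      have "dist (phi n u) (phi n' u) \<le> dist (phi n u) (psi_iter i u) + dist (phi n' u) (psi_iter i u)" by (rule dist_triangle2)
      then show ?thesis using N[OF that(1)] N[OF that(2)] i unfolding dist_norm by linarith
    qed
    then show "\<exists>N. \<forall>n\<ge>N. \<forall>n'\<ge>N. dist (phi n u) (phi n' u) < \<epsilon>" by blast
  qed
  then have "\<forall>u. \<exists>l. (\<lambda>n. phi n u) \<longlonglongrightarrow> l" using Cauchy_convergent_iff convergent_def by blast
  then obtain \<Phi> where \<Phi>: "\<And>u. (\<lambda>n. phi n u) \<longlonglongrightarrow> \<Phi> u" by metis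
  have "norm (\<Phi> u - psi_iter i u) \<le> C * q ^ i * u\<^sup>2" for i u
  proof (rule field_le_epsilon)
    fix \<epsilon> :: real assume "\<epsilon> > 0"
    show "norm (\<Phi> u - psi_iter i u) \<le> C * q ^ i * u\<^sup>2 + \<epsilon>"
      by (rule tendsto_upperbound[OF tendsto_norm[OF tendsto_diff[OF \<Phi> tendsto_const]] ev1[OF \<open>\<epsilon> > 0\<close>]]) simp
  qed
  then show ?thesis using that \<Phi> C by blast
qed

lemma Z_law_abs_moments: "\<exists>C. \<forall>n. E n (\<lambda>x. \<bar>x / w n\<bar> ^ k) \<le> C"
proof -
  obtain K where K: "K \<ge> 0" "\<And>n. E n (\<lambda>x. \<bar>x\<bar> ^ k) \<le> K * w n ^ k" using abs_moment_bound by blast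
  have "E n (\<lambda>x. \<bar>x / w n\<bar> ^ k) \<le> K" for n
  proof -
    have "E n (\<lambda>x. \<bar>x / w n\<bar> ^ k) = E n (\<lambda>x. \<bar>x\<bar> ^ k) / w n ^ k" by (simp add: abs_divide power_divide)
    also have "\<dots> \<le> K" using K(2)[of n] w_pos[of n] by (simp add: pos_divide_le_eq)
    finally show ?thesis .
  qed
  then show ?thesis by blast
qed

text \<open>The vanishing shift \<open>\<delta>\<close> is built in so that centring at \<mu>(n+1)
  can be exchanged for centring at \<mu> n in both the weak limit and the moments.\<close>

theorem limit_law:
  assumes \<delta>: "\<delta> \<longlonglongrightarrow> 0"
  defines "M \<equiv> \<lambda>n. distr (measure_pmf (Q n)) borel (\<lambda>x. x / w n + \<delta> n)"
  obtains D where "solves_fixed_point m \<beta> D" "\<And>D'. solves_fixed_point m \<beta> D' \<Longrightarrow> D' = D" "weak_conv_m M D"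
    "\<And>k. integrable D (\<lambda>x. x ^ k)" "\<And>k. (\<lambda>n. E n (\<lambda>x. (x / w n + \<delta> n) ^ k)) \<longlonglongrightarrow> (\<integral>x. x ^ k \<partial>D)"
proof -
  obtain \<Phi> C where \<Phi>: "\<And>u. (\<lambda>n. phi n u) \<longlonglongrightarrow> \<Phi> u" "C \<ge> 0" "\<And>i u. norm (\<Phi> u - psi_iter i u) \<le> C * q ^ i * u\<^sup>2"
    using phi_limit by blast
  have rdM: "real_distribution (M n)" for n
    unfolding M_def by (rule prob_space.real_distribution_distr) (auto intro: prob_space_measure_pmf)
  have intM: "integrable (M n) h" "integral\<^sup>L (M n) h = E n (\<lambda>x. h (x / w n + \<delta> n))" if "h \<in> borel_measurable borel"
    for n and h :: "real \<Rightarrow> 'c::{banach, second_countable_topology}"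
    using that unfolding M_def by (auto simp: integrable_distr_eq integral_distr intro: E_int)
  have "tight Z_law"
  proof -
    obtain K where K: "\<And>n. E n (\<lambda>x. \<bar>x / w n\<bar>\<^sup>2) \<le> K" using Z_law_abs_moments by blast
    then have K: "E n (\<lambda>x. (x / w n)\<^sup>2) \<le> K" for n by (simp only: power2_abs)
    show ?thesis
      by (rule tight_second_moment[OF real_distribution_Z_law, where C = K]) (use K in \<open>simp_all add: integral_Z_law\<close>)
  qed
  \<comment> \<open>Tightness supplies only a subsequential limit, but its characteristic function
    must be the pointwise limit \<open>\<Phi>\<close> of the full sequence. Continuity of
    characteristic functions then gives convergence along all n.\<close>
  then obtain r D where r: "strict_mono r" and D: "real_distribution D" and conv: "weak_conv_m (Z_law \<circ> id \<circ> r) D"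
    using tight_imp_convergent_subsubsequence[of Z_law id] strict_mono_id by blast
  interpret D: real_distribution D by (rule D)
  have charD: "char D = \<Phi>"
  proof
    fix u
    have "(\<lambda>n. char ((Z_law \<circ> id \<circ> r) n) u) \<longlonglongrightarrow> char D u"
      by (rule levy_continuity1[OF _ D conv]) (simp add: real_distribution_Z_law)
    moreover have "(\<lambda>n. char ((Z_law \<circ> id \<circ> r) n) u) \<longlonglongrightarrow> \<Phi> u"
      using LIMSEQ_subseq_LIMSEQ[OF \<Phi>(1) r, of u] by (simp add: phi_def o_def)
    ultimately show "char D u = \<Phi> u" by (rule LIMSEQ_unique)
  qed
  have smooth: "smoothing m \<beta> (char D) = char D"
  proof
    fix u
    \<comment> \<open>Both functions are compared with the iterate i+1: smoothing contracts the
      distance of \<open>\<Phi>\<close> to the iterate i, and \<open>\<Phi>\<close> itself is close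
      to the iterate i+1.\<close>
    have le: "norm (smoothing m \<beta> (char D) u - char D u) \<le> 2 * C * u\<^sup>2 * q ^ i" for i
    proof -
      have 1: "norm (smoothing m \<beta> (char D) u - psi_iter (Suc i) u) \<le> (C * q ^ i) * q * u\<^sup>2"
        unfolding psi_iter.simps
        by (rule smoothing_contraction[OF m_ge \<beta>_pos D.char_measurable D.cmod_char_le_1 measurable_psi_iter norm_psi_iter_le_1])
           (simp add: charD \<Phi>(3))
      have 2: "norm (char D u - psi_iter (Suc i) u) \<le> C * q ^ Suc i * u\<^sup>2" unfolding charD by (rule \<Phi>(3))
      have "norm (smoothing m \<beta> (char D) u - char D u) \<le> norm (smoothing m \<beta> (char D) u - psi_iter (Suc i) u) + norm (char D u - psi_iter (Suc i) u)"
        unfolding dist_norm[symmetric] by (rule dist_triangle2)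
      also have "\<dots> \<le> 2 * C * u\<^sup>2 * q ^ i * q" using 1 2 by (simp add: mult_ac)
      also have "\<dots> \<le> 2 * C * u\<^sup>2 * q ^ i * 1" using q_bounds \<Phi>(2) by (intro mult_left_mono) auto
      finally show ?thesis by simp
    qed
    have "(\<lambda>i. 2 * C * u\<^sup>2 * q ^ i) \<longlonglongrightarrow> 2 * C * u\<^sup>2 * 0" using q_bounds by (intro tendsto_mult tendsto_const LIMSEQ_realpow_zero) auto
    from LIMSEQ_le_const[OF this, of "norm (smoothing m \<beta> (char D) u - char D u)"] le
    have "norm (smoothing m \<beta> (char D) u - char D u) \<le> 0" by auto
    then show "smoothing m \<beta> (char D) u = char D u" by simp
  qed
  have weak: "weak_conv_m M D"
  proof (rule levy_continuity[OF rdM D])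
    fix u
    have "char (M n) u = iexp (u * \<delta> n) * phi n u" for n
    proof -
      have "char (M n) u = E n (\<lambda>x. iexp (u * (x / w n + \<delta> n)))" unfolding char_def by (rule intM(2)) measurable
      also have "\<dots> = E n (\<lambda>x. iexp (u * \<delta> n) * iexp (u * (x / w n)))" by (simp add: distrib_left exp_add mult.commute)
      also have "\<dots> = iexp (u * \<delta> n) * phi n u" unfolding phi_eq by (rule integral_mult_right_zero)
      finally show ?thesis .
    qed
    moreover have "(\<lambda>n. iexp (u * \<delta> n) * phi n u) \<longlonglongrightarrow> iexp (u * 0) * \<Phi> u"
      by (intro tendsto_intros \<Phi>(1) \<delta>)
    ultimately show "(\<lambda>n. char (M n) u) \<longlonglongrightarrow> char D u" by (simp add: charD)
  qed
  have bnd: "\<exists>C. \<forall>n. integrable (M n) (\<lambda>x. \<bar>x\<bar> ^ k) \<and> (\<integral>x. \<bar>x\<bar> ^ k \<partial>M n) \<le> C" for k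
  proof -
    obtain K where K: "\<And>n. E n (\<lambda>x. \<bar>x / w n\<bar> ^ k) \<le> K" using Z_law_abs_moments by blast
    have "Bseq \<delta>" using \<delta> by (intro convergent_imp_Bseq) (auto simp: convergent_def)
    then obtain B where B: "B > 0" "\<And>n. \<bar>\<delta> n\<bar> \<le> B" by (auto simp: Bseq_def)
    have "(\<integral>x. \<bar>x\<bar> ^ k \<partial>M n) \<le> 2 ^ k * K + 2 ^ k * B ^ k" for n
    proof -
      have "(\<integral>x. \<bar>x\<bar> ^ k \<partial>M n) = E n (\<lambda>x. \<bar>x / w n + \<delta> n\<bar> ^ k)" by (rule intM(2)) measurable
      also have "\<dots> \<le> E n (\<lambda>x. 2 ^ k * \<bar>x / w n\<bar> ^ k + 2 ^ k * B ^ k)"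
      proof (rule integral_mono[OF E_int E_int])
        fix x :: real
        have "\<bar>x / w n + \<delta> n\<bar> \<le> 2 * max \<bar>x / w n\<bar> B" using B(2)[of n] abs_triangle_ineq[of "x / w n" "\<delta> n"] by linarith
        then have "\<bar>x / w n + \<delta> n\<bar> ^ k \<le> (2 * max \<bar>x / w n\<bar> B) ^ k" by (intro power_mono) auto
        also have "\<dots> = 2 ^ k * (max \<bar>x / w n\<bar> B) ^ k" by (rule power_mult_distrib)
        also have "(max \<bar>x / w n\<bar> B) ^ k \<le> \<bar>x / w n\<bar> ^ k + B ^ k" using B(1) by (cases "\<bar>x / w n\<bar> \<le> B") (auto simp: max_def)
        finally show "\<bar>x / w n + \<delta> n\<bar> ^ k \<le> 2 ^ k * \<bar>x / w n\<bar> ^ k + 2 ^ k * B ^ k" by (simp add: distrib_left)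
      qed
      also have "\<dots> = 2 ^ k * E n (\<lambda>x. \<bar>x / w n\<bar> ^ k) + 2 ^ k * B ^ k"
        by (subst Bochner_Integration.integral_add[OF E_int E_int]) (simp only: integral_mult_right_zero lebesgue_integral_const measure_pmf.prob_space scaleR_one)
      also have "\<dots> \<le> 2 ^ k * K + 2 ^ k * B ^ k" using K[of n] by (intro add_right_mono mult_left_mono) auto
      finally show ?thesis .
    qed
    moreover have "integrable (M n) (\<lambda>x. \<bar>x\<bar> ^ k)" for n by (rule intM(1)) measurable
    ultimately show ?thesis by blast
  qed
  note mom = weak_conv_moments[OF rdM D weak bnd]
  have solves: "solves_fixed_point m \<beta> D"
    unfolding solves_fixed_point_def using D mom(1)[of 2] fixed_point_map_eq_iff[OF D, of m \<beta>] smooth by blast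
  \<comment> \<open>Both solutions have mean c, so each characteristic function is within a
    quadratic error of that of the point mass at c. Their difference is then quadratic at 0, as the
    contraction requires.\<close>
  moreover have "D' = D" if D': "solves_fixed_point m \<beta> D'" for D'
  proof -
    interpret D': real_distribution D' using D' by (simp add: solves_fixed_point_def)
    have smooth': "smoothing m \<beta> (char D') = char D'"
      using D' fixed_point_map_eq_iff[OF D'.real_distribution_axioms, of m \<beta>] by (auto simp: solves_fixed_point_def)
    obtain C1 where C1: "\<And>x. norm (char D x - iexp (x * c)) \<le> C1 * x\<^sup>2"
      using solves_fixed_point_char_bound[OF m_ge \<beta>_pos solves limit_mean_eq] by blast
    obtain C2 where C2: "\<And>x. norm (char D' x - iexp (x * c)) \<le> C2 * x\<^sup>2"
      using solves_fixed_point_char_bound[OF m_ge \<beta>_pos D' limit_mean_eq] by blast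
    have "norm (char D' x - char D x) \<le> (C2 + C1) * x\<^sup>2" for x
    proof -
      have "norm (char D' x - char D x) \<le> norm (char D' x - iexp (x * c)) + norm (char D x - iexp (x * c))"
        unfolding dist_norm[symmetric] by (rule dist_triangle2)
      also have "\<dots> \<le> C2 * x\<^sup>2 + C1 * x\<^sup>2" by (intro add_mono C1 C2)
      finally show ?thesis by (simp add: distrib_right)
    qed
    then have "char D' = char D"
      by (intro smoothing_fixed_point_unique[OF m_ge \<beta>_half D'.char_measurable D'.cmod_char_le_1 smooth'
            D.char_measurable D.cmod_char_le_1 smooth])
    then show ?thesis by (intro Levy_uniqueness D D'.real_distribution_axioms)
  qed
  moreover have "(\<lambda>n. E n (\<lambda>x. (x / w n + \<delta> n) ^ k)) \<longlonglongrightarrow> (\<integral>x. x ^ k \<partial>D)" for k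
  proof -
    have "(\<integral>x. x ^ k \<partial>M n) = E n (\<lambda>x. (x / w n + \<delta> n) ^ k)" for n by (rule intM(2)) measurable
    then show ?thesis using mom(2)[of k] by simp
  qed
  ultimately show ?thesis using that weak mom(1) by blast
qed

end

section \<open>Centring\<close>

lemma sum_law_shift:
  "sum_law (\<lambda>j. map_pmf (\<lambda>x. x - b j) (qs j)) \<tau> r = map_pmf (\<lambda>x. x - (\<Sum>j<r. b j)) (sum_law qs \<tau> r)"
proof (induction r)
  case (Suc r)
  have "sum_law (\<lambda>j. map_pmf (\<lambda>x. x - b j) (qs j)) \<tau> (Suc r) =
      map_pmf (\<lambda>(y, s). y + s) (map_pmf (\<lambda>(y, s). (y - b r, s - (\<Sum>j<r. b j))) (pair_pmf (qs r) (sum_law qs \<tau> r)))"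
    unfolding sum_law_Suc Suc map_pair ..
  also have "\<dots> = map_pmf (\<lambda>x. x - (\<Sum>j<Suc r. b j)) (sum_law qs \<tau> (Suc r))"
    unfolding sum_law_Suc pmf.map_comp by (intro pmf.map_cong refl) (auto simp: algebra_simps)
  finally show ?case .
qed (simp add: sum_law_0)

lemma finite_set_X_law: "finite (set_pmf (X_law m t n))"
  by (simp add: X_law_def random_perm_def)

lemma X_law_mean_rec:
  assumes m: "m \<ge> 2" and n: "n \<ge> m - 1"
  shows "real (n choose (m - 1)) * (X_mean m t n - t n) = (\<Sum>v\<in>natpermute (n - (m - 1)) m. \<Sum>i<m. X_mean m t (v ! i))"
proof -
  have mean: "X_mean m t k = measure_pmf.expectation (X_law m t k) (\<lambda>x. x)" for k
    by (simp add: X_mean_def X_law_def)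
  let ?N = "natpermute (n - (m - 1)) m"
  have card: "card ?N = n choose (m - 1)" by (rule card_natpermute_gaps[OF m n])
  then have pos: "real (card ?N) > 0" using n by simp
  then have ne: "?N \<noteq> {}" by force
  have "X_mean m t n = (\<Sum>v\<in>?N. measure_pmf.expectation (sum_law (\<lambda>j. X_law m t (v ! j)) (t n) m) (\<lambda>x. x) /\<^sub>R real (card ?N))"
    unfolding mean X_law_rec[OF m n, of t 0] sum_law_def[symmetric]
    by (rule pmf_expectation_bind_pmf_of_set[OF ne natpermute_finite]) (auto intro!: finite_set_sum_law finite_set_X_law)
  also have "\<dots> = (\<Sum>v\<in>?N. ((\<Sum>i<m. X_mean m t (v ! i)) + t n) /\<^sub>R real (card ?N))"
    unfolding mean by (intro sum.cong refl) (subst mean_sum_law, auto intro: finite_set_X_law)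
  also have "\<dots> = ((\<Sum>v\<in>?N. \<Sum>i<m. X_mean m t (v ! i)) + real (card ?N) * t n) / real (card ?N)"
    by (simp add: sum.distrib sum_divide_distrib[symmetric] divide_inverse_commute sum_distrib_left[symmetric])
  finally have "X_mean m t n * real (card ?N) = (\<Sum>v\<in>?N. \<Sum>i<m. X_mean m t (v ! i)) + real (card ?N) * t n"
    using pos by (simp add: eq_divide_eq)
  then show ?thesis unfolding card by (simp add: algebra_simps)
qed

text \<open>Since the sizes satisfy \<open>(\<Sum>j<m. v ! j + 1) = n + 1\<close>, subtracting a multiple of \<open>n + 1\<close> leaves the recursion unchanged.\<close>

lemma shifted_X_law_rec:
  fixes t :: "nat \<Rightarrow> real" and \<mu> :: real
  assumes m: "m \<ge> 2" and n: "n \<ge> m - 1"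
  defines "Q \<equiv> \<lambda>n. map_pmf (\<lambda>x. x - \<mu> * real (Suc n)) (X_law m t n)"
  shows "Q n = bind_pmf (pmf_of_set (natpermute (n - (m - 1)) m)) (\<lambda>v. sum_law (\<lambda>j. Q (v ! j)) (t n) m)"
proof -
  have fin: "finite (natpermute (n - (m - 1)) m)" by (rule natpermute_finite)
  have "card (natpermute (n - (m - 1)) m) \<noteq> 0" using card_natpermute_gaps[OF m n] n by simp
  then have ne: "natpermute (n - (m - 1)) m \<noteq> {}" by force
  have "Q n = bind_pmf (pmf_of_set (natpermute (n - (m - 1)) m))
     (\<lambda>v. map_pmf (\<lambda>x. x - \<mu> * real (Suc n)) (sum_law (\<lambda>j. X_law m t (v ! j)) (t n) m))"
    unfolding Q_def X_law_rec[OF m n, of t 0] sum_law_def[symmetric] by (rule map_bind_pmf)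
  also have "\<dots> = bind_pmf (pmf_of_set (natpermute (n - (m - 1)) m)) (\<lambda>v. sum_law (\<lambda>j. Q (v ! j)) (t n) m)"
  proof (rule bind_pmf_cong[OF refl])
    fix v assume "v \<in> set_pmf (pmf_of_set (natpermute (n - (m - 1)) m))"
    then have v: "length v = m" "sum_list v = n - (m - 1)" using fin ne by (auto simp: natpermute_def)
    have "(\<Sum>j<m. v ! j) = n - (m - 1)" using v by (simp add: sum_list_sum_nth lessThan_atLeast0)
    then have "(\<Sum>j<m. Suc (v ! j)) = n - (m - 1) + m" by (simp only: sum_Suc card_lessThan)
    also have "\<dots> = Suc n" using m n by linarith
    finally have "(\<Sum>j<m. Suc (v ! j)) = Suc n" .
    then have "(\<Sum>j<m. \<mu> * real (Suc (v ! j))) = \<mu> * real (Suc n)"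
      by (simp only: sum_distrib_left[symmetric] of_nat_sum[symmetric])
    then show "map_pmf (\<lambda>x. x - \<mu> * real (Suc n)) (sum_law (\<lambda>j. X_law m t (v ! j)) (t n) m) = sum_law (\<lambda>j. Q (v ! j)) (t n) m"
      unfolding Q_def sum_law_shift by simp
  qed
  finally show ?thesis .
qed

text \<open>For m = 2 the polynomial is z - 2 and has no other root, in accordance with the value
  -\<infinity>. For larger m the maximum is over a finite set because the polynomial is
  nonzero.\<close>

lemma root_Re_less:
  assumes "m \<ge> 2" "alpha m < ereal b" "psi m z = 0" "z \<noteq> 2"
  shows "Re z < b"
proof (cases "m = 2")
  case True
  then have "z = 2" using assms(3) by (simp add: psi_def fact_2)
  then show ?thesis using assms(4) by simp
next
  case False
  have "psi m 0 \<noteq> 0" using assms(1) by (simp add: psi_def pochhammer_0_left)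
  then have "psi_poly m \<noteq> 0" using poly_psi_poly[of m 0] by auto
  then have "finite {z. psi m z = 0}" using poly_roots_finite[of "psi_poly m"] by (simp add: poly_psi_poly)
  then have "finite {z. psi m z = 0 \<and> z \<noteq> 2}" by (rule finite_subset[rotated]) auto
  then have "Re z \<le> Max (Re ` {z. psi m z = 0 \<and> z \<noteq> 2})" using assms by (intro Max_ge) auto
  also have "\<dots> < b" using assms(2) False by (simp add: alpha_def)
  finally show ?thesis .
qed

theorem theorem6p2:
  fixes m :: nat and \<beta> :: real and t :: "nat \<Rightarrow> real" and L :: "real \<Rightarrow> real"
  assumes "2 \<le> m" and "1 / 2 < \<beta>" and "\<beta> < 1"
    and "alpha m < ereal (1 + \<beta>)"
    and "slowly_varying L"
    and "t \<sim>[sequentially] (\<lambda>n. real n powr \<beta> * L (real n))"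
  shows "summable (\<lambda>j. t j / ((real j + 1) * (real j + 2)))
    \<and> (\<lambda>n. X_mean m t n - (slope m t * real n
              - rho m \<beta> / (fact m - rho m \<beta>) * (real n powr \<beta> * L (real n))))
        \<in> o[sequentially](\<lambda>n. real n powr \<beta> * L (real n))
    \<and> (\<exists>D. solves_fixed_point m \<beta> D
        \<and> (\<forall>D'. solves_fixed_point m \<beta> D' \<longrightarrow> D' = D)
        \<and> weak_conv_m
            (\<lambda>n. distr (measure_pmf (random_perm n)) borel
               (\<lambda>xs. (X m t xs - slope m t * real n) / (real n powr \<beta> * L (real n)))) D
        \<and> (\<forall>k::nat. integrable D (\<lambda>x. x ^ k)
            \<and> (\<lambda>n. measure_pmf.expectation (random_perm n)
                 (\<lambda>xs. ((X m t xs - slope m t * real n) / (real n powr \<beta> * L (real n))) ^ k))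
              \<longlonglongrightarrow> integral\<^sup>L D (\<lambda>x. x ^ k)))"
proof -
  \<comment> \<open>At n = 0 the formula gives 0, but weights have to be positive for empty subtrees
    as well.\<close>
  define w where "w = (\<lambda>n. if n = 0 then 1 else real n powr \<beta> * L (real n))"
  have w_eq: "w n = real n powr \<beta> * L (real n)" if "n \<ge> 1" for n using that by (simp add: w_def)
  have w_pos: "w n > 0" for n using assms(5) by (auto simp: w_def slowly_varying_def)
  interpret rv_weight w \<beta>
  proof
    show "w n > 0" for n by (rule w_pos)
    show "0 < \<beta>" "\<beta> < 1" using assms(2,3) by auto
    show "eventually (\<lambda>n. \<forall>j\<le>n. \<bar>w j / w n - (real j / real n) powr \<beta>\<bar> \<le> \<epsilon>) sequentially" if "\<epsilon> > 0" for \<epsilon>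
      using assms(2) that by (intro regularly_varying_uniform[OF assms(5)] w_eq) auto
  qed
  have ev_w: "eventually (\<lambda>n. w n = real n powr \<beta> * L (real n)) sequentially"
    using eventually_ge_at_top[of 1] by eventually_elim (rule w_eq)
  have "eventually (\<lambda>n. real n powr \<beta> * L (real n) \<noteq> 0) sequentially"
    using ev_w by eventually_elim (metis w_pos less_irrefl)
  then have nz: "eventually (\<lambda>n. t n \<noteq> 0 \<or> real n powr \<beta> * L (real n) \<noteq> 0) sequentially"
    by (auto elim: eventually_mono)
  have toll: "(\<lambda>n. t n / w n) \<longlonglongrightarrow> 1"
    using asymp_equivD_strong[OF assms(6) nz]
    by (rule Lim_transform_eventually) (use ev_w in \<open>auto elim: eventually_mono\<close>)
  define \<mu> where "\<mu> = slope m t"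
  define c where "c = - rho m \<beta> / (fact m - rho m \<beta>)"
  have init: "X_mean m t n = t n" if "n < m - 1" for n
  proof -
    have "X_mean m t n = measure_pmf.expectation (X_law m t n) (\<lambda>x. x)" by (simp add: X_mean_def X_law_def)
    then show ?thesis using X_law_small[OF assms(1) that, of t] by simp
  qed
  have roots: "\<And>z. psi m z = 0 \<Longrightarrow> z \<noteq> 2 \<Longrightarrow> Re z < 1 + \<beta>"
    by (rule root_Re_less[OF assms(1,4)])
  note ma = mean_asymp[OF assms(1) toll init X_law_mean_rec[OF assms(1)] roots]
  have sm: "summable (\<lambda>j. t j / ((real j + 1) * (real j + 2)))" by (rule ma(1))
  have X_mean_lim: "(\<lambda>n. (X_mean m t n - \<mu> * real (Suc n)) / w n) \<longlonglongrightarrow> c" unfolding \<mu>_def c_def by (rule ma(2))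
  define Q where "Q = (\<lambda>n. map_pmf (\<lambda>x. x - \<mu> * real (Suc n)) (X_law m t n))"
  interpret tree_limit w \<beta> m Q t c
  proof
    show "finite (set_pmf (Q n))" for n by (simp add: Q_def finite_set_X_law)
    show "Q n = bind_pmf (pmf_of_set (natpermute (n - (m - 1)) m)) (\<lambda>v. sum_law (\<lambda>j. Q (v ! j)) (t n) m)" if "n \<ge> m - 1" for n
      unfolding Q_def by (rule shifted_X_law_rec[OF assms(1) that])
    have "measure_pmf.expectation (Q n) (\<lambda>x. x) = X_mean m t n - \<mu> * real (Suc n)" for n
    proof -
      have "measure_pmf.expectation (Q n) (\<lambda>x. x) = measure_pmf.expectation (X_law m t n) (\<lambda>x. x - \<mu> * real (Suc n))"
        by (simp add: Q_def)
      also have "\<dots> = measure_pmf.expectation (X_law m t n) (\<lambda>x. x) - \<mu> * real (Suc n)"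
        by (subst Bochner_Integration.integral_diff) (auto intro: integrable_measure_pmf_finite finite_set_X_law)
      finally show ?thesis by (simp add: X_law_def X_mean_def)
    qed
    then show "(\<lambda>n. measure_pmf.expectation (Q n) (\<lambda>x. x) / w n) \<longlonglongrightarrow> c" using X_mean_lim by simp
  qed (use assms toll in auto)
  let ?g = "\<lambda>n. real n powr \<beta> * L (real n)"
  have smallo: "(\<lambda>n. X_mean m t n - (slope m t * real n - rho m \<beta> / (fact m - rho m \<beta>) * ?g n)) \<in> o[sequentially](?g)"
  proof (rule smalloI_tendsto)
    \<comment> \<open>Passing from \<mu>(n+1) to \<mu> n adds \<mu>/w_n, which tends to 0 because
      the weights tend to infinity.\<close>
    have "(\<lambda>n. (X_mean m t n - \<mu> * real (Suc n)) / w n + \<mu> / w n - c) \<longlonglongrightarrow> c + 0 - c"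
      by (rule tendsto_diff[OF tendsto_add[OF _ const_over_w] tendsto_const]) (rule X_mean_lim)
    then have "(\<lambda>n. (X_mean m t n - \<mu> * real (Suc n)) / w n + \<mu> / w n - c) \<longlonglongrightarrow> 0" by simp
    then show "(\<lambda>n. (X_mean m t n - (slope m t * real n - rho m \<beta> / (fact m - rho m \<beta>) * ?g n)) / ?g n) \<longlonglongrightarrow> 0"
    proof (rule Lim_transform_eventually)
      show "eventually (\<lambda>n. (X_mean m t n - \<mu> * real (Suc n)) / w n + \<mu> / w n - c = (X_mean m t n - (slope m t * real n - rho m \<beta> / (fact m - rho m \<beta>) * ?g n)) / ?g n) sequentially"
        using ev_w
      proof eventually_elim
        case (elim n)
        have "(X_mean m t n - \<mu> * real (Suc n)) / w n + \<mu> / w n - c = (X_mean m t n - (\<mu> * real n - (- c) * w n)) / w n"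
        proof -
          have "(x - u * (1 + y)) / W + u / W - c = (x - (u * y - (- c) * W)) / W" if "W \<noteq> 0" for x u y W :: real
            using that by (simp add: field_simps)
          from this[of "w n" "X_mean m t n" \<mu> "real n"] show ?thesis by (simp only: of_nat_Suc w_nz not_False_eq_True simp_thms)
        qed
        then show ?case unfolding elim[symmetric] by (simp add: c_def \<mu>_def)
      qed
    qed
    show "eventually (\<lambda>n. ?g n \<noteq> 0) sequentially" using ev_w by eventually_elim (metis w_pos less_irrefl)
  qed
  obtain D where D: "solves_fixed_point m \<beta> D" "\<And>D'. solves_fixed_point m \<beta> D' \<Longrightarrow> D' = D"
    and weak: "weak_conv_m (\<lambda>n. distr (measure_pmf (Q n)) borel (\<lambda>x. x / w n + \<mu> / w n)) D"
    and int: "\<And>k. integrable D (\<lambda>x. x ^ k)"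
    and mom: "\<And>k. (\<lambda>n. measure_pmf.expectation (Q n) (\<lambda>x. (x / w n + \<mu> / w n) ^ k)) \<longlonglongrightarrow> (\<integral>x. x ^ k \<partial>D)"
  proof (rule limit_law[OF const_over_w[of \<mu>]], goal_cases)
    case (1 D)
    show ?case by (rule 1(1)[OF 1(2-6)])
  qed
  \<comment> \<open>The shift \<mu>/w_n restores the centring at \<mu> n.\<close>
  have shift: "(x - \<mu> * real (Suc n)) / w n + \<mu> / w n = (x - \<mu> * real n) / w n" for x n
    by (simp add: add_divide_distrib[symmetric] algebra_simps)
  have law_eq: "distr (measure_pmf (Q n)) borel (\<lambda>x. x / w n + \<mu> / w n) = distr (measure_pmf (random_perm n)) borel (\<lambda>xs. (X m t xs - slope m t * real n) / ?g n)"
    if "w n = ?g n" for n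
    unfolding Q_def X_law_def map_pmf_rep_eq
    by (subst distr_distr, simp, simp, subst distr_distr) (simp_all add: o_def shift[unfolded \<mu>_def] that[symmetric] \<mu>_def del: of_nat_Suc)
  have mom_eq: "measure_pmf.expectation (Q n) (\<lambda>x. (x / w n + \<mu> / w n) ^ k) = measure_pmf.expectation (random_perm n) (\<lambda>xs. ((X m t xs - slope m t * real n) / ?g n) ^ k)"
    if "w n = ?g n" for n k
    unfolding Q_def X_law_def integral_map_pmf shift unfolding that \<mu>_def ..
  \<comment> \<open>The two sequences of laws agree as soon as w_n is given by the formula, so their
    distribution functions have the same limits.\<close>
  have "weak_conv_m (\<lambda>n. distr (measure_pmf (random_perm n)) borel (\<lambda>xs. (X m t xs - slope m t * real n) / ?g n)) D"
    unfolding weak_conv_m_def weak_conv_def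
  proof (intro allI impI)
    fix x assume "isCont (cdf D) x"
    then have "(\<lambda>n. cdf (distr (measure_pmf (Q n)) borel (\<lambda>x. x / w n + \<mu> / w n)) x) \<longlonglongrightarrow> cdf D x"
      using weak by (auto simp: weak_conv_m_def weak_conv_def)
    then show "(\<lambda>n. cdf (distr (measure_pmf (random_perm n)) borel (\<lambda>xs. (X m t xs - slope m t * real n) / ?g n)) x) \<longlonglongrightarrow> cdf D x"
    proof (rule Lim_transform_eventually)
      show "eventually (\<lambda>n. cdf (distr (measure_pmf (Q n)) borel (\<lambda>x. x / w n + \<mu> / w n)) x = cdf (distr (measure_pmf (random_perm n)) borel (\<lambda>xs. (X m t xs - slope m t * real n) / ?g n)) x) sequentially"
        using ev_w by eventually_elim (rule arg_cong[OF law_eq, where f = "\<lambda>M. cdf M x"])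
    qed
  qed
  moreover have "(\<lambda>n. measure_pmf.expectation (random_perm n) (\<lambda>xs. ((X m t xs - slope m t * real n) / ?g n) ^ k)) \<longlonglongrightarrow> (\<integral>x. x ^ k \<partial>D)" for k
    using mom[of k]
  proof (rule Lim_transform_eventually)
    show "eventually (\<lambda>n. measure_pmf.expectation (Q n) (\<lambda>x. (x / w n + \<mu> / w n) ^ k) = measure_pmf.expectation (random_perm n) (\<lambda>xs. ((X m t xs - slope m t * real n) / ?g n) ^ k)) sequentially"
      using ev_w by eventually_elim (rule mom_eq)
  qed
  ultimately show ?thesis using sm smallo D int by blast
qed

end
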